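(* Let $T>0$, let $S$ be a real orthogonal $n\times n$ matrix and let $D\in C([0,T],M_n(\mathbb{C}))$. Then for every $\nu\in\mathbb{C}$, $$\det\Big[\Big(\tfrac{d}{dt}-D+\nu I_n\Big)\Big(\tfrac{d}{dt}+\hat P_0\Big)^{-1}\Big]=(-1)^n\,|C(S)|\,e^{-\frac{n\nu T}{2}}\,e^{-\frac12\int_0^T \mathrm{Tr}(D(t))\,dt}\,\det\big(S\gamma_D(T)-e^{\nu T}I_n\big),$$ where the left-hand side is a conditional Fredholm determinant, $k_0=\dim\ker(S-I_n)$, $W=\ker(S-I_n)^{\perp}$, and $$C(S)=T^{-k_0}\,\frac{1}{\det[(S-I_n)|_{W}]}.$$
   Context: $\frac{d}{dt}$ is the closed densely defined operator on $E=L^2([0,T],\mathbb{C}^n)$ with domain $D_S=\{z\in W^{1,2}([0,T],\mathbb{C}^n): z(0)=Sz(T)\}$. $D$ also denotes the bounded multiplication operator $(Dz)(t)=D(t)z(t)$ on $E$. $\gamma_D$ is the fundamental solution: $\dot\gamma_D(t)=D(t)\gamma_D(t)$, $\gamma_D(0)=I_n$. $\hat P_0$ is the orthogonal projection of $E$ onto $\ker\frac{d}{dt}$, i.e. onto the constant functions with values in $\ker(S-I_n)$. The determinant of the restriction to $W=\{0\}$ is $1$. Conditional Fredholm determinant: for $N\ge 0$ let $\hat P_N$ be the orthogonal projection of $E$ onto the finite-dimensional space $V_N=\bigoplus_{\mu\in\sigma(\frac{d}{dt}),\,|\mu|\le N}\ker(\mu-\frac{d}{dt})$. For a Hilbert-Schmidt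 operator $F$ on $E$ such that $\lim_{N\to\infty}\mathrm{Tr}(\hat P_NF\hat P_N)$ exists and is finite, set $\det(id+F)=\lim_{N\to\infty}\det(id+\hat P_NF\hat P_N)$. Here $(\frac{d}{dt}-D+\nu I_n)(\frac{d}{dt}+\hat P_0)^{-1}=id-(D+\hat P_0-\nu I_n)(\frac{d}{dt}+\hat P_0)^{-1}$, so the determinant is $\lim_{N\to\infty}\det\big[id-\hat P_N(D+\hat P_0-\nu I_n)(\frac{d}{dt}+\hat P_0)^{-1}\hat P_N\big]$. *)

theory Defs
  imports
    "HOL-Analysis.Analysis"
    "HOL-Library.Function_Algebras"
    "Jordan_Normal_Form.Determinant"
begin

no_notation Matrix.vec_index (infixl "$" 100)
hide_const (open) Determinant.det Matrix.mat Matrix.vec Matrix.row Matrix.col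
hide_type (open) Matrix.vec

text \<open>For a subspace \<open>V\<close> mapped into itself by \<open>A\<close>, everything is read off from the matrix of
  \<open>A\<close> in some ordered basis of \<open>V\<close>; the results do not depend on the basis. For \<open>V = {0}\<close>
  the basis is the empty list and the determinant is \<open>1\<close>.\<close>

definition ordered_basis ::
    "('k::field \<Rightarrow> 'v::ab_group_add \<Rightarrow> 'v) \<Rightarrow> 'v set \<Rightarrow> 'v list \<Rightarrow> bool" where
  "ordered_basis sc V bs \<longleftrightarrow>
     distinct bs \<and> \<not> module.dependent sc (set bs) \<and> module.span sc (set bs) = V"

definition matrix_of ::
    "('k::field \<Rightarrow> 'v::ab_group_add \<Rightarrow> 'v) \<Rightarrow> 'v list \<Rightarrow> ('v \<Rightarrow> 'v) \<Rightarrow> 'k mat" where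
  "matrix_of sc bs A = Matrix.mat (length bs) (length bs)
     (\<lambda>(i, j). module.representation sc (set bs) (A (bs ! j)) (bs ! i))"

definition det_on ::
    "('k::field \<Rightarrow> 'v::ab_group_add \<Rightarrow> 'v) \<Rightarrow> 'v set \<Rightarrow> ('v \<Rightarrow> 'v) \<Rightarrow> 'k" where
  "det_on sc V A = Determinant.det (matrix_of sc (SOME bs. ordered_basis sc V bs) A)"

definition trace_on ::
    "('k::field \<Rightarrow> 'v::ab_group_add \<Rightarrow> 'v) \<Rightarrow> 'v set \<Rightarrow> ('v \<Rightarrow> 'v) \<Rightarrow> 'k" where
  "trace_on sc V A =
     (let M = matrix_of sc (SOME bs. ordered_basis sc V bs) A
      in \<Sum>i<dim_row M. M $$ (i, i))"

lemma det_on_zero: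
  fixes sc :: "'k::field \<Rightarrow> 'v::ab_group_add \<Rightarrow> 'v"
  assumes "vector_space sc"
  shows "det_on sc {0} A = 1"
proof -
  interpret vector_space sc by fact
  have "ordered_basis sc {0} bs \<longleftrightarrow> bs = []" for bs :: "'v list"
  proof
    assume *: "ordered_basis sc {0} bs"
    then have "set bs \<subseteq> {0}"
      unfolding ordered_basis_def using span_superset by blast
    moreover have "0 \<notin> set bs"
      using * unfolding ordered_basis_def by (meson dependent_zero)
    ultimately show "bs = []" by (cases bs) auto
  qed (use independent_empty in \<open>simp add: ordered_basis_def\<close>)
  then show ?thesis
    by (simp add: det_on_def matrix_of_def)
qed

text \<open>Elements are square integrable functions on \<open>[0,T]\<close>, with equality almost everywhere
  (\<open>eq_ae\<close>) in the role of equality. Values outside \<open>[0,T]\<close> are irrelevant.\<close>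

definition L2 :: "real \<Rightarrow> (real \<Rightarrow> complex^'n) set" where
  "L2 T = {f. f \<in> borel_measurable (lebesgue_on {0..T}) \<and>
              integrable (lebesgue_on {0..T}) (\<lambda>t. (norm (f t))\<^sup>2)}"

definition eq_ae :: "real \<Rightarrow> (real \<Rightarrow> complex^'n) \<Rightarrow> (real \<Rightarrow> complex^'n) \<Rightarrow> bool" where
  "eq_ae T f g \<longleftrightarrow> (AE t in lebesgue_on {0..T}. f t = g t)"

definition L2_inner :: "real \<Rightarrow> (real \<Rightarrow> complex^'n) \<Rightarrow> (real \<Rightarrow> complex^'n) \<Rightarrow> complex" where
  "L2_inner T f g = (\<integral>t. (\<Sum>i\<in>UNIV. f t $ i * cnj (g t $ i)) \<partial>lebesgue_on {0..T})"

definition L2_norm :: "real \<Rightarrow> (real \<Rightarrow> complex^'n) \<Rightarrow> real" where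
  "L2_norm T f = sqrt (\<integral>t. (norm (f t))\<^sup>2 \<partial>lebesgue_on {0..T})"

definition fscale :: "complex \<Rightarrow> (real \<Rightarrow> complex^'n) \<Rightarrow> (real \<Rightarrow> complex^'n)" where
  "fscale c f = (\<lambda>t. c *s f t)"

lemma vector_space_fscale: "vector_space (fscale :: _ \<Rightarrow> (real \<Rightarrow> complex^'n) \<Rightarrow> _)"
  by unfold_locales
    (auto simp: fscale_def fun_eq_iff vec_eq_iff algebra_simps)

text \<open>Intended for finite-dimensional \<open>V\<close> whose elements are determined by their class modulo
  \<open>eq_ae\<close>, so that the projection is a well-defined function.\<close>

definition orth_proj ::
    "real \<Rightarrow> (real \<Rightarrow> complex^'n) set \<Rightarrow> (real \<Rightarrow> complex^'n) \<Rightarrow> (real \<Rightarrow> complex^'n)" where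
  "orth_proj T V f = (THE p. p \<in> V \<and> (\<forall>v\<in>V. L2_inner T (f - p) v = 0))"

definition bounded_op :: "real \<Rightarrow> ((real \<Rightarrow> complex^'n) \<Rightarrow> (real \<Rightarrow> complex^'n)) \<Rightarrow> bool" where
  "bounded_op T F \<longleftrightarrow>
     (\<forall>f\<in>L2 T. F f \<in> L2 T) \<and>
     (\<forall>f\<in>L2 T. \<forall>g\<in>L2 T. eq_ae T f g \<longrightarrow> eq_ae T (F f) (F g)) \<and>
     (\<forall>f\<in>L2 T. \<forall>g\<in>L2 T. eq_ae T (F (f + g)) (F f + F g)) \<and>
     (\<forall>c. \<forall>f\<in>L2 T. eq_ae T (F (fscale c f)) (fscale c (F f))) \<and>
     (\<exists>C. \<forall>f\<in>L2 T. L2_norm T (F f) \<le> C * L2_norm T f)"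

definition orthonormal_basis :: "real \<Rightarrow> (nat \<Rightarrow> real \<Rightarrow> complex^'n) \<Rightarrow> bool" where
  "orthonormal_basis T e \<longleftrightarrow>
     (\<forall>i. e i \<in> L2 T) \<and>
     (\<forall>i j. L2_inner T (e i) (e j) = (if i = j then 1 else 0)) \<and>
     (\<forall>f\<in>L2 T. (\<forall>i. L2_inner T f (e i) = 0) \<longrightarrow> eq_ae T f 0)"

definition hilbert_schmidt :: "real \<Rightarrow> ((real \<Rightarrow> complex^'n) \<Rightarrow> (real \<Rightarrow> complex^'n)) \<Rightarrow> bool" where
  "hilbert_schmidt T F \<longleftrightarrow> bounded_op T F \<and>
     (\<forall>e. orthonormal_basis T e \<longrightarrow> summable (\<lambda>i. (L2_norm T (F (e i)))\<^sup>2))"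

definition cmatrix :: "real^'n^'n \<Rightarrow> complex^'n^'n" where
  "cmatrix S = (\<chi> i j. complex_of_real (S $ i $ j))"

definition is_weak_deriv :: "real \<Rightarrow> (real \<Rightarrow> complex^'n) \<Rightarrow> (real \<Rightarrow> complex^'n) \<Rightarrow> bool" where
  "is_weak_deriv T z w \<longleftrightarrow>
     w \<in> L2 T \<and> (\<forall>t\<in>{0..T}. z t = z 0 + (\<integral>s. w s \<partial>lebesgue_on {0..t}))"

text \<open>A class in \<open>W\<^sup>1\<^sup>,\<^sup>2\<close> is represented by its unique member that is absolutely continuous on
  \<open>[0,T]\<close> and zero outside. So two elements of \<open>W12 T\<close> that agree almost everywhere on
  \<open>[0,T]\<close> are equal as functions.\<close>

definition W12 :: "real \<Rightarrow> (real \<Rightarrow> complex^'n) set" where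
  "W12 T = {z. (\<exists>w. is_weak_deriv T z w) \<and> (\<forall>t. t \<notin> {0..T} \<longrightarrow> z t = 0)}"

definition dom_ddt :: "real \<Rightarrow> real^'n^'n \<Rightarrow> (real \<Rightarrow> complex^'n) set" where
  "dom_ddt T S = {z \<in> W12 T. z 0 = cmatrix S *v z T}"

text \<open>The derivative is unique only up to \<open>eq_ae\<close>; an arbitrary representative is chosen.\<close>

definition ddt :: "real \<Rightarrow> (real \<Rightarrow> complex^'n) \<Rightarrow> (real \<Rightarrow> complex^'n)" where
  "ddt T z = (SOME w. is_weak_deriv T z w)"

definition ker_ddt :: "real \<Rightarrow> real^'n^'n \<Rightarrow> complex \<Rightarrow> (real \<Rightarrow> complex^'n) set" where
  "ker_ddt T S \<mu> = {z \<in> dom_ddt T S. eq_ae T (fscale \<mu> z - ddt T z) 0}"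

definition resolvent_ddt :: "real \<Rightarrow> real^'n^'n \<Rightarrow> complex set" where
  "resolvent_ddt T S = {\<mu>.
     (\<forall>f\<in>L2 T. \<exists>!z. z \<in> dom_ddt T S \<and> eq_ae T (fscale \<mu> z - ddt T z) f) \<and>
     (\<exists>C. \<forall>z\<in>dom_ddt T S. L2_norm T z \<le> C * L2_norm T (fscale \<mu> z - ddt T z))}"

definition spectrum_ddt :: "real \<Rightarrow> real^'n^'n \<Rightarrow> complex set" where
  "spectrum_ddt T S = - resolvent_ddt T S"

definition V_space :: "real \<Rightarrow> real^'n^'n \<Rightarrow> real \<Rightarrow> (real \<Rightarrow> complex^'n) set" where
  "V_space T S N =
     module.span fscale (\<Union>\<mu>\<in>{\<mu> \<in> spectrum_ddt T S. cmod \<mu> \<le> N}. ker_ddt T S \<mu>)"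

definition P_hat ::
    "real \<Rightarrow> real^'n^'n \<Rightarrow> real \<Rightarrow> (real \<Rightarrow> complex^'n) \<Rightarrow> (real \<Rightarrow> complex^'n)" where
  "P_hat T S N = orth_proj T (V_space T S N)"

definition P0_hat ::
    "real \<Rightarrow> real^'n^'n \<Rightarrow> (real \<Rightarrow> complex^'n) \<Rightarrow> (real \<Rightarrow> complex^'n)" where
  "P0_hat T S = orth_proj T (ker_ddt T S 0)"

definition inv_ddt_P0 ::
    "real \<Rightarrow> real^'n^'n \<Rightarrow> (real \<Rightarrow> complex^'n) \<Rightarrow> (real \<Rightarrow> complex^'n)" where
  "inv_ddt_P0 T S f = (THE z. z \<in> dom_ddt T S \<and> eq_ae T (ddt T z + P0_hat T S z) f)"

definition ddt_minus ::
    "real \<Rightarrow> (real \<Rightarrow> complex^'n^'n) \<Rightarrow> complex \<Rightarrow> (real \<Rightarrow> complex^'n) \<Rightarrow> (real \<Rightarrow> complex^'n)" where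
  "ddt_minus T D \<nu> z = ddt T z - (\<lambda>t. D t *v z t) + fscale \<nu> z"

text \<open>\<open>has_cond_det T S A d\<close> says that the conditional Fredholm determinant of the operator \<open>A\<close>
  is defined and equals \<open>d\<close>, where \<open>A = id + F\<close> with \<open>F = A - id\<close>. Since \<open>P\<^sub>N F P\<^sub>N\<close> has its
  range in the finite-dimensional space \<open>V\<^sub>N\<close>, its trace is that of its restriction to \<open>V\<^sub>N\<close>,
  and \<open>det (id + P\<^sub>N F P\<^sub>N)\<close> is the determinant of the restriction of \<open>id + P\<^sub>N F P\<^sub>N\<close> to \<open>V\<^sub>N\<close>
  (the operator being the identity modulo \<open>V\<^sub>N\<close>).\<close>

definition compress ::
    "real \<Rightarrow> real^'n^'n \<Rightarrow> real \<Rightarrow> ((real \<Rightarrow> complex^'n) \<Rightarrow> (real \<Rightarrow> complex^'n)) \<Rightarrow>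
     (real \<Rightarrow> complex^'n) \<Rightarrow> (real \<Rightarrow> complex^'n)" where
  "compress T S N F = P_hat T S N \<circ> F \<circ> P_hat T S N"

definition has_cond_det ::
    "real \<Rightarrow> real^'n^'n \<Rightarrow> ((real \<Rightarrow> complex^'n) \<Rightarrow> (real \<Rightarrow> complex^'n)) \<Rightarrow> complex \<Rightarrow> bool" where
  "has_cond_det T S A d \<longleftrightarrow>
     (let F = (\<lambda>f. A f - f) in
       hilbert_schmidt T F \<and>
       (\<exists>\<tau>. ((\<lambda>N. trace_on fscale (V_space T S N) (compress T S N F)) \<longlongrightarrow> \<tau>) at_top) \<and>
       ((\<lambda>N. det_on fscale (V_space T S N) (\<lambda>f. f + compress T S N F f)) \<longlongrightarrow> d) at_top)"

definition is_fundamental_solution ::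
    "real \<Rightarrow> (real \<Rightarrow> complex^'n^'n) \<Rightarrow> (real \<Rightarrow> complex^'n^'n) \<Rightarrow> bool" where
  "is_fundamental_solution T D \<gamma> \<longleftrightarrow>
     \<gamma> 0 = mat 1 \<and>
     (\<forall>t\<in>{0..T}. (\<gamma> has_vector_derivative (D t ** \<gamma> t)) (at t within {0..T}))"

definition ker_S :: "real^'n^'n \<Rightarrow> (real^'n) set" where
  "ker_S S = {x. (S - mat 1) *v x = 0}"

definition W_S :: "real^'n^'n \<Rightarrow> (real^'n) set" where
  "W_S S = {x. \<forall>y\<in>ker_S S. x \<bullet> y = 0}"

definition C_S :: "real \<Rightarrow> real^'n^'n \<Rightarrow> real" where
  "C_S T S = inverse (T ^ dim (ker_S S)) * (1 / det_on (*\<^sub>R) (W_S S) ((*v) (S - mat 1)))"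

end

theory Submission
  imports Defs "Jordan_Normal_Form.Spectral_Radius"
begin

hide_const (open) Matrix.vec_index Determinant.det Matrix.mat Matrix.vec Matrix.row Matrix.col
no_notation Matrix.vec_index (infixl "$" 100)
hide_type (open) Matrix.vec

text \<open>In a unitary eigenbasis \<open>v\<^sub>j\<close> of \<open>S\<close> with eigenvalues \<open>cis \<theta>\<^sub>j\<close>, the space \<open>V\<^sub>N\<close> is spanned by
  the functions \<open>exp (\<i>\<omega>t) v\<^sub>j / sqrt T\<close> with \<open>\<omega> = (2\<pi>k - \<theta>\<^sub>j) / T\<close> and \<open>\<bar>\<omega>\<bar> \<le> N\<close>. In this basis the
  compressed operator is, up to the factor \<open>\<Prod>(1 + \<i>\<omega>) / \<lambda>\<close> with \<open>\<lambda> = \<i>\<omega>\<close> (and \<open>\<lambda> = 1\<close> for \<open>\<omega> = 0\<close>),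
  the compression of \<open>1 - (d/dt + 1)\<^sup>-\<^sup>1 M\<close> with \<open>M = D - \<nu> + 1\<close>; the factor converges by the product
  formula of the sine.

  The operator \<open>(d/dt + 1)\<^sup>-\<^sup>1 M\<close> is the sum of a Volterra operator and an operator of rank \<open>n\<close>. For
  the compression \<open>X\<^sub>N\<close> of the Volterra part, \<open>det (1 - X\<^sub>N) exp (tr X\<^sub>N)\<close> tends to \<open>1\<close>: triangularise
  \<open>X\<^sub>N\<close> in a basis that is orthonormal for the inner product weighted by \<open>exp (-2ct)\<close>; then the sum
  of the squared moduli of its eigenvalues is \<open>O(1/c)\<close> up to an error that vanishes with \<open>N\<close>. The
  rank \<open>n\<close> part contributes, by \<open>det (1 - PR) = det (1 - RP)\<close>, the quotient of \<open>det (1 - S Y(T))\<close> and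
  \<open>det (1 - exp (-T) S)\<close>, where \<open>Y' = (M - 1) Y\<close> and \<open>Y(0) = 1\<close>. The trace of the whole comes from the
  partial fractions of the cotangent.

  Finally \<open>det (S - 1)\<close> on \<open>W\<close> is the product of \<open>cis \<theta>\<^sub>j - 1\<close> over \<open>\<theta>\<^sub>j \<noteq> 0\<close>.\<close>

section \<open>Determinants and traces in a basis\<close>

text \<open>The inverse of \<open>d/dt + P_0\<close> has eigenvalues of order 1/|\<omega>|, so the
  operator is Hilbert-Schmidt but in general not trace class: the sections converge only because
  positive and negative frequencies are cut at the same height. The factors 1/2 in the exponents
  come from there, since the Green function of a first order operator jumps by 1 across the diagonal
  and the symmetric cutoff sees the mean of the two sides. Passing to \<open>d/dt + 1\<close>
  removes the kernel: 1 - exp(-T) S is invertible for every orthogonal S, so one Green function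
  serves all boundary conditions. The obstacle is that a Volterra operator has no nonzero
  eigenvalues while its compressions do. They are small only in the weighted norm, for which the
  projections are not orthogonal. The compression is therefore compared with the Volterra operator
  itself. The difference is a Fourier tail, small uniformly over orthonormal families because each
  coefficient gains a factor 1/|1 + i \<omega>|. The weight has to be fixed before N, since the tail
  bound grows with c.\<close>

text \<open>Linearity is required on \<open>V\<close> only. The compressions are built from
  integrals and choice operators whose values away from \<open>V\<close> are not controlled.\<close>

definition endo :: "('k::field \<Rightarrow> 'v::ab_group_add \<Rightarrow> 'v) \<Rightarrow> 'v set \<Rightarrow> ('v \<Rightarrow> 'v) \<Rightarrow> bool" where
  "endo sc V A \<longleftrightarrow> (\<forall>x\<in>V. A x \<in> V) \<and> (\<forall>x\<in>V. \<forall>y\<in>V. A (x + y) = A x + A y) \<and>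
     (\<forall>c. \<forall>x\<in>V. A (sc c x) = sc c (A x))"

context vector_space
begin

lemma ordered_basisD:
  assumes "ordered_basis scale V bs"
  shows "distinct bs" "independent (set bs)" "span (set bs) = V" "set bs \<subseteq> V" "subspace V"
  using assms by (auto simp: ordered_basis_def intro: span_base)

lemma ordered_basis_expand:
  assumes "ordered_basis scale V bs" "v \<in> V"
  shows "v = (\<Sum>i<length bs. scale (representation (set bs) v (bs ! i)) (bs ! i))"
proof -
  note D = ordered_basisD[OF assms(1)]
  have "v = (\<Sum>b\<in>set bs. scale (representation (set bs) v b) b)"
    using sum_representation_eq[OF D(2), of v "set bs"] assms(2) D(3) by simp
  also have "\<dots> = (\<Sum>i<length bs. scale (representation (set bs) v (bs ! i)) (bs ! i))"
    using sum.reindex_bij_betw[OF bij_betw_nth[OF D(1) refl refl], of "\<lambda>b. scale (representation (set bs) v b) b"]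
    by simp
  finally show ?thesis .
qed

lemma ordered_basis_repr:
  assumes "ordered_basis scale V bs" "k < length bs"
  shows "representation (set bs) (\<Sum>i<length bs. scale (m i) (bs ! i)) (bs ! k) = m k"
proof -
  note D = ordered_basisD[OF assms(1)]
  have s: "bs ! i \<in> span (set bs)" if "i < length bs" for i
    using that by (simp add: span_base)
  have "representation (set bs) (\<Sum>i<length bs. scale (m i) (bs ! i)) =
      (\<lambda>b. \<Sum>i<length bs. representation (set bs) (scale (m i) (bs ! i)) b)"
    by (rule representation_sum[OF D(2)]) (auto intro: span_scale s)
  then have "representation (set bs) (\<Sum>i<length bs. scale (m i) (bs ! i)) (bs ! k) =
      (\<Sum>i<length bs. m i * representation (set bs) (bs ! i) (bs ! k))"
    using D(2) s by (simp add: representation_scale)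
  also have "\<dots> = (\<Sum>i<length bs. if i = k then m k else 0)"
    using D(1,2) assms(2) by (intro sum.cong) (auto simp: representation_basis nth_eq_iff_index_eq)
  also have "\<dots> = m k" using assms(2) by simp
  finally show ?thesis .
qed

lemma ordered_basis_sum_eq_iff:
  assumes "ordered_basis scale V bs"
    "(\<Sum>i<length bs. scale (m i) (bs ! i)) = (\<Sum>i<length bs. scale (m' i) (bs ! i))" "k < length bs"
  shows "m k = m' k"
  using ordered_basis_repr[OF assms(1,3), of m] ordered_basis_repr[OF assms(1,3), of m'] assms(2) by simp

lemma matrix_of_carrier [simp]: "matrix_of scale bs A \<in> carrier_mat (length bs) (length bs)"
  by (simp add: matrix_of_def)

lemma matrix_of_eqI:
  assumes "ordered_basis scale V bs"
    "\<And>j. j < length bs \<Longrightarrow> A (bs ! j) = (\<Sum>i<length bs. scale (m i j) (bs ! i))"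
  shows "matrix_of scale bs A = Matrix.mat (length bs) (length bs) (\<lambda>(i, j). m i j)"
  unfolding matrix_of_def by (rule eq_matI) (auto simp: assms(2) ordered_basis_repr[OF assms(1)])

lemma endo_sum:
  assumes "endo scale V A" "subspace V" "finite I" "\<And>i. i \<in> I \<Longrightarrow> x i \<in> V"
  shows "A (\<Sum>i\<in>I. scale (c i) (x i)) = (\<Sum>i\<in>I. scale (c i) (A (x i)))"
  using assms(3,4)
proof (induction I rule: finite_induct)
  case empty
  have "A (scale 0 0) = scale 0 (A 0)"
    using assms(1) subspace_0[OF assms(2)] unfolding endo_def by blast
  then show ?case by simp
next
  case (insert i I)
  have "scale (c i) (x i) \<in> V" "(\<Sum>i\<in>I. scale (c i) (x i)) \<in> V"
    using insert assms(2) by (auto intro!: subspace_sum subspace_scale)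
  then show ?case using insert assms(1) by (auto simp: endo_def)
qed

lemma matrix_of_expand:
  assumes "ordered_basis scale V bs" "endo scale V A" "j < length bs"
  shows "A (bs ! j) = (\<Sum>i<length bs. scale (matrix_of scale bs A $$ (i, j)) (bs ! i))"
proof -
  have "A (bs ! j) \<in> V"
    using assms(2,3) ordered_basisD(4)[OF assms(1)] nth_mem unfolding endo_def by blast
  from ordered_basis_expand[OF assms(1) this] show ?thesis
    using assms(3) by (simp add: matrix_of_def)
qed

text \<open>Substituting one coordinate expansion into another multiplies the coefficient matrices.
  This carries every passage from operators to matrices below.\<close>

lemma sum_scale_swap:
  "(\<Sum>i\<in>I. scale (c i) (\<Sum>j\<in>J. scale (d j i) (x j))) = (\<Sum>j\<in>J. scale (\<Sum>i\<in>I. d j i * c i) (x j))"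
  by (simp add: scale_sum_right scale_sum_left mult.commute sum.swap[of _ I J])

lemma mat_mult_eq:
  assumes "A \<in> carrier_mat n n" "B \<in> carrier_mat n n"
  shows "A * B = Matrix.mat n n (\<lambda>(i, j). \<Sum>k<n. A $$ (i, k) * B $$ (k, j))"
  using assms by (intro eq_matI) (auto simp: scalar_prod_def atLeast0LessThan)

lemma ordered_basis_length_eq:
  assumes "ordered_basis scale V bs" "ordered_basis scale V cs"
  shows "length bs = length cs"
proof -
  note D = ordered_basisD[OF assms(1)] ordered_basisD[OF assms(2)]
  have "card (set bs) = card (set cs)"
    using dim_span_eq_card_independent[OF D(2)] dim_span_eq_card_independent[OF D(7)] D(3,8) by simp
  then show ?thesis using D(1,6) by (simp add: distinct_card)
qed

text \<open>With \<open>cs\<^sub>j = \<Sum>\<^sub>i P\<^sub>i\<^sub>j bs\<^sub>i\<close> and \<open>bs\<^sub>j = \<Sum>\<^sub>i Q\<^sub>i\<^sub>j cs\<^sub>i\<close>, one has \<open>QP = 1\<close> and the matrix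
  in the basis \<open>cs\<close> is \<open>QNP\<close>.\<close>

lemma matrix_of_change_basis:
  assumes bs: "ordered_basis scale V bs" and cs: "ordered_basis scale V cs"
    and A: "endo scale V A"
  shows "\<exists>P Q. P \<in> carrier_mat (length bs) (length bs) \<and> Q \<in> carrier_mat (length bs) (length bs) \<and>
    Q * P = 1\<^sub>m (length bs) \<and> matrix_of scale cs A = Q * matrix_of scale bs A * P"
proof -
  note L = ordered_basis_length_eq[OF bs cs]
  note D = ordered_basisD[OF bs] note E = ordered_basisD[OF cs]
  define n where "n = length bs"
  define p where "p i j = representation (set bs) (cs ! j) (bs ! i)" for i j
  define q where "q i j = representation (set cs) (bs ! j) (cs ! i)" for i j
  have p: "cs ! j = (\<Sum>i<n. scale (p i j) (bs ! i))" if "j < n" for j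
  proof -
    have "cs ! j \<in> V" using E(4) that L nth_mem[of j cs] by (auto simp: n_def)
    from ordered_basis_expand[OF bs this] show ?thesis unfolding p_def n_def .
  qed
  have q: "bs ! j = (\<Sum>i<n. scale (q i j) (cs ! i))" if "j < n" for j
  proof -
    have "bs ! j \<in> V" using D(4) that nth_mem[of j bs] by (auto simp: n_def)
    from ordered_basis_expand[OF cs this] show ?thesis unfolding q_def n_def L .
  qed
  define N where "N = matrix_of scale bs A"
  have N: "N \<in> carrier_mat n n" by (simp add: N_def n_def)
  define P where "P = Matrix.mat n n (\<lambda>(i, j). p i j)"
  define Q where "Q = Matrix.mat n n (\<lambda>(i, j). q i j)"
  have PQ: "P \<in> carrier_mat n n" "Q \<in> carrier_mat n n" by (auto simp: P_def Q_def)
  have "cs ! j = (\<Sum>l<n. scale (\<Sum>i<n. q l i * p i j) (cs ! l))" if "j < n" for j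
  proof -
    have "cs ! j = (\<Sum>i<n. scale (p i j) (\<Sum>l<n. scale (q l i) (cs ! l)))"
      unfolding p[OF that] by (rule sum.cong[OF refl]) (simp flip: q)
    then show ?thesis by (simp only: sum_scale_swap)
  qed
  then have "matrix_of scale cs (\<lambda>x. x) = Matrix.mat n n (\<lambda>(l, j). \<Sum>i<n. q l i * p i j)"
    using matrix_of_eqI[OF cs, of "\<lambda>x. x" "\<lambda>l j. \<Sum>i<n. q l i * p i j"] L by (simp add: n_def)
  also have "\<dots> = Q * P" by (subst mat_mult_eq[OF PQ(2,1)]) (auto simp: P_def Q_def intro!: eq_matI)
  finally have "Q * P = matrix_of scale cs (\<lambda>x. x)" ..
  also have "\<dots> = 1\<^sub>m n"
    using matrix_of_eqI[OF cs, of "\<lambda>x. x" "\<lambda>i j. if i = j then 1 else 0"]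
    by (auto simp: n_def L if_distrib[of "\<lambda>c. scale c _"] sum.delta' cong: if_cong intro!: eq_matI)
  finally have 1: "Q * P = 1\<^sub>m n" .
  have "A (cs ! j) = (\<Sum>l<n. scale (\<Sum>k<n. q l k * (\<Sum>i<n. N $$ (k, i) * p i j)) (cs ! l))"
    if "j < n" for j
  proof -
    have "A (cs ! j) = (\<Sum>i<n. scale (p i j) (A (bs ! i)))"
      unfolding p[OF that] using D(4) by (intro endo_sum[OF A D(5)]) (auto simp: n_def)
    also have "\<dots> = (\<Sum>i<n. scale (p i j) (\<Sum>k<n. scale (N $$ (k, i)) (bs ! k)))"
      using matrix_of_expand[OF bs A] by (simp add: N_def n_def)
    also have "\<dots> = (\<Sum>k<n. scale (\<Sum>i<n. N $$ (k, i) * p i j) (\<Sum>l<n. scale (q l k) (cs ! l)))"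
      by (subst sum_scale_swap, rule sum.cong[OF refl]) (simp flip: q)
    finally show ?thesis by (simp only: sum_scale_swap)
  qed
  then have "matrix_of scale cs A =
      Matrix.mat n n (\<lambda>(l, j). \<Sum>k<n. q l k * (\<Sum>i<n. N $$ (k, i) * p i j))"
    using matrix_of_eqI[OF cs, of A "\<lambda>l j. \<Sum>k<n. q l k * (\<Sum>i<n. N $$ (k, i) * p i j)"] L by (simp add: n_def)
  also have "\<dots> = Q * (N * P)"
    unfolding mat_mult_eq[OF N PQ(1)] by (subst mat_mult_eq[OF PQ(2)]) (auto simp: P_def Q_def intro!: eq_matI)
  also have "\<dots> = Q * N * P" using assoc_mult_mat[OF PQ(2) N PQ(1)] by simp
  finally show ?thesis using 1 PQ unfolding n_def N_def by blast
qed

lemma det_matrix_of_change_basis: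
  assumes bs: "ordered_basis scale V bs" and cs: "ordered_basis scale V cs" and A: "endo scale V A"
  shows "Determinant.det (matrix_of scale cs A) = Determinant.det (matrix_of scale bs A)"
proof -
  define n where "n = length bs"
  obtain P Q where PQ: "P \<in> carrier_mat n n" "Q \<in> carrier_mat n n" "Q * P = 1\<^sub>m n"
    "matrix_of scale cs A = Q * matrix_of scale bs A * P"
    using matrix_of_change_basis[OF assms] unfolding n_def by blast
  have N: "matrix_of scale bs A \<in> carrier_mat n n" by (simp add: n_def)
  have "Determinant.det Q * Determinant.det P = 1"
    using det_mult[OF PQ(2,1)] PQ(3) by simp
  moreover have "Determinant.det (matrix_of scale cs A) =
      Determinant.det Q * Determinant.det (matrix_of scale bs A) * Determinant.det P"
    using PQ N by (simp add: det_mult[of _ n])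
  ultimately show ?thesis by (metis mult.commute mult.left_commute mult.right_neutral)
qed

lemma trace_matrix_of_change_basis:
  assumes bs: "ordered_basis scale V bs" and cs: "ordered_basis scale V cs" and A: "endo scale V A"
  shows "(\<Sum>i<length cs. matrix_of scale cs A $$ (i, i)) = (\<Sum>i<length bs. matrix_of scale bs A $$ (i, i))"
proof -
  define n where "n = length bs"
  define N where "N = matrix_of scale bs A"
  obtain P Q where PQ: "P \<in> carrier_mat n n" "Q \<in> carrier_mat n n" "Q * P = 1\<^sub>m n"
    "matrix_of scale cs A = Q * N * P"
    using matrix_of_change_basis[OF assms] unfolding n_def N_def by blast
  have N: "N \<in> carrier_mat n n" by (simp add: n_def N_def)
  have PQ1: "P * Q = 1\<^sub>m n" using mat_mult_left_right_inverse[OF PQ(2,1,3)] .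
  have QN: "Q * N \<in> carrier_mat n n" using PQ N by simp
  have "(\<Sum>i<n. matrix_of scale cs A $$ (i, i)) = (\<Sum>i<n. \<Sum>k<n. (Q * N) $$ (i, k) * P $$ (k, i))"
    unfolding PQ(4) mat_mult_eq[OF QN PQ(1)] by simp
  also have "\<dots> = (\<Sum>k<n. \<Sum>i<n. P $$ (k, i) * (Q * N) $$ (i, k))"
    by (subst sum.swap) (simp add: mult.commute)
  also have "\<dots> = (\<Sum>k<n. (P * (Q * N)) $$ (k, k))"
    unfolding mat_mult_eq[OF PQ(1) QN] by simp
  also have "P * (Q * N) = N"
    using assoc_mult_mat[OF PQ(1,2) N] PQ1 N by simp
  finally show ?thesis unfolding n_def N_def ordered_basis_length_eq[OF bs cs] .
qed

text \<open>Similarity makes the basis picked by \<open>SOME\<close> irrelevant, so determinants may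
  be computed in the Fourier basis and in a Schur basis of the same space.\<close>

lemma det_on_eq:
  assumes "ordered_basis scale V bs" "endo scale V A"
  shows "det_on scale V A = Determinant.det (matrix_of scale bs A)"
proof -
  have "ordered_basis scale V (SOME bs. ordered_basis scale V bs)"
    using assms(1) by (rule someI)
  from det_matrix_of_change_basis[OF assms(1) this assms(2)] show ?thesis
    unfolding det_on_def .
qed

lemma trace_on_eq:
  assumes "ordered_basis scale V bs" "endo scale V A"
  shows "trace_on scale V A = (\<Sum>i<length bs. matrix_of scale bs A $$ (i, i))"
proof -
  define cs where "cs = (SOME bs. ordered_basis scale V bs)"
  have "ordered_basis scale V cs"
    unfolding cs_def using assms(1) by (rule someI)
  from trace_matrix_of_change_basis[OF assms(1) this assms(2)]
  have "(\<Sum>i<length cs. matrix_of scale cs A $$ (i, i)) = (\<Sum>i<length bs. matrix_of scale bs A $$ (i, i))" .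
  then show ?thesis
    unfolding trace_on_def Let_def cs_def[symmetric] carrier_matD(1)[OF matrix_of_carrier] .
qed

text \<open>The hypothesis \<open>ev\<close> stands for algebraic closedness of the scalars.
  \<open>W\<close> sits in the span of a finite set, so an eigenvector of the matrix of
  \<open>X\<close> in a basis of \<open>W\<close> supplies the coordinates of
  \<open>h\<close>.\<close>

lemma exists_eigenvector:
  fixes X :: "'b \<Rightarrow> 'b"
  assumes "subspace W" "finite B" "W \<subseteq> span B" "W \<noteq> {0}" "endo scale W X"
    and ev: "\<And>n M. M \<in> carrier_mat n n \<Longrightarrow> n > 0 \<Longrightarrow> \<exists>k v. eigenvector (M :: 'a mat) v k"
  shows "\<exists>h\<in>W. h \<noteq> 0 \<and> (\<exists>k. X h = scale k h)"
proof -
  obtain C where C: "C \<subseteq> W" "independent C" "W \<subseteq> span C" using maximal_independent_subset by blast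
  have "finite C" using independent_span_bound[OF assms(2) C(2)] C(1) assms(3) by auto
  then obtain bs where bs: "set bs = C" "distinct bs" using finite_distinct_list by blast
  have "span C = W" using C assms(1) span_minimal by blast
  then have ob: "ordered_basis scale W bs" using bs C by (simp add: ordered_basis_def)
  define n where "n = length bs"
  have "n > 0" using \<open>W \<noteq> {0}\<close> \<open>span C = W\<close> bs by (auto simp: n_def)
  define M where "M = matrix_of scale bs X"
  have M: "M \<in> carrier_mat n n" by (simp add: M_def n_def)
  obtain k v where v: "eigenvector M v k" using ev[OF M \<open>n > 0\<close>] by blast
  then have vn: "v \<in> carrier_vec n" "v \<noteq> 0\<^sub>v n" "M *\<^sub>v v = k \<cdot>\<^sub>v v"
    using M by (auto simp: eigenvector_def)
  define h where "h = (\<Sum>i<n. scale (Matrix.vec_index v i) (bs ! i))"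
  have hW: "h \<in> W" unfolding h_def using C bs assms(1)
    by (intro subspace_sum subspace_scale) (auto simp: n_def)
  have "X h = (\<Sum>i<n. scale (Matrix.vec_index v i) (X (bs ! i)))"
    unfolding h_def using C bs by (intro endo_sum[OF assms(5,1)]) (auto simp: n_def)
  also have "\<dots> = (\<Sum>i<n. scale (Matrix.vec_index v i) (\<Sum>l<n. scale (M $$ (l, i)) (bs ! l)))"
    using matrix_of_expand[OF ob assms(5)] by (simp add: M_def n_def)
  also have "\<dots> = (\<Sum>l<n. scale (\<Sum>i<n. M $$ (l, i) * Matrix.vec_index v i) (bs ! l))"
    by (rule sum_scale_swap)
  also have "\<dots> = (\<Sum>l<n. scale (k * Matrix.vec_index v l) (bs ! l))"
  proof (rule sum.cong[OF refl])
    fix l assume l: "l \<in> {..<n}"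
    have "Matrix.vec_index (M *\<^sub>v v) l = (\<Sum>i<n. M $$ (l, i) * Matrix.vec_index v i)"
      using l M vn(1) by (auto simp: scalar_prod_def atLeast0LessThan)
    then have "(\<Sum>i<n. M $$ (l, i) * Matrix.vec_index v i) = k * Matrix.vec_index v l"
      using vn l by simp
    then show "scale (\<Sum>i<n. M $$ (l, i) * Matrix.vec_index v i) (bs ! l) = scale (k * Matrix.vec_index v l) (bs ! l)"
      by simp
  qed
  also have "\<dots> = scale k h" by (simp add: h_def scale_sum_right)
  finally have 1: "X h = scale k h" .
  have "h \<noteq> 0"
  proof
    assume "h = 0"
    then have "(\<Sum>i<length bs. scale (Matrix.vec_index v i) (bs ! i)) = (\<Sum>i<length bs. scale 0 (bs ! i))"
      by (simp add: h_def n_def)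
    from ordered_basis_sum_eq_iff[OF ob this] have "v = 0\<^sub>v n"
      using vn(1) by (intro eq_vecI) (auto simp: n_def)
    then show False using vn by simp
  qed
  with 1 hW show ?thesis by blast
qed

end

lemma complex_mat_eigenvector:
  assumes "(M :: complex mat) \<in> carrier_mat n n" "n > 0"
  shows "\<exists>k v. eigenvector M v k"
  using spectrum_non_empty[OF assms(1)] assms(2) by (auto simp: spectrum_def eigenvalue_def)

section \<open>Semi-inner products, Bessel's inequality and Schur triangularisation\<close>

locale semi_ip = vector_space scale
  for scale :: "complex \<Rightarrow> 'v::ab_group_add \<Rightarrow> 'v" (infixr "*s" 75) +
  fixes H :: "'v set" and ip :: "'v \<Rightarrow> 'v \<Rightarrow> complex"
  assumes subspace_H: "subspace H"
    and ip_add_left: "\<lbrakk>x \<in> H; y \<in> H; z \<in> H\<rbrakk> \<Longrightarrow> ip (x + y) z = ip x z + ip y z"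
    and ip_scale_left: "\<lbrakk>x \<in> H; y \<in> H\<rbrakk> \<Longrightarrow> ip (scale c x) y = c * ip x y"
    and ip_cnj: "\<lbrakk>x \<in> H; y \<in> H\<rbrakk> \<Longrightarrow> ip y x = cnj (ip x y)"
    and ip_nonneg: "x \<in> H \<Longrightarrow> 0 \<le> Re (ip x x)"
begin

abbreviation nrm2 :: "'v \<Rightarrow> real" where "nrm2 x \<equiv> Re (ip x x)"

definition orthonormal :: "'i set \<Rightarrow> ('i \<Rightarrow> 'v) \<Rightarrow> bool" where
  "orthonormal A g \<longleftrightarrow> g ` A \<subseteq> H \<and> (\<forall>a\<in>A. \<forall>b\<in>A. ip (g a) (g b) = (if a = b then 1 else 0))"

lemma ip_self: "x \<in> H \<Longrightarrow> ip x x = complex_of_real (nrm2 x)"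
  using ip_cnj[of x x] by (metis Reals_cnj_iff of_real_Re)

lemma ip_add_right: "\<lbrakk>x \<in> H; y \<in> H; z \<in> H\<rbrakk> \<Longrightarrow> ip x (y + z) = ip x y + ip x z"
  using ip_cnj[of "y + z" x] ip_add_left[of y z x] ip_cnj[of y x] ip_cnj[of z x]
    subspace_add[OF subspace_H] by simp

lemma ip_scale_right: "\<lbrakk>x \<in> H; y \<in> H\<rbrakk> \<Longrightarrow> ip x (scale c y) = cnj c * ip x y"
  using ip_cnj[of "scale c y" x] ip_scale_left[of y x c] ip_cnj[of y x]
    subspace_scale[OF subspace_H] by simp

lemma ip_zero_left: "y \<in> H \<Longrightarrow> ip 0 y = 0"
  using ip_scale_left[of 0 y 0] subspace_0[OF subspace_H] by simp

lemma ip_diff_left: "\<lbrakk>x \<in> H; y \<in> H; z \<in> H\<rbrakk> \<Longrightarrow> ip (x - y) z = ip x z - ip y z"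
  using ip_add_left[of "x - y" y z] subspace_diff[OF subspace_H] by (simp add: algebra_simps)

lemma ip_diff_right: "\<lbrakk>x \<in> H; y \<in> H; z \<in> H\<rbrakk> \<Longrightarrow> ip x (y - z) = ip x y - ip x z"
  using ip_add_right[of x "y - z" z] subspace_diff[OF subspace_H] by (simp add: algebra_simps)

lemma comb_in_H: "finite A \<Longrightarrow> g ` A \<subseteq> H \<Longrightarrow> (\<Sum>a\<in>A. scale (c a) (g a)) \<in> H"
  using subspace_H by (auto intro!: subspace_sum subspace_scale)

lemma ip_sum_left:
  assumes "finite A" "g ` A \<subseteq> H" "y \<in> H"
  shows "ip (\<Sum>a\<in>A. scale (c a) (g a)) y = (\<Sum>a\<in>A. c a * ip (g a) y)"
  using assms
proof (induction A rule: finite_induct)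
  case (insert a A)
  then have "scale (c a) (g a) \<in> H" "(\<Sum>a\<in>A. scale (c a) (g a)) \<in> H"
    using subspace_H by (auto intro!: comb_in_H subspace_scale)
  then show ?case using insert by (simp add: ip_add_left ip_scale_left)
qed (simp add: ip_zero_left)

lemma ip_sum_right:
  assumes "finite A" "g ` A \<subseteq> H" "y \<in> H"
  shows "ip y (\<Sum>a\<in>A. scale (c a) (g a)) = (\<Sum>a\<in>A. cnj (c a) * ip y (g a))"
proof -
  have "ip y (\<Sum>a\<in>A. scale (c a) (g a)) = cnj (\<Sum>a\<in>A. c a * ip (g a) y)"
    using ip_cnj[of "\<Sum>a\<in>A. scale (c a) (g a)" y] comb_in_H[OF assms(1,2)] ip_sum_left[OF assms] assms(3) by simp
  also have "\<dots> = (\<Sum>a\<in>A. cnj (c a) * ip y (g a))"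
    unfolding cnj_sum
  proof (rule sum.cong[OF refl])
    fix a assume "a \<in> A"
    then show "cnj (c a * ip (g a) y) = cnj (c a) * ip y (g a)"
      using ip_cnj[of "g a" y] assms(2,3) by auto
  qed
  finally show ?thesis .
qed

lemma orthonormal_ip_comb:
  assumes "finite A" "orthonormal A g" "b \<in> A"
  shows "ip (\<Sum>a\<in>A. scale (c a) (g a)) (g b) = c b"
proof -
  have "ip (\<Sum>a\<in>A. scale (c a) (g a)) (g b) = (\<Sum>a\<in>A. c a * ip (g a) (g b))"
    using assms by (intro ip_sum_left) (auto simp: orthonormal_def)
  also have "\<dots> = (\<Sum>a\<in>A. if a = b then c a else 0)"
    using assms by (intro sum.cong) (auto simp: orthonormal_def)
  finally show ?thesis using assms by simp
qed

text \<open>Completing the square in the coefficients. The choice \<open>c a = ip x (g a)\<close>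
  gives Bessel's inequality, \<open>x\<close> equal to the combination gives Parseval, and the last
  sum being nonnegative gives best approximation.\<close>

lemma nrm2_diff_comb:
  assumes "finite A" "orthonormal A g" "x \<in> H"
  shows "nrm2 (x - (\<Sum>a\<in>A. scale (c a) (g a))) =
    nrm2 x - (\<Sum>a\<in>A. (cmod (ip x (g a)))\<^sup>2) + (\<Sum>a\<in>A. (cmod (c a - ip x (g a)))\<^sup>2)"
proof -
  define s where "s = (\<Sum>a\<in>A. scale (c a) (g a))"
  have g: "g ` A \<subseteq> H" using assms by (auto simp: orthonormal_def)
  have s: "s \<in> H" unfolding s_def using assms g by (intro comb_in_H)
  have ss: "ip s s = (\<Sum>a\<in>A. cnj (c a) * c a)"
    unfolding s_def using assms g s
    by (subst ip_sum_right) (auto simp: s_def orthonormal_ip_comb)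
  have xs: "ip x s = (\<Sum>a\<in>A. cnj (c a) * ip x (g a))"
    unfolding s_def using assms g by (intro ip_sum_right)
  have "ip (x - s) (x - s) = ip x x - ip x s - cnj (ip x s) + ip s s"
    using assms s subspace_diff[OF subspace_H] ip_cnj[of x s]
    by (simp add: ip_diff_left ip_diff_right)
  also have "Re \<dots> = nrm2 x + (Re (ip s s) - 2 * Re (ip x s))"
    by simp
  also have "\<dots> = nrm2 x + (\<Sum>a\<in>A. Re (cnj (c a) * c a) - 2 * Re (cnj (c a) * ip x (g a)))"
    unfolding ss xs by (simp only: Re_sum sum_subtractf sum_distrib_left)
  also have "\<dots> = nrm2 x + (\<Sum>a\<in>A. (cmod (c a - ip x (g a)))\<^sup>2 - (cmod (ip x (g a)))\<^sup>2)"
    by (intro arg_cong2[where f = "(+)"] refl sum.cong) (simp_all only: cmod_power2, auto simp: power2_eq_square algebra_simps)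
  finally show ?thesis unfolding s_def by (simp add: sum_subtractf)
qed

lemma bessel:
  assumes "finite A" "orthonormal A g" "x \<in> H"
  shows "(\<Sum>a\<in>A. (cmod (ip x (g a)))\<^sup>2) \<le> nrm2 x"
proof -
  have "0 \<le> nrm2 (x - (\<Sum>a\<in>A. scale (ip x (g a)) (g a)))"
    using assms subspace_H by (intro ip_nonneg subspace_diff comb_in_H) (auto simp: orthonormal_def)
  then show ?thesis using nrm2_diff_comb[OF assms, of "\<lambda>a. ip x (g a)"] by simp
qed

lemma nrm2_comb:
  assumes "finite A" "orthonormal A g"
  shows "nrm2 (\<Sum>a\<in>A. scale (c a) (g a)) = (\<Sum>a\<in>A. (cmod (c a))\<^sup>2)"
proof -
  define s where "s = (\<Sum>a\<in>A. scale (c a) (g a))"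
  have "s \<in> H" unfolding s_def using assms by (intro comb_in_H) (auto simp: orthonormal_def)
  note nrm2_diff_comb[OF assms this, of c, folded s_def]
  moreover have "nrm2 (s - s) = 0" using ip_zero_left[of 0] subspace_0[OF subspace_H] by simp
  moreover have "ip s (g a) = c a" if "a \<in> A" for a
    unfolding s_def by (rule orthonormal_ip_comb[OF assms that])
  ultimately show ?thesis unfolding s_def[symmetric] by simp
qed

lemma nrm2_add_le:
  assumes "x \<in> H" "y \<in> H"
  shows "nrm2 (x + y) \<le> 2 * nrm2 x + 2 * nrm2 y"
proof -
  have "0 \<le> nrm2 (x - y)" using assms by (intro ip_nonneg subspace_diff[OF subspace_H])
  then show ?thesis
    using assms subspace_add[OF subspace_H] subspace_diff[OF subspace_H]
    by (simp add: ip_add_left ip_add_right ip_diff_left ip_diff_right)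
qed

text \<open>Expand the squared norm of x - t <x,y> y for real t; the factor <x,y> takes care of the
  phase. The form is only semi-definite, so besides the usual t = 1 / \<open>nrm2 y\<close> the case
  \<open>nrm2 y = 0\<close> needs a large t, for which the linear term would win.\<close>

lemma cauchy_schwarz:
  assumes "x \<in> H" "y \<in> H"
  shows "(cmod (ip x y))\<^sup>2 \<le> nrm2 x * nrm2 y"
proof -
  have key: "0 \<le> nrm2 x - 2 * t * (cmod (ip x y))\<^sup>2 + t\<^sup>2 * (cmod (ip x y))\<^sup>2 * nrm2 y" for t :: real
  proof -
    define c where "c = of_real t * ip x y"
    have cy: "scale c y \<in> H" using assms subspace_scale[OF subspace_H] by blast
    have "0 \<le> nrm2 (x - scale c y)"
      using assms cy by (intro ip_nonneg subspace_diff[OF subspace_H])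
    also have "ip (x - scale c y) (x - scale c y) =
        ip x x - cnj c * ip x y - c * cnj (ip x y) + c * cnj c * ip y y"
      using assms cy subspace_diff[OF subspace_H] ip_cnj[of x y]
      by (simp add: ip_diff_left ip_diff_right ip_scale_left ip_scale_right algebra_simps)
    also have "\<dots> = ip x x - 2 * of_real t * (ip x y * cnj (ip x y)) + (of_real t)\<^sup>2 * (ip x y * cnj (ip x y)) * ip y y"
      by (simp add: c_def power2_eq_square)
    also have "ip x y * cnj (ip x y) = of_real ((cmod (ip x y))\<^sup>2)"
      by (simp add: complex_norm_square del: of_real_power)
    finally show ?thesis using ip_self[OF assms(2)] by (simp add: power2_eq_square)
  qed
  define b where "b = (cmod (ip x y))\<^sup>2"
  show ?thesis
  proof (cases "nrm2 y = 0")
    case True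
    have "b = 0"
    proof (rule ccontr)
      assume "b \<noteq> 0"
      then have "b > 0" by (simp add: b_def)
      have "0 \<le> nrm2 x - 2 * ((nrm2 x + 1) / b) * b"
        using key[of "(nrm2 x + 1) / b"] True unfolding b_def by simp
      then show False using \<open>b > 0\<close> ip_nonneg[OF assms(1)] by simp
    qed
    then show ?thesis using True by (simp add: b_def)
  next
    case False
    then have p: "nrm2 y > 0" using ip_nonneg[OF assms(2)] by simp
    have "0 \<le> nrm2 x - b / nrm2 y"
      using key[of "1 / nrm2 y"] p unfolding b_def[symmetric] by (simp add: power2_eq_square)
    then show ?thesis using p by (simp add: b_def field_simps)
  qed
qed

lemma orthonormal_independent:
  assumes "orthonormal {..<length gs} ((!) gs)"
  shows "distinct gs" "independent (set gs)"
proof -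
  have o: "ip (gs ! i) (gs ! j) = (if i = j then 1 else 0)" if "i < length gs" "j < length gs" for i j
    using assms that by (auto simp: orthonormal_def)
  show d: "distinct gs"
    unfolding distinct_conv_nth
  proof (intro allI impI)
    fix i j assume "i < length gs" "j < length gs" "i \<noteq> j"
    then show "gs ! i \<noteq> gs ! j" using o[of i j] o[of j j] by auto
  qed
  show "independent (set gs)"
  proof
    assume "dependent (set gs)"
    then obtain u v where u: "v \<in> set gs" "u v \<noteq> 0" "(\<Sum>v\<in>set gs. scale (u v) v) = 0"
      unfolding dependent_finite[OF finite_set] by blast
    have "orthonormal (set gs) (\<lambda>v. v)"
      unfolding orthonormal_def
    proof (intro conjI ballI)
      show "(\<lambda>v. v) ` set gs \<subseteq> H" using assms by (auto simp: orthonormal_def in_set_conv_nth image_subset_iff)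
      fix a b assume "a \<in> set gs" "b \<in> set gs"
      then obtain i j where "a = gs ! i" "b = gs ! j" "i < length gs" "j < length gs"
        by (metis in_set_conv_nth)
      then show "ip a b = (if a = b then 1 else 0)"
        using o[of i j] d by (simp add: nth_eq_iff_index_eq)
    qed
    from orthonormal_ip_comb[OF finite_set this u(1), of u] have "ip 0 v = u v"
      unfolding u(3) .
    moreover have "v \<in> H" using assms u(1) by (auto simp: orthonormal_def in_set_conv_nth)
    ultimately show False using u(2) ip_zero_left by simp
  qed
qed

lemma orthonormal_basis_expand:
  assumes "ordered_basis scale V gs" "orthonormal {..<length gs} ((!) gs)" "v \<in> V"
  shows "v = (\<Sum>i<length gs. scale (ip v (gs ! i)) (gs ! i))"
proof -
  have e: "v = (\<Sum>i<length gs. scale (representation (set gs) v (gs ! i)) (gs ! i))"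
    by (rule ordered_basis_expand[OF assms(1,3)])
  have "ip v (gs ! i) = representation (set gs) v (gs ! i)" if "i < length gs" for i
    by (subst e, subst orthonormal_ip_comb[OF _ assms(2)]) (use that in auto)
  then show ?thesis using e by simp
qed

lemma orthonormal_matrix_of:
  assumes "ordered_basis scale V gs" "orthonormal {..<length gs} ((!) gs)" "endo scale V A"
  shows "matrix_of scale gs A = Matrix.mat (length gs) (length gs) (\<lambda>(i, j). ip (A (gs ! j)) (gs ! i))"
proof (rule matrix_of_eqI[OF assms(1)])
  fix j assume "j < length gs"
  then have "A (gs ! j) \<in> V"
    using assms(3) ordered_basisD(4)[OF assms(1)] nth_mem unfolding endo_def by blast
  then show "A (gs ! j) = (\<Sum>i<length gs. scale (ip (A (gs ! j)) (gs ! i)) (gs ! i))"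
    by (rule orthonormal_basis_expand[OF assms(1,2)])
qed

text \<open>A triangularising list of maximal length is a basis: otherwise the compression of \<open>X\<close> to the
  orthogonal complement has an eigenvector, which extends the list.\<close>

lemma schur_basis:
  assumes V: "subspace V" "V \<subseteq> H" "finite B" "V \<subseteq> span B"
    and def: "\<And>x. x \<in> V \<Longrightarrow> nrm2 x = 0 \<Longrightarrow> x = 0" and X: "endo scale V X"
  obtains gs where "ordered_basis scale V gs" "orthonormal {..<length gs} ((!) gs)"
    "\<And>i. i < length gs \<Longrightarrow> X (gs ! i) \<in> span (set (take (Suc i) gs))"
proof -
  define P where "P gs \<longleftrightarrow> set gs \<subseteq> V \<and> orthonormal {..<length gs} ((!) gs) \<and>
     (\<forall>i<length gs. X (gs ! i) \<in> span (set (take (Suc i) gs)))" for gs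
  have P0: "P []" by (auto simp: P_def orthonormal_def)
  have bd: "length gs < Suc (card B)" if "P gs" for gs
  proof -
    have "independent (set gs)" "set gs \<subseteq> span B" "distinct gs"
      using that orthonormal_independent V by (auto simp: P_def)
    then show ?thesis using independent_span_bound[OF V(3)] by (metis distinct_card less_Suc_eq_le)
  qed
  \<comment> \<open>Orthonormal lists are independent, so the dimension bound \<open>card B\<close>
    limits their length and a longest one exists.\<close>
  obtain gs where gs: "P gs" "\<And>hs. P hs \<Longrightarrow> length hs \<le> length gs"
    using ex_has_greatest_nat[of P "[]" length "Suc (card B)"] P0 bd by blast
  define n where "n = length gs"
  have on: "orthonormal {..<n} ((!) gs)" and gV: "set gs \<subseteq> V" using gs(1) by (auto simp: P_def n_def)
  have gV': "gs ! i \<in> V" if "i < n" for i using gV that by (auto simp: n_def)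
  have gH: "((!) gs) ` {..<n} \<subseteq> H" using on by (auto simp: orthonormal_def)
  have tri: "X (gs ! i) \<in> span (set (take (Suc i) gs))" if "i < n" for i
    using gs(1) that by (auto simp: P_def n_def)
  have vH: "x \<in> H" if "x \<in> V" for x using that V(2) by blast
  have gH': "gs ! i \<in> H" if "i < n" for i using gV'[OF that] by (rule vH)
  define pr where "pr x = (\<Sum>i<n. scale (ip x (gs ! i)) (gs ! i))" for x
  have prV: "pr x \<in> V" for x unfolding pr_def using V(1) gV' by (intro subspace_sum subspace_scale) auto
  have prspan: "pr x \<in> span (set gs)" for x
    unfolding pr_def by (intro span_sum span_scale span_base) (auto simp: n_def)
  define W where "W = {x \<in> V. \<forall>i<n. ip x (gs ! i) = 0}"
  have subV: "span (set gs) \<subseteq> V" using gV V(1) by (rule span_minimal)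
  have "span (set gs) = V"
  proof (rule ccontr)
    assume "span (set gs) \<noteq> V"
    then obtain x where x: "x \<in> V" "x \<notin> span (set gs)" using subV by blast
    have res: "y - pr y \<in> W" if yV: "y \<in> V" for y
    proof -
      have "ip (y - pr y) (gs ! i) = 0" if i: "i < n" for i
      proof -
        have "ip (pr y) (gs ! i) = ip y (gs ! i)" unfolding pr_def
          by (rule orthonormal_ip_comb[OF _ on]) (use i in auto)
        then show ?thesis using ip_diff_left[OF vH[OF yV] vH[OF prV] gH'[OF i]] by simp
      qed
      then show ?thesis using subspace_diff[OF V(1) yV prV] by (simp add: W_def)
    qed
    have "x - pr x \<noteq> 0"
    proof
      assume "x - pr x = 0"
      then have "x = pr x" by simp
      then show False using prspan[of x] x(2) by metis
    qed
    then have Wne: "W \<noteq> {0}" using res[OF x(1)] by auto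
    have Wsub: "subspace W"
    proof (rule subspaceI)
      show "0 \<in> W" using subspace_0[OF V(1)] gH' by (simp add: W_def ip_zero_left)
    next
      fix y z assume "y \<in> W" "z \<in> W"
      then show "y + z \<in> W" using vH gH' subspace_add[OF V(1)] by (simp add: W_def ip_add_left)
    next
      fix c y assume "y \<in> W"
      then show "scale c y \<in> W" using vH gH' subspace_scale[OF V(1)] by (simp add: W_def ip_scale_left)
    qed
    have XV: "X y \<in> V" if "y \<in> V" for y using X that by (auto simp: endo_def)
    have WV: "W \<subseteq> V" by (auto simp: W_def)
    have lin: "pr (y + z) = pr y + pr z" "pr (scale c y) = scale c (pr y)" if "y \<in> V" "z \<in> V" for y z c
    proof -
      have "pr (y + z) = (\<Sum>i<n. scale (ip y (gs ! i) + ip z (gs ! i)) (gs ! i))"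
        unfolding pr_def using that vH gH' by (intro sum.cong) (simp_all add: ip_add_left)
      then show "pr (y + z) = pr y + pr z" by (simp add: pr_def scale_left_distrib sum.distrib)
      have "pr (scale c y) = (\<Sum>i<n. scale (c * ip y (gs ! i)) (gs ! i))"
        unfolding pr_def using that vH gH' by (intro sum.cong) (simp_all add: ip_scale_left)
      then show "pr (scale c y) = scale c (pr y)" by (simp add: pr_def scale_sum_right)
    qed
    have Xa: "X (y + z) = X y + X z" "X (scale c y) = scale c (X y)" if "y \<in> V" "z \<in> V" for y z c
      using X that by (auto simp: endo_def)
    have XW: "endo scale W (\<lambda>y. X y - pr (X y))"
      unfolding endo_def
    proof (intro conjI ballI allI)
      fix y z c assume y: "y \<in> W" and z: "z \<in> W"
      then have yz: "y \<in> V" "z \<in> V" using WV by auto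
      show "X y - pr (X y) \<in> W" using res[OF XV[OF yz(1)]] .
      show "X (y + z) - pr (X (y + z)) = X y - pr (X y) + (X z - pr (X z))"
        using Xa(1)[OF yz] lin(1)[OF XV[OF yz(1)] XV[OF yz(2)]] by simp
      show "X (scale c y) - pr (X (scale c y)) = scale c (X y - pr (X y))"
        using Xa(2)[OF yz(1,1)] lin(2)[OF XV[OF yz(1)] XV[OF yz(1)]] by (simp add: scale_right_diff_distrib)
    qed
    have "\<exists>h\<in>W. h \<noteq> 0 \<and> (\<exists>k. X h - pr (X h) = scale k h)"
      by (rule exists_eigenvector[OF Wsub V(3) _ Wne XW complex_mat_eigenvector]) (use WV V(4) in auto)
    then obtain h k where h: "h \<in> W" "h \<noteq> 0" "X h - pr (X h) = scale k h" by blast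
    have hV: "h \<in> V" "h \<in> H" using h WV V(2) by auto
    \<comment> \<open>Here definiteness on \<open>V\<close> enters: it lets the eigenvector be
      normalised.\<close>
    have np: "nrm2 h > 0" using def[OF hV(1)] h(2) ip_nonneg[OF hV(2)] by fastforce
    define s where "s = complex_of_real (1 / sqrt (nrm2 h))"
    define g where "g = scale s h"
    have gg: "g \<in> V" "g \<in> H" using hV V(1) subspace_H by (auto simp: g_def subspace_scale)
    have s2: "s * cnj s * complex_of_real (nrm2 h) = 1"
      using np by (simp add: s_def flip: of_real_mult)
    have "ip g g = s * cnj s * ip h h"
      using hV subspace_H by (simp add: g_def ip_scale_left ip_scale_right subspace_scale)
    then have ip1: "ip g g = 1" using s2 ip_self[OF hV(2)] by simp
    have ip0: "ip g (gs ! i) = 0" if "i < n" for i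
      using h(1) that hV gH' by (simp add: g_def ip_scale_left W_def)
    have ip0': "ip (gs ! i) g = 0" if "i < n" for i
      using ip_cnj[of g "gs ! i"] ip0[OF that] gg gH'[OF that] by simp
    have "P (gs @ [g])"
      unfolding P_def
    proof (intro conjI allI impI)
      show "set (gs @ [g]) \<subseteq> V" using gV gg by simp
      show "orthonormal {..<length (gs @ [g])} ((!) (gs @ [g]))"
        unfolding orthonormal_def
      proof (intro conjI ballI)
        show "(!) (gs @ [g]) ` {..<length (gs @ [g])} \<subseteq> H"
          using gH' gg(2) by (auto simp: nth_append n_def)
      next
        fix a b assume "a \<in> {..<length (gs @ [g])}" "b \<in> {..<length (gs @ [g])}"
        then have ab: "a < n \<or> a = n" "b < n \<or> b = n" by (auto simp: n_def)
        have e: "(gs @ [g]) ! i = (if i < n then gs ! i else g)" if "i < n \<or> i = n" for i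
          using that by (auto simp: nth_append n_def)
        have "ip (gs ! a) (gs ! b) = (if a = b then 1 else 0)" if "a < n" "b < n"
          using on that by (auto simp: orthonormal_def)
        then show "ip ((gs @ [g]) ! a) ((gs @ [g]) ! b) = (if a = b then 1 else 0)"
          using ab ip0 ip0' ip1 by (auto simp: e)
      qed
    next
      fix i assume i: "i < length (gs @ [g])"
      show "X ((gs @ [g]) ! i) \<in> span (set (take (Suc i) (gs @ [g])))"
      proof (cases "i < n")
        case True
        then show ?thesis using tri[OF True] by (simp add: nth_append n_def)
      next
        case False
        then have i: "i = n" using i by (simp add: n_def)
        \<comment> \<open>The part of \<open>X h\<close> that the compression dropped lies in the
          span of the old list, so the extended list is still triangularising.\<close>
        have "X h = scale k h + pr (X h)" using h(3) by (metis diff_add_cancel)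
        have "X g = scale s (X h)" using Xa(2)[OF hV(1) hV(1)] by (simp add: g_def)
        also have "\<dots> = scale s (scale k h + pr (X h))"
          using \<open>X h = scale k h + pr (X h)\<close> by (rule arg_cong)
        also have "\<dots> = scale k g + scale s (pr (X h))"
          by (simp add: g_def scale_right_distrib mult.commute)
        finally have Xg: "X g = scale k g + scale s (pr (X h))" .
        have "pr (X h) \<in> span (insert g (set gs))"
          using prspan span_mono[of "set gs" "insert g (set gs)"] by blast
        then have "X g \<in> span (insert g (set gs))"
          unfolding Xg by (intro span_add span_scale) (auto intro: span_base)
        then show ?thesis using i by (simp add: n_def)
      qed
    qed
    from gs(2)[OF this] show False by simp
  qed
  then have "ordered_basis scale V gs"
    using orthonormal_independent on by (auto simp: ordered_basis_def n_def)
  then show thesis using that on tri by (auto simp: n_def)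
qed

lemma ip_span_zero:
  assumes "finite A" "A \<subseteq> H" "y \<in> H" "\<And>x. x \<in> A \<Longrightarrow> ip x y = 0" "v \<in> span A"
  shows "ip v y = 0"
proof -
  have "v \<in> range (\<lambda>u. \<Sum>a\<in>A. scale (u a) a)" using assms(5) unfolding span_finite[OF assms(1)] .
  then obtain u where "v = (\<Sum>a\<in>A. scale (u a) a)" by blast
  then show ?thesis using ip_sum_left[of A "\<lambda>a. a" y u] assms by simp
qed

text \<open>The matrix of \<open>X\<close> is upper triangular in this basis, so the numbers
  \<open>ip (X (gs ! i)) (gs ! i)\<close> are its eigenvalues with multiplicity. In this form they
  are bounded by Cauchy-Schwarz, which gives Schur's inequality for the sum of their squared
  moduli.\<close>

lemma schur_det_trace:
  assumes gs: "ordered_basis scale V gs" "orthonormal {..<length gs} ((!) gs)"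
    and tri: "\<And>i. i < length gs \<Longrightarrow> X (gs ! i) \<in> span (set (take (Suc i) gs))" and X: "endo scale V X"
  shows "det_on scale V (\<lambda>x. x - X x) = (\<Prod>i<length gs. 1 - ip (X (gs ! i)) (gs ! i))"
    "trace_on scale V X = (\<Sum>i<length gs. ip (X (gs ! i)) (gs ! i))"
proof -
  define n where "n = length gs"
  have gH: "gs ! i \<in> H" if "i < n" for i using gs(2) that by (auto simp: orthonormal_def n_def)
  have gV: "gs ! i \<in> V" if "i < n" for i using ordered_basisD(4)[OF gs(1)] that by (auto simp: n_def)
  have "subspace V" using ordered_basisD(5)[OF gs(1)] .
  then have E: "endo scale V (\<lambda>x. x - X x)"
    using X by (auto simp: endo_def scale_right_diff_distrib subspace_diff)
  have z: "ip (X (gs ! j)) (gs ! i) = 0" if "j < i" "i < n" for i j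
  proof (rule ip_span_zero[OF _ _ _ _ tri[of j]])
    fix x assume "x \<in> set (take (Suc j) gs)"
    then obtain k where "k < Suc j" "x = gs ! k" by (auto simp: in_set_conv_nth)
    then show "ip x (gs ! i) = 0" using gs(2) that by (auto simp: orthonormal_def n_def)
  qed (use that gH in \<open>auto simp: n_def in_set_conv_nth\<close>)
  define N where "N = matrix_of scale gs (\<lambda>x. x - X x)"
  have XV: "X (gs ! i) \<in> H" if "i < n" for i
  proof -
    have "set (take (Suc i) gs) \<subseteq> H" using gH by (auto simp: n_def in_set_conv_nth)
    then show ?thesis using span_minimal[OF _ subspace_H] tri that by (auto simp: n_def)
  qed
  have Ne: "N = Matrix.mat n n (\<lambda>(i, j). ip (gs ! j - X (gs ! j)) (gs ! i))"
    unfolding N_def n_def by (rule orthonormal_matrix_of[OF gs E])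
  have N: "N \<in> carrier_mat n n" by (simp add: Ne)
  have o: "ip (gs ! i) (gs ! j) = (if i = j then 1 else 0)" if "i < n" "j < n" for i j
    using gs(2) that by (auto simp: orthonormal_def n_def)
  have ent: "N $$ (i, j) = (if i = j then 1 else 0) - ip (X (gs ! j)) (gs ! i)" if "i < n" "j < n" for i j
    using that gH XV o[of j i] by (auto simp: Ne ip_diff_left)
  have "upper_triangular N" using ent z N unfolding upper_triangular_def by auto
  then have "Determinant.det N = prod_list (diag_mat N)" using det_upper_triangular N by blast
  also have "\<dots> = (\<Prod>i<n. N $$ (i, i))"
    using N by (simp add: diag_mat_def prod.list_conv_set_nth atLeast0LessThan)
  finally show "det_on scale V (\<lambda>x. x - X x) = (\<Prod>i<length gs. 1 - ip (X (gs ! i)) (gs ! i))"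
    unfolding det_on_eq[OF gs(1) E] N_def[symmetric] using ent by (simp add: n_def)
  show "trace_on scale V X = (\<Sum>i<length gs. ip (X (gs ! i)) (gs ! i))"
    unfolding trace_on_eq[OF gs(1) X] orthonormal_matrix_of[OF gs X] by simp
qed

end

section \<open>The space of square integrable functions\<close>

definition cip :: "complex^'n \<Rightarrow> complex^'n \<Rightarrow> complex" where
  "cip x y = (\<Sum>i\<in>UNIV. x $ i * cnj (y $ i))"

lemma cip_simps:
  "cip (x + y) z = cip x z + cip y z" "cip z (x + y) = cip z x + cip z y"
  "cip (x - y) z = cip x z - cip y z" "cip z (x - y) = cip z x - cip z y"
  "cip (c *s x) z = c * cip x z" "cip z (c *s x) = cnj c * cip z x"
  "cip 0 z = 0" "cip z 0 = 0"
  by (simp_all add: cip_def sum.distrib sum_subtractf sum_distrib_left algebra_simps)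

lemma cip_cnj: "cip y x = cnj (cip x y)"
  by (simp add: cip_def mult.commute)

lemma cip_self: "cip x x = complex_of_real ((norm x)\<^sup>2)"
  by (simp add: cip_def norm_vec_def L2_set_def sum_nonneg complex_norm_square[symmetric])

lemma cip_scaleR: "cip (r *\<^sub>R x) z = of_real r * cip x z" "cip z (r *\<^sub>R x) = of_real r * cip z x"
  by (simp_all add: cip_def sum_distrib_left scaleR_conv_of_real[where 'a=complex] algebra_simps)

lemma cip_bound: "cmod (cip x y) \<le> norm x * norm y"
proof -
  have "cmod (cip x y) \<le> (\<Sum>i\<in>UNIV. \<bar>cmod (x $ i)\<bar> * \<bar>cmod (y $ i)\<bar>)"
    unfolding cip_def by (rule order_trans[OF norm_sum]) (simp add: norm_mult)
  also have "\<dots> \<le> norm x * norm y"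
    unfolding norm_vec_def by (rule L2_set_mult_ineq)
  finally show ?thesis .
qed

lemma bounded_bilinear_cip: "bounded_bilinear (cip :: complex^'n \<Rightarrow> _)"
proof
  show "\<exists>K. \<forall>a b :: complex^'n. norm (cip a b) \<le> norm a * norm b * K"
    by (rule exI[of _ 1]) (simp add: cip_bound)
qed (auto simp: cip_simps cip_scaleR scaleR_conv_of_real[where 'a=complex])

lemmas continuous_on_cip [continuous_intros] = bounded_bilinear.continuous_on[OF bounded_bilinear_cip]

lemma bounded_bilinear_matrix_vector: "bounded_bilinear ((*v) :: complex^'n^'m \<Rightarrow> complex^'n \<Rightarrow> complex^'m)"
proof -
  have "bounded_linear (\<lambda>A::complex^'n^'m. A $ i)" for i by (rule bounded_linear_vec_nth)
  define K :: real where "K = real CARD('n) * real CARD('m)"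
  show ?thesis
  proof
    show "\<exists>K. \<forall>(a::complex^'n^'m) b. norm (a *v b) \<le> norm a * norm b * K"
    proof (intro exI allI)
      fix a :: "complex^'n^'m" and b
      have "norm (a *v b) \<le> (\<Sum>i\<in>UNIV. norm ((a *v b) $ i))" 
        unfolding norm_vec_def by (rule L2_set_le_sum) auto
      also have "\<dots> \<le> (\<Sum>i\<in>(UNIV :: 'm set). real CARD('n) * (norm a * norm b))"
      proof (rule sum_mono)
        fix i :: 'm
        have "norm ((a *v b) $ i) \<le> (\<Sum>j\<in>UNIV. norm (a $ i $ j * b $ j))"
          unfolding matrix_vector_mult_def by (simp add: norm_sum)
        also have "\<dots> \<le> (\<Sum>j\<in>(UNIV :: 'n set). norm a * norm b)"
          by (intro sum_mono) (auto simp: norm_mult intro!: mult_mono order_trans[OF Finite_Cartesian_Product.norm_nth_le Finite_Cartesian_Product.norm_nth_le] Finite_Cartesian_Product.norm_nth_le)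
        finally show "norm ((a *v b) $ i) \<le> real CARD('n) * (norm a * norm b)" by simp
      qed
      finally show "norm (a *v b) \<le> norm a * norm b * K" by (simp add: K_def algebra_simps)
    qed
  qed (auto simp: Finite_Cartesian_Product.vec_eq_iff matrix_vector_mult_def scaleR_sum_right
      sum.distrib algebra_simps)
qed

lemmas continuous_on_matrix_vector [continuous_intros] =
  bounded_bilinear.continuous_on[OF bounded_bilinear_matrix_vector]

lemma L2_inner_cip: "L2_inner T f g = (\<integral>t. cip (f t) (g t) \<partial>lebesgue_on {0..T})"
  by (simp add: L2_inner_def cip_def)

lemma sum_fun_apply: "(\<Sum>a\<in>A. f a) t = (\<Sum>a\<in>A. f a t)"
  by (induction A rule: infinite_finite_induct) auto

lemma fscale_apply [simp]: "fscale c f t = c *s f t"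
  by (simp add: fscale_def)

lemma L2D: "f \<in> L2 T \<Longrightarrow> f \<in> borel_measurable (lebesgue_on {0..T})"
  "f \<in> L2 T \<Longrightarrow> integrable (lebesgue_on {0..T}) (\<lambda>t. (norm (f t))\<^sup>2)"
  by (auto simp: L2_def)

lemma finite_measure_interval: "finite_measure (lebesgue_on {0..T::real})"
  by (rule finite_measure_lebesgue_on) (simp add: lmeasurable_interval)

lemma borel_measurable_cip:
  assumes "f \<in> borel_measurable M" "g \<in> borel_measurable M"
  shows "(\<lambda>t. cip (f t) (g t)) \<in> borel_measurable M"
  using borel_measurable_continuous_Pair[OF assms, of cip]
  by (simp add: case_prod_beta bounded_bilinear.continuous_on[OF bounded_bilinear_cip] continuous_on_fst continuous_on_snd)

lemma borel_measurable_matrix_vector: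
  fixes A :: "'a \<Rightarrow> complex^'n^'m"
  assumes "A \<in> borel_measurable M" "g \<in> borel_measurable M"
  shows "(\<lambda>t. A t *v g t) \<in> borel_measurable M"
  using borel_measurable_continuous_Pair[OF assms, of "(*v)"]
  by (simp add: case_prod_beta bounded_bilinear.continuous_on[OF bounded_bilinear_matrix_vector] continuous_on_fst continuous_on_snd)

lemma continuous_borel_measurable:
  "continuous_on {0..T} f \<Longrightarrow> (f :: real \<Rightarrow> 'b::euclidean_space) \<in> borel_measurable (lebesgue_on {0..T})"
  by (rule continuous_imp_measurable_on_sets_lebesgue) auto

lemma L2_bound:
  assumes "f \<in> borel_measurable (lebesgue_on {0..T})" "integrable (lebesgue_on {0..T}) h"
    "\<And>t. t \<in> {0..T} \<Longrightarrow> (norm (f t))\<^sup>2 \<le> h t"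
  shows "f \<in> L2 T"
  unfolding L2_def
proof (intro CollectI conjI)
  show "integrable (lebesgue_on {0..T}) (\<lambda>t. (norm (f t))\<^sup>2)"
  proof (rule Bochner_Integration.integrable_bound[OF assms(2)])
    show "AE x in lebesgue_on {0..T}. norm ((norm (f x))\<^sup>2) \<le> norm (h x)"
    proof (rule AE_I2)
      fix x assume "x \<in> space (lebesgue_on {0..T})"
      then show "norm ((norm (f x))\<^sup>2) \<le> norm (h x)" using assms(3)[of x] by simp
    qed
  qed (use assms(1) in measurable)
qed (fact assms(1))

lemma continuous_L2: "continuous_on {0..T} f \<Longrightarrow> f \<in> L2 T"
  by (rule L2_bound[where h = "\<lambda>t. (norm (f t))\<^sup>2"])
    (auto intro!: continuous_borel_measurable continuous_imp_integrable_real continuous_intros)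

lemma continuous_cbound:
  fixes f :: "real \<Rightarrow> 'a::real_normed_vector"
  assumes "continuous_on {0..T} f"
  shows "\<exists>B>0. \<forall>t\<in>{0..T}. norm (f t) \<le> B"
proof -
  have "bounded (f ` {0..T})" using assms by (intro compact_imp_bounded compact_continuous_image) auto
  then show ?thesis by (auto simp: bounded_pos)
qed

lemma L2_bounded_measurable:
  assumes "f \<in> borel_measurable (lebesgue_on {0..T})" "\<And>t. t \<in> {0..T} \<Longrightarrow> norm (f t) \<le> B"
  shows "f \<in> L2 T"
proof (rule L2_bound[OF assms(1), of "\<lambda>_. B\<^sup>2"])
  show "integrable (lebesgue_on {0..T}) (\<lambda>_. B\<^sup>2)"
    using finite_measure.integrable_const[OF finite_measure_interval] .
qed (use assms(2) in \<open>auto intro: power_mono\<close>)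

lemma L2_add: assumes "f \<in> L2 T" "g \<in> L2 T" shows "f + g \<in> L2 T"
proof (rule L2_bound[of _ _ "\<lambda>t. 2 * (norm (f t))\<^sup>2 + 2 * (norm (g t))\<^sup>2"])
  show "f + g \<in> borel_measurable (lebesgue_on {0..T})"
    using L2D(1)[OF assms(1)] L2D(1)[OF assms(2)] by (simp add: plus_fun_def)
  show "integrable (lebesgue_on {0..T}) (\<lambda>t. 2 * (norm (f t))\<^sup>2 + 2 * (norm (g t))\<^sup>2)"
    using L2D(2)[OF assms(1)] L2D(2)[OF assms(2)] by auto
  fix t
  have "(norm (f t + g t))\<^sup>2 \<le> (norm (f t) + norm (g t))\<^sup>2"
    by (intro power_mono norm_triangle_ineq) auto
  also have "\<dots> \<le> 2 * (norm (f t))\<^sup>2 + 2 * (norm (g t))\<^sup>2"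
    using sum_squares_bound[of "norm (f t)" "norm (g t)"] by (simp add: power2_sum)
  finally show "(norm ((f + g) t))\<^sup>2 \<le> 2 * (norm (f t))\<^sup>2 + 2 * (norm (g t))\<^sup>2" by simp
qed

lemma norm_vector_smult: "norm (c *s (x :: complex^'n)) = cmod c * norm x"
  by (simp add: norm_vec_def norm_mult L2_set_right_distrib)

lemma bounded_linear_vsmult: "bounded_linear (\<lambda>x :: complex^'n. c *s x)"
  by (rule bounded_linear_intro[of _ "cmod c"])
    (simp_all add: vector_add_ldistrib norm_vector_smult Finite_Cartesian_Product.vec_eq_iff mult.commute)

lemma vector_smult_matrix: "c *s (x :: complex^'n) = mat c *v x"
  by (simp add: Finite_Cartesian_Product.vec_eq_iff matrix_vector_mult_def Finite_Cartesian_Product.mat_def if_distrib[of "\<lambda>c. c * _"] cong: if_cong)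

lemma L2_matrix_vector:
  fixes A :: "real \<Rightarrow> complex^'n^'m"
  assumes "continuous_on {0..T} A" "f \<in> L2 T"
  shows "(\<lambda>t. A t *v f t) \<in> L2 T"
proof -
  obtain B where B: "B > 0" "\<And>t. t \<in> {0..T} \<Longrightarrow> norm (A t) \<le> B"
    using continuous_cbound[OF assms(1)] by blast
  obtain K where K: "K > 0" "\<And>(a::complex^'n^'m) b. norm (a *v b) \<le> norm a * norm b * K"
    using bounded_bilinear.pos_bounded[OF bounded_bilinear_matrix_vector] by blast
  show ?thesis
  proof (rule L2_bound[of _ _ "\<lambda>t. (B * K)\<^sup>2 * (norm (f t))\<^sup>2"])
    show "(\<lambda>t. A t *v f t) \<in> borel_measurable (lebesgue_on {0..T})"
      using continuous_borel_measurable[OF assms(1)] L2D(1)[OF assms(2)]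
      by (rule borel_measurable_matrix_vector)
    fix t assume "t \<in> {0..T}"
    then have "norm (A t) * (norm (f t) * K) \<le> B * (norm (f t) * K)"
      using B K(1) by (intro mult_right_mono) auto
    then have "norm (A t *v f t) \<le> B * K * norm (f t)"
      using K(2)[of "A t" "f t"] by (simp add: mult_ac)
    then show "(norm (A t *v f t))\<^sup>2 \<le> (B * K)\<^sup>2 * (norm (f t))\<^sup>2"
      using power_mono[of "norm (A t *v f t)" "B * K * norm (f t)" 2] by (simp add: power_mult_distrib)
  qed (use L2D(2)[OF assms(2)] in auto)
qed

lemma L2_smult:
  fixes a :: "real \<Rightarrow> complex"
  assumes "continuous_on {0..T} a" "f \<in> L2 T"
  shows "(\<lambda>t. a t *s f t) \<in> L2 T"
proof -
  have "continuous_on {0..T} (\<lambda>t. mat (a t) :: complex^'n^'n)"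
    unfolding Finite_Cartesian_Product.mat_def
  proof (intro continuous_on_vec_lambda)
    show "continuous_on {0..T} (\<lambda>t. if i = j then a t else 0)" for i j :: 'n
      using assms(1) by (cases "i = j") auto
  qed
  from L2_matrix_vector[OF this assms(2)] show ?thesis by (simp flip: vector_smult_matrix)
qed

lemma L2_fscale: "f \<in> L2 T \<Longrightarrow> fscale c f \<in> L2 T"
  using L2_smult[of T "\<lambda>_. c" f] by (simp add: fscale_def)

lemma L2_zero: "0 \<in> L2 T"
  by (rule continuous_L2) (simp add: zero_fun_def)

lemma L2_subspace: "module.subspace fscale (L2 T)"
proof -
  interpret vector_space "fscale :: complex \<Rightarrow> (real \<Rightarrow> complex^'n) \<Rightarrow> _" by (rule vector_space_fscale)
  show "subspace (L2 T)" by (rule subspaceI) (auto intro: L2_zero L2_add L2_fscale)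
qed

lemma L2_diff: "f \<in> L2 T \<Longrightarrow> g \<in> L2 T \<Longrightarrow> f - g \<in> L2 T"
  using L2_add[of f T "fscale (-1) g"] L2_fscale[of g T "-1"]
  by (simp add: fscale_def plus_fun_def fun_diff_def)

lemma L2_integrable_norm: "f \<in> L2 T \<Longrightarrow> integrable (lebesgue_on {0..T}) (\<lambda>t. norm (f t))"
proof (rule Bochner_Integration.integrable_bound[where f = "\<lambda>t. 1 + (norm (f t))\<^sup>2"])
  assume f: "f \<in> L2 T"
  show "integrable (lebesgue_on {0..T}) (\<lambda>t. 1 + (norm (f t))\<^sup>2)"
    using L2D(2)[OF f] finite_measure.integrable_const[OF finite_measure_interval] by auto
  show "(\<lambda>t. norm (f t)) \<in> borel_measurable (lebesgue_on {0..T})" using L2D(1)[OF f] by measurable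
  have "x \<le> 1 + x\<^sup>2" for x :: real
    using zero_le_power2[of "x - 1/2"] by (simp add: power2_eq_square algebra_simps)
  then show "AE x in lebesgue_on {0..T}. norm (norm (f x)) \<le> norm (1 + (norm (f x))\<^sup>2)"
    by (intro AE_I2) (simp add: abs_of_nonneg)
qed

lemma L2_integrable: "f \<in> L2 T \<Longrightarrow> integrable (lebesgue_on {0..T}) f"
  using L2_integrable_norm[of f T] L2D(1)[of f T] by (simp add: integrable_norm_iff)

lemma L2_cip_integrable:
  assumes "f \<in> L2 T" "g \<in> L2 T"
  shows "integrable (lebesgue_on {0..T}) (\<lambda>t. cip (f t) (g t))"
proof (rule Bochner_Integration.integrable_bound[where f = "\<lambda>t. (norm (f t))\<^sup>2 + (norm (g t))\<^sup>2"])
  show "integrable (lebesgue_on {0..T}) (\<lambda>t. (norm (f t))\<^sup>2 + (norm (g t))\<^sup>2)"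
    using L2D(2)[OF assms(1)] L2D(2)[OF assms(2)] by auto
  show "(\<lambda>t. cip (f t) (g t)) \<in> borel_measurable (lebesgue_on {0..T})"
    using L2D(1) assms by (intro borel_measurable_cip)
  have "cmod (cip x y) \<le> (norm x)\<^sup>2 + (norm y)\<^sup>2" for x y :: "complex^'a"
    using cip_bound[of x y] sum_squares_bound[of "norm x" "norm y"] mult_nonneg_nonneg[OF norm_ge_zero[of x] norm_ge_zero[of y]]
    by linarith
  then show "AE x in lebesgue_on {0..T}. norm (cip (f x) (g x)) \<le> norm ((norm (f x))\<^sup>2 + (norm (g x))\<^sup>2)"
    by (intro AE_I2) (simp add: abs_of_nonneg)
qed

lemma L2_inner_self: "L2_inner T f f = complex_of_real (\<integral>t. (norm (f t))\<^sup>2 \<partial>lebesgue_on {0..T})"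
  by (simp add: L2_inner_cip cip_self del: of_real_power)

text \<open>For large \<open>c\<close> the weight makes a Volterra operator small in Hilbert-Schmidt norm.\<close>

definition wip :: "real \<Rightarrow> real \<Rightarrow> (real \<Rightarrow> complex^'n) \<Rightarrow> (real \<Rightarrow> complex^'n) \<Rightarrow> complex" where
  "wip T c f g = L2_inner T (\<lambda>t. of_real (exp (- c * t)) *s f t) (\<lambda>t. of_real (exp (- c * t)) *s g t)"

lemma L2_weight: "f \<in> L2 T \<Longrightarrow> (\<lambda>t. of_real (exp (c * t)) *s f t) \<in> L2 T"
  by (rule L2_smult) (auto intro!: continuous_intros)

lemma semi_ip_wip: "semi_ip fscale (L2 T) (wip T c :: (real \<Rightarrow> complex^'n) \<Rightarrow> _)"
proof -
  interpret vector_space "fscale :: complex \<Rightarrow> (real \<Rightarrow> complex^'n) \<Rightarrow> _" by (rule vector_space_fscale)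
  show ?thesis
  proof
    show "subspace (L2 T)" by (rule L2_subspace)
  next
    fix x y z :: "real \<Rightarrow> complex^'n" assume "x \<in> L2 T" "y \<in> L2 T" "z \<in> L2 T"
    note H = this[THEN L2_weight, of "- c"]
    let ?w = "\<lambda>x t. of_real (exp (- c * t)) *s (x t :: complex^'n)"
    have "wip T c (x + y) z = (\<integral>t. cip (?w x t) (?w z t) + cip (?w y t) (?w z t) \<partial>lebesgue_on {0..T})"
      unfolding wip_def L2_inner_cip
      by (intro Bochner_Integration.integral_cong refl) (simp only: plus_fun_apply vector_add_ldistrib cip_simps(1))
    then show "wip T c (x + y) z = wip T c x z + wip T c y z"
      using Bochner_Integration.integral_add[OF L2_cip_integrable[OF H(1,3)] L2_cip_integrable[OF H(2,3)]]
      by (simp only: wip_def L2_inner_cip)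
  next
    fix x y :: "real \<Rightarrow> complex^'n" and a assume "x \<in> L2 T" "y \<in> L2 T"
    note H = this[THEN L2_weight, of "- c"]
    have "wip T c (fscale a x) y =
        (\<integral>t. a * cip (of_real (exp (- c * t)) *s x t) (of_real (exp (- c * t)) *s y t) \<partial>lebesgue_on {0..T})"
      by (simp add: wip_def L2_inner_cip cip_simps algebra_simps)
    then show "wip T c (fscale a x) y = a * wip T c x y"
      by (simp add: wip_def L2_inner_cip)
  next
    fix x y :: "real \<Rightarrow> complex^'n"
    show "wip T c y x = cnj (wip T c x y)"
      unfolding wip_def L2_inner_cip
      by (simp only: Bochner_Integration.integral_cnj[symmetric] cip_cnj[symmetric])
  next
    fix x :: "real \<Rightarrow> complex^'n"
    show "0 \<le> Re (wip T c x x)" unfolding wip_def L2_inner_self by simp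
  qed
qed

lemma wip_zero: "wip T 0 = L2_inner T"
  by (intro ext) (simp add: wip_def)

lemma semi_ip_L2_inner: "semi_ip fscale (L2 T) (L2_inner T)"
  using semi_ip_wip[of T 0] by (simp add: wip_zero)

lemma Re_wip_self: "Re (wip T c f f) = (\<integral>t. exp (- 2 * c * t) * (norm (f t))\<^sup>2 \<partial>lebesgue_on {0..T})"
  by (simp add: wip_def L2_inner_self norm_vector_smult power_mult_distrib exp_double[symmetric] algebra_simps
      del: of_real_exp)

lemma eq_ae_L2_inner:
  assumes "f \<in> L2 T" "g \<in> L2 T" "h \<in> L2 T" "eq_ae T f g"
  shows "L2_inner T f h = L2_inner T g h"
  unfolding L2_inner_cip using assms L2D(1)
  by (intro integral_cong_AE borel_measurable_cip) (auto simp: eq_ae_def)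

lemma L2_inner_integral:
  assumes "continuous_on {0..T} f" "continuous_on {0..T} g"
  shows "L2_inner T f g = integral {0..T} (\<lambda>t. cip (f t) (g t))"
  unfolding L2_inner_cip
  by (rule lebesgue_integral_eq_integral) (auto intro!: continuous_imp_integrable_real continuous_intros assms)

text \<open>For c \<ge> 0 the weight lies between exp(-2cT) and 1 on [0,T]. This bound and the next
  make the weighted norm equivalent to the plain one, with constants independent of the cutoff
  N.\<close>

lemma Re_wip_le:
  assumes "c \<ge> 0" "f \<in> L2 T"
  shows "Re (wip T c f f) \<le> Re (L2_inner T f f)"
proof -
  have "integrable (lebesgue_on {0..T}) (\<lambda>t. exp (- 2 * c * t) * (norm (f t))\<^sup>2)"
    using L2D(2)[OF L2_weight[OF assms(2), of "- c"]]
    by (simp add: norm_vector_smult power_mult_distrib exp_double[symmetric] algebra_simps del: of_real_exp)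
  then show ?thesis
    unfolding Re_wip_self L2_inner_self using assms L2D(2)[OF assms(2)]
    by (simp, intro integral_mono) (auto intro!: mult_left_le_one_le)
qed

lemma Re_wip_ge:
  assumes "c \<ge> 0" "f \<in> L2 T"
  shows "Re (L2_inner T f f) \<le> exp (2 * c * T) * Re (wip T c f f)"
proof -
  have i: "integrable (lebesgue_on {0..T}) (\<lambda>t. exp (- 2 * c * t) * (norm (f t))\<^sup>2)"
    using L2D(2)[OF L2_weight[OF assms(2), of "- c"]]
    by (simp add: norm_vector_smult power_mult_distrib exp_double[symmetric] algebra_simps del: of_real_exp)
  have "Re (L2_inner T f f) = (\<integral>t. (norm (f t))\<^sup>2 \<partial>lebesgue_on {0..T})" by (simp add: L2_inner_self)
  also have "\<dots> \<le> (\<integral>t. exp (2 * c * T) * (exp (- 2 * c * t) * (norm (f t))\<^sup>2) \<partial>lebesgue_on {0..T})"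
  proof (rule integral_mono)
    fix t assume "t \<in> space (lebesgue_on {0..T})"
    then have "1 \<le> exp (2 * c * T) * exp (- 2 * c * t)"
      using assms(1) by (simp add: exp_add[symmetric] mult_left_mono)
    then show "(norm (f t))\<^sup>2 \<le> exp (2 * c * T) * (exp (- 2 * c * t) * (norm (f t))\<^sup>2)"
      using mult_right_mono[of 1 "exp (2 * c * T) * exp (- 2 * c * t)" "(norm (f t))\<^sup>2"] by (simp add: mult.assoc)
  qed (use i L2D(2)[OF assms(2)] in auto)
  also have "\<dots> = exp (2 * c * T) * Re (wip T c f f)"
    unfolding Re_wip_self by (rule integral_mult_right_zero)
  finally show ?thesis .
qed

section \<open>Diagonalisation of orthogonal matrices\<close>

lemma cmatrix_mult: "cmatrix (A ** B) = cmatrix A ** cmatrix B"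
  by (simp add: cmatrix_def matrix_matrix_mult_def Finite_Cartesian_Product.vec_eq_iff)

lemma cmatrix_mat: "cmatrix (mat 1) = mat 1"
  by (simp add: cmatrix_def Finite_Cartesian_Product.mat_def Finite_Cartesian_Product.vec_eq_iff)

lemma cip_cmatrix_transpose: "cip (cmatrix A *v x) y = cip x (cmatrix (Finite_Cartesian_Product.transpose A) *v y)"
proof -
  have "cip (cmatrix A *v x) y = (\<Sum>i\<in>UNIV. \<Sum>j\<in>UNIV. of_real (A $ i $ j) * x $ j * cnj (y $ i))"
    by (simp add: cip_def cmatrix_def matrix_vector_mult_def sum_distrib_right)
  also have "\<dots> = (\<Sum>j\<in>UNIV. \<Sum>i\<in>UNIV. of_real (A $ i $ j) * x $ j * cnj (y $ i))"
    by (rule sum.swap)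
  also have "\<dots> = cip x (cmatrix (Finite_Cartesian_Product.transpose A) *v y)"
    by (simp add: cip_def cmatrix_def matrix_vector_mult_def Finite_Cartesian_Product.transpose_def
        sum_distrib_left mult_ac)
  finally show ?thesis .
qed

lemma cip_orthogonal:
  assumes "orthogonal_matrix S"
  shows "cip (cmatrix S *v x) (cmatrix S *v y) = cip x y"
proof -
  have "cmatrix (Finite_Cartesian_Product.transpose S) ** cmatrix S = mat 1"
    using assms unfolding orthogonal_matrix cmatrix_mult[symmetric] by (simp add: cmatrix_mat)
  then show ?thesis by (simp add: cip_cmatrix_transpose matrix_vector_mul_assoc)
qed

lemma semi_ip_cip: "semi_ip ((*s) :: complex \<Rightarrow> complex^'n \<Rightarrow> _) UNIV cip"
  by unfold_locales (auto simp: cip_simps cip_self cip_cnj[symmetric] vec.subspace_UNIV)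

lemma norm_eq_1_cip: "cip x x = 1 \<Longrightarrow> norm x = 1"
proof -
  assume "cip x x = 1"
  then have "(norm x)\<^sup>2 = 1" unfolding cip_self of_real_eq_1_iff .
  then show "norm x = 1" using norm_ge_zero[of x] by (simp add: power2_eq_1_iff)
qed

lemma unitary_diagonalization:
  fixes S :: "real^'n^'n"
  assumes S: "orthogonal_matrix S"
  obtains v :: "'n \<Rightarrow> complex^'n" and \<theta> :: "'n \<Rightarrow> real" where
    "\<And>i j. cip (v i) (v j) = (if i = j then 1 else 0)"
    "\<And>j. cmatrix S *v v j = cis (\<theta> j) *s v j" "\<And>j. - pi < \<theta> j \<and> \<theta> j \<le> pi"
proof -
  interpret C: semi_ip "(*s) :: complex \<Rightarrow> complex^'n \<Rightarrow> _" UNIV cip by (rule semi_ip_cip)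
  have "endo (*s) UNIV ((*v) (cmatrix S))"
    by (auto simp: endo_def matrix_vector_right_distrib vector_scalar_commute)
  from C.schur_basis[OF _ _ vec.finite_Basis _ _ this] obtain gs where
    gs: "ordered_basis (*s) UNIV gs" "C.orthonormal {..<length gs} ((!) gs)"
      "\<And>i. i < length gs \<Longrightarrow> cmatrix S *v (gs ! i) \<in> vec.span (set (take (Suc i) gs))"
    by (metis cip_self vec.span_Basis vec.subspace_UNIV subset_UNIV Re_complex_of_real zero_eq_power2 norm_eq_zero order_refl)
  have o: "cip (gs ! i) (gs ! j) = (if i = j then 1 else 0)" if "i < length gs" "j < length gs" for i j
    using gs(2) that by (auto simp: C.orthonormal_def)
  have len: "length gs = CARD('n)"
  proof -
    have "card (set gs) = CARD('n)"
      using vec.dim_span_eq_card_independent[OF vec.ordered_basisD(2)[OF gs(1)]] vec.ordered_basisD(3)[OF gs(1)]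
      by (simp add: vec.dim_UNIV card_cart_basis)
    then show ?thesis using vec.ordered_basisD(1)[OF gs(1)] by (simp add: distinct_card)
  qed
  have eig: "\<exists>k. cmatrix S *v (gs ! i) = k *s (gs ! i) \<and> cmod k = 1" if "i < length gs" for i
    using that
  proof (induction i rule: less_induct)
    case (less i)
    define y where "y = cmatrix S *v (gs ! i)"
    have "y = (\<Sum>k<length gs. cip y (gs ! k) *s gs ! k)"
      by (rule C.orthonormal_basis_expand[OF gs(1,2)]) simp
    also have "\<dots> = (\<Sum>k<length gs. if k = i then cip y (gs ! i) *s gs ! i else 0)"
    proof (rule sum.cong[OF refl])
      fix k assume k: "k \<in> {..<length gs}"
      \<comment> \<open>By induction the earlier basis vectors are eigenvectors, so unitarity
        carries the orthogonality of \<open>gs ! i\<close> and \<open>gs ! k\<close> over to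
        \<open>y\<close> and \<open>gs ! k\<close>.\<close>
      have "cip y (gs ! k) = 0" if ki: "k < i"
      proof -
        obtain c where c: "cmatrix S *v (gs ! k) = c *s (gs ! k)" "cmod c = 1"
          using less.IH[OF ki] k by auto
        have "cip y (c *s gs ! k) = cip (gs ! i) (gs ! k)"
          unfolding y_def c(1)[symmetric] by (rule cip_orthogonal[OF S])
        also have "\<dots> = 0" using o less.prems k ki by auto
        finally show ?thesis using c(2) by (auto simp: cip_simps)
      qed
      \<comment> \<open>The components beyond i vanish by triangularity.\<close>
      moreover have "cip y (gs ! k) = 0" if "i < k"
      proof (rule C.ip_span_zero[OF _ _ _ _ gs(3)[OF less.prems, folded y_def]])
        fix x assume "x \<in> set (take (Suc i) gs)"
        then obtain l where "l < Suc i" "l < length gs" "x = gs ! l" by (auto simp: in_set_conv_nth)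
        then show "cip x (gs ! k) = 0" using o k that by auto
      qed auto
      ultimately show "cip y (gs ! k) *s gs ! k = (if k = i then cip y (gs ! i) *s gs ! i else 0)"
        by (cases k i rule: linorder_cases) auto
    qed
    also have "\<dots> = cip y (gs ! i) *s gs ! i" using less.prems by simp
    finally have y: "y = cip y (gs ! i) *s gs ! i" .
    have "cip y y = 1"
      unfolding y_def cip_orthogonal[OF S] using o less.prems by simp
    then have "norm y = 1" by (rule norm_eq_1_cip)
    moreover have "norm (gs ! i) = 1"
      using o[OF less.prems less.prems] by (intro norm_eq_1_cip) simp
    ultimately have "cmod (cip y (gs ! i)) = 1"
      using y norm_vector_smult[of "cip y (gs ! i)" "gs ! i"] by simp
    then show ?case using y unfolding y_def by blast
  qed
  obtain f :: "'n \<Rightarrow> nat" where f: "bij_betw f UNIV {..<CARD('n)}"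
    using ex_bij_betw_finite_nat[of "UNIV :: 'n set"] by (auto simp: atLeast0LessThan)
  have fl: "f i < length gs" for i using f len by (auto simp: bij_betw_def)
  obtain k where k: "\<And>j. cmatrix S *v (gs ! f j) = k j *s (gs ! f j)" "\<And>j. cmod (k j) = 1"
    using eig[OF fl] by metis
  show thesis
  proof (rule that[of "\<lambda>j. gs ! f j" "\<lambda>j. Arg (k j)"])
    show "cip (gs ! f i) (gs ! f j) = (if i = j then 1 else 0)" for i j
      using o[OF fl fl] f by (auto simp: bij_betw_def inj_eq)
    have "cis (Arg (k j)) = k j" for j
      using k(2)[of j] rcis_cmod_Arg[of "k j"] by (simp add: rcis_def)
    then show "cmatrix S *v (gs ! f j) = cis (Arg (k j)) *s (gs ! f j)" for j
      using k(1) by simp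
    show "- pi < Arg (k j) \<and> Arg (k j) \<le> pi" for j by (rule Arg_bounded)
  qed
qed

section \<open>Coordinates and functional calculus in a unitary basis\<close>

locale unitary_basis =
  fixes v :: "'n \<Rightarrow> complex^'n"
  assumes v_ortho: "cip (v i) (v j) = (if i = j then 1 else 0)"
begin

definition U :: "complex^'n^'n" where "U = (\<chi> i j. v j $ i)"
definition Ua :: "complex^'n^'n" where "Ua = (\<chi> i j. cnj (v i $ j))"

lemma UaU: "Ua ** U = mat 1"
proof -
  have "(\<Sum>k\<in>UNIV. cnj (v i $ k) * v j $ k) = (if i = j then 1 else 0)" for i j
    using v_ortho[of j i] by (simp add: cip_def mult.commute)
  then show ?thesis
    by (simp add: Ua_def U_def matrix_matrix_mult_def Finite_Cartesian_Product.mat_def Finite_Cartesian_Product.vec_eq_iff)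
qed

lemma UUa: "U ** Ua = mat 1" using UaU matrix_left_right_inverse by blast

lemma v_expand: "x = (\<Sum>j\<in>UNIV. cip x (v j) *s v j)"
proof -
  have "x = U *v (Ua *v x)" by (simp add: matrix_vector_mul_assoc UUa)
  also have "\<dots> = (\<Sum>j\<in>UNIV. cip x (v j) *s v j)"
    by (simp add: Finite_Cartesian_Product.vec_eq_iff U_def Ua_def matrix_vector_mult_def cip_def mult.commute)
  finally show ?thesis .
qed

lemma v_eqI: "(\<And>j. cip x (v j) = cip y (v j)) \<Longrightarrow> x = y"
  by (subst v_expand[of x], subst v_expand[of y]) simp

lemma cip_v_sum: "cip (\<Sum>j\<in>UNIV. c j *s v j) (v i) = c i"
proof -
  have "cip (\<Sum>j\<in>UNIV. c j *s v j) (v i) = (\<Sum>j\<in>UNIV. cip (c j *s v j) (v i))"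
    by (simp add: bounded_bilinear.sum_left[OF bounded_bilinear_cip])
  also have "\<dots> = (\<Sum>j\<in>UNIV. if j = i then c i else 0)"
    by (intro sum.cong) (auto simp: cip_simps v_ortho)
  finally show ?thesis by simp
qed

lemma norm_v [simp]: "norm (v j) = 1"
  using v_ortho[of j j] by (intro norm_eq_1_cip) simp

lemma norm_expand: "(norm x)\<^sup>2 = (\<Sum>j\<in>UNIV. (cmod (cip x (v j)))\<^sup>2)"
proof -
  have "cip x x = cip (\<Sum>j\<in>UNIV. cip x (v j) *s v j) x" using v_expand[of x] by simp
  also have "\<dots> = (\<Sum>j\<in>UNIV. cip x (v j) * cnj (cip x (v j)))"
    by (simp add: bounded_bilinear.sum_left[OF bounded_bilinear_cip] cip_simps cip_cnj[symmetric])
  also have "\<dots> = complex_of_real (\<Sum>j\<in>UNIV. (cmod (cip x (v j)))\<^sup>2)"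
    by (simp only: complex_norm_square of_real_sum)
  finally show ?thesis unfolding cip_self of_real_eq_iff .
qed

lemma matrix_eq_v: "(\<And>j. A *v v j = B *v v j) \<Longrightarrow> A = B"
proof -
  assume *: "\<And>j. A *v v j = B *v v j"
  have "A ** U = B ** U"
    using * by (simp add: Finite_Cartesian_Product.vec_eq_iff U_def matrix_matrix_mult_def matrix_vector_mult_def)
  then have "A ** (U ** Ua) = B ** (U ** Ua)" by (simp add: matrix_mul_assoc)
  then show "A = B" by (simp add: UUa)
qed

text \<open>Functional calculus: any function of a matrix diagonal in this basis is
  \<open>diagm\<close> of the function on the eigenvalues, so determinants of such functions are
  products.\<close>

definition diagm :: "('n \<Rightarrow> complex) \<Rightarrow> complex^'n^'n" where
  "diagm k = U ** (\<chi> i j. if i = j then k i else 0) ** Ua"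

lemma diagm_v: "diagm k *v v j = k j *s v j"
proof -
  have "Ua *v v j = axis j 1"
    using v_ortho[of j] by (auto simp: Finite_Cartesian_Product.vec_eq_iff Ua_def matrix_vector_mult_def cip_def axis_def mult.commute)
  then have "diagm k *v v j = U *v ((\<chi> i j. if i = j then k i else 0) *v axis j 1)"
    by (simp add: diagm_def matrix_vector_mul_assoc[symmetric])
  also have "\<dots> = k j *s v j"
    by (simp add: Finite_Cartesian_Product.vec_eq_iff U_def matrix_vector_mult_def axis_def
        if_distrib[of "\<lambda>c. _ * c"] mult.commute cong: if_cong)
  finally show ?thesis .
qed

lemma diagm_eqI: "(\<And>j. A *v v j = k j *s v j) \<Longrightarrow> A = diagm k"
  by (rule matrix_eq_v) (simp add: diagm_v)

lemma det_diagm: "det (diagm k) = (\<Prod>j\<in>UNIV. k j)"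
proof -
  have "det U * det Ua = 1" using UUa by (metis det_mul det_I)
  then show ?thesis
    by (simp add: diagm_def det_mul det_diagonal mult.commute mult.left_commute)
qed

lemma trace_v: "trace A = (\<Sum>j\<in>UNIV. cip (A *v v j) (v j))"
proof -
  have "trace A = trace (Ua ** (A ** U))"
    using trace_mul_sym[of Ua "A ** U"] by (simp add: matrix_mul_assoc[symmetric] UUa)
  also have "\<dots> = (\<Sum>j\<in>UNIV. cip (A *v v j) (v j))"
    by (simp add: trace_def U_def Ua_def matrix_matrix_mult_def matrix_vector_mult_def cip_def mult.commute)
  finally show ?thesis .
qed

end

section \<open>Exponentials adapted to the boundary condition\<close>

inductive trigp :: "(real \<Rightarrow> complex) \<Rightarrow> bool" where
  mono: "trigp (\<lambda>t. c * cis (of_int k * t))"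
| add: "trigp f \<Longrightarrow> trigp g \<Longrightarrow> trigp (\<lambda>t. f t + g t)"

lemma trigp_const: "trigp (\<lambda>t. c)"
  using trigp.mono[of c 0] by simp

lemma trigp_mult:
  assumes "trigp f" "trigp g"
  shows "trigp (\<lambda>t. f t * g t)"
  using assms(1)
proof induction
  case (mono c k)
  show ?case using assms(2)
  proof induction
    case (mono d l)
    have eq: "(\<lambda>t. c * cis (of_int k * t) * (d * cis (of_int l * t))) = (\<lambda>t. (c * d) * cis (of_int (k + l) * t))"
      by (intro ext) (simp add: distrib_right flip: cis_mult)
    show ?case unfolding eq by (rule trigp.mono)
  next
    case (add f g)
    then show ?case using trigp.add[OF add.IH] by (simp add: distrib_left)
  qed
next
  case (add f h)
  then show ?case using trigp.add[OF add.IH] by (simp add: distrib_right)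
qed

text \<open>Polynomials on the plane, restricted to the unit circle, are trigonometric polynomials:
  a real linear functional of \<open>cis t\<close> is a combination of cosine and sine, hence of
  \<open>cis t\<close> and \<open>cis (- t)\<close>, and products are covered by
  \<open>trigp_mult\<close>.\<close>

lemma trigp_real_polynomial:
  assumes "real_polynomial_function (R :: complex \<Rightarrow> real)"
  shows "trigp (\<lambda>t. complex_of_real (R (cis t)))"
  using assms
proof induction
  case (linear f)
  have eq: "(\<lambda>t. complex_of_real (f (cis t))) = (\<lambda>t. ((f 1 - \<i> * f \<i>) / 2) * cis (of_int 1 * t) + ((f 1 + \<i> * f \<i>) / 2) * cis (of_int (-1) * t))"
  proof
    fix t
    have "cis t = cos t *\<^sub>R 1 + sin t *\<^sub>R \<i>" by (simp add: complex_eq_iff)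
    then have "f (cis t) = cos t * f 1 + sin t * f \<i>"
      using linear.hyps by (simp add: linear_simps(1) bounded_linear.linear linear_cmul linear_add)
    then show "complex_of_real (f (cis t)) =
      ((f 1 - \<i> * f \<i>) / 2) * cis (of_int 1 * t) + ((f 1 + \<i> * f \<i>) / 2) * cis (of_int (-1) * t)"
      by (simp add: complex_eq_iff field_simps)
  qed
  show ?case unfolding eq by (rule trigp.add[OF trigp.mono trigp.mono])
qed (use trigp_const trigp.add trigp_mult in auto)

text \<open>Since p vanishes near both ends it descends to a continuous function on the unit circle,
  where Stone-Weierstrass applies to polynomials in the real and imaginary part.\<close>

lemma trig_dense_periodic:
  fixes p :: "real \<Rightarrow> complex"
  assumes "continuous_on {0..2*pi} p" "0 < a" "a < pi"
    and z: "\<And>t. t \<le> a \<Longrightarrow> p t = 0" "\<And>t. t \<ge> 2 * pi - a \<Longrightarrow> p t = 0" and "e > 0"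
  shows "\<exists>f. trigp f \<and> (\<forall>t\<in>{0..2*pi}. cmod (p t - f t) < e)"
proof -
  define g where "g w = p (Arg2pi w)" for w
  \<comment> \<open>\<open>A\<close> is an open sector of half-angle a about the positive axis, on
    which g vanishes; \<open>B\<close> is the plane slit along that axis, on which
    \<open>Arg2pi\<close> is continuous. The jump of the argument is thus hidden inside
    \<open>A\<close>.\<close>
  define A where "A = {w. Re w > cos a * cmod w}"
  define B where "B = - (\<real>\<^sub>\<ge>\<^sub>0 :: complex set)"
  have oA: "open A" unfolding A_def by (intro open_Collect_less continuous_intros)
  have oB: "open B" unfolding B_def using closed_nonneg_Reals_complex by (simp add: open_Compl)
  have gA: "g w = 0" if "w \<in> A" for w
  proof -
    have w0: "cmod w > 0" using that by (auto simp: A_def)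
    define x where "x = Arg2pi w"
    have x: "0 \<le> x" "x < 2 * pi" "w = of_real (norm w) * exp (\<i> * of_real x)"
      using Arg2pi[of w] by (auto simp: x_def is_Arg_def)
    have "Re w = norm w * cos x" by (subst x(3)) (simp add: cis_conv_exp[symmetric])
    then have c: "cos x > cos a" using that w0 by (simp add: A_def mult.commute)
    have "x < a \<or> x > 2 * pi - a"
    proof (rule ccontr)
      assume n: "\<not> (x < a \<or> x > 2 * pi - a)"
      show False
      proof (cases "x \<le> pi")
        case True
        then have "cos x \<le> cos a" using n assms by (intro cos_monotone_0_pi_le) auto
        then show False using c by simp
      next
        case False
        have "cos (2 * pi - x) \<le> cos a" using n assms False x by (intro cos_monotone_0_pi_le) auto
        then show False using c by (simp add: cos_diff)
      qed
    qed
    then show ?thesis using z by (auto simp: g_def x_def)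
  qed
  have cA: "continuous_on A g" using gA by (simp cong: continuous_on_cong)
  have cB: "continuous_on B g"
  proof -
    have "continuous_on B (p \<circ> Arg2pi)"
    proof (rule continuous_on_compose)
      show "continuous_on B Arg2pi" unfolding B_def
        by (intro continuous_at_imp_continuous_on ballI continuous_at_Arg2pi) auto
      show "continuous_on (Arg2pi ` B) p"
        by (rule continuous_on_subset[OF assms(1)]) (auto simp: Arg2pi_ge_0 intro: less_imp_le[OF Arg2pi_lt_2pi])
    qed
    then show ?thesis by (simp add: g_def comp_def)
  qed
  have sub: "sphere 0 1 \<subseteq> A \<union> B"
  proof
    fix w :: complex assume w: "w \<in> sphere 0 1"
    show "w \<in> A \<union> B"
    proof (cases "w \<in> \<real>\<^sub>\<ge>\<^sub>0")
      case True
      then obtain r where "w = of_real r" "r \<ge> 0" by (auto simp: nonneg_Reals_def)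
      then have "w = 1" using w by simp
      moreover have "cos a < 1" using cos_monotone_0_pi[of 0 a] assms by simp
      ultimately show ?thesis by (simp add: A_def)
    qed (simp add: B_def)
  qed
  have "continuous_on (sphere 0 1) g"
    by (rule continuous_on_subset[OF continuous_on_open_Un[OF oA oB cA cB] sub])
  from Stone_Weierstrass_polynomial_function[OF compact_sphere this \<open>e > 0\<close>]
  obtain q where q: "polynomial_function q" "\<And>w. w \<in> sphere 0 1 \<Longrightarrow> cmod (g w - q w) < e" by blast
  have R: "real_polynomial_function (\<lambda>w. Re (q w))" "real_polynomial_function (\<lambda>w. Im (q w))"
    using q(1) bounded_linear_Re bounded_linear_Im by (auto simp: polynomial_function_def comp_def)
  define f where "f t = complex_of_real (Re (q (cis t))) + \<i> * complex_of_real (Im (q (cis t)))" for t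
  have "trigp f" unfolding f_def
    by (intro trigp.add trigp_mult trigp_const trigp_real_polynomial R)
  moreover have "cmod (p t - f t) < e" if t: "t \<in> {0..2*pi}" for t
  proof -
    have "g (cis t) = p t"
    proof (cases "t = 2 * pi")
      case True
      then show ?thesis using gA[of 1] cos_monotone_0_pi[of 0 a] assms z(2)[of t] by (simp add: A_def)
    next
      case False
      have "Arg2pi (cis t) = t"
        by (rule Arg2pi_unique[of 1]) (use t False in \<open>auto simp: cis_conv_exp\<close>)
      then show ?thesis by (simp add: g_def)
    qed
    moreover have "f t = q (cis t)" by (simp add: f_def complex_eq_iff)
    ultimately show ?thesis using q(2)[of "cis t"] by simp
  qed
  ultimately show ?thesis by blast
qed

text \<open>Multiplication by \<open>cis (\<theta> * t / T)\<close> turns the twisted problem into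
  the periodic one. The function need not match at the ends, so uniform approximation is out of
  reach; it is cut off near 0 and T, which costs little in mean square.\<close>

lemma trig_dense:
  fixes \<zeta> :: "real \<Rightarrow> complex"
  assumes "T > 0" "continuous_on {0..T} \<zeta>" "\<epsilon> > 0"
  shows "\<exists>f. trigp f \<and> integral {0..T} (\<lambda>t. (cmod (\<zeta> t - f (2 * pi * t / T) * cis (- \<theta> * t / T)))\<^sup>2) \<le> \<epsilon>"
proof -
  obtain B where B: "B > 0" "\<And>t. t \<in> {0..T} \<Longrightarrow> norm (\<zeta> t) \<le> B" using continuous_cbound[OF assms(2)] by blast
  \<comment> \<open>The cutoff differs from 1 on two intervals of length 2d, where the error is at
    most B; with the factor 2 from squaring a sum this costs 8 d B^2, at most half of \<epsilon>.
    The uniform error, sqrt(\<epsilon> / (4 T)), costs the other half.\<close>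
  define d where "d = min (T / 8) (\<epsilon> / (16 * B\<^sup>2))"
  have d: "d > 0" "d \<le> T / 8" "16 * d * B\<^sup>2 \<le> \<epsilon>"
    using assms B by (auto simp: d_def min_def field_simps)
  \<comment> \<open>A trapezoid: zero within distance d of the ends and one from distance 2d
    on.\<close>
  define cut where "cut t = min 1 (max 0 (min (t / d - 1) ((T - t) / d - 1)))" for t
  have cut: "continuous_on UNIV cut" "\<And>t. 0 \<le> cut t" "\<And>t. cut t \<le> 1"
    unfolding cut_def using d by (auto intro!: continuous_intros)
  have cut0: "cut t = 0" if "t \<le> d \<or> t \<ge> T - d" for t
    using that d by (auto simp: cut_def field_simps min_def max_def)
  have cut1: "cut t = 1" if "2 * d \<le> t" "t \<le> T - 2 * d" for t
    using that d by (auto simp: cut_def field_simps min_def max_def)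
  \<comment> \<open>Rescaled to period 2 pi, with the twist undone. Multiplying p by the twist gives
    back the truncated function.\<close>
  define p where "p s = (let t = T * s / (2 * pi) in of_real (cut t) * (\<zeta> t * cis (\<theta> * t / T)))" for s
  have p_eq: "p (2 * pi * t / T) = of_real (cut t) * (\<zeta> t * cis (\<theta> * t / T))" for t
    using assms(1) by (simp add: p_def Let_def)
  have im: "(\<lambda>s. T * s / (2 * pi)) ` {0..2*pi} \<subseteq> {0..T}"
    using assms(1) by (auto simp: field_simps)
  have "continuous_on {0..2*pi} p"
    unfolding p_def Let_def using assms(1)
    by (intro continuous_intros continuous_on_compose2[OF cut(1)] continuous_on_compose2[OF assms(2)])
      (use im in auto)
  moreover define a where "a = 2 * pi * d / T"
  have "a > 0" "a < pi" using d assms(1) by (auto simp: a_def field_simps)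
  moreover have "p s = 0" if "s \<le> a" for s
  proof -
    have "T * s / (2 * pi) \<le> d" using that assms(1) by (simp add: a_def field_simps)
    then show ?thesis using cut0 by (simp add: p_def)
  qed
  moreover have "p s = 0" if "s \<ge> 2 * pi - a" for s
  proof -
    have "T * s / (2 * pi) \<ge> T - d" using that assms(1) by (simp add: a_def field_simps)
    then show ?thesis using cut0 by (simp add: p_def)
  qed
  moreover define e where "e = sqrt (\<epsilon> / (4 * T))"
  have "e > 0" using assms by (simp add: e_def)
  ultimately obtain f where f: "trigp f" "\<And>s. s \<in> {0..2*pi} \<Longrightarrow> cmod (p s - f s) < e"
    using trig_dense_periodic[of p a e] by blast
  define h where "h t = (if t \<in> {0..2*d} then 2 * B\<^sup>2 else 0) + (if t \<in> {T-2*d..T} then 2 * B\<^sup>2 else 0) + 2 * e\<^sup>2" for t :: real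
  have tf: "continuous_on UNIV f" using f(1) by induction (auto intro!: continuous_intros)
  have bd: "(cmod (\<zeta> t - f (2 * pi * t / T) * cis (- \<theta> * t / T)))\<^sup>2 \<le> h t" if t: "t \<in> {0..T}" for t
  proof -
    have s: "2 * pi * t / T \<in> {0..2*pi}" using t assms(1) by (auto simp: field_simps)
    have "cmod (of_real (cut t) * \<zeta> t - f (2 * pi * t / T) * cis (- \<theta> * t / T)) =
        cmod (p (2 * pi * t / T) - f (2 * pi * t / T))"
    proof -
      have "p (2 * pi * t / T) * cis (- \<theta> * t / T) = of_real (cut t) * \<zeta> t"
        unfolding p_eq by (simp add: cis_mult mult.assoc)
      then have "(p (2 * pi * t / T) - f (2 * pi * t / T)) * cis (- \<theta> * t / T) =
          of_real (cut t) * \<zeta> t - f (2 * pi * t / T) * cis (- \<theta> * t / T)"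
        by (simp only: left_diff_distrib)
      then show ?thesis by (metis norm_mult norm_cis mult.right_neutral)
    qed
    also have "\<dots> \<le> e" using f(2)[OF s] by simp
    finally have 1: "cmod (of_real (cut t) * \<zeta> t - f (2 * pi * t / T) * cis (- \<theta> * t / T)) \<le> e" .
    have 2: "(cmod (\<zeta> t - of_real (cut t) * \<zeta> t))\<^sup>2 \<le>
        (if t \<in> {0..2*d} then B\<^sup>2 else 0) + (if t \<in> {T-2*d..T} then B\<^sup>2 else 0)"
    proof (cases "t \<in> {0..2*d} \<or> t \<in> {T-2*d..T}")
      case True
      have "\<zeta> t - of_real (cut t) * \<zeta> t = of_real (1 - cut t) * \<zeta> t"
        by (simp add: algebra_simps)
      then have "cmod (\<zeta> t - of_real (cut t) * \<zeta> t) = \<bar>1 - cut t\<bar> * cmod (\<zeta> t)"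
        by (simp only: norm_mult norm_of_real)
      also have "\<dots> \<le> 1 * B" using cut(2,3)[of t] B t by (intro mult_mono) auto
      finally have "(cmod (\<zeta> t - of_real (cut t) * \<zeta> t))\<^sup>2 \<le> B\<^sup>2" by (intro power_mono) auto
      then show ?thesis using True by (smt (verit) zero_le_power2)
    next
      case False
      then have "cut t = 1" using t by (intro cut1) auto
      then show ?thesis by simp
    qed
    have "(cmod (x + y))\<^sup>2 \<le> 2 * (cmod x)\<^sup>2 + 2 * (cmod y)\<^sup>2" for x y
    proof -
      have "(cmod (x + y))\<^sup>2 \<le> (cmod x + cmod y)\<^sup>2" by (intro power_mono norm_triangle_ineq) auto
      then show ?thesis using sum_squares_bound[of "cmod x" "cmod y"] by (simp add: power2_sum)
    qed
    note AA = this[of "\<zeta> t - of_real (cut t) * \<zeta> t" "of_real (cut t) * \<zeta> t - f (2 * pi * t / T) * cis (- \<theta> * t / T)"]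
    have BB: "\<zeta> t - of_real (cut t) * \<zeta> t + (of_real (cut t) * \<zeta> t - f (2 * pi * t / T) * cis (- \<theta> * t / T))
        = \<zeta> t - f (2 * pi * t / T) * cis (- \<theta> * t / T)" by simp
    have CC: "(cmod (of_real (cut t) * \<zeta> t - f (2 * pi * t / T) * cis (- \<theta> * t / T)))\<^sup>2 \<le> e\<^sup>2"
      using power_mono[OF 1, of 2] by simp
    define q1 q2 where "q1 = (if t \<in> {0..2*d} then B\<^sup>2 else 0)" and "q2 = (if t \<in> {T-2*d..T} then B\<^sup>2 else 0)"
    have "h t = 2 * q1 + 2 * q2 + 2 * e\<^sup>2" by (simp add: h_def q1_def q2_def)
    then show ?thesis using AA[unfolded BB] CC 2[folded q1_def q2_def] by linarith
  qed
  have i1: "((\<lambda>t. if t \<in> {u..w} then 2 * B\<^sup>2 else 0) has_integral (2 * B\<^sup>2) * (w - u)) {0..T}"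
    if "0 \<le> u" "u \<le> w" "w \<le> T" for u w
  proof -
    have "((\<lambda>t. 2 * B\<^sup>2) has_integral (w - u) *\<^sub>R (2 * B\<^sup>2)) {u..w}"
      using has_integral_const_real[of "2 * B\<^sup>2" u w] that by simp
    then show ?thesis using that
      by (subst has_integral_restrict) (auto simp: mult.commute)
  qed
  have "(h has_integral (2 * B\<^sup>2) * (2 * d - 0) + (2 * B\<^sup>2) * (T - (T - 2 * d)) + (T - 0) *\<^sub>R (2 * e\<^sup>2)) {0..T}"
    unfolding h_def using d assms(1) has_integral_const_real[of "2 * e\<^sup>2" 0 T]
    by (intro has_integral_add i1) auto
  moreover have "(2 * B\<^sup>2) * (2 * d - 0) + (2 * B\<^sup>2) * (T - (T - 2 * d)) + (T - 0) *\<^sub>R (2 * e\<^sup>2) \<le> \<epsilon>"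
    using d assms(1,3) by (simp add: e_def)
  moreover have "(\<lambda>t. (cmod (\<zeta> t - f (2 * pi * t / T) * cis (- \<theta> * t / T)))\<^sup>2) integrable_on {0..T}"
    using assms(1) by (intro integrable_continuous_real continuous_intros assms(2) continuous_on_compose2[OF tf]) auto
  ultimately have "integral {0..T} (\<lambda>t. (cmod (\<zeta> t - f (2 * pi * t / T) * cis (- \<theta> * t / T)))\<^sup>2) \<le> \<epsilon>"
    using bd by (meson has_integral_le integrable_integral order_trans)
  then show ?thesis using f(1) by blast
qed

lemma cis_has_vector_derivative:
  "((\<lambda>t. cis (w * t)) has_vector_derivative (\<i> * of_real w * cis (w * t))) (at t within A)"
proof -
  have "(\<lambda>t. cis (w * t)) = (\<lambda>t. exp (t *\<^sub>R (\<i> * of_real w)))"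
    by (simp add: cis_conv_exp scaleR_conv_of_real mult_ac)
  then show ?thesis
    using exp_scaleR_has_vector_derivative_right[of "\<i> * of_real w" t A]
    by (simp add: cis_conv_exp scaleR_conv_of_real mult_ac)
qed

lemma integral_cis:
  assumes "0 \<le> T" "w \<noteq> 0"
  shows "integral {0..T} (\<lambda>t. cis (w * t)) = (cis (w * T) - 1) / (\<i> * of_real w)"
proof -
  have "((\<lambda>t. cis (w * t) / (\<i> * of_real w)) has_vector_derivative cis (w * t)) (at t within {0..T})" for t
    using has_vector_derivative_mult_right[OF cis_has_vector_derivative[of w t "{0..T}"], of "1 / (\<i> * of_real w)"] assms
    by simp
  from fundamental_theorem_of_calculus[OF assms(1) this] show ?thesis
    by (intro integral_unique) (simp add: diff_divide_distrib)
qed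

section \<open>Eigenfunctions, Fourier projections and their completeness\<close>

locale spectral = unitary_basis v for v :: "'n::finite \<Rightarrow> complex^'n" +
  fixes T :: real and \<theta> :: "'n \<Rightarrow> real" and Sc :: "complex^'n^'n"
  assumes T_pos: "T > 0" and Sc_v: "Sc *v v j = cis (\<theta> j) *s v j"
    and theta_bound: "- pi < \<theta> j \<and> \<theta> j \<le> pi"
begin

sublocale L: semi_ip fscale "L2 T" "L2_inner T" by (rule semi_ip_L2_inner)

definition om :: "'n \<times> int \<Rightarrow> real" where "om a = (2 * pi * of_int (snd a) - \<theta> (fst a)) / T"

text \<open>Vanishing outside [0,T] follows the normalisation of \<open>W12\<close>, so equality of
  elements of the spaces below is equality of functions.\<close>

definition e :: "'n \<times> int \<Rightarrow> real \<Rightarrow> complex^'n" where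
  "e a t = (if t \<in> {0..T} then (cis (om a * t) / of_real (sqrt T)) *s v (fst a) else 0)"

definition idx :: "real \<Rightarrow> ('n \<times> int) set" where "idx N = {a. \<bar>om a\<bar> \<le> N}"

definition VV :: "real \<Rightarrow> (real \<Rightarrow> complex^'n) set" where "VV N = L.span (e ` idx N)"

text \<open>The Fourier partial sum, an explicit formula defined for all functions. It agrees with
  \<open>P_hat\<close> on \<open>L2 T\<close>, which is shown once the spectral spaces are
  known.\<close>

definition PP :: "real \<Rightarrow> (real \<Rightarrow> complex^'n) \<Rightarrow> real \<Rightarrow> complex^'n" where
  "PP N f = (\<Sum>a\<in>idx N. fscale (L2_inner T f (e a)) (e a))"

lemma om_T: "cis (om a * T) = cis (- \<theta> (fst a))"
proof -
  have "om a * T = - \<theta> (fst a) + 2 * pi * of_int (snd a)" using T_pos by (simp add: om_def)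
  then have "cis (om a * T) = cis (- \<theta> (fst a)) * cis (2 * pi * of_int (snd a))"
    by (simp only: cis_mult)
  then show ?thesis by (simp add: cis_multiple_2pi)
qed

lemma continuous_on_smult [continuous_intros]:
  "continuous_on A f \<Longrightarrow> continuous_on A g \<Longrightarrow> continuous_on A (\<lambda>t. f t *s (g t :: complex^'n))" for A :: "real set"
  unfolding vector_scalar_mult_def by (intro continuous_on_vec_lambda continuous_intros)

lemma e_continuous: "continuous_on {0..T} (e a)"
proof -
  have "continuous_on {0..T} (\<lambda>t. (cis (om a * t) / of_real (sqrt T)) *s v (fst a))"
    using T_pos by (auto intro!: continuous_intros)
  then show ?thesis by (rule continuous_on_eq) (simp add: e_def)
qed

lemma e_L2 [simp]: "e a \<in> L2 T" by (intro continuous_L2 e_continuous)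

lemma e_outside: "t \<notin> {0..T} \<Longrightarrow> e a t = 0" by (auto simp: e_def)

lemma sqrt_T: "complex_of_real (sqrt T) * complex_of_real (sqrt T) = of_real T"
  using T_pos by (simp flip: of_real_mult)

lemma cip_e: "t \<in> {0..T} \<Longrightarrow> cip (A *v e b t) (e a t) = cis ((om b - om a) * t) / of_real T * cip (A *v v (fst b)) (v (fst a))"
  using sqrt_T
  by (simp add: e_def vector_scalar_commute cip_simps cis_cnj cis_mult left_diff_distrib)

lemma L2_inner_e: "L2_inner T (e b) (e a) = (if a = b then 1 else 0)"
proof -
  have "L2_inner T (e b) (e a) = integral {0..T} (\<lambda>t. cip (mat 1 *v e b t) (e a t))"
    by (simp add: L2_inner_integral e_continuous)
  also have "\<dots> = integral {0..T} (\<lambda>t. cip (v (fst b)) (v (fst a)) / of_real T * cis ((om b - om a) * t))"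
    by (rule integral_cong, subst cip_e) simp_all
  also have "\<dots> = cip (v (fst b)) (v (fst a)) / of_real T * integral {0..T} (\<lambda>t. cis ((om b - om a) * t))"
    by simp
  also have "\<dots> = (if a = b then 1 else 0)"
  proof (cases "fst a = fst b")
    case False
    then show ?thesis by (auto simp: v_ortho)
  next
    case True
    show ?thesis
    proof (cases "a = b")
      case True
      then show ?thesis using T_pos by (simp add: v_ortho scaleR_conv_of_real)
    next
      case False
      then have "snd a \<noteq> snd b" using True by (simp add: prod_eq_iff)
      then have "om b - om a \<noteq> 0" using True T_pos by (simp add: om_def)
      moreover have "cis ((om b - om a) * T) = 1"
        using True by (simp add: left_diff_distrib om_T flip: cis_divide)
      ultimately show ?thesis using False T_pos by (simp add: integral_cis)
    qed
  qed
  finally show ?thesis .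
qed

lemma e_orthonormal: "L.orthonormal A e"
  by (auto simp: L.orthonormal_def L2_inner_e)

text \<open>The angle costs at most pi, that is half of 2 pi |k| when k is not 0. Finiteness of
  \<open>idx\<close> and square summability of the inverse frequencies both rest on this.\<close>

lemma om_lower:
  assumes "snd a \<noteq> 0"
  shows "\<bar>om a\<bar> \<ge> pi * \<bar>of_int (snd a)\<bar> / T"
proof -
  have "\<bar>2 * pi * of_int (snd a) - \<theta> (fst a)\<bar> \<ge> 2 * pi * \<bar>of_int (snd a)\<bar> - \<bar>\<theta> (fst a)\<bar>"
    using abs_triangle_ineq2[of "2 * pi * of_int (snd a)" "\<theta> (fst a)"] by (simp add: abs_mult)
  moreover have "\<bar>\<theta> (fst a)\<bar> \<le> pi * 1" using theta_bound[of "fst a"] by auto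
  moreover have "pi * 1 \<le> pi * \<bar>of_int (snd a)\<bar>" using assms by (intro mult_left_mono) auto
  ultimately have "pi * \<bar>of_int (snd a)\<bar> \<le> \<bar>2 * pi * of_int (snd a) - \<theta> (fst a)\<bar>" by linarith
  then show ?thesis using T_pos by (simp add: om_def abs_divide divide_right_mono)
qed

lemma finite_idx: "finite (idx N)"
proof -
  have "a \<in> UNIV \<times> {- \<lceil>\<bar>N\<bar> * T / pi\<rceil>..\<lceil>\<bar>N\<bar> * T / pi\<rceil>}" if "a \<in> idx N" for a
  proof (cases "snd a = 0")
    case True
    have "0 \<le> \<bar>N\<bar> * T / pi" using T_pos by simp
    then have "0 \<le> \<lceil>\<bar>N\<bar> * T / pi\<rceil>" by linarith
    then show ?thesis using True by (simp add: mem_Times_iff)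
  next
    case False
    have "\<bar>om a\<bar> \<le> \<bar>N\<bar>" using that by (simp add: idx_def)
    then have "pi * \<bar>of_int (snd a)\<bar> / T \<le> \<bar>N\<bar>" using om_lower[OF False] by linarith
    then have "\<bar>real_of_int (snd a)\<bar> \<le> \<bar>N\<bar> * T / pi" using T_pos by (simp add: field_simps)
    then have "real_of_int \<bar>snd a\<bar> \<le> of_int \<lceil>\<bar>N\<bar> * T / pi\<rceil>"
      using le_of_int_ceiling[of "\<bar>N\<bar> * T / pi"] by linarith
    then have "\<bar>snd a\<bar> \<le> \<lceil>\<bar>N\<bar> * T / pi\<rceil>" by linarith
    then show ?thesis by (auto simp: mem_Times_iff)
  qed
  then show ?thesis by (meson finite_SigmaI finite finite_atLeastAtMost_int finite_subset subsetI)
qed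

lemma idx_mono: "N \<le> N' \<Longrightarrow> idx N \<subseteq> idx N'" by (auto simp: idx_def)

lemma PP_in_L2: "PP N f \<in> L2 T"
  unfolding PP_def by (rule L.comb_in_H) (auto intro: finite_idx)

lemma PP_in_VV: "PP N f \<in> VV N"
  unfolding PP_def VV_def by (intro L.span_sum L.span_scale L.span_base) auto

lemma VV_subspace: "L.subspace (VV N)" unfolding VV_def by (rule L.subspace_span)

lemma VV_L2: "VV N \<subseteq> L2 T"
  unfolding VV_def by (rule L.span_minimal[OF _ L2_subspace]) auto

lemma VV_mono: "N \<le> N' \<Longrightarrow> VV N \<subseteq> VV N'"
  unfolding VV_def by (intro L.span_mono image_mono idx_mono)

lemma VV_E:
  assumes "f \<in> VV N" obtains c where "f = (\<Sum>a\<in>idx N. fscale (c a) (e a))"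
proof -
  have inj: "inj_on e (idx N)"
  proof (rule inj_onI)
    fix a b assume "e a = e b"
    then show "a = b" using L2_inner_e[of a a] L2_inner_e[of a b] by (auto split: if_splits)
  qed
  have "f \<in> range (\<lambda>u. \<Sum>x\<in>e ` idx N. fscale (u x) x)"
    using assms unfolding VV_def L.span_finite[OF finite_imageI[OF finite_idx]] .
  then obtain u where "f = (\<Sum>x\<in>e ` idx N. fscale (u x) x)" by blast
  then have "f = (\<Sum>a\<in>idx N. fscale (u (e a)) (e a))" by (simp add: sum.reindex[OF inj])
  then show thesis by (rule that)
qed

lemma VV_continuous: "f \<in> VV N \<Longrightarrow> continuous_on {0..T} f"
proof -
  assume "f \<in> VV N"
  then obtain c where "f = (\<Sum>a\<in>idx N. fscale (c a) (e a))" by (rule VV_E)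
  then have "f = (\<lambda>t. \<Sum>a\<in>idx N. c a *s e a t)" by (auto simp: sum_fun_apply)
  moreover have "continuous_on {0..T} (\<lambda>t. \<Sum>a\<in>idx N. c a *s e a t)"
    by (intro continuous_intros e_continuous)
  ultimately show ?thesis by simp
qed

lemma VV_outside: "f \<in> VV N \<Longrightarrow> t \<notin> {0..T} \<Longrightarrow> f t = 0"
  by (erule VV_E) (simp add: sum_fun_apply e_outside)

lemma PP_VV: "f \<in> VV N \<Longrightarrow> PP N f = f"
proof -
  assume "f \<in> VV N"
  then obtain c where f: "f = (\<Sum>a\<in>idx N. fscale (c a) (e a))" by (rule VV_E)
  have "L2_inner T f (e a) = c a" if "a \<in> idx N" for a
    unfolding f by (rule L.orthonormal_ip_comb[OF finite_idx e_orthonormal that])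
  then show ?thesis unfolding PP_def f by simp
qed

lemma PP_ip: "a \<in> idx N \<Longrightarrow> L2_inner T (PP N f) (e a) = L2_inner T f (e a)"
  unfolding PP_def by (rule L.orthonormal_ip_comb[OF finite_idx e_orthonormal])

lemma PP_add: "f \<in> L2 T \<Longrightarrow> g \<in> L2 T \<Longrightarrow> PP N (f + g) = PP N f + PP N g"
  unfolding PP_def by (simp add: L.ip_add_left L.scale_left_distrib sum.distrib)

lemma PP_diff: "f \<in> L2 T \<Longrightarrow> g \<in> L2 T \<Longrightarrow> PP N (f - g) = PP N f - PP N g"
  unfolding PP_def by (simp add: L.ip_diff_left L.scale_left_diff_distrib sum_subtractf)

lemma PP_scale: "f \<in> L2 T \<Longrightarrow> PP N (fscale c f) = fscale c (PP N f)"
  unfolding PP_def by (simp add: L.ip_scale_left L.scale_sum_right)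

lemma nrm2_PP: "L.nrm2 (PP N f) = (\<Sum>a\<in>idx N. (cmod (L2_inner T f (e a)))\<^sup>2)"
  unfolding PP_def by (rule L.nrm2_comb[OF finite_idx e_orthonormal])

lemma nrm2_PP_le: "f \<in> L2 T \<Longrightarrow> L.nrm2 (PP N f) \<le> L.nrm2 f"
  unfolding nrm2_PP by (rule L.bessel[OF finite_idx e_orthonormal])

lemma nrm2_diff_PP: "f \<in> L2 T \<Longrightarrow> L.nrm2 (f - PP N f) = L.nrm2 f - (\<Sum>a\<in>idx N. (cmod (L2_inner T f (e a)))\<^sup>2)"
  unfolding PP_def by (subst L.nrm2_diff_comb[OF finite_idx e_orthonormal]) simp_all

lemma nrm2_diff_PP_best: "f \<in> L2 T \<Longrightarrow> g \<in> VV N \<Longrightarrow> L.nrm2 (f - PP N f) \<le> L.nrm2 (f - g)"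
proof (erule VV_E)
  fix c assume f: "f \<in> L2 T" and g: "g = (\<Sum>a\<in>idx N. fscale (c a) (e a))"
  show ?thesis
    unfolding g L.nrm2_diff_comb[OF finite_idx e_orthonormal f] nrm2_diff_PP[OF f]
    by (simp add: sum_nonneg)
qed

text \<open>The coordinates in the eigenbasis decouple, and each one is approximated by a
  trigonometric polynomial times its own twist, which lies in some \<open>VV N\<close>. Best
  approximation extends the estimate to all larger cutoffs. Continuous functions suffice because the
  operators below produce nothing else.\<close>

lemma PP_complete:
  assumes z: "continuous_on {0..T} z" and "\<epsilon> > 0"
  shows "\<exists>N0. \<forall>N\<ge>N0. L.nrm2 (z - PP N z) \<le> \<epsilon>"
proof -
  define \<zeta> where "\<zeta> j t = cip (z t) (v j)" for j t
  have \<zeta>c: "continuous_on {0..T} (\<zeta> j)" for j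
    unfolding \<zeta>_def by (intro continuous_intros z)
  \<comment> \<open>The squared errors of the coordinates add up, so each one gets an equal
    share.\<close>
  define \<delta> where "\<delta> = \<epsilon> / real CARD('n)"
  have "\<delta> > 0" using assms(2) by (simp add: \<delta>_def)
  have "\<forall>j. \<exists>f. trigp f \<and> integral {0..T} (\<lambda>t. (cmod (\<zeta> j t - f (2 * pi * t / T) * cis (- \<theta> j * t / T)))\<^sup>2) \<le> \<delta>"
    by (intro allI trig_dense[OF T_pos \<zeta>c \<open>\<delta> > 0\<close>])
  from choice[OF this] obtain f where f': "\<forall>j. trigp (f j) \<and>
    integral {0..T} (\<lambda>t. (cmod (\<zeta> j t - f j (2 * pi * t / T) * cis (- \<theta> j * t / T)))\<^sup>2) \<le> \<delta>" ..
  then have f: "\<And>j. trigp (f j)"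
    "\<And>j. integral {0..T} (\<lambda>t. (cmod (\<zeta> j t - f j (2 * pi * t / T) * cis (- \<theta> j * t / T)))\<^sup>2) \<le> \<delta>"
    by simp_all
  define g where "g h j t = (if t \<in> {0..T} then (h (2 * pi * t / T) * cis (- \<theta> j * t / T)) *s v j else 0)" for h j t
  have gV: "\<exists>N. g h j \<in> VV N" if "trigp h" for h j
    using that
  proof induction
    case (mono c k)
    \<comment> \<open>A twisted monomial is a multiple of one eigenfunction, because the twist
      shifts the frequency 2 pi k / T to \<open>om (j, k)\<close>.\<close>
    have "g (\<lambda>t. c * cis (of_int k * t)) j = fscale (c * of_real (sqrt T)) (e (j, k))"
    proof
      fix t
      have "of_int k * (2 * pi * t / T) + - \<theta> j * t / T = om (j, k) * t"
        using T_pos by (simp add: om_def field_simps)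
      then have "cis (of_int k * (2 * pi * t / T)) * cis (- \<theta> j * t / T) = cis (om (j, k) * t)"
        unfolding cis_mult by (rule arg_cong)
      then have "c * cis (of_int k * (2 * pi * t / T)) * cis (- \<theta> j * t / T) =
          c * of_real (sqrt T) * (cis (om (j, k) * t) / of_real (sqrt T))"
        using T_pos unfolding mult.assoc by simp
      then show "g (\<lambda>t. c * cis (of_int k * t)) j t = fscale (c * of_real (sqrt T)) (e (j, k)) t"
        unfolding g_def e_def fscale_apply
        by (cases "t \<in> {0..T}") (simp_all only: if_True if_False vector_smult_assoc fst_conv vector_smult_rzero)
    qed
    moreover have "fscale (c * of_real (sqrt T)) (e (j, k)) \<in> VV \<bar>om (j, k)\<bar>"
      unfolding VV_def by (intro L.span_scale L.span_base imageI) (simp add: idx_def)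
    ultimately have "g (\<lambda>t. c * cis (of_int k * t)) j \<in> VV \<bar>om (j, k)\<bar>" by simp
    then show ?case by blast
  next
    case (add h1 h2)
    then obtain N1 N2 where N: "g h1 j \<in> VV N1" "g h2 j \<in> VV N2" by blast
    have "g (\<lambda>t. h1 t + h2 t) j = g h1 j + g h2 j"
      by (auto simp: g_def fun_eq_iff vector_sadd_rdistrib distrib_right)
    moreover have "g h1 j + g h2 j \<in> VV (max N1 N2)"
      using N VV_mono[of N1 "max N1 N2"] VV_mono[of N2 "max N1 N2"]
      by (intro L.subspace_add[OF VV_subspace]) auto
    ultimately have "g (\<lambda>t. h1 t + h2 t) j \<in> VV (max N1 N2)" by simp
    then show ?case by blast
  qed
  have "\<forall>j. \<exists>N. g (f j) j \<in> VV N" using gV f(1) by blast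
  then obtain Nj where Nj: "\<And>j. g (f j) j \<in> VV (Nj j)" by metis
  define N0 where "N0 = Max (range Nj)"
  have gN0: "g (f j) j \<in> VV N0" for j
    using Nj[of j] VV_mono[of "Nj j" N0] by (auto simp: N0_def)
  define G where "G = (\<Sum>j\<in>UNIV. g (f j) j)"
  have G: "G \<in> VV N0" unfolding G_def by (intro L.subspace_sum[OF VV_subspace] gN0)
  have zL: "z \<in> L2 T" by (rule continuous_L2[OF z])
  define d where "d j t = (cmod (\<zeta> j t - f j (2 * pi * t / T) * cis (- \<theta> j * t / T)))\<^sup>2" for j t
  have tf: "continuous_on UNIV (f j)" for j using f(1)[of j] by induction (auto intro!: continuous_intros)
  have dc: "continuous_on {0..T} (d j)" for j
    unfolding d_def using T_pos by (intro continuous_intros \<zeta>c continuous_on_compose2[OF tf]) auto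
  have "(norm (z t - G t))\<^sup>2 = (\<Sum>j\<in>UNIV. d j t)" if "t \<in> {0..T}" for t
  proof -
    have Gt: "G t = (\<Sum>j\<in>UNIV. (f j (2 * pi * t / T) * cis (- \<theta> j * t / T)) *s v j)"
      using that by (simp add: G_def sum_fun_apply g_def)
    have "cip (z t - G t) (v j) = \<zeta> j t - f j (2 * pi * t / T) * cis (- \<theta> j * t / T)" for j
      unfolding cip_simps Gt cip_v_sum \<zeta>_def ..
    then show ?thesis by (simp add: norm_expand d_def)
  qed
  then have "L.nrm2 (z - G) = (\<integral>t. (\<Sum>j\<in>UNIV. d j t) \<partial>lebesgue_on {0..T})"
    by (auto simp: L2_inner_self intro!: Bochner_Integration.integral_cong)
  also have "\<dots> = (\<Sum>j\<in>UNIV. \<integral>t. d j t \<partial>lebesgue_on {0..T})"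
    by (intro Bochner_Integration.integral_sum continuous_imp_integrable_real dc)
  also have "\<dots> = (\<Sum>j\<in>UNIV. integral {0..T} (d j))"
    by (intro sum.cong lebesgue_integral_eq_integral continuous_imp_integrable_real dc refl) simp
  also have "\<dots> \<le> (\<Sum>j\<in>(UNIV::'n set). \<delta>)" unfolding d_def by (intro sum_mono f(2))
  also have "\<dots> = \<epsilon>" by (simp add: \<delta>_def)
  finally have "L.nrm2 (z - G) \<le> \<epsilon>" .
  then have "L.nrm2 (z - PP N z) \<le> \<epsilon>" if "N \<ge> N0" for N
  proof -
    have "G \<in> VV N" using G VV_mono[OF that] by blast
    from nrm2_diff_PP_best[OF zL this] \<open>L.nrm2 (z - G) \<le> \<epsilon>\<close> show ?thesis by linarith
  qed
  then show ?thesis by blast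
qed

text \<open>Comparison with the sum of 1 / (1 + k^2) over the integers, split into nonnegative and
  negative k, for each of the finitely many j. These terms are the squared moduli of the eigenvalues
  of the inverse of d/dt + 1.\<close>

lemma om_summable: "(\<lambda>a. 1 / (1 + (om a)\<^sup>2)) summable_on UNIV"
proof -
  \<comment> \<open>By \<open>om_lower\<close>, k^2 is at most T^2 / pi^2 times the squared
    frequency for nonzero k; the summand 1 covers the constant term and k = 0.\<close>
  define K where "K = 1 + T\<^sup>2 / pi\<^sup>2"
  have K: "K > 0" by (simp add: K_def add_pos_nonneg)
  define f where "f k = K / (1 + (of_int k)\<^sup>2)" for k :: int
  have sq: "summable (\<lambda>n. 1 / (1 + (real n + c)\<^sup>2))" if "c \<ge> 0" for c
  proof (rule summable_comparison_test_ev[OF _ inverse_power_summable[of 2, where 'a = real]])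
    show "\<forall>\<^sub>F n in sequentially. norm (1 / (1 + (real n + c)\<^sup>2)) \<le> inverse (real n ^ 2)"
      using eventually_gt_at_top[of 0]
    proof eventually_elim
      fix n :: nat assume n: "n > 0"
      have "(real n)\<^sup>2 \<le> (real n + c)\<^sup>2" using that by (intro power_mono) auto
      then have "(real n)\<^sup>2 \<le> 1 + (real n + c)\<^sup>2" by linarith
      then show "norm (1 / (1 + (real n + c)\<^sup>2)) \<le> inverse (real n ^ 2)"
        using n frac_le[of 1 1 "(real n)\<^sup>2" "1 + (real n + c)\<^sup>2"] by (simp add: inverse_eq_divide)
    qed
  qed simp
  have n1: "(\<lambda>n. f (int n)) summable_on UNIV"
  proof (rule norm_summable_imp_summable_on)
    show "summable (\<lambda>n. norm (f (int n)))"
      using summable_mult[OF sq[of 0], of K] K by (simp add: f_def abs_of_pos add_pos_nonneg)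
  qed
  have n2: "(\<lambda>n. f (- int n - 1)) summable_on UNIV"
  proof (rule norm_summable_imp_summable_on)
    have "(- real n - 1)\<^sup>2 = (real n + 1)\<^sup>2" for n by (simp add: power2_eq_square algebra_simps)
    then show "summable (\<lambda>n. norm (f (- int n - 1)))"
      using summable_mult[OF sq[of 1], of K] K by (simp add: f_def abs_of_pos add_pos_nonneg)
  qed
  have "f summable_on range int"
    using n1 summable_on_reindex[of int UNIV f] by (simp add: comp_def)
  moreover have "inj (\<lambda>n. - int n - 1)" by (rule injI) simp
  then have "f summable_on range (\<lambda>n. - int n - 1)"
    using n2 summable_on_reindex[of "\<lambda>n. - int n - 1" UNIV f] by (simp add: comp_def)
  ultimately have "f summable_on (range int \<union> range (\<lambda>n. - int n - 1))"
    by (rule summable_on_union)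
  moreover have "range int \<union> range (\<lambda>n. - int n - 1) = UNIV"
  proof -
    have "k \<in> range int \<union> range (\<lambda>n. - int n - 1)" for k
    proof (cases "k \<ge> 0")
      case True
      then have "k = int (nat k)" by simp
      then show ?thesis by blast
    next
      case False
      then have "k = - int (nat (- k - 1)) - 1" by simp
      then show ?thesis by blast
    qed
    then show ?thesis by blast
  qed
  ultimately have fs: "f summable_on UNIV" by simp
  have "(\<lambda>a. f (snd a)) summable_on (UNIV \<times> UNIV :: ('n \<times> int) set)"
  proof -
    have *: "(\<lambda>a. f (snd a)) summable_on ({j} \<times> UNIV)" for j :: 'n
    proof -
      have img: "{j} \<times> UNIV = range (Pair j)" by auto
      show ?thesis
        unfolding img using fs summable_on_reindex[of "Pair j" UNIV "\<lambda>a. f (snd a)"]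
        by (simp add: comp_def inj_on_def)
    qed
    have **: "(\<lambda>a. f (snd a)) summable_on (\<Union>j\<in>J. {j} \<times> UNIV)" if "finite J" for J :: "'n set"
      using that
    proof induction
      case (insert j J)
      then show ?case unfolding UN_insert by (intro summable_on_union[OF *])
    qed simp
    have eq: "(UNIV \<times> UNIV :: ('n \<times> int) set) = (\<Union>j\<in>UNIV. {j} \<times> UNIV)"
    proof (rule Set.set_eqI)
      show "a \<in> UNIV \<times> UNIV \<longleftrightarrow> a \<in> (\<Union>j\<in>UNIV. {j} \<times> UNIV)" for a :: "'n \<times> int"
        by (cases a) (simp only: mem_Times_iff UN_iff singleton_iff UNIV_I simp_thms fst_conv, blast)
    qed
    show ?thesis using **[OF finite_class.finite_UNIV] by (simp only: eq)
  qed
  moreover have "1 / (1 + (om a)\<^sup>2) \<le> f (snd a)" for a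
  proof -
    have "1 + (of_int (snd a))\<^sup>2 \<le> K * (1 + (om a)\<^sup>2)"
    proof (cases "snd a = 0")
      case True
      then show ?thesis using mult_mono[of 1 K 1 "1 + (om a)\<^sup>2"] by (simp add: K_def)
    next
      case False
      have "pi * \<bar>of_int (snd a)\<bar> / T \<le> \<bar>om a\<bar>" using om_lower[OF False] .
      then have "(pi * \<bar>of_int (snd a)\<bar> / T)\<^sup>2 \<le> (om a)\<^sup>2"
        using T_pos power_mono[of "pi * \<bar>of_int (snd a)\<bar> / T" "\<bar>om a\<bar>" 2] by simp
      then have "(of_int (snd a))\<^sup>2 \<le> T\<^sup>2 / pi\<^sup>2 * (om a)\<^sup>2"
        using T_pos by (simp add: power_divide power_mult_distrib field_simps)
      moreover have "K * (1 + (om a)\<^sup>2) = 1 + T\<^sup>2 / pi\<^sup>2 + (om a)\<^sup>2 + T\<^sup>2 / pi\<^sup>2 * (om a)\<^sup>2"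
        by (simp add: K_def algebra_simps add_divide_distrib)
      moreover have "0 \<le> T\<^sup>2 / pi\<^sup>2" "0 \<le> (om a)\<^sup>2" by simp_all
      ultimately show ?thesis by linarith
    qed
    moreover have A: "1 + (om a)\<^sup>2 > 0" and B: "1 + (real_of_int (snd a))\<^sup>2 > 0"
      by (simp_all add: add_pos_nonneg)
    ultimately have "(1 + (real_of_int (snd a))\<^sup>2) / (1 + (om a)\<^sup>2) \<le> K"
      unfolding pos_divide_le_eq[OF A] by simp
    then show ?thesis unfolding f_def pos_le_divide_eq[OF B] by simp
  qed
  ultimately show ?thesis
    unfolding UNIV_Times_UNIV by (rule summable_on_comparison_test) simp_all
qed

text \<open>The Cauchy criterion, phrased for finite sets of high frequencies so that it can be
  summed against finite orthonormal families.\<close>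

lemma om_tail:
  assumes "\<epsilon> > 0"
  shows "\<exists>N0. \<forall>A. finite A \<and> (\<forall>a\<in>A. \<bar>om a\<bar> > N0) \<longrightarrow> (\<Sum>a\<in>A. 1 / (1 + (om a)\<^sup>2)) \<le> \<epsilon>"
proof -
  define f where "f a = 1 / (1 + (om a)\<^sup>2)" for a
  obtain s where "(f has_sum s) UNIV" using om_summable unfolding f_def summable_on_def by blast
  then have "\<forall>\<^sub>F F in finite_subsets_at_top UNIV. dist (sum f F) s < \<epsilon> / 2"
    unfolding has_sum_def using assms by (intro tendstoD) auto
  then obtain X where X: "finite X" "\<And>Y. finite Y \<Longrightarrow> X \<subseteq> Y \<Longrightarrow> dist (sum f Y) s < \<epsilon> / 2"
    unfolding eventually_finite_subsets_at_top by auto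
  define N0 where "N0 = Max (insert 0 ((\<lambda>a. \<bar>om a\<bar>) ` X))"
  show ?thesis
  proof (intro exI[of _ N0] allI impI)
    fix A assume A: "finite A \<and> (\<forall>a\<in>A. \<bar>om a\<bar> > N0)"
    have "\<bar>om a\<bar> \<le> N0" if "a \<in> X" for a unfolding N0_def using X(1) that by (intro Max_ge) auto
    then have "A \<inter> X = {}" using A by force
    then have "sum f (A \<union> X) = sum f A + sum f X" using A X(1) by (intro sum.union_disjoint) auto
    moreover have "dist (sum f (A \<union> X)) s < \<epsilon> / 2" "dist (sum f X) s < \<epsilon> / 2"
      using X A by auto
    ultimately have "sum f A \<le> \<epsilon>" unfolding dist_real_def by linarith
    then show "(\<Sum>a\<in>A. 1 / (1 + (om a)\<^sup>2)) \<le> \<epsilon>" by (simp add: f_def)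
  qed
qed

lemma cip_Sc: "cip (Sc *v x) (v j) = cis (\<theta> j) * cip x (v j)"
proof -
  have "Sc *v x = (\<Sum>i\<in>UNIV. cip x (v i) *s (Sc *v v i))"
  proof -
    have "Sc *v x = Sc *v (\<Sum>i\<in>UNIV. cip x (v i) *s v i)" by (rule arg_cong[OF v_expand])
    also have "\<dots> = (\<Sum>i\<in>UNIV. cip x (v i) *s (Sc *v v i))"
      by (simp add: bounded_bilinear.sum_right[OF bounded_bilinear_matrix_vector] vector_scalar_commute)
    finally show ?thesis .
  qed
  also have "\<dots> = (\<Sum>i\<in>UNIV. (cip x (v i) * cis (\<theta> i)) *s v i)" by (simp add: Sc_v)
  finally show ?thesis by (simp add: cip_v_sum)
qed

text \<open>The boundary condition of the eigenfunction, moved to the other factor by unitarity. It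
  makes the boundary terms of \<open>by_parts\<close> cancel for functions with z(0) = S
  z(T).\<close>

lemma e_boundary: "cip (Sc *v x) (e a 0) = cip x (e a T)"
  using T_pos by (simp add: e_def cip_simps cip_Sc om_T cis_cnj)

lemma by_parts:
  assumes z: "\<And>t. t \<in> {0..T} \<Longrightarrow> (z has_vector_derivative z' t) (at t within {0..T})"
    and z': "continuous_on {0..T} z'"
  shows "L2_inner T z' (e a) = cip (z T) (e a T) - cip (z 0) (e a 0) + \<i> * om a * L2_inner T z (e a)"
proof -
  \<comment> \<open>\<open>E\<close> is the eigenfunction without the cut outside [0,T], hence
    differentiable.\<close>
  define E where "E t = cis (om a * t) *s (inverse (of_real (sqrt T)) *s v (fst a))" for t
  have eE: "e a t = E t" if "t \<in> {0..T}" for t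
    using that by (simp add: e_def E_def divide_inverse)
  have blin: "bounded_linear (\<lambda>c. c *s (x :: complex^'n))" for x
    by (rule bounded_linear_intro[where K = "norm x"])
      (simp_all add: vector_sadd_rdistrib norm_vector_smult Finite_Cartesian_Product.vec_eq_iff)
  have E': "(E has_vector_derivative (\<i> * of_real (om a)) *s E t) (at t within {0..T})" for t
    using bounded_linear.has_vector_derivative[OF blin[of "inverse (of_real (sqrt T)) *s v (fst a)"] cis_has_vector_derivative[of "om a" t "{0..T}"]]
    unfolding E_def by (simp only: vector_smult_assoc mult.assoc)
  have zc: "continuous_on {0..T} z" using z by (meson continuous_on_eq_continuous_within has_vector_derivative_continuous)
  have Ec: "continuous_on {0..T} E" using E' by (meson continuous_on_eq_continuous_within has_vector_derivative_continuous)
  have "((\<lambda>t. cip (z t) (E t)) has_vector_derivative cip (z t) ((\<i> * of_real (om a)) *s E t) + cip (z' t) (E t)) (at t within {0..T})"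
    if "t \<in> {0..T}" for t
    by (rule bounded_bilinear.has_vector_derivative[OF bounded_bilinear_cip z[OF that] E'])
  from fundamental_theorem_of_calculus[OF less_imp_le[OF T_pos] this]
  have "((\<lambda>t. cip (z t) ((\<i> * of_real (om a)) *s E t) + cip (z' t) (E t)) has_integral
     cip (z T) (E T) - cip (z 0) (E 0)) {0..T}" .
  then have "integral {0..T} (\<lambda>t. cip (z t) ((\<i> * of_real (om a)) *s E t) + cip (z' t) (E t)) =
     cip (z T) (E T) - cip (z 0) (E 0)" by (rule integral_unique)
  also have "integral {0..T} (\<lambda>t. cip (z t) ((\<i> * of_real (om a)) *s E t) + cip (z' t) (E t)) =
     integral {0..T} (\<lambda>t. cip (z t) ((\<i> * of_real (om a)) *s E t)) + integral {0..T} (\<lambda>t. cip (z' t) (E t))"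
    by (intro Henstock_Kurzweil_Integration.integral_add integrable_continuous_real continuous_intros zc Ec z')
  also have "integral {0..T} (\<lambda>t. cip (z t) ((\<i> * of_real (om a)) *s E t)) = - (\<i> * of_real (om a)) * integral {0..T} (\<lambda>t. cip (z t) (E t))"
    by (simp add: cip_simps)
  also have "integral {0..T} (\<lambda>t. cip (z t) (E t)) = L2_inner T z (e a)"
    by (subst L2_inner_integral[OF zc e_continuous]) (auto intro!: integral_cong simp: eE)
  also have "integral {0..T} (\<lambda>t. cip (z' t) (E t)) = L2_inner T z' (e a)"
    by (subst L2_inner_integral[OF z' e_continuous]) (auto intro!: integral_cong simp: eE)
  finally show ?thesis using T_pos by (simp add: eE algebra_simps)
qed

end

section \<open>Partial fractions and infinite products\<close>

lemma sum_symmetric_int: "(\<Sum>k\<in>{- int m..int m}. f k) = f 0 + (\<Sum>n=1..m. f (int n) + f (- int n))" for f :: "int \<Rightarrow> complex"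
proof (induction m)
  case (Suc m)
  have "{- int (Suc m)..int (Suc m)} = insert (int (Suc m)) (insert (- int (Suc m)) {- int m..int m})" by auto
  then show ?case using Suc by (simp add: algebra_simps)
qed simp

lemma prod_symmetric_int: "(\<Prod>k\<in>{- int m..int m}. f k) = f 0 * (\<Prod>n=1..m. f (int n) * f (- int n))" for f :: "int \<Rightarrow> complex"
proof (induction m)
  case (Suc m)
  have "{- int (Suc m)..int (Suc m)} = insert (int (Suc m)) (insert (- int (Suc m)) {- int m..int m})" by auto
  then show ?case using Suc by (simp add: algebra_simps)
qed simp

text \<open>The logarithmic derivative of the reflection formula Gamma(z) Gamma(1 - z) = pi / sin(pi
  z).\<close>

lemma Digamma_reflection:
  fixes w :: complex
  assumes "w \<notin> \<int>"
  shows "Digamma (1 - w) - Digamma w = of_real pi * (cos (of_real pi * w) / sin (of_real pi * w))"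
proof -
  have w: "w \<notin> \<int>\<^sub>\<le>\<^sub>0" "1 - w \<notin> \<int>\<^sub>\<le>\<^sub>0"
  proof -
    show "w \<notin> \<int>\<^sub>\<le>\<^sub>0" using assms nonpos_Ints_Int by blast
    show "1 - w \<notin> \<int>\<^sub>\<le>\<^sub>0"
    proof
      assume "1 - w \<in> \<int>\<^sub>\<le>\<^sub>0"
      then have "1 - (1 - w) \<in> \<int>" using nonpos_Ints_Int by (intro Ints_diff) auto
      then show False using assms by simp
    qed
  qed
  define s where "s = sin (of_real pi * w)"
  have s: "s \<noteq> 0"
  proof
    assume "s = 0"
    then obtain n where "of_real pi * w = of_real (of_int n * pi)"
      unfolding s_def sin_eq_0 by (auto simp: mult.commute)
    then have "w = of_int n" by (simp add: field_simps)
    then show False using assms by simp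
  qed
  have d1: "((\<lambda>z. Gamma z * Gamma (1 - z)) has_field_derivative
      Gamma w * Digamma w * Gamma (1 - w) + (Gamma (1 - w) * Digamma (1 - w) * (- 1)) * Gamma w) (at w)"
    by (rule derivative_eq_intros DERIV_chain2[where f = Gamma and g = "\<lambda>z. 1 - z"] has_field_derivative_Gamma w refl | simp)+
  have d2: "((\<lambda>z. of_real pi / sin (of_real pi * z)) has_field_derivative
      - (of_real pi * (cos (of_real pi * w) * of_real pi)) / (s * s)) (at w)"
    using s unfolding s_def by (auto intro!: derivative_eq_intros simp: field_simps)
  have "(\<lambda>z. Gamma z * Gamma (1 - z)) = (\<lambda>z::complex. of_real pi / sin (of_real pi * z))"
    by (intro ext Gamma_reflection_complex)
  from DERIV_unique[OF d1[unfolded this] d2]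
  have "Gamma w * Gamma (1 - w) * (Digamma (1 - w) - Digamma w) = of_real pi * (cos (of_real pi * w) * of_real pi) / (s * s)"
    by (simp add: algebra_simps)
  also have "Gamma w * Gamma (1 - w) = of_real pi / s" unfolding s_def by (rule Gamma_reflection_complex)
  also have "of_real pi * (cos (of_real pi * w) * of_real pi) / (s * s) =
      of_real pi / s * (of_real pi * (cos (of_real pi * w) / s))" by (simp add: field_simps)
  finally have "of_real pi / s * (Digamma (1 - w) - Digamma w) = of_real pi / s * (of_real pi * (cos (of_real pi * w) / s))" .
  moreover have "of_real pi / s \<noteq> 0" using s by simp
  ultimately show ?thesis unfolding s_def[symmetric] by (simp only: mult_cancel_left simp_thms)
qed

text \<open>The terms with k \<ge> 0 and those with k < 0 each diverge like a logarithm; these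
  cancel in the difference of the limit formulas for Digamma at w and 1 - w.\<close>

lemma cot_partial_fractions:
  fixes w :: complex
  assumes "w \<notin> \<int>"
  shows "(\<lambda>m. \<Sum>k\<in>{- int m..int m}. 1 / (of_int k + w)) \<longlonglongrightarrow> of_real pi * (cos (of_real pi * w) / sin (of_real pi * w))"
proof -
  have nz: "w \<noteq> 0" "1 - w \<noteq> 0" using assms by auto
  have n0: "of_int k + w \<noteq> 0" for k
  proof
    assume "of_int k + w = 0"
    then have "w = of_int (- k)" by (simp add: eq_neg_iff_add_eq_0 add.commute)
    then show False using assms by (metis Ints_of_int)
  qed
  have "(\<lambda>m. (of_real (ln (real m)) - (\<Sum>n<m. inverse ((1 - w) + of_nat n))) - (of_real (ln (real m)) - (\<Sum>n<m. inverse (w + of_nat n))))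
      \<longlonglongrightarrow> Digamma (1 - w) - Digamma w"
    by (intro tendsto_diff Digamma_LIMSEQ nz)
  then have 1: "(\<lambda>m. (\<Sum>n<m. inverse (w + of_nat n)) - (\<Sum>n<m. inverse ((1 - w) + of_nat n)))
      \<longlonglongrightarrow> Digamma (1 - w) - Digamma w"
    by simp
  have 2: "(\<lambda>m. 1 / (of_nat m + w)) \<longlonglongrightarrow> 0"
  proof -
    have "filterlim (\<lambda>m. of_nat m + w) at_infinity sequentially"
      by (rule tendsto_add_filterlim_at_infinity'[OF tendsto_of_nat tendsto_const])
    from filterlim_compose[OF tendsto_inverse_0 this] show ?thesis by (simp add: divide_inverse)
  qed
  \<comment> \<open>There are m + 1 nonnegative indices but only m negative ones. The surplus term 1
    / (m + w) tends to 0.\<close>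
  have "(\<Sum>k\<in>{- int m..int m}. 1 / (of_int k + w)) =
      (\<Sum>n<m. inverse (w + of_nat n)) - (\<Sum>n<m. inverse ((1 - w) + of_nat n)) + 1 / (of_nat m + w)" for m
  proof (induction m)
    case (Suc m)
    have "{- int (Suc m)..int (Suc m)} = insert (int (Suc m)) (insert (- int (Suc m)) {- int m..int m})" by auto
    then have "(\<Sum>k\<in>{- int (Suc m)..int (Suc m)}. 1 / (of_int k + w)) =
        1 / (of_int (int (Suc m)) + w) + (1 / (of_int (- int (Suc m)) + w) + (\<Sum>k\<in>{- int m..int m}. 1 / (of_int k + w)))"
      by (simp del: of_nat_Suc)
    moreover have "1 / (of_int (- int (Suc m)) + w) = - inverse ((1 - w) + of_nat m)"
      by (simp add: divide_inverse flip: inverse_minus_eq)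
    ultimately show ?case using Suc by (simp add: divide_inverse add.commute)
  qed (simp add: divide_inverse)
  then show ?thesis using tendsto_add[OF 1 2] Digamma_reflection[OF assms] by simp
qed

lemma sin_quotient_product:
  fixes w :: complex
  shows "(\<lambda>m. w * (\<Prod>n=1..m. 1 - w\<^sup>2 / of_nat n ^ 2)) \<longlonglongrightarrow> sin (of_real pi * w) / of_real pi"
proof -
  have "(\<lambda>m. of_real pi * w * (\<Prod>n=1..m. 1 - w\<^sup>2 / of_nat n ^ 2) / of_real pi) \<longlonglongrightarrow> sin (of_real pi * w) / of_real pi"
    by (intro tendsto_divide sin_product_formula_complex tendsto_const) simp
  then show ?thesis by (simp add: mult.assoc)
qed

lemma prod_quadratic:
  fixes w :: complex
  shows "(\<Prod>n=1..m. (of_nat n + w) * (- of_nat n + w)) = (\<Prod>n=1..m. - (of_nat n)\<^sup>2) * (\<Prod>n=1..m. 1 - w\<^sup>2 / of_nat n ^ 2)"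
  unfolding prod.distrib[symmetric]
proof (rule prod.cong[OF refl])
  fix n assume "n \<in> {1..m}"
  then have "of_nat n \<noteq> (0 :: complex)" by simp
  then show "(of_nat n + w) * (- of_nat n + w) = - (of_nat n)\<^sup>2 * (1 - w\<^sup>2 / of_nat n ^ 2)"
    by (simp add: field_simps power2_eq_square)
qed

text \<open>Pairing n with -n turns each product into a divergent factor, common to both, times
  Euler's product of the sine. The quotient keeps only the sines.\<close>

lemma shifted_product_limit:
  fixes w w0 :: complex
  assumes "w0 \<notin> \<int>"
  shows "(\<lambda>m. \<Prod>k\<in>{- int m..int m}. (of_int k + w) / (of_int k + w0)) \<longlonglongrightarrow> sin (of_real pi * w) / sin (of_real pi * w0)"
proof -
  have "sin (of_real pi * w0) \<noteq> 0"
  proof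
    assume "sin (of_real pi * w0) = 0"
    then obtain n where "of_real pi * w0 = of_real (of_int n * pi)"
      unfolding sin_eq_0 by (auto simp: mult.commute)
    then have "w0 = of_int n" by (simp add: field_simps)
    then show False using assms by simp
  qed
  then have "(\<lambda>m. (w * (\<Prod>n=1..m. 1 - w\<^sup>2 / of_nat n ^ 2)) / (w0 * (\<Prod>n=1..m. 1 - w0\<^sup>2 / of_nat n ^ 2)))
     \<longlonglongrightarrow> (sin (of_real pi * w) / of_real pi) / (sin (of_real pi * w0) / of_real pi)"
    by (intro tendsto_divide sin_quotient_product) simp
  moreover have "(\<Prod>k\<in>{- int m..int m}. (of_int k + w) / (of_int k + w0)) =
      (w * (\<Prod>n=1..m. 1 - w\<^sup>2 / of_nat n ^ 2)) / (w0 * (\<Prod>n=1..m. 1 - w0\<^sup>2 / of_nat n ^ 2))" for m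
  proof -
    have nz: "(\<Prod>n=1..m. - (of_nat n)\<^sup>2) \<noteq> (0::complex)" by (simp add: prod_zero_iff)
    have p: "(\<Prod>k\<in>{- int m..int m}. of_int k + z) = z * ((\<Prod>n=1..m. - (of_nat n)\<^sup>2) * (\<Prod>n=1..m. 1 - z\<^sup>2 / of_nat n ^ 2))" for z :: complex
      unfolding prod_symmetric_int prod_quadratic[symmetric] by simp
    show ?thesis unfolding prod_dividef p using nz by (simp add: mult.left_commute)
  qed
  ultimately show ?thesis by simp
qed

text \<open>The version for w0 = 0, where the factor at k = 0 has no denominator. It serves the
  angles \<theta> = 0, that is the kernel of the derivative.\<close>

lemma punctured_product_limit:
  fixes w :: complex
  shows "(\<lambda>m. \<Prod>k\<in>{- int m..int m}. if k = 0 then w else (of_int k + w) / of_int k) \<longlonglongrightarrow> sin (of_real pi * w) / of_real pi"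
proof -
  have "(\<Prod>k\<in>{- int m..int m}. if k = 0 then w else (of_int k + w) / of_int k) = w * (\<Prod>n=1..m. 1 - w\<^sup>2 / of_nat n ^ 2)" for m
    unfolding prod_symmetric_int
  proof (intro arg_cong2[where f = "(*)"] prod.cong refl)
    fix n assume "n \<in> {1..m}"
    then have "of_nat n \<noteq> (0 :: complex)" "n \<noteq> 0" by auto
    then show "(if int n = 0 then w else (of_int (int n) + w) / of_int (int n)) *
        (if - int n = 0 then w else (of_int (- int n) + w) / of_int (- int n)) = 1 - w\<^sup>2 / of_nat n ^ 2"
      by (simp add: field_simps power2_eq_square)
  qed simp
  then show ?thesis using sin_quotient_product[of w] by simp
qed

section \<open>From symmetric index blocks to the spectral cutoff\<close>

definition cutset :: "real \<Rightarrow> real \<Rightarrow> real \<Rightarrow> int set" where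
  "cutset T \<theta> N = {k. \<bar>2 * pi * of_int k - \<theta>\<bar> \<le> N * T}"

text \<open>Radius of a symmetric block inside \<open>cutset\<close>. The subtracted 1 leaves room
  for the shift by \<theta>, which is at most half a step.\<close>

definition cutm :: "real \<Rightarrow> real \<Rightarrow> nat" where "cutm T N = nat \<lfloor>N * T / (2 * pi)\<rfloor> - 1"

text \<open>Rounding down, the subtracted 1 and the shift by \<theta> together lose at most two
  indices at either end.\<close>

lemma cutset_bounds:
  assumes "T > 0" "\<bar>\<theta>\<bar> \<le> pi" "N * T / (2 * pi) \<ge> 1"
  shows "{- int (cutm T N)..int (cutm T N)} \<subseteq> cutset T \<theta> N"
    "cutset T \<theta> N \<subseteq> {- int (cutm T N) - 2..int (cutm T N) + 2}"
proof -
  define x where "x = N * T / (2 * pi)"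
  have x: "x \<ge> 1" "N * T = 2 * pi * x" using assms by (auto simp: x_def)
  have m: "of_int (int (cutm T N)) \<le> x - 1" "x < of_int (int (cutm T N)) + 2"
  proof -
    have f: "\<lfloor>x\<rfloor> \<ge> 1" using x by simp
    have "int (nat a - 1) = a - 1" if "a \<ge> 1" for a using that by arith
    from this[OF f] have "int (cutm T N) = \<lfloor>x\<rfloor> - 1" unfolding cutm_def x_def[symmetric] .
    then show "of_int (int (cutm T N)) \<le> x - 1" "x < of_int (int (cutm T N)) + 2"
      by linarith+
  qed
  show "{- int (cutm T N)..int (cutm T N)} \<subseteq> cutset T \<theta> N"
  proof
    fix k assume "k \<in> {- int (cutm T N)..int (cutm T N)}"
    then have "\<bar>real_of_int k\<bar> \<le> x - 1" using m(1) by (simp add: abs_le_iff)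
    then have "2 * pi * \<bar>real_of_int k\<bar> \<le> 2 * pi * (x - 1)" by (intro mult_left_mono) auto
    moreover have "\<bar>2 * pi * of_int k - \<theta>\<bar> \<le> 2 * pi * \<bar>real_of_int k\<bar> + \<bar>\<theta>\<bar>"
      using abs_triangle_ineq4[of "2 * pi * of_int k" \<theta>] by (simp add: abs_mult)
    ultimately have "\<bar>2 * pi * of_int k - \<theta>\<bar> \<le> 2 * pi * x" using assms(2) pi_gt_zero by (simp add: algebra_simps)
    then show "k \<in> cutset T \<theta> N" by (simp add: cutset_def x)
  qed
  show "cutset T \<theta> N \<subseteq> {- int (cutm T N) - 2..int (cutm T N) + 2}"
  proof
    fix k assume "k \<in> cutset T \<theta> N"
    then have "\<bar>2 * pi * of_int k - \<theta>\<bar> \<le> 2 * pi * x" by (simp add: cutset_def x)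
    moreover have "2 * pi * \<bar>real_of_int k\<bar> \<le> \<bar>2 * pi * of_int k - \<theta>\<bar> + \<bar>\<theta>\<bar>"
      using abs_triangle_ineq2[of "2 * pi * of_int k" \<theta>] by (simp add: abs_mult)
    ultimately have "2 * pi * \<bar>real_of_int k\<bar> \<le> 2 * pi * (x + 1 / 2)" using assms(2) by (simp add: algebra_simps)
    then have "\<bar>real_of_int k\<bar> \<le> x + 1 / 2" using mult_le_cancel_left_pos[of "2 * pi"] by simp
    then show "k \<in> {- int (cutm T N) - 2..int (cutm T N) + 2}" using m(2) by simp linarith
  qed
qed

lemma finite_cutset: "T > 0 \<Longrightarrow> \<bar>\<theta>\<bar> \<le> pi \<Longrightarrow> N * T / (2 * pi) \<ge> 1 \<Longrightarrow> finite (cutset T \<theta> N)"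
  by (rule finite_subset[OF cutset_bounds(2)]) auto

lemma filterlim_cutm: "T > 0 \<Longrightarrow> filterlim (cutm T) at_top at_top"
proof (rule filterlim_at_top_mono[where f = "\<lambda>N. nat \<lfloor>N * (T / (2 * pi)) - 1\<rfloor>"])
  assume T: "T > 0"
  have "filterlim (\<lambda>N. - 1 + N * (T / (2 * pi))) at_top at_top"
    by (intro filterlim_tendsto_add_at_top[OF tendsto_const] filterlim_at_top_mult_tendsto_pos[OF tendsto_const] filterlim_ident)
      (use T in auto)
  then have "filterlim (\<lambda>N. N * (T / (2 * pi)) - 1) at_top at_top" by simp
  then show "filterlim (\<lambda>N. nat \<lfloor>N * (T / (2 * pi)) - 1\<rfloor>) at_top at_top"
    by (intro filterlim_compose[OF filterlim_nat_sequentially] filterlim_compose[OF filterlim_floor_sequentially])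
  show "\<forall>\<^sub>F N in at_top. nat \<lfloor>N * (T / (2 * pi)) - 1\<rfloor> \<le> cutm T N"
    by (intro always_eventually allI) (simp add: cutm_def)
qed

lemma eventually_cut: "T > 0 \<Longrightarrow> \<forall>\<^sub>F N in at_top. N * T / (2 * pi) \<ge> 1"
  using eventually_ge_at_top[of "2 * pi / T"] by eventually_elim (simp add: field_simps)

text \<open>At most four indices lie outside the symmetric block, and all of them go to infinity
  with N. So terms tending to 0 suffice, although the series converge only conditionally.\<close>

lemma cut_remainder:
  fixes a :: "int \<Rightarrow> real"
  assumes T: "T > 0" and \<theta>: "\<bar>\<theta>\<bar> \<le> pi" and a: "\<And>\<epsilon>. \<epsilon> > 0 \<Longrightarrow> \<exists>M. \<forall>k. \<bar>k\<bar> \<ge> M \<longrightarrow> \<bar>a k\<bar> \<le> \<epsilon>"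
  shows "((\<lambda>N. \<Sum>k\<in>cutset T \<theta> N - {- int (cutm T N)..int (cutm T N)}. \<bar>a k\<bar>) \<longlongrightarrow> 0) at_top"
proof (rule tendstoI)
  fix \<epsilon> :: real assume "\<epsilon> > 0"
  then obtain M where M: "\<And>k. \<bar>k\<bar> \<ge> M \<Longrightarrow> \<bar>a k\<bar> \<le> \<epsilon> / 8" using a[of "\<epsilon> / 8"] by auto
  have "\<forall>\<^sub>F N in at_top. cutm T N \<ge> nat M" using filterlim_cutm[OF T] by (simp add: filterlim_at_top)
  then show "\<forall>\<^sub>F N in at_top. dist (\<Sum>k\<in>cutset T \<theta> N - {- int (cutm T N)..int (cutm T N)}. \<bar>a k\<bar>) 0 < \<epsilon>"
    using eventually_cut[OF T]
  proof eventually_elim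
    case (elim N)
    define R where "R = cutset T \<theta> N - {- int (cutm T N)..int (cutm T N)}"
    have R: "R \<subseteq> {- int (cutm T N) - 2, - int (cutm T N) - 1, int (cutm T N) + 1, int (cutm T N) + 2}"
      using cutset_bounds(2)[OF T \<theta> elim(2)] by (auto simp: R_def)
    have "card R \<le> card {- int (cutm T N) - 2, - int (cutm T N) - 1, int (cutm T N) + 1, int (cutm T N) + 2}"
      by (rule card_mono[OF _ R]) simp
    also have "\<dots> \<le> 4" by (simp add: card_insert_if)
    finally have c: "card R \<le> 4" .
    have "(\<Sum>k\<in>R. \<bar>a k\<bar>) \<le> of_nat (card R) * (\<epsilon> / 8)"
    proof (rule sum_bounded_above)
      fix k assume "k \<in> R"
      then have "\<bar>k\<bar> \<ge> M" using R elim(1) by auto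
      then show "\<bar>a k\<bar> \<le> \<epsilon> / 8" by (rule M)
    qed
    also have "\<dots> \<le> 4 * (\<epsilon> / 8)" using c \<open>\<epsilon> > 0\<close> by (intro mult_right_mono) auto
    finally show ?case using \<open>\<epsilon> > 0\<close> by (simp add: R_def[symmetric] sum_nonneg)
  qed
qed

lemma cut_sum:
  fixes a :: "int \<Rightarrow> complex"
  assumes T: "T > 0" and \<theta>: "\<bar>\<theta>\<bar> \<le> pi" and a: "\<And>\<epsilon>. \<epsilon> > 0 \<Longrightarrow> \<exists>M. \<forall>k. \<bar>k\<bar> \<ge> M \<longrightarrow> cmod (a k) \<le> \<epsilon>"
    and lim: "(\<lambda>m. \<Sum>k\<in>{- int m..int m}. a k) \<longlonglongrightarrow> l"
  shows "((\<lambda>N. \<Sum>k\<in>cutset T \<theta> N. a k) \<longlongrightarrow> l) at_top"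
proof -
  let ?R = "\<lambda>N. cutset T \<theta> N - {- int (cutm T N)..int (cutm T N)}"
  have "((\<lambda>N. \<Sum>k\<in>?R N. \<bar>cmod (a k)\<bar>) \<longlongrightarrow> 0) at_top"
    by (rule cut_remainder[OF T \<theta>]) (use a in auto)
  then have "((\<lambda>N. \<Sum>k\<in>?R N. a k) \<longlongrightarrow> 0) at_top"
    by (rule Lim_null_comparison[rotated]) (auto intro!: always_eventually norm_sum)
  from tendsto_add[OF filterlim_compose[OF lim filterlim_cutm[OF T]] this]
  have "((\<lambda>N. (\<Sum>k\<in>{- int (cutm T N)..int (cutm T N)}. a k) + (\<Sum>k\<in>?R N. a k)) \<longlongrightarrow> l) at_top" by simp
  moreover have "\<forall>\<^sub>F N in at_top. (\<Sum>k\<in>{- int (cutm T N)..int (cutm T N)}. a k) + (\<Sum>k\<in>?R N. a k) = (\<Sum>k\<in>cutset T \<theta> N. a k)"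
    using eventually_cut[OF T]
    by eventually_elim (simp add: sum.subset_diff[OF cutset_bounds(1)[OF T \<theta>] finite_cutset[OF T \<theta>]] add.commute)
  ultimately show ?thesis by (rule Lim_transform_eventually)
qed

text \<open>Expand the product: the triangle inequality replaces every monomial by its modulus.
  Combined with 1 + x \<le> exp x it controls products by sums, here and for the eigenvalues of the
  compressions.\<close>

lemma norm_prod_minus1_le:
  fixes f :: "'i \<Rightarrow> complex"
  shows "cmod ((\<Prod>i\<in>A. 1 + f i) - 1) \<le> (\<Prod>i\<in>A. 1 + cmod (f i)) - 1"
proof (induction A rule: infinite_finite_induct)
  case (insert x A)
  define P Q where "P = (\<Prod>i\<in>A. 1 + f i)" and "Q = (\<Prod>i\<in>A. 1 + cmod (f i))"
  have "cmod P \<le> Q"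
    unfolding P_def Q_def prod_norm[symmetric]
    by (intro prod_mono) (auto intro: order_trans[OF norm_triangle_ineq])
  have "(1 + f x) * P - 1 = (P - 1) + f x * P" by (simp add: algebra_simps)
  then have "cmod ((1 + f x) * P - 1) \<le> cmod (P - 1) + cmod (f x) * cmod P"
    by (metis norm_mult norm_triangle_ineq)
  also have "\<dots> \<le> (Q - 1) + cmod (f x) * Q"
    using insert.IH \<open>cmod P \<le> Q\<close> by (intro add_mono mult_left_mono) (auto simp: P_def Q_def)
  also have "\<dots> = (1 + cmod (f x)) * Q - 1" by (simp add: algebra_simps)
  finally show ?case using insert.hyps by (simp add: P_def Q_def)
qed auto

lemma cut_prod:
  fixes b :: "int \<Rightarrow> complex"
  assumes T: "T > 0" and \<theta>: "\<bar>\<theta>\<bar> \<le> pi" and b: "\<And>\<epsilon>. \<epsilon> > 0 \<Longrightarrow> \<exists>M. \<forall>k. \<bar>k\<bar> \<ge> M \<longrightarrow> cmod (b k - 1) \<le> \<epsilon>"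
    and lim: "(\<lambda>m. \<Prod>k\<in>{- int m..int m}. b k) \<longlonglongrightarrow> l"
  shows "((\<lambda>N. \<Prod>k\<in>cutset T \<theta> N. b k) \<longlongrightarrow> l) at_top"
proof -
  let ?R = "\<lambda>N. cutset T \<theta> N - {- int (cutm T N)..int (cutm T N)}"
  have "((\<lambda>N. \<Sum>k\<in>?R N. \<bar>cmod (b k - 1)\<bar>) \<longlongrightarrow> 0) at_top"
    by (rule cut_remainder[OF T \<theta>]) (use b in auto)
  then have "((\<lambda>N. exp (\<Sum>k\<in>?R N. cmod (b k - 1)) - 1) \<longlongrightarrow> exp 0 - 1) at_top"
    by (intro tendsto_intros) simp
  then have 0: "((\<lambda>N. exp (\<Sum>k\<in>?R N. cmod (b k - 1)) - 1) \<longlongrightarrow> 0) at_top" by simp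
  have 1: "cmod ((\<Prod>k\<in>?R N. b k) - 1) \<le> exp (\<Sum>k\<in>?R N. cmod (b k - 1)) - 1" for N
  proof -
    have "cmod ((\<Prod>k\<in>?R N. 1 + (b k - 1)) - 1) \<le> (\<Prod>k\<in>?R N. 1 + cmod (b k - 1)) - 1"
      by (rule norm_prod_minus1_le)
    also have "(\<Prod>k\<in>?R N. 1 + cmod (b k - 1)) \<le> (\<Prod>k\<in>?R N. exp (cmod (b k - 1)))"
      by (intro prod_mono) (simp add: add_nonneg_nonneg)
    also have "\<dots> \<le> exp (\<Sum>k\<in>?R N. cmod (b k - 1))"
      by (cases "finite (?R N)") (simp_all add: exp_sum)
    finally show ?thesis by simp
  qed
  have "((\<lambda>N. (\<Prod>k\<in>?R N. b k) - 1) \<longlongrightarrow> 0) at_top"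
    by (rule Lim_null_comparison[OF always_eventually 0]) (use 1 in simp)
  then have "((\<lambda>N. \<Prod>k\<in>?R N. b k) \<longlongrightarrow> 1) at_top" by (simp add: LIM_zero_iff)
  from tendsto_mult[OF filterlim_compose[OF lim filterlim_cutm[OF T]] this]
  have "((\<lambda>N. (\<Prod>k\<in>{- int (cutm T N)..int (cutm T N)}. b k) * (\<Prod>k\<in>?R N. b k)) \<longlongrightarrow> l) at_top" by simp
  moreover have "\<forall>\<^sub>F N in at_top. (\<Prod>k\<in>{- int (cutm T N)..int (cutm T N)}. b k) * (\<Prod>k\<in>?R N. b k) = (\<Prod>k\<in>cutset T \<theta> N. b k)"
    using eventually_cut[OF T]
    by eventually_elim (simp add: prod.subset_diff[OF cutset_bounds(1)[OF T \<theta>] finite_cutset[OF T \<theta>]] mult.commute)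
  ultimately show ?thesis by (rule Lim_transform_eventually)
qed

lemma inverse_int_small:
  fixes w c :: complex
  assumes "\<epsilon> > 0"
  shows "\<exists>M. \<forall>k::int. \<bar>k\<bar> \<ge> M \<longrightarrow> cmod (c / (of_int k + w)) \<le> \<epsilon>"
proof -
  define M where "M = \<lceil>cmod w + cmod c / \<epsilon> + 1\<rceil>"
  have "cmod (c / (of_int k + w)) \<le> \<epsilon>" if "\<bar>k\<bar> \<ge> M" for k :: int
  proof -
    have "real_of_int \<bar>k\<bar> \<ge> cmod w + cmod c / \<epsilon> + 1" using that unfolding M_def by linarith
    moreover have "cmod (of_int k + w) \<ge> real_of_int \<bar>k\<bar> - cmod w"
      using norm_diff_ineq[of "of_int k" w] by simp
    ultimately have 1: "cmod (of_int k + w) \<ge> cmod c / \<epsilon> + 1" by linarith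
    moreover have "cmod c / \<epsilon> \<ge> 0" using assms by simp
    ultimately have p: "cmod (of_int k + w) > 0" by linarith
    have "cmod c \<le> \<epsilon> * cmod (of_int k + w)"
    proof -
      have "cmod c = \<epsilon> * (cmod c / \<epsilon>)" using assms by simp
      also have "\<dots> \<le> \<epsilon> * cmod (of_int k + w)" using 1 assms by (intro mult_left_mono) auto
      finally show ?thesis .
    qed
    then show ?thesis using p by (simp add: norm_divide pos_divide_le_eq)
  qed
  then show ?thesis by blast
qed

text \<open>Links determinants of matrices indexed by a finite type with those indexed by numbers:
  permutations and their signs are transported along the enumeration \<open>f\<close>.\<close>

lemma det_reindex:
  fixes A :: "'a::comm_ring_1^'n^'n"
  assumes f: "bij_betw f {0..<CARD('n)} (UNIV :: 'n set)"
  shows "det A = Determinant.det (Matrix.mat CARD('n) CARD('n) (\<lambda>(i, j). A $ f i $ f j))"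
proof -
  define n where "n = CARD('n)"
  define g where "g = inv_into {0..<n} f"
  have f': "bij_betw f {0..<n} UNIV" using f by (simp add: n_def)
  have g: "bij_betw g UNIV {0..<n}" unfolding g_def by (rule bij_betw_inv_into[OF f'])
  have gf: "g (f x) = x" if "x \<in> {0..<n}" for x
    unfolding g_def by (rule inv_into_f_f) (use f' that in \<open>auto simp: bij_betw_def\<close>)
  have fg: "f (g y) = y" for y
    unfolding g_def by (rule f_inv_into_f) (use f' in \<open>auto simp: bij_betw_def\<close>)
  have fi: "inj_on f {0..<n}" and gi: "inj_on g UNIV" using f' g by (auto simp: bij_betw_def)
  have gn: "g y \<in> {0..<n}" for y using g by (auto simp: bij_betw_def)
  have "Determinant.det (Matrix.mat n n (\<lambda>(i, j). A $ f i $ f j)) =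
      (\<Sum>p\<in>{p. p permutes {0..<n}}. of_int (sign p) * (\<Prod>i = 0..<n. Matrix.mat n n (\<lambda>(i, j). A $ f i $ f j) $$ (i, p i)))"
    by (rule det_def') simp
  also have "\<dots> = (\<Sum>q\<in>{q. q permutes UNIV}. of_int (sign q) * (\<Prod>i\<in>UNIV. A $ i $ q i))"
  proof (rule sum.reindex_bij_witness[of _ "map_permutation UNIV g" "map_permutation {0..<n} f"])
    fix p assume "p \<in> {p. p permutes {0..<n}}"
    then have p: "p permutes {0..<n}" by simp
    show q: "map_permutation {0..<n} f p \<in> {q. q permutes UNIV}"
      using map_permutation_permutes[OF f' p] by simp
    have qf: "map_permutation {0..<n} f p (f x) = f (p x)" if "x \<in> {0..<n}" for x
      by (rule map_permutation_apply[OF fi that])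
    show "map_permutation UNIV g (map_permutation {0..<n} f p) = p"
    proof
      fix x
      show "map_permutation UNIV g (map_permutation {0..<n} f p) x = p x"
      proof (cases "x \<in> {0..<n}")
        case True
        then show ?thesis
          using map_permutation_apply[OF gi, of "f x" "map_permutation {0..<n} f p"] qf[OF True] gf[OF True]
            gf[of "p x"] permutes_in_image[OF p, of x] by simp
      next
        case False
        have "map_permutation UNIV g (map_permutation {0..<n} f p) permutes {0..<n}"
          using map_permutation_permutes[OF g] q by simp
        then show ?thesis using permutes_not_in[OF _ False] p by metis
      qed
    qed
    have "sign (map_permutation {0..<n} f p) = sign p"
      by (rule sign_map_permutation[OF fi p]) simp
    moreover have "(\<Prod>i\<in>UNIV. A $ i $ map_permutation {0..<n} f p i) =
        (\<Prod>i\<in>{0..<n}. A $ f i $ map_permutation {0..<n} f p (f i))"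
      by (rule prod.reindex_bij_betw[OF f', symmetric])
    moreover have "\<dots> = (\<Prod>i = 0..<n. Matrix.mat n n (\<lambda>(i, j). A $ f i $ f j) $$ (i, p i))"
      using qf permutes_in_image[OF p] by (intro prod.cong refl) auto
    ultimately show "of_int (sign (map_permutation {0..<n} f p)) * (\<Prod>i\<in>UNIV. A $ i $ map_permutation {0..<n} f p i) =
        of_int (sign p) * (\<Prod>i = 0..<n. Matrix.mat n n (\<lambda>(i, j). A $ f i $ f j) $$ (i, p i))" by simp
  next
    fix q :: "'n \<Rightarrow> 'n" assume "q \<in> {q. q permutes UNIV}"
    then have q: "q permutes UNIV" by simp
    show "map_permutation UNIV g q \<in> {p. p permutes {0..<n}}"
      using map_permutation_permutes[OF g q] by simp
    show "map_permutation {0..<n} f (map_permutation UNIV g q) = q"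
    proof
      fix y
      have "map_permutation {0..<n} f (map_permutation UNIV g q) (f (g y)) = f (map_permutation UNIV g q (g y))"
        by (rule map_permutation_apply[OF fi gn])
      also have "map_permutation UNIV g q (g y) = g (q y)" by (rule map_permutation_apply[OF gi UNIV_I])
      finally show "map_permutation {0..<n} f (map_permutation UNIV g q) y = q y" by (simp add: fg)
    qed
  qed
  also have "\<dots> = det A" by (simp add: Determinants.det_def)
  finally show ?thesis by (simp add: n_def)
qed

text \<open>Sylvester's identity. Multiplying the block matrix with rows (1, P) and (R, 1) by the
  same unipotent matrix on the right or on the left exposes one or the other determinant.\<close>

lemma det_one_minus_mult_commute:
  fixes P :: "'a::idom mat"
  assumes P: "P \<in> carrier_mat m n" and R: "R \<in> carrier_mat n m"
  shows "Determinant.det (1\<^sub>m m - P * R) = Determinant.det (1\<^sub>m n - R * P)"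
proof -
  define A where "A = four_block_mat (1\<^sub>m m) P R (1\<^sub>m n)"
  define B where "B = four_block_mat (1\<^sub>m m) (- P) (0\<^sub>m n m) (1\<^sub>m n)"
  have A: "A \<in> carrier_mat (m + n) (m + n)" and B: "B \<in> carrier_mat (m + n) (m + n)"
    unfolding A_def B_def by (auto intro!: four_block_carrier_mat)
  have detB: "Determinant.det B = 1"
    unfolding B_def by (subst det_four_block_mat_lower_left_zero[of _ m _ n]) (use P in auto)
  have neg: "R * - P = - (R * P)" "- P * R = - (P * R)"
    using P R by (auto intro!: eq_matI simp: scalar_prod_def sum_negf)
  have "A * B = four_block_mat (1\<^sub>m m) (0\<^sub>m m n) R (1\<^sub>m n - R * P)"
    unfolding A_def B_def
    by (subst mult_four_block_mat[of _ m m _ n _ n]) (use P R neg in \<open>auto intro!: arg_cong4[where f = four_block_mat] eq_matI\<close>)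
  then have 1: "Determinant.det (A * B) = Determinant.det (1\<^sub>m n - R * P)"
    using P R by (simp add: det_four_block_mat_upper_right_zero[of _ m _ n] minus_carrier_mat)
  have "B * A = four_block_mat (1\<^sub>m m - P * R) (0\<^sub>m m n) R (1\<^sub>m n)"
    unfolding A_def B_def
    by (subst mult_four_block_mat[of _ m m _ n _ n]) (use P R neg in \<open>auto intro!: arg_cong4[where f = four_block_mat] eq_matI\<close>)
  then have 2: "Determinant.det (B * A) = Determinant.det (1\<^sub>m m - P * R)"
    using P R by (simp add: det_four_block_mat_upper_right_zero[of _ m _ n] minus_carrier_mat)
  show ?thesis using 1 2 det_mult[OF A B] det_mult[OF B A] detB by simp
qed

text \<open>With the inverse \<open>B\<close> of \<open>A\<close>, factor A - P R = A (1 - B P R)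
  and commute. A determinant of size m, which grows with the cutoff, becomes one of fixed size
  n.\<close>

lemma det_finite_rank_update:
  fixes A :: "'a::idom mat"
  assumes A: "A \<in> carrier_mat m m" and B: "B \<in> carrier_mat m m" "A * B = 1\<^sub>m m"
    and P: "P \<in> carrier_mat m n" and R: "R \<in> carrier_mat n m"
  shows "Determinant.det (A - P * R) = Determinant.det A * Determinant.det (1\<^sub>m n - R * (B * P))"
proof -
  have BP: "B * P \<in> carrier_mat m n" using B P by simp
  have "A * (1\<^sub>m m - (B * P) * R) = A * 1\<^sub>m m - A * ((B * P) * R)"
    using A BP R by (intro mult_minus_distrib_mat) auto
  also have "A * (B * P) = P" using assoc_mult_mat[OF A B(1) P] B(2) P by simp
  then have "A * ((B * P) * R) = P * R" using assoc_mult_mat[OF A BP R] by simp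
  finally have "A - P * R = A * (1\<^sub>m m - (B * P) * R)" using A B P R by simp
  then have "Determinant.det (A - P * R) = Determinant.det A * Determinant.det (1\<^sub>m m - (B * P) * R)"
    using A BP R by (simp add: det_mult[of _ m] minus_carrier_mat)
  then show ?thesis using det_one_minus_mult_commute[OF BP R] by simp
qed

lemma mat_inverse_exists:
  assumes "A \<in> carrier_mat n n" "Determinant.det A \<noteq> (0 :: 'a :: field)"
  shows "\<exists>B. B \<in> carrier_mat n n \<and> A * B = 1\<^sub>m n"
proof -
  from det_non_zero_imp_unit[OF assms, unfolded Units_def, of "()"]
  show ?thesis by (auto simp: ring_mat_def)
qed

text \<open>The derivative of (1 - z) exp z is - z exp z, so the function leaves 1 only
  quadratically. This is the factor of an eigenvalue in the regularised determinant of a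
  Hilbert-Schmidt operator.\<close>

lemma exp_ratio_bound:
  fixes z :: complex
  assumes "cmod z \<le> 1 / 2"
  shows "cmod ((1 - z) * exp z - 1) \<le> 2 * (cmod z)\<^sup>2"
proof -
  have "norm ((1 - z) * exp z - (1 - 0) * exp 0) \<le> (2 * cmod z) * norm (z - 0)"
  proof (rule field_differentiable_bound[where S = "cball 0 (cmod z)"])
    fix x assume x: "x \<in> cball (0::complex) (cmod z)"
    show "((\<lambda>z. (1 - z) * exp z) has_field_derivative - x * exp x) (at x within cball 0 (cmod z))"
      by (auto intro!: derivative_eq_intros simp: algebra_simps)
    have "cmod (exp x) \<le> exp (1 / 2)" using norm_exp[of x] x assms
      by (smt (verit) exp_le_cancel_iff mem_cball_0)
    also have "\<dots> \<le> 2" by (rule exp_half_le2)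
    finally have "cmod (exp x) \<le> 2" .
    then show "norm (- x * exp x) \<le> 2 * cmod z"
      using x mult_mono[of "cmod x" "cmod z" "cmod (exp x)" 2] by (simp add: norm_mult mult.commute)
  qed auto
  then show ?thesis by (simp add: power2_eq_square mult.assoc)
qed

section \<open>Limits of sums and products over the spectrum\<close>

context spectral
begin

definition qT :: real where "qT = exp (- T)"
text \<open>The eigenvalues of q S (1 - q S)^(-1) with q = exp(-T), the part of the Green function
  of d/dt + 1 that is due to the boundary condition.\<close>

definition \<kappa> :: "'n \<Rightarrow> complex" where "\<kappa> j = qT * cis (\<theta> j) / (1 - qT * cis (\<theta> j))"

lemma qT_bounds: "0 < qT" "qT < 1" using T_pos by (auto simp: qT_def)

lemma one_minus_q_nz: "1 - complex_of_real qT * cis (\<theta> j) \<noteq> 0"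
proof
  assume "1 - complex_of_real qT * cis (\<theta> j) = 0"
  then have "cmod (complex_of_real qT * cis (\<theta> j)) = cmod 1" by simp
  then show False using qT_bounds by (simp add: norm_mult)
qed

lemma idx_eq: "idx N = Sigma UNIV (\<lambda>j. cutset T (\<theta> j) N)"
  using T_pos by (auto simp: idx_def cutset_def om_def abs_divide field_simps)

lemma theta_abs: "\<bar>\<theta> j\<bar> \<le> pi" using theta_bound[of j] by auto

lemma finite_cut: "finite (cutset T (\<theta> j) N)"
proof -
  have "cutset T (\<theta> j) N = Pair j -` idx N" by (auto simp: idx_eq)
  then show ?thesis using finite_vimageI[OF finite_idx, of "Pair j"] by (simp add: inj_on_def)
qed

lemma sum_idx: "(\<Sum>a\<in>idx N. f a) = (\<Sum>j\<in>UNIV. \<Sum>k\<in>cutset T (\<theta> j) N. f (j, k))" for f :: "_ \<Rightarrow> complex"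
  unfolding idx_eq by (subst sum.Sigma) (auto intro: finite_cut)

lemma prod_idx: "(\<Prod>a\<in>idx N. f a) = (\<Prod>j\<in>UNIV. \<Prod>k\<in>cutset T (\<theta> j) N. f (j, k))" for f :: "_ \<Rightarrow> complex"
  unfolding idx_eq by (subst prod.Sigma) (auto intro: finite_cut)

text \<open>Shifts that put the eigenvalues of d/dt and d/dt + 1 into the form (2 pi i / T) (k + w),
  as the partial fraction and product formulas require. \<open>w1\<close> is never an integer, its
  imaginary part being nonzero.\<close>

definition w0 :: "'n \<Rightarrow> complex" where "w0 j = of_real (- \<theta> j / (2 * pi))"
definition w1 :: "'n \<Rightarrow> complex" where "w1 j = w0 j - \<i> * of_real (T / (2 * pi))"

lemma om_w0: "\<i> * of_real (om (j, k)) = (2 * pi * \<i> / T) * (of_int k + w0 j)"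
  using T_pos by (simp add: om_def w0_def field_simps)

lemma om_w1: "1 + \<i> * of_real (om (j, k)) = (2 * pi * \<i> / T) * (of_int k + w1 j)"
proof -
  have "(2 * pi * \<i> / T) * (of_int k + w1 j) = \<i> * of_real (om (j, k)) - (2 * pi * \<i> / T) * (\<i> * of_real (T / (2 * pi)))"
    unfolding om_w0 w1_def by (simp add: algebra_simps)
  moreover have "(2 * pi * \<i> / T) * (\<i> * of_real (T / (2 * pi))) = -1" using T_pos by (simp add: field_simps)
  ultimately show ?thesis by simp
qed

lemma w1_not_int: "w1 j \<notin> \<int>"
proof
  assume "w1 j \<in> \<int>"
  then have "Im (w1 j) = 0" by (auto elim: Ints_cases)
  then show False using T_pos by (simp add: w1_def w0_def)
qed

lemma w0_not_int: "\<theta> j \<noteq> 0 \<Longrightarrow> w0 j \<notin> \<int>"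
proof
  assume t: "\<theta> j \<noteq> 0" and "w0 j \<in> \<int>"
  then obtain k where "w0 j = of_int k" by (auto elim: Ints_cases)
  then have "- \<theta> j / (2 * pi) = of_int k" unfolding w0_def by (metis of_real_eq_iff of_real_of_int_eq)
  then have e: "\<theta> j = - of_int k * (2 * pi)" by (simp add: field_simps)
  then have k: "k \<noteq> 0" using t by auto
  have "2 * pi * 1 \<le> 2 * pi * \<bar>real_of_int k\<bar>" using k by (intro mult_left_mono) auto
  also have "\<dots> = \<bar>\<theta> j\<bar>" using e by (simp add: abs_mult)
  finally show False using theta_abs[of j] pi_gt_zero by linarith
qed

lemma exp_w1: "exp (\<i> * (of_real pi * w1 j)) = exp (of_real T / 2) * exp (\<i> * (of_real pi * w0 j))"
proof -
  have "\<i> * (of_real pi * w1 j) = of_real (T / 2) + \<i> * (of_real pi * w0 j)"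
    by (simp add: w1_def algebra_simps)
  then show ?thesis by (simp add: exp_add)
qed

lemma exp_w0_sq: "exp (- (\<i> * (of_real pi * w0 j))) * exp (- (\<i> * (of_real pi * w0 j))) = cis (\<theta> j)"
proof -
  have "- (\<i> * (of_real pi * w0 j)) + - (\<i> * (of_real pi * w0 j)) = \<i> * of_real (\<theta> j)"
    by (simp add: w0_def)
  then show ?thesis by (simp only: exp_add[symmetric] cis_conv_exp)
qed

lemma exp_w1_sq: "exp (- (\<i> * (of_real pi * w1 j))) * exp (- (\<i> * (of_real pi * w1 j))) = qT * cis (\<theta> j)"
proof -
  have "- (\<i> * (of_real pi * w1 j)) + - (\<i> * (of_real pi * w1 j)) = of_real (- T) + \<i> * of_real (\<theta> j)"
    by (simp add: w1_def w0_def algebra_simps)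
  then have "exp (- (\<i> * (of_real pi * w1 j))) * exp (- (\<i> * (of_real pi * w1 j))) = exp (of_real (- T)) * cis (\<theta> j)"
    by (simp only: exp_add[symmetric] cis_conv_exp)
  then show ?thesis by (simp add: qT_def exp_of_real[symmetric])
qed

text \<open>Extracting exp(iz) leaves only exp(-2iz), which at pi \<open>w0\<close> and pi
  \<open>w1\<close> is the eigenvalue of S, respectively of exp(-T) S.\<close>

lemma sin_exp: "sin z = exp (\<i> * z) * (1 - exp (- (\<i> * z)) * exp (- (\<i> * z))) / (2 * \<i>)" for z :: complex
  unfolding sin_exp_eq by (simp add: algebra_simps exp_minus_inverse mult.assoc[symmetric])

lemma cos_exp: "cos z = exp (\<i> * z) * (1 + exp (- (\<i> * z)) * exp (- (\<i> * z))) / 2" for z :: complex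
  unfolding cos_exp_eq by (simp add: algebra_simps exp_minus_inverse mult.assoc[symmetric])

lemma sin_w1: "sin (of_real pi * w1 j) = exp (of_real T / 2) * exp (\<i> * (of_real pi * w0 j)) * (1 - qT * cis (\<theta> j)) / (2 * \<i>)"
  by (subst sin_exp) (simp only: exp_w1 exp_w1_sq)

lemma sin_w0: "sin (of_real pi * w0 j) = exp (\<i> * (of_real pi * w0 j)) * (1 - cis (\<theta> j)) / (2 * \<i>)"
  by (subst sin_exp) (simp only: exp_w0_sq)

text \<open>The conditional trace of (d/dt + 1)^(-1) on one eigenline of S. On the diagonal its
  Green function is \<open>\<kappa> j\<close> from one side and 1 + \<open>\<kappa> j\<close> from
  the other; the limit is T times the mean of the two.\<close>

lemma resolvent_sum_limit:
  "((\<lambda>N. \<Sum>k\<in>cutset T (\<theta> j) N. 1 / (1 + \<i> * of_real (om (j, k)))) \<longlongrightarrow> of_real T / 2 + of_real T * \<kappa> j) at_top"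
proof -
  define c where "c = of_real T / (2 * of_real pi * \<i>)"
  have c: "1 / (1 + \<i> * of_real (om (j, k))) = c / (of_int k + w1 j)" for k
    unfolding om_w1 c_def using T_pos by (simp add: field_simps)
  have "((\<lambda>N. \<Sum>k\<in>cutset T (\<theta> j) N. 1 / (of_int k + w1 j)) \<longlongrightarrow>
      of_real pi * (cos (of_real pi * w1 j) / sin (of_real pi * w1 j))) at_top"
    by (rule cut_sum[OF T_pos theta_abs inverse_int_small cot_partial_fractions[OF w1_not_int]])
  from tendsto_mult[OF tendsto_const[of c] this]
  have 1: "((\<lambda>N. \<Sum>k\<in>cutset T (\<theta> j) N. 1 / (1 + \<i> * of_real (om (j, k)))) \<longlongrightarrow>
      c * (of_real pi * (cos (of_real pi * w1 j) / sin (of_real pi * w1 j)))) at_top"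
    unfolding sum_distrib_left c by simp
  define u where "u = complex_of_real qT * cis (\<theta> j)"
  have u: "1 - u \<noteq> 0" unfolding u_def by (rule one_minus_q_nz)
  have "cos (of_real pi * w1 j) / sin (of_real pi * w1 j) = \<i> * (1 + u) / (1 - u)"
    unfolding cos_exp[of "of_real pi * w1 j"] sin_exp[of "of_real pi * w1 j"] exp_w1_sq u_def[symmetric]
    using u by (simp add: field_simps)
  then have "c * (of_real pi * (cos (of_real pi * w1 j) / sin (of_real pi * w1 j))) = (c * of_real pi * \<i>) * ((1 + u) / (1 - u))"
    by simp
  also have "c * of_real pi * \<i> = of_real T / 2" by (simp add: c_def complex_eq_iff)
  also have "(1 + u) / (1 - u) = 1 + 2 * (u / (1 - u))" using u by (simp add: field_simps)
  also have "of_real T / 2 * (1 + 2 * (u / (1 - u))) = of_real T / 2 + of_real T * \<kappa> j"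
    by (simp add: \<kappa>_def u_def algebra_simps)
  finally show ?thesis using 1 by simp
qed

definition lam :: "'n \<times> int \<Rightarrow> complex" where "lam a = (if om a = 0 then 1 else \<i> * of_real (om a))"

text \<open>The denominators left by the sine quotients. Their product over j turns out to be the
  reciprocal of |C(S)|.\<close>

definition den :: "'n \<Rightarrow> complex" where "den j = (if \<theta> j = 0 then of_real T else 1 - cis (\<theta> j))"

lemma om_zero_iff: "om (j, k) = 0 \<longleftrightarrow> \<theta> j = 0 \<and> k = 0"
proof -
  have "om (j, k) = 0 \<longleftrightarrow> of_int k + w0 j = 0"
    using om_w0[of j k] T_pos by auto
  moreover have "of_int k + w0 j \<noteq> 0" if "\<theta> j \<noteq> 0"
  proof
    assume "of_int k + w0 j = 0"
    then have "w0 j = of_int (- k)" by (simp add: eq_neg_iff_add_eq_0 add.commute)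
    then show False using w0_not_int[OF that] by (metis Ints_of_int)
  qed
  ultimately show ?thesis by (cases "\<theta> j = 0") (auto simp: w0_def)
qed

lemma normalization_limit:
  "((\<lambda>N. \<Prod>k\<in>cutset T (\<theta> j) N. (1 + \<i> * of_real (om (j, k))) / lam (j, k)) \<longlongrightarrow>
     exp (of_real T / 2) * (1 - qT * cis (\<theta> j)) / den j) at_top"
proof (cases "\<theta> j = 0")
  case False
  have k0: "of_int k + w0 j \<noteq> 0" for k using om_zero_iff[of j k] om_w0[of j k] False by auto
  have e: "(1 + \<i> * of_real (om (j, k))) / lam (j, k) = (of_int k + w1 j) / (of_int k + w0 j)" for k
  proof -
    have l: "lam (j, k) = (2 * pi * \<i> / T) * (of_int k + w0 j)"
      unfolding om_w0[symmetric] using False by (simp add: lam_def om_zero_iff)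
    show ?thesis unfolding om_w1 l using T_pos k0[of k] by simp
  qed
  have "((\<lambda>N. \<Prod>k\<in>cutset T (\<theta> j) N. (of_int k + w1 j) / (of_int k + w0 j)) \<longlongrightarrow>
      sin (of_real pi * w1 j) / sin (of_real pi * w0 j)) at_top"
  proof (rule cut_prod[OF T_pos theta_abs _ shifted_product_limit[OF w0_not_int[OF False]]])
    fix \<epsilon> :: real assume "\<epsilon> > 0"
    have "(of_int k + w1 j) / (of_int k + w0 j) - 1 = (w1 j - w0 j) / (of_int k + w0 j)" for k
      using k0[of k] by (simp add: field_simps)
    show "\<exists>M. \<forall>k. \<bar>k\<bar> \<ge> M \<longrightarrow> cmod ((of_int k + w1 j) / (of_int k + w0 j) - 1) \<le> \<epsilon>"
      using inverse_int_small[OF \<open>\<epsilon> > 0\<close>, of "w1 j - w0 j" "w0 j"] k0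
      by (simp add: diff_divide_eq_iff divide_diff_eq_iff)
  qed
  moreover have "sin (of_real pi * w1 j) / sin (of_real pi * w0 j) = exp (of_real T / 2) * (1 - qT * cis (\<theta> j)) / den j"
    using False by (simp add: sin_w1 sin_w0 den_def)
  ultimately show ?thesis unfolding e by simp
next
  case True
  have w: "w0 j = 0" using True by (simp add: w0_def)
  \<comment> \<open>At k = 0 the eigenvalue \<open>lam\<close> is 1 instead of a multiple of 2 pi i
    / T, so one factor c is left over there. It becomes the factor 1 / T in the limit.\<close>
  define c where "c = 2 * of_real pi * \<i> / of_real T"
  have c0: "c \<noteq> 0" using T_pos by (simp add: c_def)
  have e: "(1 + \<i> * of_real (om (j, k))) / lam (j, k) = (if k = 0 then c else 1) * (if k = 0 then w1 j else (of_int k + w1 j) / of_int k)" for k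
  proof -
    have l: "lam (j, k) = (if k = 0 then 1 else c * of_int k)"
      using om_w0[of j k] True by (simp add: lam_def om_zero_iff w c_def)
    show ?thesis unfolding om_w1 l using T_pos by (simp add: c_def)
  qed
  have "((\<lambda>N. \<Prod>k\<in>cutset T (\<theta> j) N. (if k = 0 then c else 1) * (if k = 0 then w1 j else (of_int k + w1 j) / of_int k)) \<longlongrightarrow>
      c * (sin (of_real pi * w1 j) / of_real pi)) at_top"
  proof (rule cut_prod[OF T_pos theta_abs])
    fix \<epsilon> :: real assume "\<epsilon> > 0"
    obtain M where M: "\<And>k::int. \<bar>k\<bar> \<ge> M \<Longrightarrow> cmod (w1 j / (of_int k + 0)) \<le> \<epsilon>"
      using inverse_int_small[OF \<open>\<epsilon> > 0\<close>, of "w1 j" 0] by blast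
    show "\<exists>M. \<forall>k. \<bar>k\<bar> \<ge> M \<longrightarrow> cmod ((if k = 0 then c else 1) * (if k = 0 then w1 j else (of_int k + w1 j) / of_int k) - 1) \<le> \<epsilon>"
    proof (intro exI[of _ "max M 1"] allI impI)
      fix k :: int assume k: "\<bar>k\<bar> \<ge> max M 1"
      then have "k \<noteq> 0" by auto
      then have "(of_int k + w1 j) / of_int k - 1 = w1 j / of_int k" by (simp add: field_simps)
      then show "cmod ((if k = 0 then c else 1) * (if k = 0 then w1 j else (of_int k + w1 j) / of_int k) - 1) \<le> \<epsilon>"
        using k M[of k] by auto
    qed
  next
    have "(\<Prod>k\<in>{- int m..int m}. (if k = 0 then c else 1) * (if k = 0 then w1 j else (of_int k + w1 j) / of_int k)) =
      c * (\<Prod>k\<in>{- int m..int m}. if k = 0 then w1 j else (of_int k + w1 j) / of_int k)" for m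
      unfolding prod.distrib by simp
    then show "(\<lambda>m. \<Prod>k\<in>{- int m..int m}. (if k = 0 then c else 1) * (if k = 0 then w1 j else (of_int k + w1 j) / of_int k))
      \<longlonglongrightarrow> c * (sin (of_real pi * w1 j) / of_real pi)"
      using tendsto_mult[OF tendsto_const punctured_product_limit] by simp
  qed
  moreover have "c * (sin (of_real pi * w1 j) / of_real pi) = exp (of_real T / 2) * (1 - qT * cis (\<theta> j)) / den j"
    using True T_pos by (simp add: sin_w1 den_def c_def w)
  ultimately show ?thesis unfolding e by simp
qed

text \<open>This supplies the existence of the conditional trace, for which no value is asked. For
  \<theta> = 0 the terms of k and -k cancel; otherwise the partial fractions of the cotangent
  apply.\<close>

lemma inverse_sum_convergent:
  "\<exists>l. ((\<lambda>N. \<Sum>k\<in>cutset T (\<theta> j) N. if om (j, k) = 0 then 0 else 1 / (\<i> * of_real (om (j, k)))) \<longlongrightarrow> l) at_top"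
proof -
  define c where "c = 1 / (2 * pi * \<i> / T)"
  have e: "(if om (j, k) = 0 then 0 else 1 / (\<i> * of_real (om (j, k)))) = c * (if om (j, k) = 0 then 0 else 1 / (of_int k + w0 j))" for k
    unfolding om_w0 c_def by simp
  have "\<exists>l. ((\<lambda>N. \<Sum>k\<in>cutset T (\<theta> j) N. if om (j, k) = 0 then 0 else 1 / (of_int k + w0 j)) \<longlongrightarrow> l) at_top"
  proof (cases "\<theta> j = 0")
    case False
    then show ?thesis
      using cut_sum[OF T_pos theta_abs inverse_int_small cot_partial_fractions[OF w0_not_int[OF False]]]
      by (auto simp: om_zero_iff)
  next
    case True
    have "((\<lambda>N. \<Sum>k\<in>cutset T (\<theta> j) N. if om (j, k) = 0 then 0 else 1 / (of_int k + w0 j)) \<longlongrightarrow> 0) at_top"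
    proof (rule cut_sum[OF T_pos theta_abs])
      fix \<epsilon> :: real assume "\<epsilon> > 0"
      from inverse_int_small[OF this, of 1 "w0 j"] \<open>\<epsilon> > 0\<close>
      show "\<exists>M. \<forall>k. \<bar>k\<bar> \<ge> M \<longrightarrow> cmod (if om (j, k) = 0 then 0 else 1 / (of_int k + w0 j)) \<le> \<epsilon>" by auto
    next
      have "(\<Sum>k\<in>{- int m..int m}. if om (j, k) = 0 then 0 else 1 / (of_int k + w0 j)) = 0" for m
        unfolding sum_symmetric_int using True by (simp add: om_zero_iff w0_def)
      then show "(\<lambda>m. \<Sum>k\<in>{- int m..int m}. if om (j, k) = 0 then 0 else 1 / (of_int k + w0 j)) \<longlonglongrightarrow> 0" by simp
    qed
    then show ?thesis by blast
  qed
  then obtain l where "((\<lambda>N. \<Sum>k\<in>cutset T (\<theta> j) N. if om (j, k) = 0 then 0 else 1 / (of_int k + w0 j)) \<longlongrightarrow> l) at_top" ..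
  from tendsto_mult[OF tendsto_const[of c] this] show ?thesis unfolding e sum_distrib_left by blast
qed

end

section \<open>Volterra operators\<close>

definition adjm :: "complex^'n^'m \<Rightarrow> complex^'m^'n" where "adjm A = (\<chi> i j. cnj (A $ j $ i))"

lemma cip_adjm: "cip (A *v x) y = cip x (adjm A *v y)"
proof -
  have "cip (A *v x) y = (\<Sum>i\<in>UNIV. \<Sum>j\<in>UNIV. A $ i $ j * x $ j * cnj (y $ i))"
    by (simp add: cip_def matrix_vector_mult_def sum_distrib_right)
  also have "\<dots> = (\<Sum>j\<in>UNIV. \<Sum>i\<in>UNIV. A $ i $ j * x $ j * cnj (y $ i))"
    by (rule sum.swap)
  also have "\<dots> = cip x (adjm A *v y)"
    by (simp add: cip_def adjm_def matrix_vector_mult_def sum_distrib_left mult_ac)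
  finally show ?thesis .
qed

lemma continuous_on_adjm [continuous_intros]:
  "continuous_on S A \<Longrightarrow> continuous_on S (\<lambda>t. adjm (A t))" for A :: "real \<Rightarrow> complex^'n^'m"
  unfolding adjm_def by (intro continuous_on_vec_lambda continuous_intros)

lemma integral_restrict_interval:
  fixes f :: "real \<Rightarrow> 'a::banach"
  assumes "t \<in> {0..T}" "f integrable_on {0..t}"
  shows "integral {0..T} (\<lambda>s. if s \<in> {0..t} then f s else 0) = integral {0..t} f"
proof (rule integral_unique)
  have "{0..t} \<subseteq> {0..T}" using assms(1) by auto
  from has_integral_restrict[OF this, of f] assms(2)
  show "((\<lambda>s. if s \<in> {0..t} then f s else 0) has_integral integral {0..t} f) {0..T}"
    by (simp only: integrable_integral)
qed

lemma L2_set_integral_const: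
  assumes "T > 0" "g \<in> borel_measurable (lebesgue_on {0..T})" "\<And>t. t \<in> {0..T} \<Longrightarrow> 0 \<le> g t" "\<And>t. t \<in> {0..T} \<Longrightarrow> g t \<le> B"
  shows "(\<integral>t. g t \<partial>lebesgue_on {0..T}) \<le> T * (B :: real)"
proof -
  have i: "integrable (lebesgue_on {0..T}) (\<lambda>_. B)" for B :: real
    using finite_measure.integrable_const[OF finite_measure_interval] .
  have "integrable (lebesgue_on {0..T}) g"
  proof (rule Bochner_Integration.integrable_bound[OF i[of B] assms(2)], rule AE_I2)
    fix t assume "t \<in> space (lebesgue_on {0..T})"
    then have "0 \<le> g t" "g t \<le> B" using assms(3,4) by auto
    then show "norm (g t) \<le> norm B" by simp
  qed
  then have "(\<integral>t. g t \<partial>lebesgue_on {0..T}) \<le> (\<integral>t. B \<partial>lebesgue_on {0..T})"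
    using i assms(4) by (intro integral_mono) auto
  also have "\<dots> = integral {0..T} (\<lambda>_. B)" by (rule lebesgue_integral_eq_integral[OF i]) simp
  also have "\<dots> = T * B" using assms(1) by simp
  finally show ?thesis .
qed

text \<open>Pairing with k in the plain product is pairing with exp(2cs) k in the weighted one, so
  Bessel's inequality applies to that function.\<close>

lemma wip_bessel:
  fixes g :: "'i \<Rightarrow> real \<Rightarrow> complex^'n"
  assumes I: "finite I" and g: "semi_ip.orthonormal (L2 T) (wip T c) I g" and k: "k \<in> L2 T"
  shows "(\<Sum>i\<in>I. (cmod (L2_inner T (g i) k))\<^sup>2) \<le> (\<integral>s. exp (2 * c * s) * (norm (k s))\<^sup>2 \<partial>lebesgue_on {0..T})"
proof -
  interpret W: semi_ip fscale "L2 T" "wip T c :: (real \<Rightarrow> complex^'n) \<Rightarrow> _" by (rule semi_ip_wip)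
  define h where "h = (\<lambda>t. complex_of_real (exp ((2 * c) * t)) *s k t)"
  have h: "h \<in> L2 T" unfolding h_def by (rule L2_weight[OF k])
  have gL: "g i \<in> L2 T" if "i \<in> I" for i using g that by (auto simp: W.orthonormal_def)
  have r: "complex_of_real (exp (- c * t)) * (complex_of_real (exp (- c * t)) * complex_of_real (exp ((2 * c) * t))) = 1" for t
    by (simp flip: of_real_mult exp_add)
  have e: "wip T c f h = L2_inner T f k" for f
    unfolding wip_def L2_inner_cip h_def
  proof (rule Bochner_Integration.integral_cong[OF refl])
    fix t
    have "cip (complex_of_real (exp (- c * t)) *s f t) (complex_of_real (exp (- c * t)) *s (complex_of_real (exp ((2 * c) * t)) *s k t))
      = complex_of_real (exp (- c * t)) * (complex_of_real (exp (- c * t)) * complex_of_real (exp ((2 * c) * t))) * cip (f t) (k t)"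
      by (simp only: cip_simps complex_cnj_complex_of_real mult_ac)
    then show "cip (complex_of_real (exp (- c * t)) *s f t) (complex_of_real (exp (- c * t)) *s (complex_of_real (exp ((2 * c) * t)) *s k t))
      = cip (f t) (k t)" unfolding r by simp
  qed
  have "(\<Sum>i\<in>I. (cmod (L2_inner T (g i) k))\<^sup>2) = (\<Sum>i\<in>I. (cmod (wip T c h (g i)))\<^sup>2)"
  proof (rule sum.cong[OF refl])
    fix i assume "i \<in> I"
    then show "(cmod (L2_inner T (g i) k))\<^sup>2 = (cmod (wip T c h (g i)))\<^sup>2"
      using W.ip_cnj[OF gL h, of i] e[of "g i"] by simp
  qed
  also have "\<dots> \<le> W.nrm2 h" by (rule W.bessel[OF I g h])
  also have "\<dots> = (\<integral>s. exp (2 * c * s) * (norm (k s))\<^sup>2 \<partial>lebesgue_on {0..T})"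
    unfolding Re_wip_self
  proof (rule Bochner_Integration.integral_cong[OF refl])
    fix t
    have "exp (- 2 * c * t) * (norm (h t))\<^sup>2 = (exp (- 2 * c * t) * (exp (2 * c * t) * exp (2 * c * t))) * (norm (k t))\<^sup>2"
      by (simp add: h_def norm_vector_smult power_mult_distrib power2_eq_square del: of_real_exp)
    also have "exp (- 2 * c * t) * (exp (2 * c * t) * exp (2 * c * t)) = exp (2 * c * t)"
      by (simp flip: exp_add)
    finally show "exp (- 2 * c * t) * (norm (h t))\<^sup>2 = exp (2 * c * t) * (norm (k t))\<^sup>2" .
  qed
  finally show ?thesis .
qed

section \<open>Kernel estimates for the Volterra part\<close>

locale volterra = spectral v T \<theta> Sc for v :: "'n::finite \<Rightarrow> complex^'n" and T \<theta> Sc +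
  fixes M Y :: "real \<Rightarrow> complex^'n^'n"
  assumes M_cont: "continuous_on {0..T} M" and Y0: "Y 0 = mat 1"
    and Y': "t \<in> {0..T} \<Longrightarrow> (Y has_vector_derivative ((M t - mat 1) ** Y t)) (at t within {0..T})"
begin

definition J :: "(real \<Rightarrow> complex^'n) \<Rightarrow> real \<Rightarrow> complex^'n" where
  "J f t = integral {0..t} (\<lambda>s. exp s *\<^sub>R (M s *v f s))"

text \<open>The solution z of z' + z = M f with z(0) = 0, by variation of constants.
  \<open>J\<close> carries the integral without the decaying factor.\<close>

definition Q :: "(real \<Rightarrow> complex^'n) \<Rightarrow> real \<Rightarrow> complex^'n" where
  "Q f t = (if t \<in> {0..T} then exp (- t) *\<^sub>R J f t else 0)"

text \<open>The vector that represents \<open>cip (J f t) x\<close> as an inner product with f. It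
  turns pointwise values of \<open>J\<close> into Fourier coefficients, to which Bessel's inequality
  applies.\<close>

definition kap :: "real \<Rightarrow> complex^'n \<Rightarrow> real \<Rightarrow> complex^'n" where
  "kap t x s = (if s \<in> {0..t} then exp s *\<^sub>R (adjm (M s) *v x) else 0)"

lemma integrand_cont: "continuous_on {0..T} f \<Longrightarrow> continuous_on {0..T} (\<lambda>s. exp s *\<^sub>R (M s *v f s))"
  by (intro continuous_intros M_cont)

lemma integrand_integrable: "continuous_on {0..T} f \<Longrightarrow> t \<le> T \<Longrightarrow> (\<lambda>s. exp s *\<^sub>R (M s *v f s)) integrable_on {0..t}"
  by (rule integrable_continuous_real[OF continuous_on_subset[OF integrand_cont]]) auto

lemma J_deriv:
  "continuous_on {0..T} f \<Longrightarrow> t \<in> {0..T} \<Longrightarrow> (J f has_vector_derivative (exp t *\<^sub>R (M t *v f t))) (at t within {0..T})"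
  unfolding J_def by (rule integral_has_vector_derivative[OF integrand_cont])

lemma J_cont: "continuous_on {0..T} f \<Longrightarrow> continuous_on {0..T} (J f)"
  using J_deriv by (meson continuous_on_eq_continuous_within has_vector_derivative_continuous)

lemma J_0: "J f 0 = 0" by (simp add: J_def)

lemma J_add:
  "continuous_on {0..T} f \<Longrightarrow> continuous_on {0..T} g \<Longrightarrow> t \<le> T \<Longrightarrow> J (f + g) t = J f t + J g t"
  unfolding J_def
  by (subst Henstock_Kurzweil_Integration.integral_add[symmetric])
    (auto intro!: integrand_integrable simp: matrix_vector_right_distrib scaleR_add_right)

lemma J_diff:
  "continuous_on {0..T} f \<Longrightarrow> continuous_on {0..T} g \<Longrightarrow> t \<le> T \<Longrightarrow> J (f - g) t = J f t - J g t"
  unfolding J_def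
  by (subst Henstock_Kurzweil_Integration.integral_diff[symmetric])
    (auto intro!: integrand_integrable simp: matrix_vector_mult_diff_distrib scaleR_diff_right fun_diff_def)

lemma J_scale:
  "continuous_on {0..T} f \<Longrightarrow> t \<le> T \<Longrightarrow> J (fscale c f) t = c *s J f t"
proof -
  assume f: "continuous_on {0..T} f" and t: "t \<le> T"
  have "(\<lambda>s. exp s *\<^sub>R (M s *v fscale c f s)) = (\<lambda>s. c *s (exp s *\<^sub>R (M s *v f s)))"
    by (simp add: fun_eq_iff vector_scalar_commute Finite_Cartesian_Product.vec_eq_iff)
  then show "J (fscale c f) t = c *s J f t"
    unfolding J_def using integral_linear[OF integrand_integrable[OF f t] bounded_linear_vsmult, of c]
    by (simp only: comp_def)
qed

lemma Q_cont: "continuous_on {0..T} f \<Longrightarrow> continuous_on {0..T} (Q f)"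
proof -
  assume "continuous_on {0..T} f"
  then have "continuous_on {0..T} (\<lambda>t. exp (- t) *\<^sub>R J f t)" by (intro continuous_intros J_cont)
  then show ?thesis by (rule continuous_on_eq) (simp add: Q_def)
qed

lemma Q_L2: "continuous_on {0..T} f \<Longrightarrow> Q f \<in> L2 T" by (intro continuous_L2 Q_cont)

lemma Q_add: "continuous_on {0..T} f \<Longrightarrow> continuous_on {0..T} g \<Longrightarrow> Q (f + g) = Q f + Q g"
  by (auto simp: Q_def fun_eq_iff J_add scaleR_add_right)

lemma Q_diff: "continuous_on {0..T} f \<Longrightarrow> continuous_on {0..T} g \<Longrightarrow> Q (f - g) = Q f - Q g"
  by (auto simp: Q_def fun_eq_iff J_diff scaleR_diff_right)

lemma Q_scale: "continuous_on {0..T} f \<Longrightarrow> Q (fscale c f) = fscale c (Q f)"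
  by (auto simp: Q_def fun_eq_iff J_scale Finite_Cartesian_Product.vec_eq_iff)

lemma Q_deriv:
  assumes f: "continuous_on {0..T} f" and t: "t \<in> {0..T}"
  shows "(Q f has_vector_derivative (M t *v f t - Q f t)) (at t within {0..T})"
proof -
  have d: "((\<lambda>t. exp (- t)) has_field_derivative - exp (- t)) (at t within {0..T})"
    by (auto intro!: derivative_eq_intros)
  have "((\<lambda>t. exp (- t) *\<^sub>R J f t) has_vector_derivative
      (exp (- t) *\<^sub>R (exp t *\<^sub>R (M t *v f t)) + (- exp (- t)) *\<^sub>R J f t)) (at t within {0..T})"
    by (rule has_vector_derivative_scaleR[OF d J_deriv[OF f t]])
  also have "exp (- t) *\<^sub>R (exp t *\<^sub>R (M t *v f t)) + (- exp (- t)) *\<^sub>R J f t = M t *v f t - Q f t"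
    using t by (simp add: Q_def exp_minus)
  finally show ?thesis
    by (rule has_vector_derivative_transform[OF t, rotated]) (simp add: Q_def)
qed

lemma M_bound: "\<exists>B>0. \<forall>s\<in>{0..T}. \<forall>x. norm (adjm (M s) *v x) \<le> B * norm x"
proof -
  obtain B where B: "B > 0" "\<forall>t\<in>{0..T}. norm (adjm (M t)) \<le> B"
    using continuous_cbound[OF continuous_on_adjm[OF M_cont]] by blast
  obtain K where K: "K > 0" "\<And>(a::complex^'n^'n) b. norm (a *v b) \<le> norm a * norm b * K"
    using bounded_bilinear.pos_bounded[OF bounded_bilinear_matrix_vector] by blast
  have "norm (adjm (M s) *v x) \<le> (B * K) * norm x" if "s \<in> {0..T}" for s x
  proof -
    have "norm (adjm (M s)) * (norm x * K) \<le> B * (norm x * K)"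
      using B K(1) that by (intro mult_right_mono) auto
    then show ?thesis using K(2)[of "adjm (M s)" x] by (simp add: mult_ac)
  qed
  then show ?thesis using B(1) K(1) by (intro exI[of _ "B * K"]) auto
qed

definition Bm :: real where "Bm = (SOME B. B > 0 \<and> (\<forall>s\<in>{0..T}. \<forall>x. norm (adjm (M s) *v x) \<le> B * norm x))"

lemma Bm: "Bm > 0" "s \<in> {0..T} \<Longrightarrow> norm (adjm (M s) *v x) \<le> Bm * norm x"
proof -
  have "Bm > 0 \<and> (\<forall>s\<in>{0..T}. \<forall>x. norm (adjm (M s) *v x) \<le> Bm * norm x)"
    unfolding Bm_def by (rule someI_ex) (use M_bound in blast)
  then show "Bm > 0" "s \<in> {0..T} \<Longrightarrow> norm (adjm (M s) *v x) \<le> Bm * norm x" by auto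
qed

lemma kap_norm: "s \<in> {0..T} \<Longrightarrow> norm (kap t x s) \<le> (if s \<in> {0..t} then exp s * (Bm * norm x) else 0)"
  using Bm(2)[of s x] by (auto simp: kap_def)

lemma kap_norm': "s \<in> {0..T} \<Longrightarrow> norm (kap t x s) \<le> exp T * (Bm * norm x)"
proof -
  assume s: "s \<in> {0..T}"
  have "exp s * (Bm * norm x) \<le> exp T * (Bm * norm x)"
    using s Bm(1) by (intro mult_right_mono) auto
  moreover have "0 \<le> exp T * (Bm * norm x)" using Bm(1) by simp
  moreover have "norm (kap t x s) \<le> exp s * (Bm * norm x) \<or> norm (kap t x s) \<le> 0"
    using kap_norm[OF s, of t x] by presburger
  ultimately show ?thesis by linarith
qed

lemma interval_sets: "{0..t} \<inter> {0..T} \<in> sets (lebesgue_on {0..T})" for t :: real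
proof -
  have "{0..t} \<inter> {0..T} = {0..T} \<inter> {0..t}" by blast
  then show ?thesis by (auto simp: sets_restrict_space)
qed

lemma kap_L2: "kap t x \<in> L2 T"
proof (rule L2_bounded_measurable)
  have "continuous_on {0..T} (\<lambda>s. exp s *\<^sub>R (adjm (M s) *v x))" by (intro continuous_intros M_cont)
  from continuous_borel_measurable[OF this]
  show "kap t x \<in> borel_measurable (lebesgue_on {0..T})"
    unfolding kap_def using interval_sets[of t]
    by (intro measurable_If_set) auto
  show "norm (kap t x s) \<le> exp T * (Bm * norm x)" if "s \<in> {0..T}" for s
    by (rule kap_norm')  (use that in auto)
qed

lemma J_ip:
  assumes f: "continuous_on {0..T} f" and t: "t \<in> {0..T}"
  shows "cip (J f t) x = L2_inner T f (kap t x)"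
proof -
  have "L2_inner T f (kap t x) = integral {0..T} (\<lambda>s. cip (f s) (kap t x s))"
    unfolding L2_inner_cip
    by (rule lebesgue_integral_eq_integral[OF L2_cip_integrable[OF continuous_L2[OF f] kap_L2]]) simp
  also have "\<dots> = integral {0..T} (\<lambda>s. if s \<in> {0..t} then cip (exp s *\<^sub>R (M s *v f s)) x else 0)"
    by (intro Henstock_Kurzweil_Integration.integral_cong) (simp add: kap_def cip_simps cip_scaleR cip_adjm)
  also have "\<dots> = integral {0..t} (\<lambda>s. cip (exp s *\<^sub>R (M s *v f s)) x)"
    using t by (intro integral_restrict_interval integrable_continuous_real continuous_on_cip
        continuous_on_subset[OF integrand_cont[OF f]] continuous_intros) auto
  also have "\<dots> = cip (J f t) x"
    unfolding J_def using integral_linear[OF integrand_integrable[OF f] bounded_bilinear.bounded_linear_left[OF bounded_bilinear_cip], of t x] t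
    by (simp add: comp_def)
  finally show ?thesis by simp
qed

text \<open>A bound for the squared Hilbert-Schmidt norm in the weighted product. Bessel's
  inequality at a fixed t leaves the integral of exp(2(c+1)s) over s \<le> t, at most exp(2(c+1)t) /
  (2(c+1)); the exponential is cancelled by the outer weight, and a factor of order 1/c
  remains.\<close>

lemma Q_weighted_bound:
  assumes c: "c \<ge> 0" and I: "finite I" and g: "semi_ip.orthonormal (L2 T) (wip T c) I g"
    and gc: "\<And>i. i \<in> I \<Longrightarrow> continuous_on {0..T} (g i)"
  shows "(\<Sum>i\<in>I. Re (wip T c (Q (g i)) (Q (g i)))) \<le> T * (real CARD('n) * (Bm\<^sup>2 / (2 * (c + 1))))"
proof -
  have kap: "(\<integral>s. exp (2 * c * s) * (norm (kap t (v j) s))\<^sup>2 \<partial>lebesgue_on {0..T}) \<le> Bm\<^sup>2 / (2 * (c + 1)) * exp (2 * (c + 1) * t)"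
    if t: "t \<in> {0..T}" for t j
  proof -
    \<comment> \<open>The majorant is supported on s \<le> t. This is where causality of the kernel
      is used: without it the outer weight could not absorb the exponential.\<close>
    define D where "D s = (if s \<in> {0..t} then Bm\<^sup>2 * exp (2 * (c + 1) * s) else 0)" for s
    have Dm: "D \<in> borel_measurable (lebesgue_on {0..T})"
      unfolding D_def using interval_sets[of t]
      by (intro measurable_If_set continuous_borel_measurable) (auto intro!: continuous_intros)
    have iconst: "integrable (lebesgue_on {0..T}) (\<lambda>_. B)" for B :: real
      using finite_measure.integrable_const[OF finite_measure_interval] .
    have Db: "norm (D s) \<le> norm (Bm\<^sup>2 * exp (2 * (c + 1) * T))" if "s \<in> {0..T}" for s
      using that c by (auto simp: D_def abs_mult intro!: mult_left_mono)
    have Di: "integrable (lebesgue_on {0..T}) D"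
      by (rule Bochner_Integration.integrable_bound[OF iconst[of "Bm\<^sup>2 * exp (2 * (c + 1) * T)"] Dm]) (use Db in \<open>auto intro!: AE_I2\<close>)
    have le: "exp (2 * c * s) * (norm (kap t (v j) s))\<^sup>2 \<le> D s" if s: "s \<in> {0..T}" for s
    proof (cases "s \<in> {0..t}")
      case True
      have "(norm (kap t (v j) s))\<^sup>2 \<le> (exp s * Bm)\<^sup>2"
        using kap_norm[OF s, of t "v j"] True by (intro power_mono) auto
      then have "exp (2 * c * s) * (norm (kap t (v j) s))\<^sup>2 \<le> exp (2 * c * s) * (exp s * Bm)\<^sup>2"
        by (intro mult_left_mono) auto
      also have "\<dots> = Bm\<^sup>2 * (exp (2 * c * s) * (exp s * exp s))" by (simp add: power_mult_distrib power2_eq_square)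
      also have "exp (2 * c * s) * (exp s * exp s) = exp (2 * (c + 1) * s)"
        by (simp add: algebra_simps flip: exp_add)
      finally show ?thesis using True by (simp add: D_def)
    next
      case False
      show ?thesis unfolding D_def kap_def if_not_P[OF False] by simp
    qed
    have "(\<integral>s. exp (2 * c * s) * (norm (kap t (v j) s))\<^sup>2 \<partial>lebesgue_on {0..T}) \<le> (\<integral>s. D s \<partial>lebesgue_on {0..T})"
    proof (rule integral_mono[OF _ Di])
      show "integrable (lebesgue_on {0..T}) (\<lambda>s. exp (2 * c * s) * (norm (kap t (v j) s))\<^sup>2)"
      proof (rule Bochner_Integration.integrable_bound[OF Di])
        show "(\<lambda>s. exp (2 * c * s) * (norm (kap t (v j) s))\<^sup>2) \<in> borel_measurable (lebesgue_on {0..T})"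
          by (intro borel_measurable_times borel_measurable_power measurable_compose[OF L2D(1)[OF kap_L2] borel_measurable_norm]
              continuous_borel_measurable[of _ "\<lambda>s. exp (2 * c * s)"] continuous_intros)
        show "AE s in lebesgue_on {0..T}. norm (exp (2 * c * s) * (norm (kap t (v j) s))\<^sup>2) \<le> norm (D s)"
          using le by (intro AE_I2) (auto simp: abs_of_nonneg intro: order_trans[OF _ abs_ge_self])
      qed
    qed (use le in auto)
    also have "\<dots> = integral {0..T} D" by (rule lebesgue_integral_eq_integral[OF Di]) simp
    also have "\<dots> = integral {0..t} (\<lambda>s. Bm\<^sup>2 * exp (2 * (c + 1) * s))"
      unfolding D_def by (rule integral_restrict_interval[OF t]) (intro integrable_continuous_real continuous_intros)
    also have "\<dots> = Bm\<^sup>2 / (2 * (c + 1)) * exp (2 * (c + 1) * t) - Bm\<^sup>2 / (2 * (c + 1)) * exp (2 * (c + 1) * 0)"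
      using t c by (intro integral_unique fundamental_theorem_of_calculus)
        (auto intro!: derivative_eq_intros simp flip: has_real_derivative_iff_has_vector_derivative)
    also have "\<dots> \<le> Bm\<^sup>2 / (2 * (c + 1)) * exp (2 * (c + 1) * t)" using c by simp
    finally show ?thesis .
  qed
  define h where "h i t = exp (- 2 * c * t) * (norm (Q (g i) t))\<^sup>2" for i t
  have hc: "continuous_on {0..T} (h i)" if "i \<in> I" for i
    unfolding h_def by (intro continuous_intros Q_cont gc that)
  have "(\<Sum>i\<in>I. Re (wip T c (Q (g i)) (Q (g i)))) = (\<Sum>i\<in>I. \<integral>t. h i t \<partial>lebesgue_on {0..T})"
    unfolding Re_wip_self h_def ..
  also have "\<dots> = (\<integral>t. (\<Sum>i\<in>I. h i t) \<partial>lebesgue_on {0..T})"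
    by (rule Bochner_Integration.integral_sum[symmetric]) (intro continuous_imp_integrable_real hc)
  also have "\<dots> \<le> T * (real CARD('n) * (Bm\<^sup>2 / (2 * (c + 1))))"
  proof (rule L2_set_integral_const[OF T_pos])
    show "(\<lambda>t. \<Sum>i\<in>I. h i t) \<in> borel_measurable (lebesgue_on {0..T})"
      by (intro continuous_borel_measurable continuous_intros hc)
    show "0 \<le> (\<Sum>i\<in>I. h i t)" for t by (simp add: h_def sum_nonneg)
    fix t assume t: "t \<in> {0..T}"
    \<comment> \<open>The exponent 2(c+1) joins the weight exp(-2ct) with the two factors exp(-t) of
      \<open>Q\<close>.\<close>
    have hi: "h i t = exp (- 2 * (c + 1) * t) * (\<Sum>j\<in>UNIV. (cmod (L2_inner T (g i) (kap t (v j))))\<^sup>2)" if "i \<in> I" for i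
    proof -
      have "(norm (Q (g i) t))\<^sup>2 = exp (- t) * exp (- t) * (norm (J (g i) t))\<^sup>2"
        using t by (simp add: Q_def power_mult_distrib power2_eq_square)
      then have "h i t = (exp (- 2 * c * t) * (exp (- t) * exp (- t))) * (norm (J (g i) t))\<^sup>2"
        by (simp add: h_def)
      also have "exp (- 2 * c * t) * (exp (- t) * exp (- t)) = exp (- 2 * (c + 1) * t)"
        by (simp add: algebra_simps flip: exp_add)
      finally show ?thesis by (simp add: norm_expand J_ip[OF gc[OF that] t])
    qed
    have "(\<Sum>i\<in>I. h i t) = exp (- 2 * (c + 1) * t) * (\<Sum>i\<in>I. \<Sum>j\<in>UNIV. (cmod (L2_inner T (g i) (kap t (v j))))\<^sup>2)"
      by (simp add: hi sum_distrib_left)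
    also have "(\<Sum>i\<in>I. \<Sum>j\<in>UNIV. (cmod (L2_inner T (g i) (kap t (v j))))\<^sup>2) =
        (\<Sum>j\<in>UNIV. \<Sum>i\<in>I. (cmod (L2_inner T (g i) (kap t (v j))))\<^sup>2)" by (rule sum.swap)
    also have "exp (- 2 * (c + 1) * t) * \<dots> \<le> exp (- 2 * (c + 1) * t) * (\<Sum>j\<in>(UNIV::'n set). Bm\<^sup>2 / (2 * (c + 1)) * exp (2 * (c + 1) * t))"
      by (intro mult_left_mono sum_mono order_trans[OF wip_bessel[OF I g kap_L2] kap[OF t]]) simp
    also have "\<dots> = real CARD('n) * (Bm\<^sup>2 / (2 * (c + 1))) * (exp (- 2 * (c + 1) * t) * exp (2 * (c + 1) * t))"
      by (simp only: sum_constant mult_ac)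
    also have "exp (- 2 * (c + 1) * t) * exp (2 * (c + 1) * t) = 1" by (simp add: exp_add[symmetric] algebra_simps)
    finally show "(\<Sum>i\<in>I. h i t) \<le> real CARD('n) * (Bm\<^sup>2 / (2 * (c + 1)))" by simp
  qed
  finally show ?thesis .
qed

lemma J_norm_bound:
  assumes r: "continuous_on {0..T} r" and t: "t \<in> {0..T}"
  shows "(norm (J r t))\<^sup>2 \<le> real CARD('n) * (T * (exp T * Bm)\<^sup>2) * L.nrm2 r"
proof -
  have k: "L.nrm2 (kap t (v j)) \<le> T * (exp T * Bm)\<^sup>2" for j
    unfolding L2_inner_self Re_complex_of_real
  proof (rule L2_set_integral_const[OF T_pos])
    show "(\<lambda>s. (norm (kap t (v j) s))\<^sup>2) \<in> borel_measurable (lebesgue_on {0..T})"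
      using L2D(1)[OF kap_L2, of t "v j"] by measurable
    show "(norm (kap t (v j) s))\<^sup>2 \<le> (exp T * Bm)\<^sup>2" if "s \<in> {0..T}" for s
      using kap_norm'[OF that, of t "v j"] by (intro power_mono) auto
  qed simp
  have "(norm (J r t))\<^sup>2 = (\<Sum>j\<in>UNIV. (cmod (L2_inner T r (kap t (v j))))\<^sup>2)"
    by (simp add: norm_expand J_ip[OF r t])
  also have "\<dots> \<le> (\<Sum>j\<in>(UNIV::'n set). L.nrm2 r * (T * (exp T * Bm)\<^sup>2))"
    by (intro sum_mono order_trans[OF L.cauchy_schwarz[OF continuous_L2[OF r] kap_L2]] mult_left_mono k
        L.ip_nonneg continuous_L2 r)
  finally show ?thesis by (simp add: mult_ac)
qed

lemma Q_nrm2_bound: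
  assumes r: "continuous_on {0..T} r"
  shows "L.nrm2 (Q r) \<le> T * (real CARD('n) * (T * (exp T * Bm)\<^sup>2) * L.nrm2 r)"
  unfolding L2_inner_self[of T "Q r"] Re_complex_of_real
proof (rule L2_set_integral_const[OF T_pos])
  show "(\<lambda>t. (norm (Q r t))\<^sup>2) \<in> borel_measurable (lebesgue_on {0..T})"
    by (intro continuous_borel_measurable continuous_intros Q_cont r)
  fix t assume t: "t \<in> {0..T}"
  have "norm (Q r t) \<le> norm (J r t)"
    using t by (simp add: Q_def mult_left_le_one_le)
  then have "(norm (Q r t))\<^sup>2 \<le> (norm (J r t))\<^sup>2" by (intro power_mono) auto
  then show "(norm (Q r t))\<^sup>2 \<le> real CARD('n) * (T * (exp T * Bm)\<^sup>2) * L.nrm2 r"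
    using J_norm_bound[OF r t] by linarith
qed simp

definition Lam :: "'n \<times> int \<Rightarrow> complex" where "Lam a = 1 + \<i> * of_real (om a)"

lemma Lam_norm: "(cmod (Lam a))\<^sup>2 = 1 + (om a)\<^sup>2"
  by (simp add: Lam_def cmod_power2)

lemma Lam_nz: "Lam a \<noteq> 0"
  by (simp add: Lam_def complex_eq_iff)

text \<open>The vector representing \<open>Lam a * L2_inner T (Q f) (e a)\<close> as a pairing with
  f; its second term comes from the boundary value at T. Its norm is bounded uniformly in a, so the
  coefficients decay like 1/|\<open>Lam a\<close>|.\<close>

definition kape :: "'n \<times> int \<Rightarrow> real \<Rightarrow> complex^'n" where
  "kape a s = adjm (M s) *v e a s - exp (- T) *\<^sub>R kap T (e a T) s"

lemma Mf_cont: "continuous_on {0..T} f \<Longrightarrow> continuous_on {0..T} (\<lambda>t. M t *v f t)"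
  by (intro continuous_intros M_cont)

text \<open>Integration by parts in the equation for \<open>Q f\<close>. Only the end T contributes,
  as \<open>Q f\<close> starts at 0.\<close>

lemma Q_coeff:
  assumes f: "continuous_on {0..T} f"
  shows "Lam a * L2_inner T (Q f) (e a) = L2_inner T (\<lambda>t. M t *v f t) (e a) - cip (Q f T) (e a T)"
proof -
  have c: "continuous_on {0..T} (\<lambda>t. M t *v f t - Q f t)" by (intro continuous_intros Mf_cont Q_cont f)
  from by_parts[OF Q_deriv[OF f] this, of a]
  have "L2_inner T (\<lambda>t. M t *v f t - Q f t) (e a) = cip (Q f T) (e a T) - cip (Q f 0) (e a 0) + \<i> * om a * L2_inner T (Q f) (e a)" .
  moreover have "L2_inner T ((\<lambda>t. M t *v f t) - Q f) (e a) = L2_inner T (\<lambda>t. M t *v f t) (e a) - L2_inner T (Q f) (e a)"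
    by (rule L.ip_diff_left[OF continuous_L2[OF Mf_cont[OF f]] Q_L2[OF f] e_L2])
  moreover have "Q f 0 = 0" by (simp add: Q_def J_0)
  ultimately show ?thesis by (simp add: fun_diff_def Lam_def cip_simps algebra_simps)
qed

lemma kape_L2: "kape a \<in> L2 T"
proof -
  have 1: "(\<lambda>s. adjm (M s) *v e a s) \<in> L2 T"
    by (intro continuous_L2 continuous_intros M_cont e_continuous)
  have 2: "fscale (of_real (exp (- T))) (kap T (e a T)) \<in> L2 T" by (rule L2_fscale[OF kap_L2])
  have "kape a = (\<lambda>s. adjm (M s) *v e a s) - fscale (of_real (exp (- T))) (kap T (e a T))"
    by (auto simp: kape_def fun_eq_iff Finite_Cartesian_Product.vec_eq_iff scaleR_conv_of_real[where 'a = complex])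
  then show ?thesis using L2_diff[OF 1 2] by simp
qed

lemma Q_coeff_kape:
  assumes f: "continuous_on {0..T} f"
  shows "Lam a * L2_inner T (Q f) (e a) = L2_inner T f (kape a)"
proof -
  have 1: "L2_inner T (\<lambda>t. M t *v f t) (e a) = L2_inner T f (\<lambda>s. adjm (M s) *v e a s)"
    by (simp add: L2_inner_cip cip_adjm)
  have "cip (Q f T) (e a T) = of_real (exp (- T)) * L2_inner T f (kap T (e a T))"
    using T_pos J_ip[OF f, of T "e a T"] by (simp add: Q_def cip_scaleR)
  also have "\<dots> = L2_inner T f (fscale (of_real (exp (- T))) (kap T (e a T)))"
    by (simp add: L.ip_scale_right continuous_L2[OF f] kap_L2 del: of_real_exp)
  finally have 2: "cip (Q f T) (e a T) = L2_inner T f (fscale (of_real (exp (- T))) (kap T (e a T)))" .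
  have "kape a = (\<lambda>s. adjm (M s) *v e a s) - fscale (of_real (exp (- T))) (kap T (e a T))"
    by (auto simp: kape_def fun_eq_iff Finite_Cartesian_Product.vec_eq_iff scaleR_conv_of_real[where 'a = complex])
  moreover have "(\<lambda>s. adjm (M s) *v e a s) \<in> L2 T"
    by (intro continuous_L2 continuous_intros M_cont e_continuous)
  ultimately show ?thesis
    unfolding Q_coeff[OF f] 1 2 using L.ip_diff_right[OF continuous_L2[OF f] _ L2_fscale[OF kap_L2]] by simp
qed

lemma e_norm: "t \<in> {0..T} \<Longrightarrow> norm (e a t) = 1 / sqrt T"
  using T_pos by (simp add: e_def norm_vector_smult norm_divide)

lemma kape_norm: "s \<in> {0..T} \<Longrightarrow> norm (kape a s) \<le> 2 * Bm / sqrt T"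
proof -
  assume s: "s \<in> {0..T}"
  have "norm (kape a s) \<le> norm (adjm (M s) *v e a s) + exp (- T) * norm (kap T (e a T) s)"
    unfolding kape_def by (rule order_trans[OF norm_triangle_ineq4]) simp
  also have "\<dots> \<le> Bm * norm (e a s) + exp (- T) * (exp s * (Bm * norm (e a T)))"
    using Bm(2)[OF s] kap_norm[OF s, of T "e a T"] s by (intro add_mono mult_left_mono) auto
  also have "exp (- T) * (exp s * (Bm * norm (e a T))) = exp (s - T) * (Bm * norm (e a T))"
    by (simp add: exp_diff exp_minus field_simps)
  also have "\<dots> \<le> 1 * (Bm * norm (e a T))"
    using s Bm(1) by (intro mult_right_mono) auto
  finally show ?thesis using s T_pos by (simp add: e_norm)
qed

text \<open>Bessel's inequality against \<open>kape a\<close>, uniformly over weighted orthonormal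
  families. The weight costs exp(2cT), while the factor 1 / (1 + \<omega>^2) is summable over the
  spectrum.\<close>

lemma Q_coeff_sum:
  assumes c: "c \<ge> 0" and I: "finite I" and g: "semi_ip.orthonormal (L2 T) (wip T c) I g"
    and gc: "\<And>i. i \<in> I \<Longrightarrow> continuous_on {0..T} (g i)"
  shows "(\<Sum>i\<in>I. (cmod (L2_inner T (Q (g i)) (e a)))\<^sup>2) \<le> (4 * Bm\<^sup>2 * exp (2 * c * T)) * (1 / (1 + (om a)\<^sup>2))"
proof -
  have "(\<integral>s. exp (2 * c * s) * (norm (kape a s))\<^sup>2 \<partial>lebesgue_on {0..T}) \<le> T * (exp (2 * c * T) * (2 * Bm / sqrt T)\<^sup>2)"
  proof (rule L2_set_integral_const[OF T_pos])
    show "(\<lambda>s. exp (2 * c * s) * (norm (kape a s))\<^sup>2) \<in> borel_measurable (lebesgue_on {0..T})"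
      by (intro borel_measurable_times borel_measurable_power measurable_compose[OF L2D(1)[OF kape_L2] borel_measurable_norm]
          continuous_borel_measurable[of _ "\<lambda>s. exp (2 * c * s)"] continuous_intros)
    show "exp (2 * c * s) * (norm (kape a s))\<^sup>2 \<le> exp (2 * c * T) * (2 * Bm / sqrt T)\<^sup>2" if "s \<in> {0..T}" for s
      using that c kape_norm[OF that] by (intro mult_mono power_mono) (auto intro: mult_left_mono)
  qed simp
  also have "\<dots> = 4 * Bm\<^sup>2 * exp (2 * c * T)" using T_pos by (simp add: power_divide power_mult_distrib)
  finally have b: "(\<Sum>i\<in>I. (cmod (L2_inner T (g i) (kape a)))\<^sup>2) \<le> 4 * Bm\<^sup>2 * exp (2 * c * T)"
    by (rule order_trans[OF wip_bessel[OF I g kape_L2]])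
  have p: "1 + (om a)\<^sup>2 > 0" by (simp add: add_pos_nonneg)
  have "(cmod (L2_inner T (Q (g i)) (e a)))\<^sup>2 * (1 + (om a)\<^sup>2) = (cmod (L2_inner T (g i) (kape a)))\<^sup>2" if "i \<in> I" for i
    using Q_coeff_kape[OF gc[OF that], of a, symmetric] by (simp add: norm_mult power_mult_distrib Lam_norm mult.commute)
  then have "(\<Sum>i\<in>I. (cmod (L2_inner T (Q (g i)) (e a)))\<^sup>2) * (1 + (om a)\<^sup>2) = (\<Sum>i\<in>I. (cmod (L2_inner T (g i) (kape a)))\<^sup>2)"
    by (simp add: sum_distrib_right)
  then show ?thesis using b p by (simp add: pos_le_divide_eq)
qed

text \<open>\<open>N0\<close> depends on c and \<epsilon> only, not on the family or its size. This
  uniformity is what a Schur basis needs, since it varies with N without further control.\<close>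

lemma Q_tail:
  assumes c: "c \<ge> 0" and "\<epsilon> > 0"
  shows "\<exists>N0. \<forall>N\<ge>N0. \<forall>I. \<forall>g::nat \<Rightarrow> _. finite I \<longrightarrow> semi_ip.orthonormal (L2 T) (wip T c) I g \<longrightarrow>
     (\<forall>i\<in>I. continuous_on {0..T} (g i)) \<longrightarrow> (\<Sum>i\<in>I. L.nrm2 (Q (g i) - PP N (Q (g i)))) \<le> \<epsilon>"
proof -
  define K where "K = 4 * Bm\<^sup>2 * exp (2 * c * T)"
  have K: "K > 0" using Bm(1) by (simp add: K_def)
  obtain N0 where N0: "\<And>A. finite A \<Longrightarrow> \<forall>a\<in>A. \<bar>om a\<bar> > N0 \<Longrightarrow> (\<Sum>a\<in>A. 1 / (1 + (om a)\<^sup>2)) \<le> \<epsilon> / K"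
    using om_tail[of "\<epsilon> / K"] K assms(2) by auto
  show ?thesis
  proof (intro exI[of _ N0] allI impI)
    fix N :: real and I :: "nat set" and g :: "nat \<Rightarrow> real \<Rightarrow> complex^'n"
    assume N: "N0 \<le> N" and I: "finite I" and g: "semi_ip.orthonormal (L2 T) (wip T c) I g"
      and gc: "\<forall>i\<in>I. continuous_on {0..T} (g i)"
    \<comment> \<open>The infinite Fourier tail is cut at a level depending on the family, with rest
      at most \<delta> per member. The finite remainder is estimated uniformly, and \<delta> is sent
      to 0 at the end.\<close>
    have step: "(\<Sum>i\<in>I. L.nrm2 (Q (g i) - PP N (Q (g i)))) \<le> \<epsilon> + real (card I) * \<delta>" if \<delta>: "\<delta> > 0" for \<delta>
    proof -
      have "\<forall>i\<in>I. \<exists>N1. \<forall>N'\<ge>N1. L.nrm2 (Q (g i) - PP N' (Q (g i))) \<le> \<delta>"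
        using PP_complete[OF Q_cont] gc \<delta> by blast
      then obtain N1 where N1: "\<And>i N'. i \<in> I \<Longrightarrow> N' \<ge> N1 i \<Longrightarrow> L.nrm2 (Q (g i) - PP N' (Q (g i))) \<le> \<delta>" by metis
      define N' where "N' = Max (insert N (N1 ` I))"
      have N': "N \<le> N'" "\<And>i. i \<in> I \<Longrightarrow> N1 i \<le> N'" using I by (auto simp: N'_def)
      define A where "A = idx N' - idx N"
      have A: "finite A" using finite_idx by (simp add: A_def)
      have "\<forall>a\<in>A. \<bar>om a\<bar> > N0" using N by (auto simp: A_def idx_def)
      note tail = N0[OF A this]
      have "L.nrm2 (Q (g i) - PP N (Q (g i))) \<le> \<delta> + (\<Sum>a\<in>A. (cmod (L2_inner T (Q (g i)) (e a)))\<^sup>2)" if i: "i \<in> I" for i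
      proof -
        have QL: "Q (g i) \<in> L2 T" using gc i by (intro Q_L2) auto
        have "(\<Sum>a\<in>idx N'. (cmod (L2_inner T (Q (g i)) (e a)))\<^sup>2) =
            (\<Sum>a\<in>A. (cmod (L2_inner T (Q (g i)) (e a)))\<^sup>2) + (\<Sum>a\<in>idx N. (cmod (L2_inner T (Q (g i)) (e a)))\<^sup>2)"
          unfolding A_def by (rule sum.subset_diff[OF idx_mono[OF N'(1)] finite_idx])
        then show ?thesis
          using N1[OF i N'(2)[OF i]] nrm2_diff_PP[OF QL, of N] nrm2_diff_PP[OF QL, of N'] by linarith
      qed
      then have "(\<Sum>i\<in>I. L.nrm2 (Q (g i) - PP N (Q (g i)))) \<le> (\<Sum>i\<in>I. \<delta> + (\<Sum>a\<in>A. (cmod (L2_inner T (Q (g i)) (e a)))\<^sup>2))"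
        by (rule sum_mono)
      also have "\<dots> = real (card I) * \<delta> + (\<Sum>a\<in>A. \<Sum>i\<in>I. (cmod (L2_inner T (Q (g i)) (e a)))\<^sup>2)"
        unfolding sum.distrib by (subst sum.swap) simp
      also have "(\<Sum>a\<in>A. \<Sum>i\<in>I. (cmod (L2_inner T (Q (g i)) (e a)))\<^sup>2) \<le> (\<Sum>a\<in>A. K * (1 / (1 + (om a)\<^sup>2)))"
        unfolding K_def using gc by (intro sum_mono Q_coeff_sum[OF c I g]) auto
      also have "\<dots> = K * (\<Sum>a\<in>A. 1 / (1 + (om a)\<^sup>2))" by (simp only: sum_distrib_left)
      also have "\<dots> \<le> K * (\<epsilon> / K)" using tail K by (intro mult_left_mono) auto
      also have "\<dots> = \<epsilon>" using K by simp
      finally show ?thesis by linarith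
    qed
    show "(\<Sum>i\<in>I. L.nrm2 (Q (g i) - PP N (Q (g i)))) \<le> \<epsilon>"
    proof (rule field_le_epsilon)
      fix \<eta> :: real assume "\<eta> > 0"
      then have "\<eta> / (real (card I) + 1) > 0" by simp
      from step[OF this] have "(\<Sum>i\<in>I. L.nrm2 (Q (g i) - PP N (Q (g i)))) \<le> \<epsilon> + real (card I) * (\<eta> / (real (card I) + 1))" .
      moreover have "real (card I) * (\<eta> / (real (card I) + 1)) \<le> \<eta>"
        using \<open>\<eta> > 0\<close> by (simp add: field_simps)
      ultimately show "(\<Sum>i\<in>I. L.nrm2 (Q (g i) - PP N (Q (g i)))) \<le> \<epsilon> + \<eta>" by linarith
    qed
  qed
qed

end

section \<open>Limit of the finite sections\<close>

lemma tendsto_det: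
  fixes A :: "'a \<Rightarrow> complex^'n^'n"
  assumes "\<And>i j. ((\<lambda>x. A x $ i $ j) \<longlongrightarrow> B $ i $ j) F"
  shows "((\<lambda>x. det (A x)) \<longlongrightarrow> det B) F"
  unfolding Determinants.det_def by (intro tendsto_sum tendsto_mult tendsto_const tendsto_prod assms)

context unitary_basis
begin

lemma cip_diagm: "cip (diagm k *v x) (v j) = k j * cip x (v j)"
proof -
  have "diagm k *v x = diagm k *v (\<Sum>i\<in>UNIV. cip x (v i) *s v i)" by (rule arg_cong[OF v_expand])
  also have "\<dots> = (\<Sum>i\<in>UNIV. (cip x (v i) * k i) *s v i)"
    by (simp add: bounded_bilinear.sum_right[OF bounded_bilinear_matrix_vector] vector_scalar_commute diagm_v)
  finally show ?thesis by (simp add: cip_v_sum)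
qed

end

lemma bounded_linear_mv: "bounded_linear (\<lambda>A. A *v (x :: complex^'n))"
  by (rule bounded_bilinear.bounded_linear_left[OF bounded_bilinear_matrix_vector])

context spectral
begin

definition ls :: "real \<Rightarrow> ('n \<times> int) list" where "ls N = (SOME l. distinct l \<and> set l = idx N)"

lemma ls: "distinct (ls N)" "set (ls N) = idx N"
proof -
  have "distinct (ls N) \<and> set (ls N) = idx N"
    unfolding ls_def by (rule someI_ex) (use finite_distinct_list[OF finite_idx] in auto)
  then show "distinct (ls N)" "set (ls N) = idx N" by auto
qed

lemma ls_nth: "i < length (ls N) \<Longrightarrow> ls N ! i \<in> idx N"
  using ls(2) nth_mem by blast

lemma sum_ls: "(\<Sum>i<length (ls N). f (ls N ! i)) = (\<Sum>a\<in>idx N. f a)"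
  using sum.reindex_bij_betw[OF bij_betw_nth[OF ls(1) refl refl], of f N] by (simp add: ls)

lemma prod_ls: "(\<Prod>i<length (ls N). f (ls N ! i)) = (\<Prod>a\<in>idx N. f a)"
  using prod.reindex_bij_betw[OF bij_betw_nth[OF ls(1) refl refl], of f N] by (simp add: ls)

lemma bs_orthonormal: "L.orthonormal {..<length (map e (ls N))} ((!) (map e (ls N)))"
  using ls(1) by (auto simp: L.orthonormal_def L2_inner_e nth_eq_iff_index_eq)

lemma bs_basis: "ordered_basis fscale (VV N) (map e (ls N))"
  using L.orthonormal_independent[OF bs_orthonormal] by (simp add: ordered_basis_def VV_def ls)

end

section \<open>Compressed Volterra operators and the finite-rank correction\<close>

context volterra
begin

definition X :: "real \<Rightarrow> (real \<Rightarrow> complex^'n) \<Rightarrow> real \<Rightarrow> complex^'n" where "X N f = PP N (Q f)"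

text \<open>The solution of z' + z = 0 with initial value x, that is the homogeneous part of the
  Green function.\<close>

definition Ex :: "complex^'n \<Rightarrow> real \<Rightarrow> complex^'n" where
  "Ex x t = (if t \<in> {0..T} then exp (- t) *\<^sub>R x else 0)"

definition C :: "complex^'n^'n" where "C = diagm \<kappa>"

text \<open>The initial value that makes \<open>Q f + Ex (rho f)\<close> satisfy z(0) = S z(T).
  Solving the boundary condition for it gives (1 - q S)^(-1) q S applied to \<open>J f T\<close>,
  with q = exp(-T).\<close>

definition rho :: "(real \<Rightarrow> complex^'n) \<Rightarrow> complex^'n" where "rho f = C *v J f T"

definition Mc :: "'n \<times> int \<Rightarrow> 'n \<times> int \<Rightarrow> complex" where "Mc b a = L2_inner T (\<lambda>t. M t *v e b t) (e a)"

definition Mint :: "complex^'n^'n" where "Mint = integral {0..T} M"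

lemma X_endo: "endo fscale (VV N) (X N)"
  unfolding endo_def X_def
  by (auto simp: PP_in_VV Q_add Q_scale PP_add PP_scale VV_continuous Q_L2)

lemma X_diff: "f \<in> VV N \<Longrightarrow> g \<in> VV N \<Longrightarrow> X N (f - g) = X N f - X N g"
  unfolding X_def by (simp add: Q_diff PP_diff VV_continuous Q_L2)

lemma id_minus_X_endo: "endo fscale (VV N) (\<lambda>f. f - X N f)"
  using X_endo[of N] by (auto simp: endo_def L.scale_right_diff_distrib L.subspace_diff[OF VV_subspace])

text \<open>The squared Hilbert-Schmidt norm of \<open>X N\<close> on \<open>VV N\<close> in the
  weighted product is at most \<epsilon>, expressed through finite orthonormal families.\<close>

definition small_at :: "real \<Rightarrow> real \<Rightarrow> real \<Rightarrow> bool" where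
  "small_at c \<epsilon> N \<longleftrightarrow> (\<forall>I. \<forall>g::nat \<Rightarrow> _. finite I \<longrightarrow> semi_ip.orthonormal (L2 T) (wip T c) I g \<longrightarrow>
     g ` I \<subseteq> VV N \<longrightarrow> (\<Sum>i\<in>I. Re (wip T c (X N (g i)) (X N (g i)))) \<le> \<epsilon>)"

lemma small_atD:
  "\<lbrakk>small_at c \<epsilon> N; finite I; semi_ip.orthonormal (L2 T) (wip T c) I g; g ` I \<subseteq> VV N\<rbrakk>
    \<Longrightarrow> (\<Sum>i\<in>I. Re (wip T c (X N (g i)) (X N (g i)))) \<le> \<epsilon>" for g :: "nat \<Rightarrow> _"
  unfolding small_at_def by simp

text \<open>Write P Q = Q + (P - 1) Q. The first part is small by the weight. The second is small in
  the plain norm, which dominates the weighted one, so no weighted bound for the projection itself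
  enters.\<close>

lemma X_small:
  assumes "\<epsilon> > 0"
  shows "\<exists>c\<ge>0. \<exists>N0. \<forall>N\<ge>N0. small_at c \<epsilon> N"
proof -
  define R where "R = T * (real CARD('n) * Bm\<^sup>2)"
  have R: "R \<ge> 0" using T_pos by (simp add: R_def)
  \<comment> \<open>Makes the weighted norm of the Volterra part at most \<epsilon>/4. The tail is
    given \<epsilon>/4 as well, and squaring a sum doubles both.\<close>
  define c where "c = 2 * R / \<epsilon>"
  have c: "c \<ge> 0" using R assms by (simp add: c_def)
  have "T * (real CARD('n) * (Bm\<^sup>2 / (2 * (c + 1)))) = R / (2 * (c + 1))" by (simp add: R_def)
  also have "\<dots> \<le> \<epsilon> / 4"
  proof -
    have "4 * R = \<epsilon> * (2 * c)" using assms by (simp add: c_def)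
    also have "\<dots> \<le> \<epsilon> * (2 * (c + 1))" using assms by simp
    finally show ?thesis using c by (simp add: pos_divide_le_eq)
  qed
  finally have b: "T * (real CARD('n) * (Bm\<^sup>2 / (2 * (c + 1)))) \<le> \<epsilon> / 4" .
  have "\<epsilon> / 4 > 0" using assms by simp
  from Q_tail[OF c this] obtain N0 where N0: "\<forall>N\<ge>N0. \<forall>I. \<forall>g::nat \<Rightarrow> _. finite I \<longrightarrow> semi_ip.orthonormal (L2 T) (wip T c) I g \<longrightarrow>
     (\<forall>i\<in>I. continuous_on {0..T} (g i)) \<longrightarrow> (\<Sum>i\<in>I. L.nrm2 (Q (g i) - PP N (Q (g i)))) \<le> \<epsilon> / 4" ..
  interpret W: semi_ip fscale "L2 T" "wip T c :: (real \<Rightarrow> complex^'n) \<Rightarrow> _" by (rule semi_ip_wip)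
  show ?thesis
  proof (rule exI[of _ c], rule conjI[OF c], rule exI[of _ N0], unfold small_at_def, intro allI impI)
    fix N :: real and I :: "nat set" and g :: "nat \<Rightarrow> real \<Rightarrow> complex^'n"
    assume N: "N0 \<le> N" and I: "finite I" and g: "W.orthonormal I g" and gV: "g ` I \<subseteq> VV N"
    have gc: "\<And>i. i \<in> I \<Longrightarrow> continuous_on {0..T} (g i)" using gV VV_continuous by blast
    have tail: "(\<Sum>i\<in>I. L.nrm2 (Q (g i) - PP N (Q (g i)))) \<le> \<epsilon> / 4"
      using N0 N I g gc by blast
    have "W.nrm2 (X N (g i)) \<le> 2 * W.nrm2 (Q (g i)) + 2 * L.nrm2 (Q (g i) - PP N (Q (g i)))" if i: "i \<in> I" for i
    proof -
      have QL: "Q (g i) \<in> L2 T" by (rule Q_L2[OF gc[OF i]])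
      have d: "PP N (Q (g i)) - Q (g i) \<in> L2 T" by (rule L2_diff[OF PP_in_L2 QL])
      have "W.nrm2 (Q (g i) + (PP N (Q (g i)) - Q (g i))) \<le> 2 * W.nrm2 (Q (g i)) + 2 * W.nrm2 (PP N (Q (g i)) - Q (g i))"
        by (rule W.nrm2_add_le[OF QL d])
      moreover have "W.nrm2 (PP N (Q (g i)) - Q (g i)) \<le> L.nrm2 (PP N (Q (g i)) - Q (g i))"
        by (rule Re_wip_le[OF c d])
      moreover have "L.nrm2 (PP N (Q (g i)) - Q (g i)) = L.nrm2 (Q (g i) - PP N (Q (g i)))"
        by (simp add: L2_inner_self norm_minus_commute)
      moreover have "Q (g i) + (PP N (Q (g i)) - Q (g i)) = X N (g i)" by (simp add: X_def)
      ultimately show ?thesis by simp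
    qed
    then have "(\<Sum>i\<in>I. W.nrm2 (X N (g i))) \<le> (\<Sum>i\<in>I. 2 * W.nrm2 (Q (g i)) + 2 * L.nrm2 (Q (g i) - PP N (Q (g i))))"
      by (rule sum_mono)
    also have "\<dots> = 2 * (\<Sum>i\<in>I. W.nrm2 (Q (g i))) + 2 * (\<Sum>i\<in>I. L.nrm2 (Q (g i) - PP N (Q (g i))))"
      by (simp only: sum.distrib sum_distrib_left)
    also have "\<dots> \<le> \<epsilon>" using tail Q_weighted_bound[OF c I g gc] b by linarith
    finally show "(\<Sum>i\<in>I. W.nrm2 (X N (g i))) \<le> \<epsilon>" .
  qed
qed

lemma VV_definite:
  assumes "c \<ge> 0" "f \<in> VV N" "Re (wip T c f f) = 0"
  shows "f = 0"
proof -
  have f: "f \<in> L2 T" using assms(2) VV_L2 by blast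
  have "L.nrm2 f \<le> 0" using Re_wip_ge[OF assms(1) f] assms(3) by simp
  moreover obtain u where u: "f = (\<Sum>a\<in>idx N. fscale (u a) (e a))" using assms(2) by (rule VV_E)
  ultimately have "(\<Sum>a\<in>idx N. (cmod (u a))\<^sup>2) \<le> 0"
    using L.nrm2_comb[OF finite_idx e_orthonormal, where c = u] by simp
  moreover have "(\<Sum>a\<in>idx N. (cmod (u a))\<^sup>2) \<ge> 0" by (intro sum_nonneg) simp
  ultimately have "(\<Sum>a\<in>idx N. (cmod (u a))\<^sup>2) = 0" by linarith
  then have "\<And>a. a \<in> idx N \<Longrightarrow> u a = 0" using finite_idx by (simp add: sum_nonneg_eq_0_iff)
  then show ?thesis unfolding u by (simp add: fscale_def fun_eq_iff sum_fun_apply)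
qed

text \<open>Determinant and trace do not depend on the inner product, so the weight may be adapted
  to the required accuracy. Each eigenvalue contributes 1 + O(|l|^2), and Schur's inequality bounds
  the sum of the squares.\<close>

lemma det_trace_limit:
  "((\<lambda>N. det_on fscale (VV N) (\<lambda>f. f - X N f) * exp (trace_on fscale (VV N) (X N))) \<longlongrightarrow> 1) at_top"
proof (rule tendstoI)
  fix r :: real assume r: "r > 0"
  \<comment> \<open>The bound 1/4 forces every eigenvalue into the disc of radius 1/2 where
    \<open>exp_ratio_bound\<close> holds; the logarithm makes the final estimate exp(2 \<epsilon>) -
    1 smaller than r.\<close>
  define \<epsilon> where "\<epsilon> = min (1 / 4) (ln (1 + r) / 4)"
  have \<epsilon>: "\<epsilon> > 0" "\<epsilon> \<le> 1 / 4" "2 * \<epsilon> < ln (1 + r)" using r by (auto simp: \<epsilon>_def min_def)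
  have "exp (2 * \<epsilon>) < exp (ln (1 + r))" using \<epsilon>(3) by simp
  then have er: "exp (2 * \<epsilon>) - 1 < r" using r by simp
  from X_small[OF \<epsilon>(1)] obtain c N0 where c: "c \<ge> 0" and N0: "\<And>N. N \<ge> N0 \<Longrightarrow> small_at c \<epsilon> N" by blast
  interpret W: semi_ip fscale "L2 T" "wip T c :: (real \<Rightarrow> complex^'n) \<Rightarrow> _" by (rule semi_ip_wip)
  show "\<forall>\<^sub>F N in at_top. dist (det_on fscale (VV N) (\<lambda>f. f - X N f) * exp (trace_on fscale (VV N) (X N))) 1 < r"
    using eventually_ge_at_top[of N0]
  proof eventually_elim
    case (elim N)
    have fin: "finite (e ` idx N)" using finite_idx by blast
    have "VV N \<subseteq> L.span (e ` idx N)" by (simp add: VV_def)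
    have vd: "x = 0" if "x \<in> VV N" "W.nrm2 x = 0" for x using VV_definite[OF c that] .
    from W.schur_basis[OF VV_subspace VV_L2 fin \<open>VV N \<subseteq> L.span (e ` idx N)\<close> vd X_endo]
    obtain gs where gs: "ordered_basis fscale (VV N) gs" "W.orthonormal {..<length gs} ((!) gs)"
      "\<And>i. i < length gs \<Longrightarrow> X N (gs ! i) \<in> L.span (set (take (Suc i) gs))" by blast
    have gV: "gs ! i \<in> VV N" if "i < length gs" for i using L.ordered_basisD(4)[OF gs(1)] that nth_mem by blast
    define l where "l i = wip T c (X N (gs ! i)) (gs ! i)" for i
    define h where "h i = (1 - l i) * exp (l i) - 1" for i
    have D: "det_on fscale (VV N) (\<lambda>f. f - X N f) = (\<Prod>i<length gs. 1 - l i)"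
      "trace_on fscale (VV N) (X N) = (\<Sum>i<length gs. l i)"
      unfolding l_def using W.schur_det_trace[OF gs X_endo] by (simp_all only:)
    have "(\<Sum>i<length gs. Re (wip T c (X N (gs ! i)) (X N (gs ! i)))) \<le> \<epsilon>"
      by (rule small_atD[OF N0[OF elim] _ gs(2)]) (use gV in auto)
    moreover have "(cmod (l i))\<^sup>2 \<le> Re (wip T c (X N (gs ! i)) (X N (gs ! i)))" if i: "i < length gs" for i
    proof -
      have "X N (gs ! i) \<in> L2 T" unfolding X_def by (rule PP_in_L2)
      moreover have "gs ! i \<in> L2 T" using gV[OF i] VV_L2 by blast
      ultimately have "(cmod (l i))\<^sup>2 \<le> W.nrm2 (X N (gs ! i)) * W.nrm2 (gs ! i)" unfolding l_def by (rule W.cauchy_schwarz)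
      moreover have "wip T c (gs ! i) (gs ! i) = 1" using gs(2) i by (simp add: W.orthonormal_def)
      ultimately show ?thesis by simp
    qed
    then have "(\<Sum>i<length gs. (cmod (l i))\<^sup>2) \<le> (\<Sum>i<length gs. Re (wip T c (X N (gs ! i)) (X N (gs ! i))))"
      by (intro sum_mono) auto
    ultimately have S: "(\<Sum>i<length gs. (cmod (l i))\<^sup>2) \<le> \<epsilon>" by linarith
    have lb: "cmod (l i) \<le> 1 / 2" if i: "i < length gs" for i
    proof -
      have "(cmod (l i))\<^sup>2 \<le> (\<Sum>i<length gs. (cmod (l i))\<^sup>2)" using i by (intro member_le_sum) auto
      then have "(cmod (l i))\<^sup>2 \<le> (1 / 2)\<^sup>2" using S \<epsilon>(2) by (simp add: power2_eq_square)
      then show ?thesis by (rule power2_le_imp_le) simp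
    qed
    have E: "det_on fscale (VV N) (\<lambda>f. f - X N f) * exp (trace_on fscale (VV N) (X N)) = (\<Prod>i<length gs. 1 + h i)"
      unfolding D h_def by (simp add: exp_sum prod.distrib)
    have "cmod ((\<Prod>i<length gs. 1 + h i) - 1) \<le> (\<Prod>i<length gs. 1 + cmod (h i)) - 1"
      by (rule norm_prod_minus1_le)
    moreover have "(\<Prod>i<length gs. 1 + cmod (h i)) \<le> (\<Prod>i<length gs. exp (2 * (cmod (l i))\<^sup>2))"
    proof (rule prod_mono)
      fix i assume i: "i \<in> {..<length gs}"
      have "cmod (h i) \<le> 2 * (cmod (l i))\<^sup>2" unfolding h_def using lb i by (intro exp_ratio_bound) auto
      then have "1 + cmod (h i) \<le> exp (2 * (cmod (l i))\<^sup>2)" using exp_ge_add_one_self[of "2 * (cmod (l i))\<^sup>2"] by linarith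
      then show "0 \<le> 1 + cmod (h i) \<and> 1 + cmod (h i) \<le> exp (2 * (cmod (l i))\<^sup>2)" by (simp add: add_nonneg_nonneg)
    qed
    moreover have "(\<Prod>i<length gs. exp (2 * (cmod (l i))\<^sup>2)) = exp (2 * (\<Sum>i<length gs. (cmod (l i))\<^sup>2))"
      by (simp add: exp_sum sum_distrib_left)
    moreover have "exp (2 * (\<Sum>i<length gs. (cmod (l i))\<^sup>2)) \<le> exp (2 * \<epsilon>)" using S by simp
    ultimately show ?case using er unfolding E dist_norm by linarith
  qed
qed

lemma J_comb:
  assumes I: "finite I" and g: "\<And>i. i \<in> I \<Longrightarrow> continuous_on {0..T} (g i)" and t: "t \<in> {0..T}"
  shows "J (\<Sum>i\<in>I. fscale (u i) (g i)) t = (\<Sum>i\<in>I. u i *s J (g i) t)"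
proof (rule v_eqI)
  fix j
  have gL: "g ` I \<subseteq> L2 T" using g continuous_L2 by blast
  have "(\<Sum>i\<in>I. fscale (u i) (g i)) = (\<lambda>t. \<Sum>i\<in>I. u i *s g i t)" by (simp add: fun_eq_iff sum_fun_apply)
  then have c: "continuous_on {0..T} (\<Sum>i\<in>I. fscale (u i) (g i))"
    using g by (auto intro!: continuous_intros)
  have "cip (J (\<Sum>i\<in>I. fscale (u i) (g i)) t) (v j) = (\<Sum>i\<in>I. u i * L2_inner T (g i) (kap t (v j)))"
    unfolding J_ip[OF c t] by (rule L.ip_sum_left[OF I gL kap_L2])
  also have "\<dots> = (\<Sum>i\<in>I. u i * cip (J (g i) t) (v j))" by (intro sum.cong refl) (simp add: J_ip[OF g t])
  also have "\<dots> = cip (\<Sum>i\<in>I. u i *s J (g i) t) (v j)"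
    by (simp add: bounded_bilinear.sum_left[OF bounded_bilinear_cip] cip_simps)
  finally show "cip (J (\<Sum>i\<in>I. fscale (u i) (g i)) t) (v j) = cip (\<Sum>i\<in>I. u i *s J (g i) t) (v j)" .
qed

lemma rho_comb:
  assumes "finite I" "\<And>i. i \<in> I \<Longrightarrow> continuous_on {0..T} (g i)"
  shows "rho (\<Sum>i\<in>I. fscale (u i) (g i)) = (\<Sum>i\<in>I. u i *s rho (g i))"
  unfolding rho_def using T_pos
  by (simp add: J_comb[OF assms] bounded_bilinear.sum_right[OF bounded_bilinear_matrix_vector] vector_scalar_commute)

lemma Ex_cont: "continuous_on {0..T} (Ex x)"
proof -
  have "continuous_on {0..T} (\<lambda>t. exp (- t) *\<^sub>R x)" by (intro continuous_intros)
  then show ?thesis by (rule continuous_on_eq) (simp add: Ex_def)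
qed

lemma Ex_L2: "Ex x \<in> L2 T" by (rule continuous_L2[OF Ex_cont])

lemma Ex_comb: "Ex x = (\<Sum>l\<in>UNIV. fscale (x $ l) (Ex (axis l 1)))"
proof
  fix t
  have "exp (- t) *\<^sub>R x = (\<Sum>l\<in>UNIV. x $ l *s (exp (- t) *\<^sub>R axis l 1))"
  proof (subst Finite_Cartesian_Product.vec_eq_iff, intro allI)
    fix i
    have "(\<Sum>l\<in>UNIV. x $ l *s (exp (- t) *\<^sub>R axis l 1)) $ i = (\<Sum>l\<in>UNIV. if l = i then exp (- t) *\<^sub>R x $ i else 0)"
      unfolding sum_component
      by (rule sum.cong) (auto simp: axis_def scaleR_conv_of_real[where 'a = complex] mult.commute)
    then show "(exp (- t) *\<^sub>R x) $ i = (\<Sum>l\<in>UNIV. x $ l *s (exp (- t) *\<^sub>R axis l 1)) $ i" by simp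
  qed
  then show "Ex x t = (\<Sum>l\<in>UNIV. fscale (x $ l) (Ex (axis l 1))) t"
    unfolding sum_fun_apply fscale_apply Ex_def
    by (cases "t \<in> {0..T}") (simp_all only: if_True if_False vector_smult_rzero sum.neutral_const)
qed

lemma Ex_coeff: "Lam a * L2_inner T (Ex x) (e a) = cip x (e a 0) - exp (- T) * cip x (e a T)"
proof -
  have d: "(Ex x has_vector_derivative - Ex x t) (at t within {0..T})" if t: "t \<in> {0..T}" for t
  proof -
    have "((\<lambda>t. exp (- t)) has_field_derivative - exp (- t)) (at t within {0..T})"
      by (auto intro!: derivative_eq_intros)
    from has_vector_derivative_scaleR[OF this has_vector_derivative_const, of x]
    have "((\<lambda>t. exp (- t) *\<^sub>R x) has_vector_derivative - Ex x t) (at t within {0..T})"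
      using t by (simp add: Ex_def)
    then show ?thesis by (rule has_vector_derivative_transform[OF t, rotated]) (simp add: Ex_def)
  qed
  have c: "continuous_on {0..T} (\<lambda>t. - Ex x t)" by (intro continuous_intros Ex_cont)
  have "L2_inner T (\<lambda>t. - Ex x t) (e a) = cip (Ex x T) (e a T) - cip (Ex x 0) (e a 0) + \<i> * om a * L2_inner T (Ex x) (e a)"
    by (rule by_parts[OF d c])
  moreover have "(\<lambda>t. - Ex x t) = fscale (-1) (Ex x)" by (simp add: fun_eq_iff Finite_Cartesian_Product.vec_eq_iff)
  then have "L2_inner T (\<lambda>t. - Ex x t) (e a) = - L2_inner T (Ex x) (e a)"
    using L.ip_scale_left[OF Ex_L2 e_L2, of "-1" x a] by simp
  ultimately show ?thesis using T_pos by (simp add: Lam_def Ex_def cip_scaleR algebra_simps)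
qed

text \<open>The boundary condition for \<open>Q f + Ex (rho f)\<close>. On each eigenline it is the
  fixed point equation s (1 + \<open>\<kappa> j\<close>) = \<open>\<kappa> j\<close> for s = exp(-T)
  cis \<theta>.\<close>

lemma rho_boundary: "rho f = Sc *v (Q f T + exp (- T) *\<^sub>R rho f)"
proof (rule v_eqI)
  fix j
  define x where "x = cip (J f T) (v j)"
  define s where "s = complex_of_real qT * cis (\<theta> j)"
  have s: "1 - s \<noteq> 0" unfolding s_def by (rule one_minus_q_nz)
  have k: "\<kappa> j = s / (1 - s)" by (simp add: \<kappa>_def s_def)
  have r: "cip (rho f) (v j) = \<kappa> j * x" by (simp add: rho_def C_def cip_diagm x_def)
  have "cip (Sc *v (Q f T + exp (- T) *\<^sub>R rho f)) (v j) = cis (\<theta> j) * (qT * x + qT * (\<kappa> j * x))"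
    using T_pos r by (simp add: cip_Sc cip_simps cip_scaleR Q_def qT_def x_def)
  also have "\<dots> = s * (1 + \<kappa> j) * x" by (simp add: s_def algebra_simps)
  also have "s * (1 + \<kappa> j) = \<kappa> j" unfolding k using s by (simp add: field_simps)
  finally show "cip (rho f) (v j) = cip (Sc *v (Q f T + exp (- T) *\<^sub>R rho f)) (v j)" by (simp add: r)
qed

text \<open>Both sides are Fourier coefficients of (d/dt + 1)^(-1) M f: on the left by dividing by
  the eigenvalue, on the right through the Green function. The boundary terms cancel by
  \<open>e_boundary\<close>. This is the splitting into Volterra part and rank n part.\<close>

lemma coeff_split:
  assumes f: "continuous_on {0..T} f"
  shows "L2_inner T (\<lambda>t. M t *v f t) (e a) / Lam a = L2_inner T (Q f) (e a) + L2_inner T (Ex (rho f)) (e a)"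
proof -
  have "cip (rho f) (e a 0) = cip (Sc *v (Q f T + exp (- T) *\<^sub>R rho f)) (e a 0)"
    by (subst rho_boundary) simp
  also have "\<dots> = cip (Q f T) (e a T) + exp (- T) * cip (rho f) (e a T)"
    unfolding e_boundary by (simp add: cip_simps cip_scaleR)
  finally have "Lam a * (L2_inner T (Q f) (e a) + L2_inner T (Ex (rho f)) (e a)) = L2_inner T (\<lambda>t. M t *v f t) (e a)"
    unfolding distrib_left Q_coeff[OF f] Ex_coeff by simp
  then show ?thesis using Lam_nz[of a] by (metis nonzero_mult_div_cancel_left)
qed

definition yf :: "complex^'n \<Rightarrow> real \<Rightarrow> complex^'n" where "yf x t = (if t \<in> {0..T} then Y t *v x else 0)"

lemma Y_cont: "continuous_on {0..T} Y"
  using Y' by (meson continuous_on_eq_continuous_within has_vector_derivative_continuous)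

lemma yf_cont: "continuous_on {0..T} (yf x)"
proof -
  have "continuous_on {0..T} (\<lambda>t. Y t *v x)" by (intro continuous_intros Y_cont)
  then show ?thesis by (rule continuous_on_eq) (simp add: yf_def)
qed

lemma J_yf: "t \<in> {0..T} \<Longrightarrow> J (yf x) t = exp t *\<^sub>R (Y t *v x) - x"
proof -
  assume t: "t \<in> {0..T}"
  have "((\<lambda>s. exp s *\<^sub>R (Y s *v x)) has_vector_derivative exp s *\<^sub>R (M s *v yf x s)) (at s within {0..t})"
    if s: "s \<in> {0..t}" for s
  proof -
    have sT: "s \<in> {0..T}" using s t by auto
    have "((\<lambda>s. exp s) has_field_derivative exp s) (at s within {0..T})" by (auto intro!: derivative_eq_intros)
    from has_vector_derivative_scaleR[OF this bounded_linear.has_vector_derivative[OF bounded_linear_mv Y'[OF sT]], of x]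
    have "((\<lambda>s. exp s *\<^sub>R (Y s *v x)) has_vector_derivative
      exp s *\<^sub>R (((M s - mat 1) ** Y s) *v x) + exp s *\<^sub>R (Y s *v x)) (at s within {0..T})" .
    moreover have "exp s *\<^sub>R (((M s - mat 1) ** Y s) *v x) + exp s *\<^sub>R (Y s *v x) = exp s *\<^sub>R (M s *v yf x s)"
      using sT by (simp add: yf_def matrix_vector_mul_assoc[symmetric] matrix_vector_mult_diff_rdistrib scaleR_diff_right)
    ultimately show ?thesis using t by (auto intro: has_vector_derivative_within_subset)
  qed
  from fundamental_theorem_of_calculus[OF _ this] t
  show ?thesis unfolding J_def by (intro integral_unique) (simp add: Y0)
qed

text \<open>The Volterra equation with right-hand side \<open>Ex x\<close> is the initial value
  problem z' + z = M z, z(0) = x, so its solution is Y x. Through it the fundamental solution enters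
  the determinant.\<close>

lemma yf_minus_Q: "yf x - Q (yf x) = Ex x"
proof
  fix t
  show "(yf x - Q (yf x)) t = Ex x t"
    by (auto simp: Q_def J_yf Ex_def yf_def scaleR_diff_right exp_minus)
qed

text \<open>Convergence of the Galerkin method. The compressed operator is a contraction in the
  weighted norm, so the Galerkin solution differs from the projection of the true one by a multiple
  of the projection error. The bound holds for any solution q, which allows an arbitrary choice
  later.\<close>

lemma solution_close:
  assumes "\<epsilon> > 0"
  shows "\<exists>N0. \<forall>N\<ge>N0. \<forall>q\<in>VV N. q - X N q = PP N (Ex x) \<longrightarrow> norm (J q T - J (yf x) T) \<le> \<epsilon>"
proof -
  have "(1/4::real) > 0" by simp
  from X_small[OF this] obtain c N1 where c: "c \<ge> 0" and N1: "\<And>N. N \<ge> N1 \<Longrightarrow> small_at c (1 / 4) N" by blast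
  interpret W: semi_ip fscale "L2 T" "wip T c :: (real \<Rightarrow> complex^'n) \<Rightarrow> _" by (rule semi_ip_wip)
  \<comment> \<open>A Hilbert-Schmidt bound dominates the operator norm: apply
    \<open>small_at\<close> to the single normalised vector.\<close>
  have contr: "W.nrm2 (X N f) \<le> W.nrm2 f / 4" if N: "N \<ge> N1" and f: "f \<in> VV N" for N f
  proof (cases "f = 0")
    case True
    have "X N 0 = X N (0 - 0)" by simp
    also have "\<dots> = 0" using L.subspace_0[OF VV_subspace] by (subst X_diff) auto
    finally show ?thesis using True W.ip_zero_left[OF L2_zero] by simp
  next
    case False
    have fL: "f \<in> L2 T" using f VV_L2 by blast
    have p: "W.nrm2 f > 0" using VV_definite[OF c f] False W.ip_nonneg[OF fL] by fastforce
    define s where "s = complex_of_real (1 / sqrt (W.nrm2 f))"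
    define g where "g = (\<lambda>i::nat. fscale s f)"
    have s2: "s * cnj s = of_real (1 / W.nrm2 f)" using p by (simp add: s_def flip: of_real_mult)
    have sL: "fscale s f \<in> L2 T" by (rule L2_fscale[OF fL])
    have sq: "wip T c (fscale s h) (fscale s h) = s * cnj s * wip T c h h" if "h \<in> L2 T" for h :: "real \<Rightarrow> complex^'n"
      using that L2_fscale[OF that, of s] by (simp add: W.ip_scale_left W.ip_scale_right)
    have "wip T c (fscale s f) (fscale s f) = of_real (1 / W.nrm2 f) * of_real (W.nrm2 f)"
      unfolding sq[OF fL] s2 by (rule arg_cong[OF W.ip_self[OF fL]])
    also have "\<dots> = 1" using p by (simp flip: of_real_mult)
    finally have "wip T c (fscale s f) (fscale s f) = 1" .
    then have "W.orthonormal {0} g" using sL by (simp add: W.orthonormal_def g_def)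
    moreover have "g ` {0} \<subseteq> VV N" using L.subspace_scale[OF VV_subspace f] by (simp add: g_def)
    ultimately have "(\<Sum>i\<in>{0}. W.nrm2 (X N (g i))) \<le> 1 / 4" by (intro small_atD[OF N1[OF N]]) auto
    then have "W.nrm2 (X N (fscale s f)) \<le> 1 / 4" by (simp add: g_def)
    moreover have "X N (fscale s f) = fscale s (X N f)" using X_endo[of N] f by (simp add: endo_def)
    moreover have "X N f \<in> L2 T" unfolding X_def by (rule PP_in_L2)
    ultimately have "W.nrm2 (X N f) / W.nrm2 f \<le> 1 / 4" using sq[of "X N f"] s2 by simp
    then show ?thesis using p by (simp add: field_simps)
  qed
  define K1 where "K1 = T * (real CARD('n) * (T * (exp T * Bm)\<^sup>2))"
  define K2 where "K2 = real CARD('n) * (T * (exp T * Bm)\<^sup>2)"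
  have K: "K1 \<ge> 0" "K2 \<ge> 0" using T_pos by (auto simp: K1_def K2_def)
  \<comment> \<open>The constant of the closing chain of estimates, enlarged by 1 to make it
    positive.\<close>
  define K3 where "K3 = 2 * K2 * (exp (2 * c * T) * 4 * K1 + 1) + 1"
  have "exp (2 * c * T) * 4 * K1 + 1 \<ge> 0" using K(1) by simp
  then have "K2 * (exp (2 * c * T) * 4 * K1 + 1) \<ge> 0" by (rule mult_nonneg_nonneg[OF K(2)])
  then have K3: "K3 > 0" unfolding K3_def by linarith
  define \<eta> where "\<eta> = \<epsilon>\<^sup>2 / K3"
  have \<eta>: "\<eta> > 0" using assms K3 by (simp add: \<eta>_def)
  obtain N2 where N2: "\<And>N. N \<ge> N2 \<Longrightarrow> L.nrm2 (yf x - PP N (yf x)) \<le> \<eta>"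
    using PP_complete[OF yf_cont \<eta>] by blast
  show ?thesis
  proof (intro exI[of _ "max N1 N2"] allI impI ballI)
    fix N q assume N: "max N1 N2 \<le> N" and q: "q \<in> VV N" and eq: "q - X N q = PP N (Ex x)"
    define p where "p = PP N (yf x)"
    define r where "r = p - yf x"
    have pV: "p \<in> VV N" unfolding p_def by (rule PP_in_VV)
    have rc: "continuous_on {0..T} r" unfolding r_def fun_diff_def using VV_continuous[OF pV] yf_cont by (intro continuous_intros)
    define d where "d = q - p"
    have dV: "d \<in> VV N" unfolding d_def using q pV by (rule L.subspace_diff[OF VV_subspace])
    have dL: "d \<in> L2 T" using dV VV_L2 by blast
    have yL: "yf x \<in> L2 T" by (rule continuous_L2[OF yf_cont])
    have nr: "L.nrm2 r \<le> \<eta>" using N2[of N] N by (simp add: r_def p_def L2_inner_self norm_minus_commute)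
    have "PP N (Ex x) = p - PP N (Q (yf x))"
      unfolding yf_minus_Q[symmetric] p_def by (rule PP_diff[OF yL Q_L2[OF yf_cont]])
    moreover have "d - X N d = (q - X N q) - (p - PP N (Q p))"
      unfolding d_def X_diff[OF q pV] by (simp add: X_def)
    ultimately have "d - X N d = PP N (Q p) - PP N (Q (yf x))"
      unfolding eq by simp
    also have "\<dots> = PP N (Q r)"
      unfolding r_def Q_diff[OF VV_continuous[OF pV] yf_cont]
      by (rule PP_diff[symmetric, OF Q_L2[OF VV_continuous[OF pV]] Q_L2[OF yf_cont]])
    \<comment> \<open>After squaring, the first term is at most half of the weighted norm of d and
      is absorbed on the left.\<close>
    finally have dd: "d = X N d + PP N (Q r)" by (simp add: algebra_simps)
    have "W.nrm2 (X N d + PP N (Q r)) \<le> 2 * W.nrm2 (X N d) + 2 * W.nrm2 (PP N (Q r))"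
      unfolding X_def by (rule W.nrm2_add_le[OF PP_in_L2 PP_in_L2])
    then have "W.nrm2 d \<le> 2 * W.nrm2 (X N d) + 2 * W.nrm2 (PP N (Q r))" using dd by simp
    moreover have "W.nrm2 (X N d) \<le> W.nrm2 d / 4" using contr N dV by simp
    moreover have "W.nrm2 (PP N (Q r)) \<le> L.nrm2 (PP N (Q r))" by (rule Re_wip_le[OF c PP_in_L2])
    moreover have "L.nrm2 (PP N (Q r)) \<le> L.nrm2 (Q r)" by (rule nrm2_PP_le[OF Q_L2[OF rc]])
    moreover have "L.nrm2 (Q r) \<le> K1 * L.nrm2 r" using Q_nrm2_bound[OF rc] by (simp add: K1_def mult.assoc)
    ultimately have "W.nrm2 d \<le> 4 * K1 * L.nrm2 r" by linarith
    then have "exp (2 * c * T) * W.nrm2 d \<le> exp (2 * c * T) * (4 * K1 * L.nrm2 r)" by (rule mult_left_mono) simp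
    then have dn: "L.nrm2 d \<le> exp (2 * c * T) * 4 * K1 * L.nrm2 r"
      using order_trans[OF Re_wip_ge[OF c dL]] by (simp only: mult.assoc)
    have T: "T \<in> {0..T}" using T_pos by simp
    have "q - yf x = d + r" by (simp add: d_def r_def)
    have "J q T - J (yf x) T = J (q - yf x) T" using J_diff[OF VV_continuous[OF q] yf_cont] by simp
    also have "\<dots> = J d T + J r T" using J_add[OF VV_continuous[OF dV] rc] \<open>q - yf x = d + r\<close> by simp
    finally have "norm (J q T - J (yf x) T) \<le> norm (J d T) + norm (J r T)" using norm_triangle_ineq by metis
    then have "(norm (J q T - J (yf x) T))\<^sup>2 \<le> (norm (J d T) + norm (J r T))\<^sup>2" by (intro power_mono) auto
    also have "\<dots> \<le> 2 * (norm (J d T))\<^sup>2 + 2 * (norm (J r T))\<^sup>2"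
      using sum_squares_bound[of "norm (J d T)" "norm (J r T)"] by (simp add: power2_sum)
    also have "\<dots> \<le> 2 * (K2 * L.nrm2 d) + 2 * (K2 * L.nrm2 r)"
      using J_norm_bound[OF VV_continuous[OF dV] T] J_norm_bound[OF rc T] unfolding K2_def[symmetric] by linarith
    also have "\<dots> \<le> 2 * (K2 * (exp (2 * c * T) * 4 * K1 * L.nrm2 r)) + 2 * (K2 * L.nrm2 r)"
      using mult_left_mono[OF dn K(2)] by linarith
    also have "\<dots> = (K3 - 1) * L.nrm2 r" by (simp add: K3_def algebra_simps)
    also have "\<dots> \<le> K3 * L.nrm2 r" using L.ip_nonneg[OF continuous_L2[OF rc]] by (simp add: algebra_simps)
    also have "\<dots> \<le> K3 * \<eta>" using nr K3 by (simp add: mult_left_mono)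
    also have "\<dots> = \<epsilon>\<^sup>2" using K3 by (simp add: \<eta>_def)
    finally have "(norm (J q T - J (yf x) T))\<^sup>2 \<le> \<epsilon>\<^sup>2" .
    then show "norm (J q T - J (yf x) T) \<le> \<epsilon>" using assms by (rule power2_le_imp_le[OF _ less_imp_le])
  qed
qed

end

lemma mat_mult_index:
  "A \<in> carrier_mat r k \<Longrightarrow> B \<in> carrier_mat k c \<Longrightarrow> i < r \<Longrightarrow> j < c \<Longrightarrow>
    (A * B) $$ (i, j) = (\<Sum>l<k. A $$ (i, l) * B $$ (l, j))"
  by (auto simp: scalar_prod_def atLeast0LessThan)

lemma matrix_vector_mult_axis: "((A :: complex^'n^'m) *v axis k 1) $ i = A $ i $ k"
  by (simp add: matrix_vector_mult_def axis_def if_distrib[of "\<lambda>c. _ * c"] cong: if_cong)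

lemma matrix_diff_left_distrib: "(A :: complex^'n^'m) ** (B - D) = A ** B - A ** D"
  by (simp add: Finite_Cartesian_Product.vec_eq_iff matrix_matrix_mult_def sum_subtractf algebra_simps)

section \<open>Reduction to a determinant of size n and the limit of the sections\<close>

context volterra
begin

text \<open>In the Fourier basis \<open>coeff_split\<close> reads A - P R, where A is the matrix of
  1 - X, P holds the coordinates of the functions \<open>Ex (axis k 1)\<close>, and R the vectors
  \<open>rho\<close>. The columns of A^(-1) P are the Galerkin solutions q, so the remaining n by n
  matrix consists of their values under \<open>rho\<close>.\<close>

lemma finite_identity:
  assumes nz: "det_on fscale (VV N) (\<lambda>f. f - X N f) \<noteq> 0"
  shows "\<exists>q. (\<forall>k. q k \<in> VV N \<and> q k - X N (q k) = PP N (Ex (axis k 1))) \<and>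
    Determinant.det (Matrix.mat (length (ls N)) (length (ls N))
      (\<lambda>(i, j). (if i = j then 1 else 0) - Mc (ls N ! j) (ls N ! i) / Lam (ls N ! i))) =
    det_on fscale (VV N) (\<lambda>f. f - X N f) * det (mat 1 - (\<chi> l k. rho (q k) $ l))"
proof -
  define n where "n = CARD('n)"
  define m where "m = length (ls N)"
  define E where "E i = e (ls N ! i)" for i
  \<comment> \<open>An enumeration of the coordinates, needed to write the n by n determinant as one
    indexed by numbers.\<close>
  obtain nn :: "nat \<Rightarrow> 'n" where nn: "bij_betw nn {0..<n} UNIV"
    using ex_bij_betw_nat_finite[of "UNIV :: 'n set"] by (auto simp: n_def)
  define g where "g = inv_into {0..<n} nn"
  have gn: "g k < n" "nn (g k) = k" for k
  proof -
    have "k \<in> nn ` {0..<n}" using nn by (auto simp: bij_betw_def)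
    then show "g k < n" "nn (g k) = k" unfolding g_def using inv_into_into[of k nn "{0..<n}"] f_inv_into_f[of k nn "{0..<n}"] by auto
  qed
  have gnn: "g (nn l) = l" if "l < n" for l
    unfolding g_def using nn that by (auto simp: bij_betw_def)
  have nninj: "nn i = nn j \<longleftrightarrow> i = j" if "i < n" "j < n" for i j
    using gnn[OF that(1)] gnn[OF that(2)] by metis
  define A where "A = matrix_of fscale (map e (ls N)) (\<lambda>f. f - X N f)"
  have Ei: "map e (ls N) ! i = E i" if "i < m" for i using that by (simp add: m_def E_def)
  have EV: "E i \<in> VV N" if "i < m" for i
    unfolding VV_def E_def using ls_nth[of i N] that by (intro L.span_base imageI) (simp add: m_def)
  have Ec: "continuous_on {0..T} (E i)" for i unfolding E_def by (rule e_continuous)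
  have EL: "E i \<in> L2 T" for i unfolding E_def by simp
  have A: "A \<in> carrier_mat m m" unfolding A_def m_def using L.matrix_of_carrier[of "map e (ls N)"] by simp
  have Ae: "A $$ (i, j) = (if i = j then 1 else 0) - L2_inner T (Q (E j)) (E i)" if "i < m" "j < m" for i j
  proof -
    have "A = Matrix.mat m m (\<lambda>(i, j). L2_inner T (map e (ls N) ! j - X N (map e (ls N) ! j)) (map e (ls N) ! i))"
      unfolding A_def using L.orthonormal_matrix_of[OF bs_basis bs_orthonormal id_minus_X_endo] by (simp add: m_def)
    then have "A $$ (i, j) = L2_inner T (E j - X N (E j)) (E i)" using that by (simp add: Ei)
    also have "\<dots> = L2_inner T (E j) (E i) - L2_inner T (X N (E j)) (E i)"
      unfolding X_def by (rule L.ip_diff_left[OF EL PP_in_L2 EL])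
    also have "L2_inner T (X N (E j)) (E i) = L2_inner T (Q (E j)) (E i)"
      unfolding X_def E_def using that ls_nth[of i N] by (intro PP_ip) (simp add: m_def)
    also have "L2_inner T (E j) (E i) = (if i = j then 1 else 0)"
      unfolding E_def L2_inner_e using ls(1) that by (auto simp: nth_eq_iff_index_eq m_def)
    finally show ?thesis .
  qed
  have detA: "det_on fscale (VV N) (\<lambda>f. f - X N f) = Determinant.det A"
    unfolding A_def by (rule L.det_on_eq[OF bs_basis id_minus_X_endo])
  obtain B where B: "B \<in> carrier_mat m m" "A * B = 1\<^sub>m m"
    using mat_inverse_exists[OF A] nz detA by auto
  define P where "P = Matrix.mat m n (\<lambda>(i, l). L2_inner T (Ex (axis (nn l) 1)) (E i))"
  define R where "R = Matrix.mat n m (\<lambda>(l, i). rho (E i) $ nn l)"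
  have P: "P \<in> carrier_mat m n" and R: "R \<in> carrier_mat n m" by (auto simp: P_def R_def)
  have BP: "B * P \<in> carrier_mat m n" using B P by simp
  have PR: "(P * R) $$ (i, j) = L2_inner T (Ex (rho (E j))) (E i)" if "i < m" "j < m" for i j
  proof -
    have "(P * R) $$ (i, j) = (\<Sum>l = 0..<n. L2_inner T (Ex (axis (nn l) 1)) (E i) * rho (E j) $ nn l)"
      using that P R by (simp add: P_def R_def scalar_prod_def)
    also have "\<dots> = (\<Sum>l\<in>UNIV. rho (E j) $ l * L2_inner T (Ex (axis l 1)) (E i))"
      using sum.reindex_bij_betw[OF nn, of "\<lambda>l. L2_inner T (Ex (axis l 1)) (E i) * rho (E j) $ l"]
      by (simp add: mult.commute)
    also have "\<dots> = L2_inner T (\<Sum>l\<in>UNIV. fscale (rho (E j) $ l) (Ex (axis l 1))) (E i)"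
      by (rule L.ip_sum_left[symmetric]) (auto simp: Ex_L2 EL)
    finally show ?thesis using Ex_comb[of "rho (E j)"] by simp
  qed
  have target: "Matrix.mat m m (\<lambda>(i, j). (if i = j then 1 else 0) - Mc (ls N ! j) (ls N ! i) / Lam (ls N ! i)) = A - P * R"
  proof (rule eq_matI)
    fix i j assume "i < dim_row (A - P * R)" "j < dim_col (A - P * R)"
    then have ij: "i < m" "j < m" using P R by auto
    have "Mc (ls N ! j) (ls N ! i) / Lam (ls N ! i) = L2_inner T (Q (E j)) (E i) + L2_inner T (Ex (rho (E j))) (E i)"
      unfolding Mc_def E_def by (rule coeff_split[OF e_continuous])
    then show "Matrix.mat m m (\<lambda>(i, j). (if i = j then 1 else 0) - Mc (ls N ! j) (ls N ! i) / Lam (ls N ! i)) $$ (i, j) = (A - P * R) $$ (i, j)"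
      using ij P R A by (simp add: Ae PR del: index_mult_mat(1))
  qed (use P R in auto)
  define q where "q k = (\<Sum>i<m. fscale ((B * P) $$ (i, g k)) (E i))" for k
  have qV: "q k \<in> VV N" for k
    unfolding q_def using EV by (intro L.subspace_sum[OF VV_subspace] L.subspace_scale[OF VV_subspace]) auto
  have qeq: "q k - X N (q k) = PP N (Ex (axis k 1))" for k
  proof -
    have "q k - X N (q k) = (\<Sum>i<m. fscale ((B * P) $$ (i, g k)) (E i - X N (E i)))"
      unfolding q_def
      using L.endo_sum[OF id_minus_X_endo VV_subspace finite_lessThan, of m E N "\<lambda>i. (B * P) $$ (i, g k)"] EV by simp
    also have "\<dots> = (\<Sum>i<m. fscale ((B * P) $$ (i, g k)) (\<Sum>r<m. fscale (A $$ (r, i)) (E r)))"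
    proof (rule sum.cong[OF refl])
      fix i assume i: "i \<in> {..<m}"
      have "E i - X N (E i) = (\<Sum>r<m. fscale (A $$ (r, i)) (E r))"
        using L.matrix_of_expand[OF bs_basis id_minus_X_endo, of i N] i by (simp add: A_def m_def E_def)
      then show "fscale ((B * P) $$ (i, g k)) (E i - X N (E i)) = fscale ((B * P) $$ (i, g k)) (\<Sum>r<m. fscale (A $$ (r, i)) (E r))" by simp
    qed
    also have "\<dots> = (\<Sum>r<m. fscale (\<Sum>i<m. A $$ (r, i) * (B * P) $$ (i, g k)) (E r))"
      by (rule L.sum_scale_swap)
    also have "\<dots> = (\<Sum>r<m. fscale (L2_inner T (Ex (axis k 1)) (E r)) (E r))"
    proof (rule sum.cong[OF refl])
      fix r assume r: "r \<in> {..<m}"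
      have "(\<Sum>i<m. A $$ (r, i) * (B * P) $$ (i, g k)) = (A * (B * P)) $$ (r, g k)"
        using mat_mult_index[OF A BP _ gn(1)] r by simp
      also have "A * (B * P) = P" using assoc_mult_mat[OF A B(1) P] B(2) P by simp
      also have "P $$ (r, g k) = L2_inner T (Ex (axis k 1)) (E r)" using r gn[of k] by (simp add: P_def)
      finally show "fscale (\<Sum>i<m. A $$ (r, i) * (B * P) $$ (i, g k)) (E r) = fscale (L2_inner T (Ex (axis k 1)) (E r)) (E r)" by simp
    qed
    also have "\<dots> = PP N (Ex (axis k 1))"
      unfolding PP_def m_def E_def by (rule sum_ls)
    finally show ?thesis .
  qed
  have "Determinant.det (1\<^sub>m n - R * (B * P)) = det (mat 1 - (\<chi> l k. rho (q k) $ l))"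
  proof -
    have RBP: "(R * (B * P)) $$ (i, j) = rho (q (nn j)) $ nn i" if "i < n" "j < n" for i j
    proof -
      have "(R * (B * P)) $$ (i, j) = (\<Sum>r<m. rho (E r) $ nn i * (B * P) $$ (r, j))"
        using mat_mult_index[OF R BP that] that by (simp add: R_def)
      also have "\<dots> = (\<Sum>r<m. (B * P) $$ (r, j) *s rho (E r)) $ nn i"
        by (simp add: mult.commute)
      also have "(\<Sum>r<m. (B * P) $$ (r, j) *s rho (E r)) = rho (q (nn j))"
        unfolding q_def gnn[OF that(2)] by (rule rho_comb[symmetric]) (auto simp: Ec)
      finally show ?thesis .
    qed
    have "det (mat 1 - (\<chi> l k. rho (q k) $ l)) =
        Determinant.det (Matrix.mat n n (\<lambda>(i, j). (mat 1 - (\<chi> l k. rho (q k) $ l)) $ nn i $ nn j))"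
      using det_reindex[OF nn[unfolded n_def], of "mat 1 - (\<chi> l k. rho (q k) $ l)"] by (simp only: n_def)
    also have "Matrix.mat n n (\<lambda>(i, j). (mat 1 - (\<chi> l k. rho (q k) $ l)) $ nn i $ nn j) = 1\<^sub>m n - R * (B * P)"
      using R BP B P by (intro eq_matI) (auto simp: RBP Finite_Cartesian_Product.mat_def nninj simp del: index_mult_mat(1))
    finally show ?thesis by simp
  qed
  then have "Determinant.det (A - P * R) = det_on fscale (VV N) (\<lambda>f. f - X N f) * det (mat 1 - (\<chi> l k. rho (q k) $ l))"
    using det_finite_rank_update[OF A B P R] detA by simp
  then show ?thesis using qV qeq target unfolding m_def by auto
qed

lemma J_tendsto_PP: "g \<in> Collect (continuous_on {0..T}) \<Longrightarrow> ((\<lambda>N. J (PP N g) T) \<longlongrightarrow> J g T) at_top"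
proof (rule tendstoI)
  assume "g \<in> Collect (continuous_on {0..T})"
  then have g: "continuous_on {0..T} g" by simp
  fix r :: real assume r: "r > 0"
  define K where "K = real CARD('n) * (T * (exp T * Bm)\<^sup>2) + 1"
  have K: "K > 0" unfolding K_def using T_pos by (intro add_nonneg_pos) auto
  define \<eta> where "\<eta> = (r / 2)\<^sup>2 / K"
  have "\<eta> > 0" using r K by (simp add: \<eta>_def)
  from PP_complete[OF g this] obtain N0 where N0: "\<And>N. N \<ge> N0 \<Longrightarrow> L.nrm2 (g - PP N g) \<le> \<eta>" by blast
  show "\<forall>\<^sub>F N in at_top. dist (J (PP N g) T) (J g T) < r"
    using eventually_ge_at_top[of N0]
  proof eventually_elim
    case (elim N)
    have c: "continuous_on {0..T} (PP N g)" by (rule VV_continuous[OF PP_in_VV])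
    have d: "continuous_on {0..T} (g - PP N g)" unfolding fun_diff_def using g c by (intro continuous_intros)
    have "(norm (J (g - PP N g) T))\<^sup>2 \<le> (K - 1) * L.nrm2 (g - PP N g)"
      using J_norm_bound[OF d, of T] T_pos by (simp add: K_def)
    also have "\<dots> \<le> K * L.nrm2 (g - PP N g)" using L.ip_nonneg[OF continuous_L2[OF d]] by (simp add: algebra_simps)
    also have "\<dots> \<le> K * \<eta>" using N0[OF elim] K by (simp add: mult_left_mono)
    also have "\<dots> = (r / 2)\<^sup>2" using K by (simp add: \<eta>_def)
    finally have "norm (J (g - PP N g) T) \<le> r / 2" using r by (rule power2_le_imp_le[OF _ less_imp_le[OF half_gt_zero]])
    then show ?case using J_diff[OF g c, of T] r by (simp add: dist_norm norm_minus_commute)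
  qed
qed

lemma rho_Ex: "rho (Ex x) = C *v (Mint *v x)"
proof -
  have "J (Ex x) T = integral {0..T} (\<lambda>s. M s *v x)"
    unfolding J_def by (rule Henstock_Kurzweil_Integration.integral_cong) (simp add: Ex_def exp_minus bounded_bilinear.scaleR_right[OF bounded_bilinear_matrix_vector])
  also have "\<dots> = Mint *v x"
    unfolding Mint_def using integral_linear[OF integrable_continuous_real[OF M_cont] bounded_linear_mv, of x]
    by (simp add: comp_def)
  finally show ?thesis by (simp add: rho_def)
qed

text \<open>The phases of the eigenfunctions cancel, so the diagonal does not depend on k and the
  trace factors into a constant times the sum of 1 / \<open>Lam\<close>.\<close>

lemma Mc_diag: "Mc (j, k) (j, k) = cip (Mint *v v j) (v j) / of_real T"
proof -
  have bl: "bounded_linear (\<lambda>A. cip (A *v v j) (v j))"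
    by (rule bounded_linear_compose[OF bounded_bilinear.bounded_linear_left[OF bounded_bilinear_cip] bounded_linear_mv])
  have "Mc (j, k) (j, k) = integral {0..T} (\<lambda>t. cip (M t *v e (j, k) t) (e (j, k) t))"
    unfolding Mc_def by (rule L2_inner_integral[OF Mf_cont[OF e_continuous] e_continuous])
  also have "\<dots> = integral {0..T} (\<lambda>t. cip (M t *v v j) (v j) / of_real T)"
    by (rule Henstock_Kurzweil_Integration.integral_cong) (simp add: cip_e)
  also have "\<dots> = integral {0..T} (\<lambda>t. cip (M t *v v j) (v j)) / of_real T" by simp
  also have "integral {0..T} (\<lambda>t. cip (M t *v v j) (v j)) = cip (Mint *v v j) (v j)"
    unfolding Mint_def using integral_linear[OF integrable_continuous_real[OF M_cont] bl] by (simp add: comp_def)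
  finally show ?thesis .
qed

text \<open>Trace of the whole minus trace of the rank n part. The latter is again a trace of size
  n, with the projection moved into the argument of \<open>rho\<close>.\<close>

lemma X_trace: "trace_on fscale (VV N) (X N) = (\<Sum>a\<in>idx N. Mc a a / Lam a) - (\<Sum>l\<in>UNIV. rho (PP N (Ex (axis l 1))) $ l)"
proof -
  have "trace_on fscale (VV N) (X N) = (\<Sum>i<length (ls N). L2_inner T (X N (e (ls N ! i))) (e (ls N ! i)))"
    unfolding L.trace_on_eq[OF bs_basis X_endo] L.orthonormal_matrix_of[OF bs_basis bs_orthonormal X_endo] by simp
  also have "\<dots> = (\<Sum>a\<in>idx N. L2_inner T (X N (e a)) (e a))" by (rule sum_ls)
  also have "\<dots> = (\<Sum>a\<in>idx N. Mc a a / Lam a - L2_inner T (Ex (rho (e a))) (e a))"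
  proof (rule sum.cong[OF refl])
    fix a assume "a \<in> idx N"
    then show "L2_inner T (X N (e a)) (e a) = Mc a a / Lam a - L2_inner T (Ex (rho (e a))) (e a)"
      unfolding X_def using coeff_split[OF e_continuous, of a a] by (simp add: PP_ip Mc_def)
  qed
  also have "\<dots> = (\<Sum>a\<in>idx N. Mc a a / Lam a) - (\<Sum>a\<in>idx N. L2_inner T (Ex (rho (e a))) (e a))"
    by (rule sum_subtractf)
  also have "(\<Sum>a\<in>idx N. L2_inner T (Ex (rho (e a))) (e a)) = (\<Sum>a\<in>idx N. \<Sum>l\<in>UNIV. rho (e a) $ l * L2_inner T (Ex (axis l 1)) (e a))"
  proof (rule sum.cong[OF refl])
    fix a
    have "L2_inner T (\<Sum>l\<in>UNIV. fscale (rho (e a) $ l) (Ex (axis l 1))) (e a) = (\<Sum>l\<in>UNIV. rho (e a) $ l * L2_inner T (Ex (axis l 1)) (e a))"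
      by (rule L.ip_sum_left) (auto simp: Ex_L2)
    then show "L2_inner T (Ex (rho (e a))) (e a) = (\<Sum>l\<in>UNIV. rho (e a) $ l * L2_inner T (Ex (axis l 1)) (e a))"
      using Ex_comb[of "rho (e a)"] by simp
  qed
  also have "\<dots> = (\<Sum>l\<in>UNIV. \<Sum>a\<in>idx N. rho (e a) $ l * L2_inner T (Ex (axis l 1)) (e a))" by (rule sum.swap)
  also have "\<dots> = (\<Sum>l\<in>UNIV. rho (PP N (Ex (axis l 1))) $ l)"
  proof (rule sum.cong[OF refl])
    fix l
    have "rho (PP N (Ex (axis l 1))) = (\<Sum>a\<in>idx N. L2_inner T (Ex (axis l 1)) (e a) *s rho (e a))"
      unfolding PP_def by (rule rho_comb[OF finite_idx e_continuous])
    then show "(\<Sum>a\<in>idx N. rho (e a) $ l * L2_inner T (Ex (axis l 1)) (e a)) = rho (PP N (Ex (axis l 1))) $ l"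
      by (simp add: mult.commute)
  qed
  finally show ?thesis .
qed

text \<open>The terms with \<open>\<kappa>\<close> from the whole operator and from the rank n part
  cancel; what stays is half the trace of the integrated coefficient, the mean value of the
  jump.\<close>

lemma trace_limit: "((\<lambda>N. trace_on fscale (VV N) (X N)) \<longlongrightarrow> trace Mint / 2) at_top"
proof -
  define mb where "mb j = cip (Mint *v v j) (v j)" for j
  have 1: "((\<lambda>N. \<Sum>a\<in>idx N. Mc a a / Lam a) \<longlongrightarrow> (\<Sum>j\<in>UNIV. mb j / of_real T * (of_real T / 2 + of_real T * \<kappa> j))) at_top"
  proof -
    have "(\<Sum>a\<in>idx N. Mc a a / Lam a) = (\<Sum>j\<in>UNIV. mb j / of_real T * (\<Sum>k\<in>cutset T (\<theta> j) N. 1 / (1 + \<i> * of_real (om (j, k)))))" for N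
      unfolding sum_idx by (simp add: Mc_diag mb_def Lam_def sum_distrib_left)
    moreover have "((\<lambda>N. \<Sum>j\<in>UNIV. mb j / of_real T * (\<Sum>k\<in>cutset T (\<theta> j) N. 1 / (1 + \<i> * of_real (om (j, k))))) \<longlongrightarrow>
        (\<Sum>j\<in>UNIV. mb j / of_real T * (of_real T / 2 + of_real T * \<kappa> j))) at_top"
      by (intro tendsto_sum tendsto_mult tendsto_const resolvent_sum_limit)
    ultimately show ?thesis by simp
  qed
  have 2: "((\<lambda>N. \<Sum>l\<in>UNIV. rho (PP N (Ex (axis l 1))) $ l) \<longlongrightarrow> (\<Sum>l\<in>UNIV. rho (Ex (axis l 1)) $ l)) at_top"
    unfolding rho_def
    by (intro tendsto_sum tendsto_vec_nth bounded_linear.tendsto[OF bounded_bilinear.bounded_linear_right[OF bounded_bilinear_matrix_vector]] J_tendsto_PP)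
      (simp add: Ex_cont)
  have "(\<Sum>l\<in>UNIV. rho (Ex (axis l 1)) $ l) = trace (C ** Mint)"
    unfolding rho_Ex matrix_vector_mul_assoc trace_def
    by (intro sum.cong refl) (simp add: matrix_vector_mult_axis)
  also have "\<dots> = trace (Mint ** C)" by (rule trace_mul_sym)
  also have "\<dots> = (\<Sum>j\<in>UNIV. \<kappa> j * mb j)"
    unfolding trace_v by (simp add: matrix_vector_mul_assoc[symmetric] C_def diagm_v vector_scalar_commute cip_simps mb_def)
  finally have 3: "(\<Sum>l\<in>UNIV. rho (Ex (axis l 1)) $ l) = (\<Sum>j\<in>UNIV. \<kappa> j * mb j)" .
  have "(\<Sum>j\<in>UNIV. mb j / of_real T * (of_real T / 2 + of_real T * \<kappa> j)) - (\<Sum>j\<in>UNIV. \<kappa> j * mb j) = (\<Sum>j\<in>UNIV. mb j / 2)"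
    unfolding sum_subtractf[symmetric] using T_pos by (intro sum.cong refl) (simp add: field_simps)
  also have "\<dots> = trace Mint / 2" unfolding trace_v mb_def by (simp add: sum_divide_distrib)
  finally have 4: "(\<Sum>j\<in>UNIV. mb j / of_real T * (of_real T / 2 + of_real T * \<kappa> j)) - (\<Sum>j\<in>UNIV. \<kappa> j * mb j) = trace Mint / 2" .
  show ?thesis unfolding X_trace using tendsto_diff[OF 1 2] unfolding 3 4 .
qed

text \<open>Multiply by D = 1 - q S, where D C = q S and q = exp(-T). The factors exp(-T) and exp T
  cancel in front of Y(T), and the two terms q S cancel each other.\<close>

lemma det_solution:
  "det (mat 1 - C ** (exp T *\<^sub>R Y T - mat 1)) * (\<Prod>j\<in>UNIV. 1 - qT * cis (\<theta> j)) = det (mat 1 - Sc ** Y T)"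
proof -
  define D where "D = diagm (\<lambda>j. 1 - qT * cis (\<theta> j))"
  define Z where "Z = exp T *\<^sub>R Y T - mat 1"
  have D: "D = mat 1 - qT *\<^sub>R Sc"
  proof (rule matrix_eq_v)
    fix j
    have "qT *\<^sub>R Sc *v v j = of_real qT *s (Sc *v v j)"
      by (simp add: Finite_Cartesian_Product.vec_eq_iff matrix_vector_mult_def sum_distrib_left scaleR_conv_of_real[where 'a = complex] mult.assoc)
    then show "D *v v j = (mat 1 - qT *\<^sub>R Sc) *v v j"
      by (simp add: D_def diagm_v matrix_vector_mult_diff_rdistrib Sc_v Finite_Cartesian_Product.vec_eq_iff algebra_simps)
  qed
  have DC: "D ** C = qT *\<^sub>R Sc"
  proof (rule matrix_eq_v)
    fix j
    have "qT *\<^sub>R Sc *v v j = of_real qT *s (Sc *v v j)"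
      by (simp add: Finite_Cartesian_Product.vec_eq_iff matrix_vector_mult_def sum_distrib_left scaleR_conv_of_real[where 'a = complex] mult.assoc)
    moreover have "(D ** C) *v v j = ((1 - qT * cis (\<theta> j)) * \<kappa> j) *s v j"
      by (simp add: matrix_vector_mul_assoc[symmetric] C_def D_def diagm_v vector_scalar_commute Finite_Cartesian_Product.vec_eq_iff algebra_simps)
    moreover have "(1 - qT * cis (\<theta> j)) * \<kappa> j = qT * cis (\<theta> j)"
      unfolding \<kappa>_def using one_minus_q_nz[of j] by simp
    ultimately show "(D ** C) *v v j = (qT *\<^sub>R Sc) *v v j" by (simp add: Sc_v)
  qed
  have "D ** (mat 1 - C ** Z) = D - qT *\<^sub>R Sc ** Z"
    unfolding DC[symmetric] by (simp add: matrix_diff_left_distrib matrix_mul_assoc)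
  also have "qT *\<^sub>R Sc ** Z = Sc ** Y T - qT *\<^sub>R Sc"
  proof -
    have "qT *\<^sub>R Sc ** Z = (qT *\<^sub>R Sc) ** (exp T *\<^sub>R Y T) - qT *\<^sub>R Sc"
      by (simp add: Z_def matrix_diff_left_distrib)
    also have "(qT *\<^sub>R Sc) ** (exp T *\<^sub>R Y T) = Sc ** Y T"
      by (simp add: Finite_Cartesian_Product.vec_eq_iff matrix_matrix_mult_def qT_def exp_minus)
    finally show ?thesis .
  qed
  finally have "D ** (mat 1 - C ** Z) = mat 1 - Sc ** Y T" by (simp add: D)
  then have "det D * det (mat 1 - C ** Z) = det (mat 1 - Sc ** Y T)" by (metis det_mul)
  then show ?thesis unfolding Z_def D_def det_diagm by (simp add: mult.commute)
qed

theorem main_limit: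
  "((\<lambda>N. Determinant.det (Matrix.mat (length (ls N)) (length (ls N))
      (\<lambda>(i, j). (if i = j then 1 else 0) - Mc (ls N ! j) (ls N ! i) / Lam (ls N ! i)))) \<longlongrightarrow>
    exp (- (trace Mint / 2)) * (det (mat 1 - Sc ** Y T) / (\<Prod>j\<in>UNIV. 1 - qT * cis (\<theta> j)))) at_top"
proof -
  define dX where "dX N = det_on fscale (VV N) (\<lambda>f. f - X N f)" for N
  define DM where "DM N = Determinant.det (Matrix.mat (length (ls N)) (length (ls N))
      (\<lambda>(i, j). (if i = j then 1 else 0) - Mc (ls N ! j) (ls N ! i) / Lam (ls N ! i)))" for N
  have "((\<lambda>N. (dX N * exp (trace_on fscale (VV N) (X N))) * exp (- trace_on fscale (VV N) (X N))) \<longlongrightarrow> 1 * exp (- (trace Mint / 2))) at_top"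
    unfolding dX_def by (intro tendsto_mult det_trace_limit tendsto_exp tendsto_minus trace_limit)
  then have dX: "(dX \<longlongrightarrow> exp (- (trace Mint / 2))) at_top"
    by (simp add: mult.assoc exp_minus_inverse)
  \<comment> \<open>The limit is not zero, so for large N the compressed equation is solvable and
    the splitting applies.\<close>
  then have ev: "\<forall>\<^sub>F N in at_top. dX N \<noteq> 0"
    by (rule tendsto_imp_eventually_ne) simp
  define good where "good N q \<longleftrightarrow> (\<forall>k. q k \<in> VV N \<and> q k - X N (q k) = PP N (Ex (axis k 1))) \<and>
      DM N = dX N * det (mat 1 - (\<chi> l k. rho (q k) $ l))" for N q
  \<comment> \<open>A choice of Galerkin solutions as a function of N, meaningful for all large
    N.\<close>
  define qf where "qf N = (SOME q. good N q)" for N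
  have good: "\<forall>\<^sub>F N in at_top. good N (qf N)"
    using ev
  proof eventually_elim
    case (elim N)
    then have "\<exists>q. good N q" unfolding good_def DM_def dX_def by (intro finite_identity)
    then show ?case unfolding qf_def by (rule someI_ex)
  qed
  have Jl: "((\<lambda>N. J (qf N k) T) \<longlongrightarrow> J (yf (axis k 1)) T) at_top" for k
  proof (rule tendstoI)
    fix r :: real assume r: "r > 0"
    then have "r / 2 > 0" by simp
    from solution_close[OF this, of "axis k 1"] obtain N0 where N0: "\<And>N q. N \<ge> N0 \<Longrightarrow> q \<in> VV N \<Longrightarrow> q - X N q = PP N (Ex (axis k 1)) \<Longrightarrow>
       norm (J q T - J (yf (axis k 1)) T) \<le> r / 2" by blast
    show "\<forall>\<^sub>F N in at_top. dist (J (qf N k) T) (J (yf (axis k 1)) T) < r"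
      using good eventually_ge_at_top[of N0]
    proof eventually_elim
      case (elim N)
      then have "norm (J (qf N k) T - J (yf (axis k 1)) T) \<le> r / 2" by (intro N0) (auto simp: good_def)
      then show ?case using r by (simp add: dist_norm)
    qed
  qed
  have rl: "((\<lambda>N. rho (qf N k) $ l) \<longlongrightarrow> rho (yf (axis k 1)) $ l) at_top" for k l
    unfolding rho_def
    by (intro tendsto_vec_nth bounded_linear.tendsto[OF bounded_bilinear.bounded_linear_right[OF bounded_bilinear_matrix_vector]] Jl)
  have dl: "((\<lambda>N. det (mat 1 - (\<chi> l k. rho (qf N k) $ l))) \<longlongrightarrow> det (mat 1 - (\<chi> l k. rho (yf (axis k 1)) $ l))) at_top"
    by (rule tendsto_det) (auto intro!: tendsto_intros rl)
  have "(\<chi> l k. rho (yf (axis k 1)) $ l) = C ** (exp T *\<^sub>R Y T - mat 1)"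
  proof -
    have "rho (yf (axis k 1)) = (C ** (exp T *\<^sub>R Y T - mat 1)) *v axis k 1" for k
      using T_pos by (simp add: rho_def J_yf matrix_vector_mul_assoc[symmetric] matrix_vector_mult_diff_rdistrib bounded_bilinear.scaleR_left[OF bounded_bilinear_matrix_vector])
    then show ?thesis
      by (simp add: Finite_Cartesian_Product.vec_eq_iff matrix_vector_mult_axis)
  qed
  then have "det (mat 1 - (\<chi> l k. rho (yf (axis k 1)) $ l)) = det (mat 1 - Sc ** Y T) / (\<Prod>j\<in>UNIV. 1 - qT * cis (\<theta> j))"
    using det_solution one_minus_q_nz by (simp add: nonzero_eq_divide_eq prod_zero_iff)
  with tendsto_mult[OF dX dl]
  have "((\<lambda>N. dX N * det (mat 1 - (\<chi> l k. rho (qf N k) $ l))) \<longlongrightarrow>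
      exp (- (trace Mint / 2)) * (det (mat 1 - Sc ** Y T) / (\<Prod>j\<in>UNIV. 1 - qT * cis (\<theta> j)))) at_top" by simp
  moreover have "\<forall>\<^sub>F N in at_top. dX N * det (mat 1 - (\<chi> l k. rho (qf N k) $ l)) = DM N"
    using good by eventually_elim (simp add: good_def)
  ultimately show ?thesis unfolding DM_def[symmetric] by (rule Lim_transform_eventually)
qed

end

section \<open>Weak derivatives and the spectrum of the derivative\<close>

lemma integrable_lebesgue_on_subinterval:
  fixes f :: "real \<Rightarrow> 'a::euclidean_space"
  assumes "integrable (lebesgue_on {0..T}) f" "t \<le> T"
  shows "integrable (lebesgue_on {0..t}) f"
proof -
  have "set_integrable lebesgue {0..T} f"
    using assms(1) by (simp add: integrable_restrict_space set_integrable_def)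
  then have "set_integrable lebesgue {0..t} f"
    by (rule set_integrable_subset) (use assms(2) in auto)
  then show ?thesis by (simp add: integrable_restrict_space set_integrable_def)
qed

lemma weak_integral_eq:
  fixes w :: "real \<Rightarrow> complex^'n"
  assumes "w \<in> L2 T" "t \<in> {0..T}"
  shows "(\<integral>s. w s \<partial>lebesgue_on {0..t}) = integral {0..t} w" "w integrable_on {0..t}"
proof -
  have *: "integrable (lebesgue_on {0..t}) w"
    using integrable_lebesgue_on_subinterval[OF L2_integrable[OF assms(1)]] assms(2) by simp
  show "(\<integral>s. w s \<partial>lebesgue_on {0..t}) = integral {0..t} w"
    by (rule lebesgue_integral_eq_integral[OF *]) simp
  show "w integrable_on {0..t}" by (rule integrable_on_lebesgue_on[OF *]) simp
qed

lemma is_weak_deriv_iff: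
  "is_weak_deriv T z w \<longleftrightarrow> w \<in> L2 T \<and> (\<forall>t\<in>{0..T}. z t = z 0 + integral {0..t} w)"
  unfolding is_weak_deriv_def using weak_integral_eq by (metis (no_types, lifting))

lemma is_weak_derivD:
  assumes "is_weak_deriv T z w"
  shows "w \<in> L2 T" "t \<in> {0..T} \<Longrightarrow> z t = z 0 + integral {0..t} w"
  using assms unfolding is_weak_deriv_iff by blast+

text \<open>The integral of f vanishes on intervals by subtraction, on Borel sets by Dynkin
  induction, and on Lebesgue sets up to null sets; then f has zero density. This gives uniqueness of
  weak derivatives.\<close>

lemma AE_zero_if_integrals_zero:
  fixes f :: "real \<Rightarrow> 'a::euclidean_space"
  assumes f: "integrable (lebesgue_on {0..T}) f" and z: "\<And>t. t \<in> {0..T} \<Longrightarrow> integral {0..t} f = 0"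
  shows "AE t in lebesgue_on {0..T}. f t = 0"
proof (rule sigma_finite_measure.density_zero[OF _ f])
  let ?M = "lebesgue_on {0..T}"
  interpret finite_measure ?M by (rule finite_measure_interval)
  show "sigma_finite_measure ?M" ..
  have fi: "f integrable_on {a..b}" if "0 \<le> a" "b \<le> T" for a b
    by (rule integrable_on_subinterval[OF integrable_on_lebesgue_on[OF f]]) (use that in simp_all)
  have bs: "B \<inter> {0..T} \<in> sets ?M" if "B \<in> sets borel" for B
    using that by (subst sets_restrict_space_iff) auto
  have sI: "integrable ?M (\<lambda>x. indicator B x *\<^sub>R f x)" if "B \<in> sets borel" for B
  proof -
    have "integrable ?M (\<lambda>x. indicator (B \<inter> {0..T}) x *\<^sub>R f x)"
      by (rule integrable_mult_indicator[OF bs[OF that] f])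
    moreover have "integrable ?M (\<lambda>x. indicator (B \<inter> {0..T}) x *\<^sub>R f x) = integrable ?M (\<lambda>x. indicator B x *\<^sub>R f x)"
      by (rule Bochner_Integration.integrable_cong) (auto simp: indicator_def)
    ultimately show ?thesis by simp
  qed
  have P: "(\<integral>x. indicator B x *\<^sub>R f x \<partial>?M) = 0" if "B \<in> sets borel" for B
    using that
  proof (induction B rule: borel_set_induct)
    case empty
    then show ?case by simp
  next
    case (interval a b)
    have "(\<integral>x. indicator {a..b} x *\<^sub>R f x \<partial>?M) = integral {0..T} (\<lambda>x. indicator {a..b} x *\<^sub>R f x)"
      by (intro lebesgue_integral_eq_integral sI) auto
    also have "\<dots> = integral {0..T} (\<lambda>x. if x \<in> {a..b} then f x else 0)"
      by (intro Henstock_Kurzweil_Integration.integral_cong) auto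
    also have "\<dots> = integral ({a..b} \<inter> {0..T}) f"
      by (rule integral_restrict_Int)
    also have "{a..b} \<inter> {0..T} = {max a 0..min b T}" by auto
    also have "integral {max a 0..min b T} f = 0"
    proof (cases "max a 0 \<le> min b T")
      case True
      then have "integral {0..max a 0} f + integral {max a 0..min b T} f = integral {0..min b T} f"
        by (intro Henstock_Kurzweil_Integration.integral_combine fi) auto
      moreover have "integral {0..max a 0} f = 0" "integral {0..min b T} f = 0"
        using True by (auto intro!: z)
      ultimately show ?thesis by simp
    qed simp
    finally show ?case .
  next
    case (compl A)
    have "(\<integral>x. f x \<partial>?M) = 0"
    proof (cases "T \<ge> 0")
      case True
      have "(\<integral>x. f x \<partial>?M) = integral {0..T} f" by (intro lebesgue_integral_eq_integral f) simp
      then show ?thesis using z[of T] True by simp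
    next
      case False
      then have "{0..T} = {}" by simp
      then show ?thesis by (auto intro!: Bochner_Integration.integral_eq_zero_AE)
    qed
    moreover have "(\<integral>x. f x \<partial>?M) = (\<integral>x. indicator A x *\<^sub>R f x + indicator (- A) x *\<^sub>R f x \<partial>?M)"
      by (intro Bochner_Integration.integral_cong) (auto simp: indicator_def)
    moreover have "\<dots> = (\<integral>x. indicator A x *\<^sub>R f x \<partial>?M) + (\<integral>x. indicator (- A) x *\<^sub>R f x \<partial>?M)"
      using compl(1) by (intro Bochner_Integration.integral_add sI) auto
    ultimately show ?case using compl by simp
  next
    case (union A)
    have "set_lebesgue_integral ?M (\<Union>i. A i \<inter> {0..T}) f = (\<Sum>i. set_lebesgue_integral ?M (A i \<inter> {0..T}) f)"
    proof (rule lebesgue_integral_countable_add)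
      show "A i \<inter> {0..T} \<in> sets ?M" for i using union bs by auto
      show "i \<noteq> j \<Longrightarrow> A i \<inter> {0..T} \<inter> (A j \<inter> {0..T}) = {}" for i j
        using union(1) by (auto simp: disjoint_family_on_def)
      show "set_integrable ?M (\<Union>i. A i \<inter> {0..T}) f"
        unfolding set_integrable_def using union bs by (intro integrable_mult_indicator[OF _ f]) auto
    qed
    moreover have "set_lebesgue_integral ?M (B \<inter> {0..T}) f = (\<integral>x. indicator B x *\<^sub>R f x \<partial>?M)" for B
      unfolding set_lebesgue_integral_def by (intro Bochner_Integration.integral_cong) (auto simp: indicator_def)
    moreover have "(\<Union>i. A i \<inter> {0..T}) = (\<Union>i. A i) \<inter> {0..T}" by auto
    ultimately show ?case using union by simp
  qed
  fix A assume A: "A \<in> sets ?M"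
  then have "A \<in> sets lebesgue" by (auto simp: sets_restrict_space)
  \<comment> \<open>A Lebesgue set is an F-sigma set up to a null set, which brings it within reach
    of the Borel induction.\<close>
  then obtain C N where C: "fsigma C" "N \<in> null_sets lebesgue" "C \<union> N = A"
    by (rule lebesgue_set_almost_fsigma)
  have Cb: "C \<in> sets borel" using C(1) by (induction rule: fsigma.induct) auto
  have "AE x in lebesgue. x \<notin> N" using C(2) by (rule AE_not_in)
  then have N: "AE x in ?M. x \<notin> N" by (subst AE_restrict_space_iff) auto
  have "set_lebesgue_integral ?M A f = (\<integral>x. indicator C x *\<^sub>R f x \<partial>?M)"
    unfolding set_lebesgue_integral_def
  proof (rule integral_cong_AE)
    show "(\<lambda>x. indicat_real A x *\<^sub>R f x) \<in> borel_measurable ?M"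
      using integrable_mult_indicator[OF A f] by (rule borel_measurable_integrable)
    show "(\<lambda>x. indicat_real C x *\<^sub>R f x) \<in> borel_measurable ?M"
      using sI[OF Cb] by (rule borel_measurable_integrable)
    show "AE x in ?M. indicat_real A x *\<^sub>R f x = indicat_real C x *\<^sub>R f x"
      using N by eventually_elim (use C(3) in \<open>auto simp: indicator_def\<close>)
  qed
  then show "set_lebesgue_integral ?M A f = 0" using P[OF Cb] by simp
qed

lemma eq_ae_refl: "eq_ae T f f" by (simp add: eq_ae_def)

lemma eq_ae_sym: "eq_ae T f g \<Longrightarrow> eq_ae T g f" by (simp add: eq_ae_def eq_commute)

lemma eq_ae_trans: "eq_ae T f g \<Longrightarrow> eq_ae T g h \<Longrightarrow> eq_ae T f h"
  unfolding eq_ae_def by (erule (1) eventually_elim2) simp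

lemma eq_ae_add: "eq_ae T f g \<Longrightarrow> eq_ae T f' g' \<Longrightarrow> eq_ae T (f + f') (g + g')"
  unfolding eq_ae_def by (erule (1) eventually_elim2) simp

lemma eq_ae_fscale: "eq_ae T f g \<Longrightarrow> eq_ae T (fscale c f) (fscale c g)"
  unfolding eq_ae_def by (erule eventually_mono) simp

lemma eq_ae_integral:
  assumes "f \<in> L2 T" "g \<in> L2 T" "eq_ae T f g" "t \<in> {0..T}"
  shows "integral {0..t} f = integral {0..t} g"
proof -
  have "AE x in lebesgue. x \<in> {0..T} \<longrightarrow> f x = g x"
    using assms(3) unfolding eq_ae_def by (subst (asm) AE_restrict_space_iff) simp_all
  then have "AE x in lebesgue. x \<in> {0..t} \<longrightarrow> f x = g x"
    by eventually_elim (use assms(4) in auto)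
  then have "AE x in lebesgue_on {0..t}. f x = g x"
    by (subst AE_restrict_space_iff) simp_all
  then have "(\<integral>s. f s \<partial>lebesgue_on {0..t}) = (\<integral>s. g s \<partial>lebesgue_on {0..t})"
    using assms(4) integrable_lebesgue_on_subinterval[OF L2_integrable[OF assms(1)]]
      integrable_lebesgue_on_subinterval[OF L2_integrable[OF assms(2)]]
    by (intro integral_cong_AE) auto
  then show ?thesis using weak_integral_eq(1) assms by metis
qed

text \<open>Justifies the arbitrary choice in \<open>ddt\<close>: any two representatives agree
  almost everywhere.\<close>

lemma weak_deriv_unique:
  assumes "is_weak_deriv T z w" "is_weak_deriv T z w'"
  shows "eq_ae T w w'"
proof -
  have L: "w \<in> L2 T" "w' \<in> L2 T" using assms by (blast dest: is_weak_derivD(1))+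
  have "AE t in lebesgue_on {0..T}. (w - w') t = 0"
  proof (rule AE_zero_if_integrals_zero[OF L2_integrable[OF L2_diff[OF L]]])
    fix t assume t: "t \<in> {0..T}"
    then have "integral {0..t} w = integral {0..t} w'"
      using assms unfolding is_weak_deriv_iff by (metis add_left_cancel)
    then show "integral {0..t} (w - w') = 0"
      using Henstock_Kurzweil_Integration.integral_diff[OF weak_integral_eq(2)[OF L(1) t] weak_integral_eq(2)[OF L(2) t]]
      by (simp add: fun_diff_def)
  qed
  then show ?thesis unfolding eq_ae_def by (rule eventually_mono) simp
qed

lemma weak_deriv_ddt: "z \<in> W12 T \<Longrightarrow> is_weak_deriv T z (ddt T z)"
  unfolding ddt_def W12_def by (simp add: someI_ex)

lemma ddt_eq_ae: "z \<in> W12 T \<Longrightarrow> is_weak_deriv T z w \<Longrightarrow> eq_ae T (ddt T z) w"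
  using weak_deriv_unique weak_deriv_ddt by blast

lemma ddt_L2: "z \<in> W12 T \<Longrightarrow> ddt T z \<in> L2 T"
  using weak_deriv_ddt by (auto simp: is_weak_deriv_iff)

lemma weak_deriv_eq_ae:
  assumes "is_weak_deriv T z w" "w' \<in> L2 T" "eq_ae T w w'"
  shows "is_weak_deriv T z w'"
  unfolding is_weak_deriv_iff
proof (intro conjI ballI assms(2))
  fix t assume t: "t \<in> {0..T}"
  show "z t = z 0 + integral {0..t} w'"
    using is_weak_derivD(2)[OF assms(1) t] eq_ae_integral[OF is_weak_derivD(1)[OF assms(1)] assms(2,3) t] by simp
qed

lemma weak_deriv_add:
  assumes "is_weak_deriv T z w" "is_weak_deriv T z' w'"
  shows "is_weak_deriv T (z + z') (w + w')"
  unfolding is_weak_deriv_iff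
proof (intro conjI ballI)
  have L: "w \<in> L2 T" "w' \<in> L2 T" using assms by (blast dest: is_weak_derivD(1))+
  then show "w + w' \<in> L2 T" by (rule L2_add)
  fix t assume t: "t \<in> {0..T}"
  have "integral {0..t} (w + w') = integral {0..t} w + integral {0..t} w'"
    using Henstock_Kurzweil_Integration.integral_add[OF weak_integral_eq(2)[OF L(1) t] weak_integral_eq(2)[OF L(2) t]]
    by (simp add: plus_fun_def)
  moreover have "z t = z 0 + integral {0..t} w" "z' t = z' 0 + integral {0..t} w'"
    using assms t unfolding is_weak_deriv_iff by blast+
  ultimately show "(z + z') t = (z + z') 0 + integral {0..t} (w + w')"
    by (simp add: algebra_simps)
qed

lemma weak_deriv_fscale:
  assumes "is_weak_deriv T z w"
  shows "is_weak_deriv T (fscale c z) (fscale c w)"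
  unfolding is_weak_deriv_iff
proof (intro conjI ballI)
  have L: "w \<in> L2 T" using assms by (blast dest: is_weak_derivD(1))+
  then show "fscale c w \<in> L2 T" by (rule L2_fscale)
  fix t assume t: "t \<in> {0..T}"
  have "integral {0..t} (fscale c w) = c *s integral {0..t} w"
    using integral_linear[OF weak_integral_eq(2)[OF L t] bounded_linear_vsmult[of c]]
    by (simp add: comp_def fscale_def)
  moreover have "z t = z 0 + integral {0..t} w"
    using assms t unfolding is_weak_deriv_iff by blast
  ultimately show "fscale c z t = fscale c z 0 + integral {0..t} (fscale c w)"
    by (simp add: vector_add_ldistrib)
qed

lemma weak_deriv_continuous:
  assumes "is_weak_deriv T z w"
  shows "continuous_on {0..T} z"
proof (cases "T \<ge> 0")
  case True
  note L = is_weak_derivD(1)[OF assms] note z = is_weak_derivD(2)[OF assms]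
  have "continuous_on {0..T} (\<lambda>t. z 0 + integral {0..t} w)"
    using weak_integral_eq(2)[OF L, of T] True
    by (intro continuous_intros indefinite_integral_continuous_1) auto
  then show ?thesis by (rule continuous_on_eq) (rule z[symmetric])
qed simp

lemma weak_deriv_classical:
  fixes z :: "real \<Rightarrow> complex^'n"
  assumes "\<And>t. t \<in> {0..T} \<Longrightarrow> (z has_vector_derivative w t) (at t within {0..T})" "w \<in> L2 T"
  shows "is_weak_deriv T z w"
  unfolding is_weak_deriv_iff
proof (intro conjI ballI)
  fix t assume t: "t \<in> {0..T}"
  have "(w has_integral (z t - z 0)) {0..t}"
    by (rule fundamental_theorem_of_calculus)
      (use t in \<open>auto intro!: has_vector_derivative_within_subset[OF assms(1)]\<close>)
  then have "integral {0..t} w = z t - z 0" by (rule integral_unique)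
  then show "z t = z 0 + integral {0..t} w" by (metis add.commute diff_add_cancel)
qed fact

lemma weak_deriv_imp_derivative:
  fixes z :: "real \<Rightarrow> complex^'n"
  assumes "is_weak_deriv T z w" "continuous_on {0..T} w'" "eq_ae T w w'" "t \<in> {0..T}"
  shows "(z has_vector_derivative w' t) (at t within {0..T})"
proof -
  have "is_weak_deriv T z w'" by (rule weak_deriv_eq_ae[OF assms(1) continuous_L2[OF assms(2)] assms(3)])
  note z = is_weak_derivD(2)[OF this]
  have "((\<lambda>t. z 0 + integral {0..t} w') has_vector_derivative 0 + w' t) (at t within {0..T})"
    by (intro has_vector_derivative_add has_vector_derivative_const integral_has_vector_derivative assms)
  from has_vector_derivative_transform[OF assms(4) z this] show ?thesis
    by simp
qed

lemma bounded_bilinear_vsmult: "bounded_bilinear ((*s) :: complex \<Rightarrow> complex^'n \<Rightarrow> _)"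
proof
  show "\<exists>K. \<forall>a (b :: complex^'n). norm (a *s b) \<le> norm a * norm b * K"
    by (rule exI[of _ 1]) (simp add: norm_vector_smult)
qed (simp_all add: Finite_Cartesian_Product.vec_eq_iff algebra_simps)

definition exp_fun :: "real \<Rightarrow> complex \<Rightarrow> complex^'n \<Rightarrow> real \<Rightarrow> complex^'n" where
  "exp_fun T \<mu> x t = (if t \<in> {0..T} then exp (\<mu> * of_real t) *s x else 0)"

lemma exp_has_vector_derivative:
  fixes \<mu> :: complex
  shows "((\<lambda>t. exp (\<mu> * of_real t)) has_vector_derivative \<mu> * exp (\<mu> * of_real t)) (at t within A)"
  using exp_scaleR_has_vector_derivative_right[of \<mu> t A]
  by (simp add: scaleR_conv_of_real mult.commute[of \<mu>])

lemma exp_fun_deriv: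
  assumes "t \<in> {0..T}"
  shows "(exp_fun T \<mu> x has_vector_derivative \<mu> *s exp_fun T \<mu> x t) (at t within {0..T})"
proof -
  have "((\<lambda>t. exp (\<mu> * of_real t) *s x) has_vector_derivative
      exp (\<mu> * of_real t) *s 0 + (\<mu> * exp (\<mu> * of_real t)) *s x) (at t within {0..T})"
    by (intro bounded_bilinear.has_vector_derivative[OF bounded_bilinear_vsmult]
        exp_has_vector_derivative has_vector_derivative_const)
  then have *: "((\<lambda>t. exp (\<mu> * of_real t) *s x) has_vector_derivative \<mu> *s exp_fun T \<mu> x t) (at t within {0..T})"
    using assms by (simp add: exp_fun_def)
  show ?thesis by (rule has_vector_derivative_transform[OF assms _ *]) (simp add: exp_fun_def)
qed

lemma has_vector_derivative_imp_continuous_on: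
  "(\<And>t. t \<in> A \<Longrightarrow> (f has_vector_derivative f' t) (at t within A)) \<Longrightarrow> continuous_on A f"
  unfolding continuous_on_eq_continuous_within by (blast intro: has_vector_derivative_continuous)

lemma exp_fun_weak_deriv: "is_weak_deriv T (exp_fun T \<mu> x) (fscale \<mu> (exp_fun T \<mu> x))"
proof (rule weak_deriv_classical)
  show "fscale \<mu> (exp_fun T \<mu> x) \<in> L2 T"
    by (rule L2_fscale[OF continuous_L2[OF has_vector_derivative_imp_continuous_on[OF exp_fun_deriv]]])
qed (simp add: exp_fun_deriv)

lemma W12I: "is_weak_deriv T z w \<Longrightarrow> (\<And>t. t \<notin> {0..T} \<Longrightarrow> z t = 0) \<Longrightarrow> z \<in> W12 T"
  by (auto simp: W12_def)

lemma W12_L2: "z \<in> W12 T \<Longrightarrow> z \<in> L2 T"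
  using weak_deriv_continuous continuous_L2 weak_deriv_ddt by blast

text \<open>Eliminates the choice in \<open>ddt\<close> from the eigenvalue equation.\<close>

lemma ker_dom_iff: "z \<in> ker_ddt T S \<mu> \<longleftrightarrow> z \<in> dom_ddt T S \<and> is_weak_deriv T z (fscale \<mu> z)"
proof -
  have "eq_ae T (fscale \<mu> z - ddt T z) 0 \<longleftrightarrow> is_weak_deriv T z (fscale \<mu> z)" if z: "z \<in> W12 T"
  proof
    assume "eq_ae T (fscale \<mu> z - ddt T z) 0"
    then have "eq_ae T (ddt T z) (fscale \<mu> z)"
      unfolding eq_ae_def by (rule eventually_mono) simp
    then show "is_weak_deriv T z (fscale \<mu> z)"
      by (rule weak_deriv_eq_ae[OF weak_deriv_ddt[OF z] L2_fscale[OF W12_L2[OF z]]])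
  next
    assume "is_weak_deriv T z (fscale \<mu> z)"
    from ddt_eq_ae[OF z this] show "eq_ae T (fscale \<mu> z - ddt T z) 0"
      unfolding eq_ae_def by (rule eventually_mono) simp
  qed
  then show ?thesis by (auto simp: ker_ddt_def dom_ddt_def)
qed

lemma dom_ddt_W12: "z \<in> dom_ddt T S \<Longrightarrow> z \<in> W12 T" by (simp add: dom_ddt_def)

lemma dom_ddt_outside: "z \<in> dom_ddt T S \<Longrightarrow> t \<notin> {0..T} \<Longrightarrow> z t = 0"
  by (auto simp: dom_ddt_def W12_def)

lemma dom_ddtI:
  "is_weak_deriv T z w \<Longrightarrow> (\<And>t. t \<notin> {0..T} \<Longrightarrow> z t = 0) \<Longrightarrow> z 0 = cmatrix S *v z T \<Longrightarrow> z \<in> dom_ddt T S"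
  unfolding dom_ddt_def by (auto intro: W12I)

lemma dom_ddt_add:
  assumes "z \<in> dom_ddt T S" "z' \<in> dom_ddt T S"
  shows "z + z' \<in> dom_ddt T S"
proof (rule dom_ddtI)
  show "is_weak_deriv T (z + z') (ddt T z + ddt T z')"
    by (intro weak_deriv_add weak_deriv_ddt dom_ddt_W12[OF assms(1)] dom_ddt_W12[OF assms(2)])
qed (use assms dom_ddt_outside in \<open>auto simp: dom_ddt_def W12_def matrix_vector_right_distrib\<close>)

lemma dom_ddt_fscale:
  assumes "z \<in> dom_ddt T S"
  shows "fscale c z \<in> dom_ddt T S"
proof (rule dom_ddtI)
  show "is_weak_deriv T (fscale c z) (fscale c (ddt T z))"
    by (intro weak_deriv_fscale weak_deriv_ddt dom_ddt_W12[OF assms(1)])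
qed (use assms in \<open>auto simp: dom_ddt_def W12_def vector_scalar_commute\<close>)

lemma minus_eq_fscale: "z - z' = z + fscale (- 1) z'"
  by (simp add: fun_eq_iff Finite_Cartesian_Product.vec_eq_iff)

lemma dom_ddt_diff: "z \<in> dom_ddt T S \<Longrightarrow> z' \<in> dom_ddt T S \<Longrightarrow> z - z' \<in> dom_ddt T S"
  unfolding minus_eq_fscale by (intro dom_ddt_add dom_ddt_fscale)

lemma weak_deriv_diff:
  "is_weak_deriv T z w \<Longrightarrow> is_weak_deriv T z' w' \<Longrightarrow> is_weak_deriv T (z - z') (w - w')"
  unfolding minus_eq_fscale by (intro weak_deriv_add weak_deriv_fscale)

lemma exp_fun_ker_iff:
  assumes "T > 0"
  shows "exp_fun T \<mu> x \<in> ker_ddt T S \<mu> \<longleftrightarrow> x = exp (\<mu> * of_real T) *s (cmatrix S *v x)"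
proof -
  have "is_weak_deriv T (exp_fun T \<mu> x) (fscale \<mu> (exp_fun T \<mu> x))" by (rule exp_fun_weak_deriv)
  then have "exp_fun T \<mu> x \<in> W12 T" by (rule W12I) (auto simp: exp_fun_def)
  then show ?thesis
    using assms exp_fun_weak_deriv[of T \<mu> x]
    by (simp add: ker_dom_iff dom_ddt_def exp_fun_def vector_scalar_commute)
qed

text \<open>Regularity: z is continuous, hence so is its weak derivative \<mu> z, so z is
  differentiable in the classical sense and exp(-\<mu> t) z is constant.\<close>

lemma ker_ddt_exp_fun:
  assumes T: "T > 0" and z: "z \<in> ker_ddt T S \<mu>"
  shows "z = exp_fun T \<mu> (z 0)"
proof -
  have w: "is_weak_deriv T z (fscale \<mu> z)" and z0: "\<And>t. t \<notin> {0..T} \<Longrightarrow> z t = 0"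
    using z dom_ddt_outside by (auto simp: ker_dom_iff)
  note zc = weak_deriv_continuous[OF w]
  have fc: "continuous_on {0..T} (fscale \<mu> z)"
    unfolding fscale_def by (intro bounded_bilinear.continuous_on[OF bounded_bilinear_vsmult] continuous_intros zc)
  have "((\<lambda>t. exp ((- \<mu>) * of_real t) *s z t) has_vector_derivative 0) (at t within {0..T})" if t: "t \<in> {0..T}" for t
  proof -
    have "((\<lambda>t. exp ((- \<mu>) * of_real t) *s z t) has_vector_derivative
        exp ((- \<mu>) * of_real t) *s fscale \<mu> z t + ((- \<mu>) * exp ((- \<mu>) * of_real t)) *s z t) (at t within {0..T})"
      by (intro bounded_bilinear.has_vector_derivative[OF bounded_bilinear_vsmult]
          exp_has_vector_derivative weak_deriv_imp_derivative[OF w fc eq_ae_refl t])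
    moreover have "exp ((- \<mu>) * of_real t) *s fscale \<mu> z t + ((- \<mu>) * exp ((- \<mu>) * of_real t)) *s z t = 0"
      by (simp add: Finite_Cartesian_Product.vec_eq_iff)
    ultimately show ?thesis by (simp only:)
  qed
  from has_vector_derivative_zero_constant[OF convex_real_interval(5) this] obtain c where
    c: "\<And>t. t \<in> {0..T} \<Longrightarrow> exp ((- \<mu>) * of_real t) *s z t = c" by blast
  have "c = z 0" using c[of 0] T by simp
  have "z t = exp_fun T \<mu> (z 0) t" for t
  proof (cases "t \<in> {0..T}")
    case True
    have "z t = exp (\<mu> * of_real t) *s (exp ((- \<mu>) * of_real t) *s z t)"
      by (simp add: vector_smult_assoc flip: exp_add)
    then show ?thesis unfolding c[OF True] using True \<open>c = z 0\<close> by (simp only: exp_fun_def if_True)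
  next
    case False
    then show ?thesis by (simp only: exp_fun_def z0[OF False] if_False)
  qed
  then show ?thesis by (rule ext)
qed

section \<open>Spectral subspaces of the boundary value problem\<close>

locale boundary_value = spectral v T \<theta> "cmatrix S"
  for v :: "'n::finite \<Rightarrow> complex^'n" and T \<theta> and S :: "real^'n^'n"
begin

lemma e_exp_fun: "e a = exp_fun T (\<i> * of_real (om a)) ((1 / of_real (sqrt T)) *s v (fst a))"
  by (auto simp: e_def exp_fun_def cis_conv_exp fun_eq_iff vector_smult_assoc mult_ac)

lemma e_ker: "e a \<in> ker_ddt T S (\<i> * of_real (om a))"
  unfolding e_exp_fun exp_fun_ker_iff[OF T_pos]
proof -
  have "exp (\<i> * of_real (om a) * of_real T) = cis (- \<theta> (fst a))"
    using om_T[of a] by (simp add: cis_conv_exp mult_ac)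
  then show "(1 / of_real (sqrt T)) *s v (fst a) =
    exp (\<i> * of_real (om a) * of_real T) *s (cmatrix S *v ((1 / of_real (sqrt T)) *s v (fst a)))"
    by (simp add: vector_scalar_commute Sc_v vector_smult_assoc mult_ac cis_mult)
qed

text \<open>Expand the initial value in the eigenbasis. A nonzero component along \<open>v j\<close>
  forces exp(\<mu> T) cis \<theta> = 1, which makes \<mu> one of the values i
  \<open>om (j, k)\<close>.\<close>

lemma ker_ddt_subset: "ker_ddt T S \<mu> \<subseteq> L.span (e ` {a. \<i> * of_real (om a) = \<mu>})"
proof
  fix z assume z: "z \<in> ker_ddt T S \<mu>"
  define x where "x = z 0"
  have zx: "z = exp_fun T \<mu> x" unfolding x_def by (rule ker_ddt_exp_fun[OF T_pos z])
  then have x: "x = exp (\<mu> * of_real T) *s (cmatrix S *v x)"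
    using z exp_fun_ker_iff[OF T_pos] by metis
  have k: "\<exists>k. \<i> * of_real (om (j, k)) = \<mu>" if j: "cip x (v j) \<noteq> 0" for j
  proof -
    have "cip x (v j) = exp (\<mu> * of_real T) * (cis (\<theta> j) * cip x (v j))"
      by (subst x) (simp add: cip_simps cip_Sc)
    then have "exp (\<mu> * of_real T) * cis (\<theta> j) = 1" using j by (simp add: mult.assoc[symmetric])
    then have "exp (\<mu> * of_real T + \<i> * of_real (\<theta> j)) = 1" by (simp add: exp_add cis_conv_exp)
    then obtain m :: int where m: "Re (\<mu> * of_real T + \<i> * of_real (\<theta> j)) = 0"
      "Im (\<mu> * of_real T + \<i> * of_real (\<theta> j)) = of_int (2 * m) * pi"
      unfolding exp_eq_1 by auto
    have "Re \<mu> = 0" using m(1) T_pos by simp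
    moreover have "Im \<mu> = om (j, m)" using m(2) T_pos by (simp add: om_def field_simps)
    ultimately have "\<i> * of_real (om (j, m)) = \<mu>" by (simp add: complex_eq_iff)
    then show ?thesis ..
  qed
  define kk where "kk j = (SOME k. \<i> * of_real (om (j, k)) = \<mu>)" for j
  have kk: "\<i> * of_real (om (j, kk j)) = \<mu>" if "cip x (v j) \<noteq> 0" for j
    unfolding kk_def by (rule someI_ex[OF k[OF that]])
  define J where "J = {j. cip x (v j) \<noteq> 0}"
  have "z t = (\<Sum>j\<in>J. fscale (cip x (v j) * of_real (sqrt T)) (e (j, kk j))) t" for t
  proof (cases "t \<in> {0..T}")
    case True
    have "z t = exp (\<mu> * of_real t) *s (\<Sum>j\<in>UNIV. cip x (v j) *s v j)"
      unfolding zx using True by (simp add: exp_fun_def flip: v_expand)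
    also have "\<dots> = (\<Sum>j\<in>UNIV. (exp (\<mu> * of_real t) * cip x (v j)) *s v j)"
      by (simp add: bounded_bilinear.sum_right[OF bounded_bilinear_vsmult] vector_smult_assoc)
    also have "\<dots> = (\<Sum>j\<in>J. (exp (\<mu> * of_real t) * cip x (v j)) *s v j)"
      by (rule sum.mono_neutral_right) (auto simp: J_def)
    also have "\<dots> = (\<Sum>j\<in>J. (cip x (v j) * of_real (sqrt T)) *s e (j, kk j) t)"
    proof (rule sum.cong[OF refl])
      fix j assume "j \<in> J"
      then have *: "\<i> * of_real (om (j, kk j)) = \<mu>" by (simp add: J_def kk)
      then show "(exp (\<mu> * of_real t) * cip x (v j)) *s v j = (cip x (v j) * of_real (sqrt T)) *s e (j, kk j) t"
        unfolding e_exp_fun * using True T_pos by (simp add: exp_fun_def vector_smult_assoc)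
    qed
    finally show ?thesis by (simp add: sum_fun_apply)
  next
    case False
    then show ?thesis by (simp only: zx exp_fun_def sum_fun_apply e_outside[OF False] fscale_apply if_False) simp
  qed
  then have "z = (\<Sum>j\<in>J. fscale (cip x (v j) * of_real (sqrt T)) (e (j, kk j)))" by (rule ext)
  then show "z \<in> L.span (e ` {a. \<i> * of_real (om a) = \<mu>})"
    by (simp only:) (auto simp: J_def kk intro!: L.span_sum L.span_scale L.span_base[OF imageI])
qed

lemma e_nz: "e a \<noteq> 0" using L2_inner_e[of a a] L.ip_zero_left[of "e a"] by auto

lemma zero_ker: "0 \<in> ker_ddt T S \<mu>"
proof -
  have "exp_fun T \<mu> 0 \<in> ker_ddt T S \<mu>" by (simp add: exp_fun_ker_iff[OF T_pos] del: exp_of_real)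
  moreover have "exp_fun T \<mu> 0 = (0 :: real \<Rightarrow> complex^'n)" by (simp add: fun_eq_iff exp_fun_def)
  ultimately show ?thesis by simp
qed

lemma om_spectrum: "\<i> * of_real (om a) \<in> spectrum_ddt T S"
proof -
  have "\<not> (\<exists>!z. z \<in> dom_ddt T S \<and> eq_ae T (fscale (\<i> * of_real (om a)) z - ddt T z) 0)"
    using e_ker[of a] zero_ker[of "\<i> * of_real (om a)"] e_nz[of a] unfolding ker_ddt_def by blast
  then show ?thesis unfolding spectrum_ddt_def resolvent_ddt_def using L2_zero by blast
qed

text \<open>The spectrum itself need not be computed: points without eigenfunctions contribute only
  0, so it is enough that the eigenvalues belong to the spectrum.\<close>

lemma V_space_eq: "V_space T S N = VV N"
proof
  show "V_space T S N \<subseteq> VV N"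
    unfolding V_space_def
  proof (rule L.span_minimal[OF _ VV_subspace], rule UN_least)
    fix \<mu> assume "\<mu> \<in> {\<mu> \<in> spectrum_ddt T S. cmod \<mu> \<le> N}"
    then have "e ` {a. \<i> * of_real (om a) = \<mu>} \<subseteq> e ` idx N" by (auto simp: idx_def norm_mult)
    then show "ker_ddt T S \<mu> \<subseteq> VV N"
      using ker_ddt_subset[of \<mu>] L.span_mono unfolding VV_def by blast
  qed
  show "VV N \<subseteq> V_space T S N"
    unfolding V_space_def VV_def
  proof (rule L.span_mono, rule image_subsetI)
    fix a assume "a \<in> idx N"
    then have "cmod (\<i> * of_real (om a)) \<le> N" by (simp add: idx_def norm_mult)
    then show "e a \<in> (\<Union>\<mu>\<in>{\<mu> \<in> spectrum_ddt T S. cmod \<mu> \<le> N}. ker_ddt T S \<mu>)"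
      using e_ker om_spectrum by blast
  qed
qed

lemma ker_0_eq: "ker_ddt T S 0 = VV 0"
proof
  have "{a. \<i> * of_real (om a) = (0::complex)} = idx 0" by (auto simp: idx_def)
  then show "ker_ddt T S 0 \<subseteq> VV 0" using ker_ddt_subset[of 0] by (simp add: VV_def)
  have "L.subspace (ker_ddt T S 0)"
  proof (rule L.subspaceI[OF zero_ker])
    fix x y assume "x \<in> ker_ddt T S 0" "y \<in> ker_ddt T S 0"
    then show "x + y \<in> ker_ddt T S 0"
      using weak_deriv_add[of T x "fscale 0 x" y "fscale 0 y"] dom_ddt_add[of x T S y] by (simp add: ker_dom_iff)
  next
    fix c x assume "x \<in> ker_ddt T S 0"
    then show "fscale c x \<in> ker_ddt T S 0"
      using weak_deriv_fscale[of T x "fscale 0 x" c] dom_ddt_fscale[of x T S c] by (simp add: ker_dom_iff)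
  qed
  then show "VV 0 \<subseteq> ker_ddt T S 0"
    unfolding VV_def using e_ker by (intro L.span_minimal) (auto simp: idx_def, metis mult_zero_right of_real_0)
qed

lemma PP_orth: "f \<in> L2 T \<Longrightarrow> u \<in> VV N \<Longrightarrow> L2_inner T (f - PP N f) u = 0"
proof -
  assume f: "f \<in> L2 T" and "u \<in> VV N"
  then obtain c where u: "u = (\<Sum>a\<in>idx N. fscale (c a) (e a))" using VV_E by blast
  have "L2_inner T (f - PP N f) (e a) = 0" if "a \<in> idx N" for a
    using that f by (simp add: L.ip_diff_left PP_in_L2 PP_ip)
  moreover have "L2_inner T (f - PP N f) u = (\<Sum>a\<in>idx N. cnj (c a) * L2_inner T (f - PP N f) (e a))"
    unfolding u by (rule L.ip_sum_right[OF finite_idx]) (auto intro!: L2_diff f PP_in_L2)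
  ultimately show ?thesis by simp
qed

lemma orth_proj_eq: "f \<in> L2 T \<Longrightarrow> orth_proj T (VV N) f = PP N f"
  unfolding orth_proj_def
proof (rule the_equality)
  assume f: "f \<in> L2 T"
  then show "PP N f \<in> VV N \<and> (\<forall>u\<in>VV N. L2_inner T (f - PP N f) u = 0)"
    using PP_in_VV PP_orth by blast
  fix p assume p: "p \<in> VV N \<and> (\<forall>u\<in>VV N. L2_inner T (f - p) u = 0)"
  then have pL: "p \<in> L2 T" using VV_L2 by blast
  have "L2_inner T p (e a) = L2_inner T f (e a)" if "a \<in> idx N" for a
  proof -
    have "e a \<in> VV N" using that unfolding VV_def by (intro L.span_base) auto
    then show ?thesis using p f pL by (auto simp: L.ip_diff_left)
  qed
  then have "PP N p = PP N f" unfolding PP_def by simp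
  then show "p = PP N f" using PP_VV p by simp
qed

lemma P_hat_eq: "f \<in> L2 T \<Longrightarrow> P_hat T S N f = PP N f"
  by (simp add: P_hat_def V_space_eq orth_proj_eq)

lemma P0_hat_eq: "f \<in> L2 T \<Longrightarrow> P0_hat T S f = PP 0 f"
  by (simp add: P0_hat_def ker_0_eq orth_proj_eq)

text \<open>The coefficients are integrals, so projections of functions equal almost everywhere are
  literally equal. Identities modulo null sets thus become identities of functions.\<close>

lemma PP_cong: "f \<in> L2 T \<Longrightarrow> g \<in> L2 T \<Longrightarrow> eq_ae T f g \<Longrightarrow> PP N f = PP N g"
  unfolding PP_def by (simp add: eq_ae_L2_inner[of f T g])

end

section \<open>The inverse of the derivative plus projection\<close>

context spectral
begin

lemma nrm2_integral: "L.nrm2 f = (\<integral>t. (norm (f t))\<^sup>2 \<partial>lebesgue_on {0..T})"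
  by (simp add: L2_inner_self)

lemma nrm2_mono:
  assumes "f \<in> L2 T" "g \<in> L2 T" "\<And>t. t \<in> {0..T} \<Longrightarrow> (norm (f t))\<^sup>2 \<le> C * (norm (g t))\<^sup>2"
  shows "L.nrm2 f \<le> C * L.nrm2 g"
proof -
  have "(\<integral>t. (norm (f t))\<^sup>2 \<partial>lebesgue_on {0..T}) \<le> (\<integral>t. C * (norm (g t))\<^sup>2 \<partial>lebesgue_on {0..T})"
    using assms by (intro integral_mono) (auto intro: L2D)
  then show ?thesis unfolding nrm2_integral by simp
qed

lemma nrm2_cong:
  assumes "f \<in> L2 T" "g \<in> L2 T" "eq_ae T f g"
  shows "L.nrm2 f = L.nrm2 g"
proof -
  have "AE t in lebesgue_on {0..T}. (norm (f t))\<^sup>2 = (norm (g t))\<^sup>2"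
    using assms(3) unfolding eq_ae_def by (rule eventually_mono) simp
  then show ?thesis
    unfolding nrm2_integral using L2D(2)[OF assms(1)] L2D(2)[OF assms(2)]
    by (intro integral_cong_AE) auto
qed

lemma nrm2_fscale: "f \<in> L2 T \<Longrightarrow> L.nrm2 (fscale c f) = (cmod c)\<^sup>2 * L.nrm2 f"
  unfolding nrm2_integral by (simp add: norm_vector_smult power_mult_distrib)

lemma L2_norm_nrm2: "L2_norm T f = sqrt (L.nrm2 f)"
  by (simp add: L2_norm_def nrm2_integral)

text \<open>Represents the value at t of the primitive, in the direction x, as an inner product;
  compare \<open>cip_prim\<close>.\<close>

definition chi_fun :: "complex^'n \<Rightarrow> real \<Rightarrow> real \<Rightarrow> complex^'n" where
  "chi_fun x t s = (if s \<in> {0..t} then x else 0)"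

lemma chi_fun_L2: "chi_fun x t \<in> L2 T"
proof (rule L2_bounded_measurable)
  have "{0..t} \<inter> {0..T} \<in> sets (lebesgue_on {0..T})" by (subst sets_restrict_space_iff) auto
  then show "chi_fun x t \<in> borel_measurable (lebesgue_on {0..T})"
    unfolding chi_fun_def by (intro measurable_If_set) (simp_all add: Int_commute)
  show "norm (chi_fun x t s) \<le> norm x" for s by (simp add: chi_fun_def)
qed

lemma chi_fun_nrm2: "L.nrm2 (chi_fun x t) \<le> T * (norm x)\<^sup>2"
proof -
  have "(\<integral>s. (norm (chi_fun x t s))\<^sup>2 \<partial>lebesgue_on {0..T}) \<le> T * (norm x)\<^sup>2"
    using L2D(2)[OF chi_fun_L2[of x t]]
    by (intro L2_set_integral_const[OF T_pos]) (auto simp: chi_fun_def)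
  then show ?thesis by (simp add: nrm2_integral)
qed

definition prim :: "(real \<Rightarrow> complex^'n) \<Rightarrow> real \<Rightarrow> complex^'n" where
  "prim f t = integral {0..t} f"

lemma cip_prim:
  assumes f: "f \<in> L2 T" and t: "t \<in> {0..T}"
  shows "cip (prim f t) x = L2_inner T f (chi_fun x t)"
proof -
  have bl: "bounded_linear (\<lambda>y. cip y x)" by (rule bounded_bilinear.bounded_linear_left[OF bounded_bilinear_cip])
  note fi = weak_integral_eq(2)[OF f t]
  have "L2_inner T f (chi_fun x t) = integral {0..T} (\<lambda>s. cip (f s) (chi_fun x t s))"
    unfolding L2_inner_cip
    by (intro lebesgue_integral_eq_integral L2_cip_integrable f chi_fun_L2) simp
  also have "\<dots> = integral {0..T} (\<lambda>s. if s \<in> {0..t} then cip (f s) x else 0)"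
    by (intro Henstock_Kurzweil_Integration.integral_cong) (simp add: chi_fun_def cip_simps)
  also have "\<dots> = integral {0..t} (\<lambda>s. cip (f s) x)"
    using integrable_linear[OF fi bl] by (intro integral_restrict_interval t) (simp add: comp_def)
  also have "\<dots> = cip (prim f t) x"
    using integral_linear[OF fi bl] by (simp add: prim_def comp_def)
  finally show ?thesis ..
qed

text \<open>Bessel's inequality at a fixed time, uniformly over orthonormal families. Integrated
  over t it says that integration is Hilbert-Schmidt.\<close>

lemma prim_bessel:
  assumes I: "finite I" and g: "L.orthonormal I g" and t: "t \<in> {0..T}"
  shows "(\<Sum>i\<in>I. (norm (prim (g i) t))\<^sup>2) \<le> real CARD('n) * T"
proof -
  have gL: "g i \<in> L2 T" if "i \<in> I" for i using g that by (auto simp: L.orthonormal_def)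
  have "(\<Sum>i\<in>I. (norm (prim (g i) t))\<^sup>2) = (\<Sum>i\<in>I. \<Sum>j\<in>UNIV. (cmod (L2_inner T (chi_fun (v j) t) (g i)))\<^sup>2)"
  proof (intro sum.cong refl)
    fix i assume i: "i \<in> I"
    have "cmod (cip (prim (g i) t) (v j)) = cmod (L2_inner T (chi_fun (v j) t) (g i))" for j
      unfolding cip_prim[OF gL[OF i] t] by (subst L.ip_cnj[OF chi_fun_L2 gL[OF i]]) simp
    then show "(norm (prim (g i) t))\<^sup>2 = (\<Sum>j\<in>UNIV. (cmod (L2_inner T (chi_fun (v j) t) (g i)))\<^sup>2)"
      by (simp add: norm_expand)
  qed
  also have "\<dots> = (\<Sum>j\<in>UNIV. \<Sum>i\<in>I. (cmod (L2_inner T (chi_fun (v j) t) (g i)))\<^sup>2)"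
    by (rule sum.swap)
  also have "\<dots> \<le> (\<Sum>j\<in>(UNIV::'n set). T)"
  proof (rule sum_mono)
    fix j
    have "(\<Sum>i\<in>I. (cmod (L2_inner T (chi_fun (v j) t) (g i)))\<^sup>2) \<le> L.nrm2 (chi_fun (v j) t)"
      by (rule L.bessel[OF I g chi_fun_L2])
    also have "\<dots> \<le> T" using chi_fun_nrm2[of "v j" t] by (simp add: norm_v)
    finally show "(\<Sum>i\<in>I. (cmod (L2_inner T (chi_fun (v j) t) (g i)))\<^sup>2) \<le> T" .
  qed
  finally show ?thesis by simp
qed

lemma prim_add: "f \<in> L2 T \<Longrightarrow> g \<in> L2 T \<Longrightarrow> t \<in> {0..T} \<Longrightarrow> prim (f + g) t = prim f t + prim g t"
  using Henstock_Kurzweil_Integration.integral_add[OF weak_integral_eq(2)[of f T t] weak_integral_eq(2)[of g T t]]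
  by (simp add: prim_def plus_fun_def)

lemma prim_fscale: "f \<in> L2 T \<Longrightarrow> t \<in> {0..T} \<Longrightarrow> prim (fscale c f) t = c *s prim f t"
  using integral_linear[OF weak_integral_eq(2) bounded_linear_vsmult[of c]]
  by (simp add: prim_def comp_def fscale_def)

lemma cis_theta_1: "cis (\<theta> j) = 1 \<longleftrightarrow> \<theta> j = 0"
proof
  assume "cis (\<theta> j) = 1"
  then have "cos (\<theta> j) = 1" by (simp add: complex_eq_iff)
  then obtain k :: int where k: "\<theta> j = of_int k * 2 * pi" using cos_one_2pi_int by auto
  have "k = 0"
  proof (rule ccontr)
    assume "k \<noteq> 0"
    then have "1 \<le> \<bar>real_of_int k\<bar>" by simp
    then have "2 * pi \<le> \<bar>\<theta> j\<bar>" using k by (simp add: abs_mult)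
    then show False using theta_bound[of j] pi_gt_zero by auto
  qed
  then show "\<theta> j = 0" using k by simp
qed simp

text \<open>S (1 - S)^(-1) on the orthogonal complement of the kernel of S - 1, and 0 on that
  kernel: the initial value for which a primitive satisfies the boundary condition there.\<close>

definition Rc :: "complex^'n \<Rightarrow> complex^'n" where
  "Rc x = (\<Sum>j\<in>UNIV. ((if \<theta> j = 0 then 0 else cis (\<theta> j) / (1 - cis (\<theta> j))) * cip x (v j)) *s v j)"

lemma cip_Rc: "cip (Rc x) (v j) = (if \<theta> j = 0 then 0 else cis (\<theta> j) / (1 - cis (\<theta> j))) * cip x (v j)"
  unfolding Rc_def by (rule cip_v_sum)

lemma Rc_add: "Rc (x + y) = Rc x + Rc y"
  by (rule v_eqI) (simp add: cip_Rc cip_simps distrib_left)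

lemma Rc_scale: "Rc (c *s x) = c *s Rc x"
  by (rule v_eqI) (simp add: cip_Rc cip_simps)

lemma Rc_bound: "\<exists>C\<ge>0. \<forall>x. (norm (Rc x))\<^sup>2 \<le> C * (norm x)\<^sup>2"
proof -
  define r where "r j = (if \<theta> j = 0 then 0 else cis (\<theta> j) / (1 - cis (\<theta> j)))" for j
  have "(norm (Rc x))\<^sup>2 \<le> (\<Sum>j\<in>UNIV. (cmod (r j))\<^sup>2) * (norm x)\<^sup>2" for x
  proof -
    have "(cmod (cip x (v j)))\<^sup>2 \<le> (norm x)\<^sup>2" for j
      unfolding norm_expand[of x] by (rule member_le_sum) auto
    then have "(norm (Rc x))\<^sup>2 \<le> (\<Sum>j\<in>UNIV. (cmod (r j))\<^sup>2 * (norm x)\<^sup>2)"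
      unfolding norm_expand[of "Rc x"] cip_Rc r_def[symmetric] norm_mult power_mult_distrib
      by (intro sum_mono mult_left_mono) auto
    then show ?thesis by (simp add: sum_distrib_right)
  qed
  then show ?thesis by (intro exI[of _ "\<Sum>j\<in>UNIV. (cmod (r j))\<^sup>2"]) (auto intro: sum_nonneg)
qed

end

section \<open>Explicit inverse of the derivative plus projection\<close>

context boundary_value
begin

lemma VV0_ker: "u \<in> VV 0 \<Longrightarrow> u \<in> dom_ddt T S" "u \<in> VV 0 \<Longrightarrow> is_weak_deriv T u 0"
proof -
  assume "u \<in> VV 0"
  then have "u \<in> ker_ddt T S 0" by (simp add: ker_0_eq)
  moreover have "fscale 0 u = 0" by (simp add: fun_eq_iff)
  ultimately show "u \<in> dom_ddt T S" "is_weak_deriv T u 0" by (simp_all add: ker_dom_iff)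
qed

lemma VV0_const: "u \<in> VV 0 \<Longrightarrow> t \<in> {0..T} \<Longrightarrow> u t = u 0"
  using is_weak_derivD(2)[OF VV0_ker(2), of u t] by (simp add: zero_fun_def)

lemma VV0_coord:
  assumes "u \<in> VV 0" "\<theta> j \<noteq> 0"
  shows "cip (u 0) (v j) = 0"
proof -
  have "u 0 = cmatrix S *v u 0"
    using VV0_ker(1)[OF assms(1)] VV0_const[OF assms(1), of T] T_pos by (simp add: dom_ddt_def)
  then have "cip (u 0) (v j) = cis (\<theta> j) * cip (u 0) (v j)" by (metis cip_Sc)
  then show ?thesis using cis_theta_1[of j] assms(2) by auto
qed

lemma VV0_prim:
  assumes u: "u \<in> VV 0" and t: "t \<in> {0..T}"
  shows "prim u t = of_real t *s u 0"
proof -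
  have "u s = u 0" if "s \<in> {0..t}" for s by (rule VV0_const[OF u]) (use that t in auto)
  then have "prim u t = integral {0..t} (\<lambda>_. u 0)"
    unfolding prim_def by (rule Henstock_Kurzweil_Integration.integral_cong)
  then show ?thesis
    using t by (simp add: Finite_Cartesian_Product.vec_eq_iff scaleR_conv_of_real[where 'a=complex])
qed

lemma inner_e0:
  assumes f: "f \<in> L2 T" and j: "\<theta> j = 0"
  shows "L2_inner T f (e (j, 0)) = cip (prim f T) (v j) / of_real (sqrt T)"
proof -
  have "e (j, 0) = fscale (1 / of_real (sqrt T)) (chi_fun (v j) T)"
    using j by (auto simp: fun_eq_iff e_def chi_fun_def om_def)
  then have "L2_inner T f (e (j, 0)) = cnj (1 / of_real (sqrt T)) * L2_inner T f (chi_fun (v j) T)"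
    by (simp only: L.ip_scale_right[OF f chi_fun_L2])
  then show ?thesis using T_pos f by (simp add: cip_prim)
qed

text \<open>The projection to the constants in the kernel is the mean value over [0,T], projected to
  the kernel of S - 1.\<close>

lemma PP0_coord:
  assumes f: "f \<in> L2 T"
  shows "of_real T * cip (PP 0 f 0) (v j) = (if \<theta> j = 0 then cip (prim f T) (v j) else 0)"
proof (cases "\<theta> j = 0")
  case True
  then have "(j, 0) \<in> idx 0" by (simp add: idx_def om_def)
  from PP_ip[OF this, of f]
  have "cip (prim (PP 0 f) T) (v j) = cip (prim f T) (v j)"
    using T_pos by (simp add: inner_e0[OF _ True] f PP_in_L2)
  then show ?thesis using True T_pos by (simp add: VV0_prim[OF PP_in_VV] cip_simps)
qed (simp add: VV0_coord[OF PP_in_VV])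

text \<open>A solution of z' = f - P_0 f in the domain. Along angle 0 removing the mean makes the
  primitive periodic; along the other eigenlines \<open>Rc\<close> adjusts the initial
  value.\<close>

definition hh :: "(real \<Rightarrow> complex^'n) \<Rightarrow> real \<Rightarrow> complex^'n" where
  "hh f t = (if t \<in> {0..T} then prim f t - of_real t *s PP 0 f 0 + Rc (prim f T) else 0)"

text \<open>Replaces the kernel component of \<open>hh f\<close> by that of f. The derivative is
  unchanged, and adding the projection of \<open>KK f\<close> restores the part P_0 f that was
  removed.\<close>

definition KK :: "(real \<Rightarrow> complex^'n) \<Rightarrow> real \<Rightarrow> complex^'n" where
  "KK f = PP 0 f + (hh f - PP 0 (hh f))"

lemma hh_weak_deriv:
  assumes f: "f \<in> L2 T"
  shows "is_weak_deriv T (hh f) (f - PP 0 f)"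
  unfolding is_weak_deriv_iff
proof (intro conjI ballI)
  show "f - PP 0 f \<in> L2 T" by (intro L2_diff f PP_in_L2)
  fix t assume t: "t \<in> {0..T}"
  have "f - PP 0 f = f + fscale (- 1) (PP 0 f)" by (rule minus_eq_fscale)
  then have "prim (f - PP 0 f) t = prim f t + prim (fscale (- 1) (PP 0 f)) t"
    by (simp only: prim_add[OF f L2_fscale[OF PP_in_L2] t])
  also have "prim (fscale (- 1) (PP 0 f)) t = - 1 *s (of_real t *s PP 0 f 0)"
    by (simp only: prim_fscale[OF PP_in_L2 t] VV0_prim[OF PP_in_VV t])
  finally have 1: "integral {0..t} (f - PP 0 f) = prim f t - of_real t *s PP 0 f 0"
    unfolding prim_def by (simp add: Finite_Cartesian_Product.vec_eq_iff)
  have "prim f 0 = 0" by (simp add: prim_def)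
  then show "hh f t = hh f 0 + integral {0..t} (f - PP 0 f)"
    using t T_pos unfolding 1 by (simp add: hh_def)
qed

lemma hh_dom:
  assumes f: "f \<in> L2 T"
  shows "hh f \<in> dom_ddt T S"
proof (rule dom_ddtI[OF hh_weak_deriv[OF f]])
  show "hh f 0 = cmatrix S *v hh f T"
  proof (rule v_eqI)
    fix j
    have "prim f 0 = 0" by (simp add: prim_def)
    then have 0: "cip (hh f 0) (v j) = cip (Rc (prim f T)) (v j)" using T_pos by (simp add: hh_def)
    have 1: "cip (cmatrix S *v hh f T) (v j) =
        cis (\<theta> j) * (cip (prim f T) (v j) - of_real T * cip (PP 0 f 0) (v j) + cip (Rc (prim f T)) (v j))"
      unfolding cip_Sc using T_pos by (simp add: hh_def cip_simps)
    show "cip (hh f 0) (v j) = cip (cmatrix S *v hh f T) (v j)"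
      unfolding 0 1 PP0_coord[OF f] cip_Rc
      using cis_theta_1[of j] by (auto simp: field_simps)
  qed
qed (auto simp: hh_def)

lemma hh_L2: "f \<in> L2 T \<Longrightarrow> hh f \<in> L2 T"
  by (rule W12_L2[OF dom_ddt_W12[OF hh_dom]])

lemma KK_dom: "f \<in> L2 T \<Longrightarrow> KK f \<in> dom_ddt T S"
  unfolding KK_def by (intro dom_ddt_add dom_ddt_diff hh_dom VV0_ker(1) PP_in_VV)

lemma KK_L2: "f \<in> L2 T \<Longrightarrow> KK f \<in> L2 T"
  by (rule W12_L2[OF dom_ddt_W12[OF KK_dom]])

lemma KK_weak_deriv: "f \<in> L2 T \<Longrightarrow> is_weak_deriv T (KK f) (f - PP 0 f)"
proof -
  assume f: "f \<in> L2 T"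
  have "is_weak_deriv T (KK f) (0 + ((f - PP 0 f) - 0))"
    unfolding KK_def by (intro weak_deriv_add weak_deriv_diff VV0_ker(2) PP_in_VV hh_weak_deriv f)
  then show ?thesis by simp
qed

lemma PP_PP: "PP N (PP N f) = PP N f" by (rule PP_VV[OF PP_in_VV])

lemma PP0_KK: "f \<in> L2 T \<Longrightarrow> PP 0 (KK f) = PP 0 f"
  unfolding KK_def by (simp add: PP_add PP_diff PP_PP PP_in_L2 hh_L2 L2_diff)

text \<open>The difference d has derivative -u with u = P_0 d constant. Along angle 0 it is
  periodic, so T u vanishes there; along the other eigenlines u is 0 anyway. Hence d lies in the
  kernel, and d = P_0 d = u = 0.\<close>

lemma ddt_plus_P0_inj:
  assumes z: "z \<in> dom_ddt T S" "is_weak_deriv T z w" and z': "z' \<in> dom_ddt T S" "is_weak_deriv T z' w'"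
    and eq: "eq_ae T (w + PP 0 z) (w' + PP 0 z')"
  shows "z = z'"
proof -
  define d where "d = z - z'"
  define u where "u = PP 0 d"
  have L: "z \<in> L2 T" "z' \<in> L2 T" using z z' by (auto intro: W12_L2 dom_ddt_W12)
  have dd: "d \<in> dom_ddt T S" unfolding d_def by (rule dom_ddt_diff[OF z(1) z'(1)])
  have u: "u \<in> VV 0" unfolding u_def by (rule PP_in_VV)
  have ud: "u = PP 0 z - PP 0 z'" unfolding u_def d_def by (rule PP_diff[OF L])
  have "eq_ae T (w - w') (fscale (- 1) u)"
    using eq unfolding eq_ae_def ud by (elim eventually_mono) (simp add: algebra_simps)
  then have dw: "is_weak_deriv T d (fscale (- 1) u)"
    unfolding d_def by (rule weak_deriv_eq_ae[OF weak_deriv_diff[OF z(2) z'(2)]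
      L2_fscale[OF subsetD[OF VV_L2 u]]])
  have dt: "d t = d 0 + - 1 *s (of_real t *s u 0)" if t: "t \<in> {0..T}" for t
    using is_weak_derivD(2)[OF dw t] prim_fscale[OF subsetD[OF VV_L2 u] t, of "- 1"] VV0_prim[OF u t]
    by (simp add: prim_def)
  have "u 0 = 0"
  proof (rule v_eqI)
    fix j
    show "cip (u 0) (v j) = cip 0 (v j)"
    proof (cases "\<theta> j = 0")
      case True
      have "d 0 = cmatrix S *v d T" using dd by (simp add: dom_ddt_def)
      then have "cip (d 0) (v j) = cip (d T) (v j)" by (metis cip_Sc True cis_zero mult_1)
      also have "\<dots> = cip (d 0) (v j) + - 1 * (of_real T * cip (u 0) (v j))"
        using T_pos by (subst dt) (simp_all only: cip_simps atLeastAtMost_iff order.refl less_imp_le simp_thms)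
      finally show ?thesis using T_pos by (simp add: cip_simps)
    qed (simp add: VV0_coord[OF u] cip_simps)
  qed
  then have u0: "u t = 0" for t using VV0_const[OF u, of t] VV_outside[OF u, of t] by auto
  then have "fscale (- 1) u = fscale 0 d" by (simp add: fun_eq_iff)
  then have "d \<in> ker_ddt T S 0" using dd dw by (simp add: ker_dom_iff)
  then have "d = u" unfolding u_def ker_0_eq by (simp add: PP_VV)
  then have "d t = 0" for t using u0 by simp
  then show "z = z'" unfolding d_def by (simp add: fun_eq_iff)
qed

lemma inv_ddt_P0_eq: "f \<in> L2 T \<Longrightarrow> inv_ddt_P0 T S f = KK f"
  unfolding inv_ddt_P0_def
proof (rule the_equality)
  assume f: "f \<in> L2 T"
  have "eq_ae T (ddt T (KK f)) (f - PP 0 f)"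
    by (rule ddt_eq_ae[OF dom_ddt_W12[OF KK_dom[OF f]] KK_weak_deriv[OF f]])
  then show "KK f \<in> dom_ddt T S \<and> eq_ae T (ddt T (KK f) + P0_hat T S (KK f)) f"
    using KK_dom[OF f] unfolding P0_hat_eq[OF KK_L2[OF f]] PP0_KK[OF f] eq_ae_def
    by (auto elim: eventually_mono)
  fix z assume z: "z \<in> dom_ddt T S \<and> eq_ae T (ddt T z + P0_hat T S z) f"
  then have W: "z \<in> W12 T" using dom_ddt_W12 by blast
  show "z = KK f"
  proof (rule ddt_plus_P0_inj[OF _ weak_deriv_ddt[OF W] KK_dom[OF f] KK_weak_deriv[OF f]])
    show "eq_ae T (ddt T z + PP 0 z) (f - PP 0 f + PP 0 (KK f))"
      using z by (simp add: P0_hat_eq[OF W12_L2[OF W]] PP0_KK[OF f])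
  qed (use z in simp)
qed

lemma PP0_e: "PP 0 (e b) = (if om b = 0 then e b else 0)"
proof (cases "om b = 0")
  case True
  then have "e b \<in> VV 0" unfolding VV_def by (intro L.span_base imageI) (simp add: idx_def)
  then show ?thesis using True by (simp add: PP_VV)
next
  case False
  then have "b \<notin> idx 0" by (simp add: idx_def)
  then show ?thesis using False unfolding PP_def by (auto simp: L2_inner_e intro!: sum.neutral)
qed

text \<open>The multiple of \<open>e b\<close> solves the defining equation, since
  \<open>lam b\<close> is the eigenvalue of d/dt + P_0. Uniqueness does the rest.\<close>

lemma KK_e: "KK (e b) = fscale (1 / lam b) (e b)"
proof (rule ddt_plus_P0_inj[OF KK_dom[OF e_L2] KK_weak_deriv[OF e_L2]])
  show "fscale (1 / lam b) (e b) \<in> dom_ddt T S" using e_ker[of b] by (auto simp: ker_dom_iff intro: dom_ddt_fscale)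
  show "is_weak_deriv T (fscale (1 / lam b) (e b)) (fscale (1 / lam b) (fscale (\<i> * of_real (om b)) (e b)))"
    using e_ker[of b] by (intro weak_deriv_fscale) (simp add: ker_dom_iff)
  have "fscale (1 / lam b) (fscale (\<i> * of_real (om b)) (e b)) + PP 0 (fscale (1 / lam b) (e b)) = e b"
    by (auto simp: fun_eq_iff PP_scale PP0_e lam_def)
  then show "eq_ae T (e b - PP 0 (e b) + PP 0 (KK (e b)))
    (fscale (1 / lam b) (fscale (\<i> * of_real (om b)) (e b)) + PP 0 (fscale (1 / lam b) (e b)))"
    by (simp add: PP0_KK eq_ae_refl)
qed

lemma hh_add: "f \<in> L2 T \<Longrightarrow> g \<in> L2 T \<Longrightarrow> hh (f + g) = hh f + hh g"
  using T_pos by (auto simp: fun_eq_iff hh_def prim_add PP_add Rc_add vector_add_ldistrib algebra_simps)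

lemma hh_scale: "f \<in> L2 T \<Longrightarrow> hh (fscale c f) = fscale c (hh f)"
  using T_pos by (auto simp: fun_eq_iff hh_def prim_fscale PP_scale Rc_scale Finite_Cartesian_Product.vec_eq_iff algebra_simps)

lemma KK_add: "f \<in> L2 T \<Longrightarrow> g \<in> L2 T \<Longrightarrow> KK (f + g) = KK f + KK g"
  unfolding KK_def by (simp add: hh_add PP_add hh_L2 algebra_simps)

lemma KK_scale: "f \<in> L2 T \<Longrightarrow> KK (fscale c f) = fscale c (KK f)"
  unfolding KK_def by (simp add: hh_scale PP_scale hh_L2 L.scale_right_distrib L.scale_right_diff_distrib)

lemma KK_cong: "f \<in> L2 T \<Longrightarrow> g \<in> L2 T \<Longrightarrow> eq_ae T f g \<Longrightarrow> KK f = KK g"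
proof -
  assume fg: "f \<in> L2 T" "g \<in> L2 T" "eq_ae T f g"
  have "prim f t = prim g t" if "t \<in> {0..T}" for t
    unfolding prim_def by (rule eq_ae_integral[OF fg that])
  moreover have "PP 0 f = PP 0 g" by (rule PP_cong[OF fg])
  ultimately have "hh f = hh g" using T_pos by (simp add: fun_eq_iff hh_def)
  then show ?thesis unfolding KK_def \<open>PP 0 f = PP 0 g\<close> by simp
qed

text \<open>The mean value and the \<open>Rc\<close> term depend only on the primitive at T. The
  factor 3 comes from the square of a sum of three terms.\<close>

lemma hh_pointwise:
  obtains C where "C \<ge> 0" "\<And>f t. f \<in> L2 T \<Longrightarrow> t \<in> {0..T} \<Longrightarrow>
    (norm (hh f t))\<^sup>2 \<le> 3 * (norm (prim f t))\<^sup>2 + C * (norm (prim f T))\<^sup>2"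
proof -
  obtain CR where CR: "CR \<ge> 0" "\<And>x. (norm (Rc x))\<^sup>2 \<le> CR * (norm x)\<^sup>2" using Rc_bound by auto
  have tri: "(norm (a - b + c))\<^sup>2 \<le> 3 * ((norm a)\<^sup>2 + (norm b)\<^sup>2 + (norm c)\<^sup>2)" for a b c :: "complex^'n"
  proof -
    have "norm (a - b + c) \<le> norm a + norm b + norm c"
      using norm_triangle_ineq[of "a - b" c] norm_triangle_ineq4[of a b] by linarith
    then have "(norm (a - b + c))\<^sup>2 \<le> (norm a + norm b + norm c)\<^sup>2" by (rule power_mono) simp
    moreover have "(x + y + z)\<^sup>2 \<le> 3 * (x\<^sup>2 + y\<^sup>2 + z\<^sup>2)" for x y z :: real
    proof -
      have "3 * (x\<^sup>2 + y\<^sup>2 + z\<^sup>2) - (x + y + z)\<^sup>2 = (x - y)\<^sup>2 + (y - z)\<^sup>2 + (z - x)\<^sup>2"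
        by (simp add: power2_eq_square algebra_simps)
      moreover have "0 \<le> (x - y)\<^sup>2 + (y - z)\<^sup>2 + (z - x)\<^sup>2" by simp
      ultimately show ?thesis by linarith
    qed
    ultimately show ?thesis by (rule order_trans)
  qed
  have "(norm (hh f t))\<^sup>2 \<le> 3 * (norm (prim f t))\<^sup>2 + (3 + 3 * CR) * (norm (prim f T))\<^sup>2"
    if f: "f \<in> L2 T" and t: "t \<in> {0..T}" for f t
  proof -
    have "(norm (of_real T *s PP 0 f 0))\<^sup>2 \<le> (norm (prim f T))\<^sup>2"
      unfolding norm_expand[of "of_real T *s PP 0 f 0"] norm_expand[of "prim f T"] cip_simps PP0_coord[OF f]
      by (intro sum_mono) auto
    moreover have "norm (of_real t *s PP 0 f 0) \<le> norm (of_real T *s PP 0 f 0)"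
      using t by (auto simp: norm_vector_smult intro: mult_right_mono)
    then have "(norm (of_real t *s PP 0 f 0))\<^sup>2 \<le> (norm (of_real T *s PP 0 f 0))\<^sup>2" by (rule power_mono) simp
    ultimately have 1: "(norm (of_real t *s PP 0 f 0))\<^sup>2 \<le> (norm (prim f T))\<^sup>2" by simp
    have "hh f t = prim f t - of_real t *s PP 0 f 0 + Rc (prim f T)" using t by (simp add: hh_def)
    then have "(norm (hh f t))\<^sup>2 \<le> 3 * ((norm (prim f t))\<^sup>2 + (norm (prim f T))\<^sup>2 + CR * (norm (prim f T))\<^sup>2)"
      using tri[of "prim f t" "of_real t *s PP 0 f 0" "Rc (prim f T)"]
      by (simp only:) (rule order_trans, assumption, intro mult_left_mono add_mono order_refl 1 CR(2), simp)
    also have "\<dots> = 3 * (norm (prim f t))\<^sup>2 + (3 + 3 * CR) * (norm (prim f T))\<^sup>2" by (simp only: distrib_left distrib_right mult.assoc add.assoc)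
    finally show ?thesis .
  qed
  then show thesis using that[of "3 + 3 * CR"] CR(1) by auto
qed

lemma PP0_bessel:
  assumes I: "finite I" and g: "L.orthonormal I g"
  shows "(\<Sum>i\<in>I. L.nrm2 (PP 0 (g i))) \<le> real (card (idx 0))"
proof -
  have gL: "g i \<in> L2 T" if "i \<in> I" for i using g that by (auto simp: L.orthonormal_def)
  have "(\<Sum>i\<in>I. L.nrm2 (PP 0 (g i))) = (\<Sum>i\<in>I. \<Sum>a\<in>idx 0. (cmod (L2_inner T (e a) (g i)))\<^sup>2)"
  proof (intro sum.cong refl)
    fix i assume i: "i \<in> I"
    have "cmod (L2_inner T (g i) (e a)) = cmod (L2_inner T (e a) (g i))" for a
      by (subst L.ip_cnj[OF e_L2 gL[OF i]]) simp
    then show "L.nrm2 (PP 0 (g i)) = (\<Sum>a\<in>idx 0. (cmod (L2_inner T (e a) (g i)))\<^sup>2)"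
      by (simp only: nrm2_PP)
  qed
  also have "\<dots> = (\<Sum>a\<in>idx 0. \<Sum>i\<in>I. (cmod (L2_inner T (e a) (g i)))\<^sup>2)" by (rule sum.swap)
  also have "\<dots> \<le> (\<Sum>a\<in>idx 0. 1)"
  proof (rule sum_mono)
    fix a
    show "(\<Sum>i\<in>I. (cmod (L2_inner T (e a) (g i)))\<^sup>2) \<le> 1"
      using L.bessel[OF I g e_L2[of a]] by (simp add: L2_inner_e)
  qed
  finally show ?thesis by simp
qed

lemma KK_hilbert_schmidt:
  obtains B where "\<And>(I :: nat set) g. finite I \<Longrightarrow> L.orthonormal I g \<Longrightarrow> (\<Sum>i\<in>I. L.nrm2 (KK (g i))) \<le> B"
proof -
  obtain C where C: "C \<ge> 0" "\<And>f t. f \<in> L2 T \<Longrightarrow> t \<in> {0..T} \<Longrightarrow>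
    (norm (hh f t))\<^sup>2 \<le> 3 * (norm (prim f t))\<^sup>2 + C * (norm (prim f T))\<^sup>2"
    using hh_pointwise by blast
  define B1 where "B1 = (3 + C) * (real CARD('n) * T)"
  have "(\<Sum>i\<in>I. L.nrm2 (KK (g i))) \<le> 2 * real (card (idx 0)) + 2 * (T * B1)"
    if I: "finite I" and g: "L.orthonormal I g" for I :: "nat set" and g
  proof -
    have gL: "g i \<in> L2 T" if "i \<in> I" for i using g that by (auto simp: L.orthonormal_def)
    have hc: "continuous_on {0..T} (\<lambda>t. (norm (hh (g i) t))\<^sup>2)" if "i \<in> I" for i
      by (intro continuous_intros weak_deriv_continuous[OF hh_weak_deriv[OF gL[OF that]]])
    have "(\<Sum>i\<in>I. L.nrm2 (hh (g i))) = (\<integral>t. (\<Sum>i\<in>I. (norm (hh (g i) t))\<^sup>2) \<partial>lebesgue_on {0..T})"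
      unfolding nrm2_integral
      by (intro Bochner_Integration.integral_sum[symmetric] continuous_imp_integrable_real hc)
    also have "\<dots> \<le> T * B1"
    proof (rule L2_set_integral_const[OF T_pos])
      show "(\<lambda>t. \<Sum>i\<in>I. (norm (hh (g i) t))\<^sup>2) \<in> borel_measurable (lebesgue_on {0..T})"
        by (intro continuous_borel_measurable continuous_on_sum hc)
      fix t assume t: "t \<in> {0..T}"
      show "0 \<le> (\<Sum>i\<in>I. (norm (hh (g i) t))\<^sup>2)" by (intro sum_nonneg) simp
      have TT: "T \<in> {0..T}" using T_pos by simp
      have "(\<Sum>i\<in>I. (norm (hh (g i) t))\<^sup>2) \<le>
          (\<Sum>i\<in>I. 3 * (norm (prim (g i) t))\<^sup>2 + C * (norm (prim (g i) T))\<^sup>2)"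
        by (intro sum_mono C(2) gL t)
      also have "\<dots> = 3 * (\<Sum>i\<in>I. (norm (prim (g i) t))\<^sup>2) + C * (\<Sum>i\<in>I. (norm (prim (g i) T))\<^sup>2)"
        by (simp add: sum.distrib sum_distrib_left)
      also have "\<dots> \<le> 3 * (real CARD('n) * T) + C * (real CARD('n) * T)"
        using prim_bessel[OF I g t] mult_left_mono[OF prim_bessel[OF I g TT] C(1)] by linarith
      finally show "(\<Sum>i\<in>I. (norm (hh (g i) t))\<^sup>2) \<le> B1" by (simp add: B1_def algebra_simps)
    qed
    finally have 1: "(\<Sum>i\<in>I. L.nrm2 (hh (g i))) \<le> T * B1" .
    have "L.nrm2 (KK (g i)) \<le> 2 * L.nrm2 (PP 0 (g i)) + 2 * L.nrm2 (hh (g i))" if i: "i \<in> I" for i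
    proof -
      have hL: "hh (g i) \<in> L2 T" by (rule hh_L2[OF gL[OF i]])
      have "0 \<le> (\<Sum>a\<in>idx 0. (cmod (L2_inner T (hh (g i)) (e a)))\<^sup>2)" by (intro sum_nonneg) simp
      then have "L.nrm2 (hh (g i) - PP 0 (hh (g i))) \<le> L.nrm2 (hh (g i))"
        unfolding nrm2_diff_PP[OF hL] by linarith
      then show ?thesis
        using L.nrm2_add_le[OF PP_in_L2[of 0 "g i"] L2_diff[OF hL PP_in_L2[of 0 "hh (g i)"]]]
        unfolding KK_def by linarith
    qed
    then have "(\<Sum>i\<in>I. L.nrm2 (KK (g i))) \<le> (\<Sum>i\<in>I. 2 * L.nrm2 (PP 0 (g i)) + 2 * L.nrm2 (hh (g i)))"
      by (rule sum_mono)
    also have "\<dots> = 2 * (\<Sum>i\<in>I. L.nrm2 (PP 0 (g i))) + 2 * (\<Sum>i\<in>I. L.nrm2 (hh (g i)))"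
      by (simp add: sum.distrib sum_distrib_left)
    finally show ?thesis using 1 PP0_bessel[OF I g] by linarith
  qed
  then show thesis by (rule that)
qed

end

section \<open>The conditional determinant\<close>

lemma mat_scalar_mult: "mat c ** A = (\<chi> i j. c * A $ i $ j)" for A :: "complex^'n^'n"
  by (simp add: Finite_Cartesian_Product.vec_eq_iff matrix_matrix_mult_def Finite_Cartesian_Product.mat_def
      if_distrib[of "\<lambda>x. x * _"] sum.delta' cong: if_cong)

lemma mult_scalar_mat: "A ** (mat c ** B) = mat c ** (A ** B)" for A B :: "complex^'n^'n"
  unfolding mat_scalar_mult
  by (simp add: Finite_Cartesian_Product.vec_eq_iff matrix_matrix_mult_def sum_distrib_left mult_ac)

lemma matrix_diff_right_distrib: "(A - B) ** C = A ** C - B ** C" for A B C :: "complex^'n^'n"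
  by (simp add: Finite_Cartesian_Product.vec_eq_iff matrix_matrix_mult_def sum_subtractf algebra_simps)

lemma bounded_bilinear_matrix_matrix:
  "bounded_bilinear ((**) :: complex^'n^'n \<Rightarrow> complex^'n^'n \<Rightarrow> complex^'n^'n)"
  unfolding bilinear_conv_bounded_bilinear[symmetric] bilinear_def
  by (auto intro!: linearI simp: Finite_Cartesian_Product.vec_eq_iff matrix_matrix_mult_def sum.distrib
      scaleR_sum_right algebra_simps)

lemma bounded_linear_mat: "bounded_linear (mat :: complex \<Rightarrow> complex^'n^'n)"
  unfolding linear_conv_bounded_linear[symmetric]
  by (auto intro!: linearI simp: Finite_Cartesian_Product.vec_eq_iff Finite_Cartesian_Product.mat_def)

lemma det_scale_columns:
  fixes A :: "nat \<Rightarrow> nat \<Rightarrow> 'a::comm_ring_1"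
  shows "Determinant.det (Matrix.mat n n (\<lambda>(i, j). A i j * c j)) =
    Determinant.det (Matrix.mat n n (\<lambda>(i, j). A i j)) * (\<Prod>j<n. c j)"
proof -
  define C where "C = Matrix.mat n n (\<lambda>(i, j). if i = j then c i else 0)"
  have C: "C \<in> carrier_mat n n" by (simp add: C_def)
  have "Matrix.mat n n (\<lambda>(i, j). A i j * c j) = Matrix.mat n n (\<lambda>(i, j). A i j) * C"
    by (rule eq_matI) (auto simp: C_def scalar_prod_def if_distrib[of "\<lambda>x. _ * x"] sum.delta' cong: if_cong)
  moreover have "Determinant.det C = (\<Prod>j<n. c j)"
  proof -
    have "Determinant.det C = prod_list (diag_mat C)"
      by (rule det_upper_triangular[OF _ C]) (simp add: C_def upper_triangular_def)
    also have "diag_mat C = map c [0..<n]" by (simp add: C_def diag_mat_def)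
    also have "prod_list (map c [0..<n]) = (\<Prod>j\<in>set [0..<n]. c j)"
      by (rule prod.distinct_set_conv_list[symmetric]) simp
    finally show ?thesis by (simp add: atLeast0LessThan)
  qed
  ultimately show ?thesis using det_mult[of "Matrix.mat n n (\<lambda>(i, j). A i j)" n C] C by simp
qed

lemma det_scale_rows:
  fixes A :: "nat \<Rightarrow> nat \<Rightarrow> 'a::comm_ring_1"
  shows "Determinant.det (Matrix.mat n n (\<lambda>(i, j). c i * A i j)) =
    (\<Prod>j<n. c j) * Determinant.det (Matrix.mat n n (\<lambda>(i, j). A i j))"
proof -
  have T: "Matrix.mat n n (\<lambda>(i, j). B j i) = transpose_mat (Matrix.mat n n (\<lambda>(i, j). B i j))" for B :: "nat \<Rightarrow> nat \<Rightarrow> 'a"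
    by (rule eq_matI) auto
  have "Determinant.det (Matrix.mat n n (\<lambda>(i, j). c i * A i j)) =
      Determinant.det (Matrix.mat n n (\<lambda>(i, j). A j i * c j))"
    unfolding T[of "\<lambda>i j. A i j * c i"] by (subst det_transpose[of _ n]) (simp_all add: mult.commute)
  also have "\<dots> = Determinant.det (Matrix.mat n n (\<lambda>(i, j). A j i)) * (\<Prod>j<n. c j)"
    by (rule det_scale_columns)
  also have "Determinant.det (Matrix.mat n n (\<lambda>(i, j). A j i)) = Determinant.det (Matrix.mat n n (\<lambda>(i, j). A i j))"
    unfolding T[of A] by (rule det_transpose[of _ n]) simp
  finally show ?thesis by (simp add: mult.commute)
qed

section \<open>The Fredholm operator, its sections and their limits\<close>

locale fredholm = boundary_value v T \<theta> S
  for v :: "'n::finite \<Rightarrow> complex^'n" and T \<theta> and S :: "real^'n^'n" +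
  fixes D \<gamma> :: "real \<Rightarrow> complex^'n^'n" and \<nu> :: complex
  assumes D_cont: "continuous_on {0..T} D" and fund: "is_fundamental_solution T D \<gamma>"
begin

definition A :: "real \<Rightarrow> complex^'n^'n" where "A t = D t - mat \<nu>"

lemma A_cont: "continuous_on {0..T} A"
  unfolding A_def by (intro continuous_intros D_cont)

definition A1 :: "real \<Rightarrow> complex^'n^'n" where "A1 t = A t + mat 1"

text \<open>The factor exp(-\<nu> t) moves \<nu> into the coefficient: \<open>Yt\<close> solves Y' =
  (D - \<nu>) Y, which is (\<open>A1\<close> - 1) Y.\<close>

definition Yt :: "real \<Rightarrow> complex^'n^'n" where "Yt t = mat (exp (- \<nu> * of_real t)) ** \<gamma> t"

sublocale volterra v T \<theta> "cmatrix S" A1 Yt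
proof
  show "continuous_on {0..T} A1" unfolding A1_def by (intro continuous_intros A_cont)
  show "Yt 0 = mat 1"
    using fund by (simp add: Yt_def is_fundamental_solution_def)
  fix t assume t: "t \<in> {0..T}"
  have "((\<lambda>t. mat (exp (- \<nu> * of_real t)) ** \<gamma> t) has_vector_derivative
      mat (exp (- \<nu> * of_real t)) ** (D t ** \<gamma> t) + mat (- \<nu> * exp (- \<nu> * of_real t)) ** \<gamma> t) (at t within {0..T})"
    using t fund
    by (intro bounded_bilinear.has_vector_derivative[OF bounded_bilinear_matrix_matrix]
        bounded_linear.has_vector_derivative[OF bounded_linear_mat] exp_has_vector_derivative)
      (simp add: is_fundamental_solution_def)
  moreover have "mat (exp (- \<nu> * of_real t)) ** (D t ** \<gamma> t) + mat (- \<nu> * exp (- \<nu> * of_real t)) ** \<gamma> t =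
      (A t + mat 1 - mat 1) ** (mat (exp (- \<nu> * of_real t)) ** \<gamma> t)"
    unfolding A_def add_diff_cancel_right' matrix_diff_right_distrib mult_scalar_mat
    by (simp add: mat_scalar_mult Finite_Cartesian_Product.vec_eq_iff algebra_simps)
  ultimately show "(Yt has_vector_derivative (A1 t - mat 1) ** Yt t) (at t within {0..T})"
    unfolding A1_def Yt_def by (simp only:)
qed

text \<open>The representative - (P_0 + A K) of the operator \<open>F\<close>. \<open>F\<close>
  contains the arbitrary choices made by \<open>ddt\<close> and is additive only almost everywhere,
  while \<open>FF\<close> is linear as a map of functions on \<open>L2 T\<close>.\<close>

definition FF :: "(real \<Rightarrow> complex^'n) \<Rightarrow> real \<Rightarrow> complex^'n" where
  "FF f = fscale (- 1) (PP 0 f + (\<lambda>t. A t *v KK f t))"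

definition F :: "(real \<Rightarrow> complex^'n) \<Rightarrow> real \<Rightarrow> complex^'n" where
  "F f = (ddt_minus T D \<nu> \<circ> inv_ddt_P0 T S) f - f"

lemma AK_L2: "f \<in> L2 T \<Longrightarrow> (\<lambda>t. A t *v KK f t) \<in> L2 T"
  by (intro L2_matrix_vector A_cont KK_L2)

lemma FF_L2: "f \<in> L2 T \<Longrightarrow> FF f \<in> L2 T"
  unfolding FF_def by (intro L2_fscale L2_add PP_in_L2 AK_L2)

lemma FF_add: "f \<in> L2 T \<Longrightarrow> g \<in> L2 T \<Longrightarrow> FF (f + g) = FF f + FF g"
  unfolding FF_def by (simp add: fun_eq_iff PP_add KK_add matrix_vector_right_distrib)

lemma FF_scale: "f \<in> L2 T \<Longrightarrow> FF (fscale c f) = fscale c (FF f)"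
  unfolding FF_def by (simp add: fun_eq_iff PP_scale KK_scale vector_scalar_commute vector_add_ldistrib)

lemma FF_cong: "f \<in> L2 T \<Longrightarrow> g \<in> L2 T \<Longrightarrow> eq_ae T f g \<Longrightarrow> FF f = FF g"
  unfolding FF_def using PP_cong[of f g] KK_cong[of f g] by simp

lemma F_L2: "f \<in> L2 T \<Longrightarrow> F f \<in> L2 T"
  unfolding F_def comp_def ddt_minus_def
  by (simp add: inv_ddt_P0_eq)
    (intro L2_add L2_diff ddt_L2 dom_ddt_W12[OF KK_dom] L2_matrix_vector D_cont KK_L2 L2_fscale)

lemma F_ae: "f \<in> L2 T \<Longrightarrow> eq_ae T (F f) (FF f)"
proof -
  assume f: "f \<in> L2 T"
  have "eq_ae T (ddt T (KK f)) (f - PP 0 f)"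
    by (rule ddt_eq_ae[OF dom_ddt_W12[OF KK_dom[OF f]] KK_weak_deriv[OF f]])
  then show ?thesis
    unfolding eq_ae_def F_def FF_def comp_def inv_ddt_P0_eq[OF f] ddt_minus_def
    by (rule eventually_mono)
      (simp add: A_def matrix_vector_mult_diff_rdistrib vector_smult_matrix[symmetric] Finite_Cartesian_Product.vec_eq_iff)
qed

lemma FF_hilbert_schmidt:
  obtains B where "\<And>(I :: nat set) g. finite I \<Longrightarrow> L.orthonormal I g \<Longrightarrow> (\<Sum>i\<in>I. L.nrm2 (FF (g i))) \<le> B"
proof -
  obtain B where B: "\<And>(I :: nat set) g. finite I \<Longrightarrow> L.orthonormal I g \<Longrightarrow> (\<Sum>i\<in>I. L.nrm2 (KK (g i))) \<le> B"
    using KK_hilbert_schmidt by blast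
  obtain BA where BA: "BA > 0" "\<And>t. t \<in> {0..T} \<Longrightarrow> norm (A t) \<le> BA"
    using continuous_cbound[OF A_cont] by blast
  obtain K where K: "K > 0" "\<And>(a::complex^'n^'n) b. norm (a *v b) \<le> norm a * norm b * K"
    using bounded_bilinear.pos_bounded[OF bounded_bilinear_matrix_vector] by blast
  define CA where "CA = (BA * K)\<^sup>2"
  have A2: "(norm (A t *v x))\<^sup>2 \<le> CA * (norm x)\<^sup>2" if "t \<in> {0..T}" for t x
  proof -
    have "norm (A t *v x) \<le> norm (A t) * norm x * K" by (rule K(2))
    also have "\<dots> \<le> BA * norm x * K" using K(1) BA(2)[OF that] by (intro mult_right_mono) auto
    finally have "norm (A t *v x) \<le> BA * K * norm x" by (simp add: mult_ac)
    then have "(norm (A t *v x))\<^sup>2 \<le> (BA * K * norm x)\<^sup>2" by (rule power_mono) simp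
    then show ?thesis by (simp add: CA_def power_mult_distrib)
  qed
  have CA: "CA \<ge> 0" by (simp add: CA_def)
  have "(\<Sum>i\<in>I. L.nrm2 (FF (g i))) \<le> 2 * real (card (idx 0)) + 2 * (CA * B)"
    if I: "finite I" and g: "L.orthonormal I g" for I :: "nat set" and g
  proof -
    have gL: "g i \<in> L2 T" if "i \<in> I" for i using g that by (auto simp: L.orthonormal_def)
    have "L.nrm2 (FF (g i)) \<le> 2 * L.nrm2 (PP 0 (g i)) + 2 * (CA * L.nrm2 (KK (g i)))" if i: "i \<in> I" for i
    proof -
      have "L.nrm2 (\<lambda>t. A t *v KK (g i) t) \<le> CA * L.nrm2 (KK (g i))"
        by (rule nrm2_mono[OF AK_L2[OF gL[OF i]] KK_L2[OF gL[OF i]] A2])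
      moreover have "L.nrm2 (FF (g i)) = L.nrm2 (PP 0 (g i) + (\<lambda>t. A t *v KK (g i) t))"
        unfolding FF_def by (subst nrm2_fscale[OF L2_add[OF PP_in_L2 AK_L2[OF gL[OF i]]]]) simp
      ultimately show ?thesis
        using L.nrm2_add_le[OF PP_in_L2[of 0 "g i"] AK_L2[OF gL[OF i]]] by linarith
    qed
    then have "(\<Sum>i\<in>I. L.nrm2 (FF (g i))) \<le> (\<Sum>i\<in>I. 2 * L.nrm2 (PP 0 (g i)) + 2 * (CA * L.nrm2 (KK (g i))))"
      by (rule sum_mono)
    also have "\<dots> = 2 * (\<Sum>i\<in>I. L.nrm2 (PP 0 (g i))) + 2 * (CA * (\<Sum>i\<in>I. L.nrm2 (KK (g i))))"
      by (simp add: sum.distrib sum_distrib_left)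
    finally show ?thesis using PP0_bessel[OF I g] mult_left_mono[OF B[OF I g] CA] by linarith
  qed
  then show thesis by (rule that)
qed

lemma F_bounded: "bounded_op T F"
  unfolding bounded_op_def
proof (intro conjI ballI allI impI)
  show "F f \<in> L2 T" if "f \<in> L2 T" for f by (rule F_L2[OF that])
  show "eq_ae T (F f) (F g)" if "f \<in> L2 T" "g \<in> L2 T" "eq_ae T f g" for f g
    using eq_ae_trans[OF F_ae[OF that(1)]] eq_ae_sym[OF F_ae[OF that(2)]] FF_cong[OF that] by simp
  show "eq_ae T (F (f + g)) (F f + F g)" if "f \<in> L2 T" "g \<in> L2 T" for f g
    using eq_ae_trans[OF F_ae[OF L2_add[OF that]]] eq_ae_sym[OF eq_ae_add[OF F_ae[OF that(1)] F_ae[OF that(2)]]]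
    by (simp add: FF_add that)
  show "eq_ae T (F (fscale c f)) (fscale c (F f))" if "f \<in> L2 T" for c f
    using eq_ae_trans[OF F_ae[OF L2_fscale[OF that]]] eq_ae_sym[OF eq_ae_fscale[OF F_ae[OF that]]]
    by (simp add: FF_scale that)
  obtain B where B: "\<And>(I :: nat set) g. finite I \<Longrightarrow> L.orthonormal I g \<Longrightarrow> (\<Sum>i\<in>I. L.nrm2 (FF (g i))) \<le> B"
    using FF_hilbert_schmidt by blast
  \<comment> \<open>The Hilbert-Schmidt bound for a one-element family is a bound for the operator
    norm. Functions that vanish almost everywhere cannot be normalised and are sent to 0.\<close>
  have "L.nrm2 (FF f) \<le> B * L.nrm2 f" if f: "f \<in> L2 T" for f
  proof (cases "L.nrm2 f = 0")
    case True
    have "eq_ae T f 0"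
    proof -
      have "AE t in lebesgue_on {0..T}. (norm (f t))\<^sup>2 = 0"
        using True L2D(2)[OF f] unfolding nrm2_integral by (subst (asm) integral_nonneg_eq_0_iff_AE) auto
      then show ?thesis unfolding eq_ae_def by (rule eventually_mono) simp
    qed
    then have "FF f = FF (fscale 0 f)"
      using FF_cong[OF f L2_fscale[OF f, of 0]] by (simp add: eq_ae_def)
    then have "L.nrm2 (FF f) = 0" by (simp only: FF_scale[OF f] nrm2_fscale[OF FF_L2[OF f]]) (simp add: nrm2_integral)
    then show ?thesis using True by simp
  next
    case False
    have p: "L.nrm2 f > 0" using False L.ip_nonneg[OF f] by simp
    define r where "r = complex_of_real (1 / sqrt (L.nrm2 f))"
    have r: "(cmod r)\<^sup>2 = 1 / L.nrm2 f" using p by (simp add: r_def norm_divide power_divide)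
    have "L.orthonormal {0::nat} (\<lambda>_. fscale r f)"
      unfolding L.orthonormal_def using L.ip_self[OF L2_fscale[OF f, of r]] nrm2_fscale[OF f, of r] p r L2_fscale[OF f, of r]
      by auto
    from B[OF _ this] have "L.nrm2 (fscale r (FF f)) \<le> B" by (simp add: FF_scale f)
    then show ?thesis unfolding nrm2_fscale[OF FF_L2[OF f]] r using p by (simp add: field_simps)
  qed
  then have "L2_norm T (F f) \<le> sqrt B * L2_norm T f" if "f \<in> L2 T" for f
    unfolding L2_norm_nrm2 nrm2_cong[OF F_L2[OF that] FF_L2[OF that] F_ae[OF that]] real_sqrt_mult[symmetric]
    using that by (intro real_sqrt_le_mono)
  then show "\<exists>C. \<forall>f\<in>L2 T. L2_norm T (F f) \<le> C * L2_norm T f" by blast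
qed

lemma F_hilbert_schmidt: "hilbert_schmidt T F"
  unfolding hilbert_schmidt_def
proof (intro conjI allI impI F_bounded)
  fix g :: "nat \<Rightarrow> real \<Rightarrow> complex^'n" assume g: "orthonormal_basis T g"
  obtain B where B: "\<And>(I :: nat set) g. finite I \<Longrightarrow> L.orthonormal I g \<Longrightarrow> (\<Sum>i\<in>I. L.nrm2 (FF (g i))) \<le> B"
    using FF_hilbert_schmidt by blast
  have gL: "g i \<in> L2 T" for i using g by (simp add: orthonormal_basis_def)
  have eq: "(L2_norm T (F (g i)))\<^sup>2 = L.nrm2 (FF (g i))" for i
    unfolding L2_norm_nrm2 nrm2_cong[OF F_L2[OF gL] FF_L2[OF gL] F_ae[OF gL]]
    using L.ip_nonneg[OF FF_L2[OF gL]] by simp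
  have og: "L.orthonormal {..<n} g" for n
    using g by (auto simp: L.orthonormal_def orthonormal_basis_def)
  show "summable (\<lambda>i. (L2_norm T (F (g i)))\<^sup>2)"
    by (rule summableI_nonneg_bounded[where x = B]) (simp_all add: eq B[OF _ og] L.ip_nonneg[OF FF_L2[OF gL]])
qed

text \<open>The outer projection does not see null sets, so on \<open>VV N\<close> the compressions
  of \<open>F\<close> and \<open>FF\<close> are equal.\<close>

lemma compress_F: "f \<in> VV N \<Longrightarrow> compress T S N F f = PP N (FF f)"
proof -
  assume f: "f \<in> VV N"
  have fL: "f \<in> L2 T" using f VV_L2 by blast
  show ?thesis
    unfolding compress_def comp_def P_hat_eq[OF fL] PP_VV[OF f] P_hat_eq[OF F_L2[OF fL]]
    by (rule PP_cong[OF F_L2[OF fL] FF_L2[OF fL] F_ae[OF fL]])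
qed

lemma compress_endo: "endo fscale (VV N) (compress T S N F)"
  unfolding endo_def
  using VV_L2[of N] L.subspace_add[OF VV_subspace, of _ N] L.subspace_scale[OF VV_subspace, of _ N]
  by (auto simp: compress_F PP_in_VV FF_add FF_scale PP_add PP_scale FF_L2 subset_iff)

lemma id_compress_endo: "endo fscale (VV N) (\<lambda>f. f + compress T S N F f)"
  using compress_endo[of N] L.subspace_add[OF VV_subspace, of _ N]
  by (auto simp: endo_def L.scale_right_distrib)

text \<open>At nonzero frequency \<open>Lam\<close> = \<open>lam\<close> + 1. At frequency 0 both
  are 1, and the projection term cancels the 1 in the coefficient, so a single formula covers both
  cases.\<close>

lemma FF_entry: "L2_inner T (FF (e b)) (e a) = (if a = b then Lam b / lam b - 1 else 0) - Mc b a / lam b"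
proof -
  have aL: "(\<lambda>t. A1 t *v e b t) \<in> L2 T"
    by (intro L2_matrix_vector M_cont e_L2)
  have "(\<lambda>t. A t *v KK (e b) t) = fscale (1 / lam b) ((\<lambda>t. A1 t *v e b t) - e b)"
    unfolding KK_e A1_def by (simp add: fun_eq_iff vector_scalar_commute matrix_vector_mult_add_rdistrib)
  then have "L2_inner T (FF (e b)) (e a) =
      - (L2_inner T (PP 0 (e b)) (e a) + 1 / lam b * (Mc b a - L2_inner T (e b) (e a)))"
    unfolding FF_def Mc_def using aL
    by (simp only: L.ip_scale_left L.ip_add_left L.ip_diff_left L2_add L2_diff L2_fscale PP_in_L2 e_L2) simp
  also have "L2_inner T (PP 0 (e b)) (e a) = (if om b = 0 then L2_inner T (e b) (e a) else 0)"
    by (simp add: PP0_e L.ip_zero_left)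
  finally have *: "L2_inner T (FF (e b)) (e a) =
    - ((if om b = 0 then L2_inner T (e b) (e a) else 0) + 1 / lam b * (Mc b a - L2_inner T (e b) (e a)))" .
  show ?thesis
    unfolding * L2_inner_e by (auto simp: lam_def Lam_def field_simps)
qed

lemma lam_nz: "lam b \<noteq> 0" by (simp add: lam_def)

text \<open>By \<open>FF_entry\<close> the matrix arises from the one of \<open>main_limit\<close>
  by scaling rows with \<open>Lam\<close> and columns with 1 / \<open>lam\<close>.\<close>

lemma det_on_compress:
  "det_on fscale (V_space T S N) (\<lambda>f. f + compress T S N F f) =
   (\<Prod>a\<in>idx N. Lam a / lam a) * Determinant.det (Matrix.mat (length (ls N)) (length (ls N))
      (\<lambda>(i, j). (if i = j then 1 else 0) - Mc (ls N ! j) (ls N ! i) / Lam (ls N ! i)))"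
proof -
  let ?n = "length (ls N)" and ?b = "\<lambda>i. ls N ! i"
  have "det_on fscale (V_space T S N) (\<lambda>f. f + compress T S N F f) =
      Determinant.det (Matrix.mat ?n ?n (\<lambda>(i, j). L2_inner T (e (?b j) + compress T S N F (e (?b j))) (e (?b i))))"
    unfolding V_space_eq L.det_on_eq[OF bs_basis id_compress_endo]
      L.orthonormal_matrix_of[OF bs_basis bs_orthonormal id_compress_endo]
    by (intro arg_cong[of _ _ Determinant.det] eq_matI) auto
  also have "\<dots> = Determinant.det (Matrix.mat ?n ?n (\<lambda>(i, j).
      (Lam (?b i) * ((if i = j then 1 else 0) - Mc (?b j) (?b i) / Lam (?b i))) * (1 / lam (?b j))))"
  proof (intro arg_cong[of _ _ Determinant.det] eq_matI)
    fix i j assume "i < dim_row (Matrix.mat ?n ?n (\<lambda>(i, j).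
        (Lam (?b i) * ((if i = j then 1 else 0) - Mc (?b j) (?b i) / Lam (?b i))) * (1 / lam (?b j))))"
      "j < dim_col (Matrix.mat ?n ?n (\<lambda>(i, j).
        (Lam (?b i) * ((if i = j then 1 else 0) - Mc (?b j) (?b i) / Lam (?b i))) * (1 / lam (?b j))))"
    then have ij: "i < ?n" "j < ?n" by auto
    have eq: "?b i = ?b j \<longleftrightarrow> i = j" using ij ls(1) by (simp add: nth_eq_iff_index_eq)
    have bj: "e (?b j) \<in> VV N" unfolding VV_def by (intro L.span_base imageI ls_nth ij)
    have "L2_inner T (e (?b j) + compress T S N F (e (?b j))) (e (?b i)) =
        L2_inner T (e (?b j)) (e (?b i)) + L2_inner T (FF (e (?b j))) (e (?b i))"
      unfolding compress_F[OF bj] using ij by (simp add: L.ip_add_left PP_in_L2 PP_ip ls_nth)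
    also have "\<dots> = (Lam (?b i) * ((if i = j then 1 else 0) - Mc (?b j) (?b i) / Lam (?b i))) * (1 / lam (?b j))"
      unfolding FF_entry L2_inner_e eq using lam_nz[of "?b j"] Lam_nz[of "?b i"]
      by (cases "i = j") (simp_all add: field_simps)
    finally show "Matrix.mat ?n ?n (\<lambda>(i, j). L2_inner T (e (?b j) + compress T S N F (e (?b j))) (e (?b i))) $$ (i, j) =
      Matrix.mat ?n ?n (\<lambda>(i, j). (Lam (?b i) * ((if i = j then 1 else 0) - Mc (?b j) (?b i) / Lam (?b i))) * (1 / lam (?b j))) $$ (i, j)"
      using ij by simp
  qed auto
  also have "\<dots> = (\<Prod>i<?n. Lam (?b i)) * Determinant.det (Matrix.mat ?n ?n
      (\<lambda>(i, j). (if i = j then 1 else 0) - Mc (?b j) (?b i) / Lam (?b i))) * (\<Prod>j<?n. 1 / lam (?b j))"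
    by (simp only: det_scale_columns[of ?n "\<lambda>i j. Lam (?b i) * ((if i = j then 1 else 0) - Mc (?b j) (?b i) / Lam (?b i))" "\<lambda>j. 1 / lam (?b j)"]
        det_scale_rows[of ?n "\<lambda>i. Lam (?b i)" "\<lambda>i j. (if i = j then 1 else 0) - Mc (?b j) (?b i) / Lam (?b i)"])
  also have "(\<Prod>i<?n. Lam (?b i)) = (\<Prod>a\<in>idx N. Lam a)" by (rule prod_ls)
  also have "(\<Prod>j<?n. 1 / lam (?b j)) = (\<Prod>a\<in>idx N. 1 / lam a)" by (rule prod_ls)
  finally show ?thesis
    by (simp only: prod_dividef prod_constant power_one times_divide_eq_right times_divide_eq_left mult_1_right)
qed

text \<open>The factors 1 - exp(-T) cis \<theta> of the normalisation cancel the denominator in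
  \<open>main_limit\<close>.\<close>

lemma det_limit:
  "((\<lambda>N. det_on fscale (V_space T S N) (\<lambda>f. f + compress T S N F f)) \<longlongrightarrow>
     (\<Prod>j\<in>UNIV. exp (of_real T / 2) / den j) * exp (- (trace Mint / 2)) *
       det (mat 1 - cmatrix S ** Yt T)) at_top"
proof -
  have "((\<lambda>N. \<Prod>a\<in>idx N. Lam a / lam a) \<longlongrightarrow>
      (\<Prod>j\<in>UNIV. exp (of_real T / 2) * (1 - qT * cis (\<theta> j)) / den j)) at_top"
    unfolding prod_idx Lam_def by (intro tendsto_prod) (use normalization_limit in simp)
  from tendsto_mult[OF this main_limit]
  have "((\<lambda>N. det_on fscale (V_space T S N) (\<lambda>f. f + compress T S N F f)) \<longlongrightarrow>
     (\<Prod>j\<in>UNIV. exp (of_real T / 2) * (1 - qT * cis (\<theta> j)) / den j) * (exp (- (trace Mint / 2)) *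
       (det (mat 1 - cmatrix S ** Yt T) / (\<Prod>j\<in>UNIV. 1 - qT * cis (\<theta> j))))) at_top"
    unfolding det_on_compress .
  moreover have "(\<Prod>j\<in>UNIV. exp (of_real T / 2) * (1 - qT * cis (\<theta> j)) / den j) =
      (\<Prod>j\<in>UNIV. exp (of_real T / 2) / den j) * (\<Prod>j\<in>UNIV. 1 - qT * cis (\<theta> j))"
    by (simp add: prod.distrib[symmetric])
  moreover have "(\<Prod>j\<in>UNIV. 1 - complex_of_real qT * cis (\<theta> j)) \<noteq> 0"
    using one_minus_q_nz by simp
  ultimately show ?thesis by (simp add: mult.assoc)
qed

lemma trace_limit: "\<exists>\<tau>. ((\<lambda>N. trace_on fscale (V_space T S N) (compress T S N F)) \<longlongrightarrow> \<tau>) at_top"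
proof -
  define m where "m j = cip (Mint *v v j) (v j) / of_real T" for j
  define r where "r j k = (if om (j, k) = 0 then 0 else 1 / (\<i> * of_real (om (j, k))))" for j k
  have ev: "\<forall>\<^sub>F N in at_top. (\<Sum>j\<in>UNIV. (1 - m j) * (\<Sum>k\<in>cutset T (\<theta> j) N. r j k) - (if \<theta> j = 0 then m j else 0)) =
      trace_on fscale (V_space T S N) (compress T S N F)"
    \<comment> \<open>For N \<ge> 0 the zero frequency, if there is one, belongs to the section, so
      its term occurs exactly once.\<close>
    using eventually_ge_at_top[of 0]
  proof eventually_elim
    fix N :: real assume N: "N \<ge> 0"
    have "trace_on fscale (V_space T S N) (compress T S N F) =
        (\<Sum>i<length (ls N). L2_inner T (FF (e (ls N ! i))) (e (ls N ! i)))"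
      unfolding V_space_eq L.trace_on_eq[OF bs_basis compress_endo]
        L.orthonormal_matrix_of[OF bs_basis bs_orthonormal compress_endo] length_map
    proof (rule sum.cong[OF refl])
      fix i assume "i \<in> {..<length (ls N)}"
      then have i: "i < length (ls N)" by simp
      then have "e (ls N ! i) \<in> VV N" unfolding VV_def by (intro L.span_base imageI ls_nth)
      then show "Matrix.mat (length (ls N)) (length (ls N))
          (\<lambda>(i, j). L2_inner T (compress T S N F (map e (ls N) ! j)) (map e (ls N) ! i)) $$ (i, i) =
        L2_inner T (FF (e (ls N ! i))) (e (ls N ! i))"
        using i by (simp add: compress_F PP_ip ls_nth)
    qed
    also have "\<dots> = (\<Sum>a\<in>idx N. L2_inner T (FF (e a)) (e a))" by (rule sum_ls)
    also have "\<dots> = (\<Sum>j\<in>UNIV. \<Sum>k\<in>cutset T (\<theta> j) N. (1 - m j) * r j k - (if \<theta> j = 0 \<and> k = 0 then m j else 0))"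
      unfolding sum_idx FF_entry Mc_diag m_def[symmetric]
      by (intro sum.cong refl) (auto simp: r_def Lam_def lam_def om_zero_iff field_simps)
    also have "\<dots> = (\<Sum>j\<in>UNIV. (1 - m j) * (\<Sum>k\<in>cutset T (\<theta> j) N. r j k) - (if \<theta> j = 0 then m j else 0))"
    proof (rule sum.cong[OF refl])
      fix j
      have "(\<Sum>k\<in>cutset T (\<theta> j) N. if \<theta> j = 0 \<and> k = 0 then m j else 0) = (if \<theta> j = 0 then m j else 0)"
      proof (cases "\<theta> j = 0")
        case True
        then have "(j, 0) \<in> idx N" using N by (simp add: idx_def om_def)
        then have "0 \<in> cutset T (\<theta> j) N" by (simp add: idx_eq)
        then show ?thesis using True sum.delta[OF finite_cut[of j N], of 0 "\<lambda>_. m j"] by (simp only: simp_thms if_True)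
      qed simp
      then show "(\<Sum>k\<in>cutset T (\<theta> j) N. (1 - m j) * r j k - (if \<theta> j = 0 \<and> k = 0 then m j else 0)) =
        (1 - m j) * (\<Sum>k\<in>cutset T (\<theta> j) N. r j k) - (if \<theta> j = 0 then m j else 0)"
        by (simp add: sum_subtractf sum_distrib_left)
    qed
    finally show "(\<Sum>j\<in>UNIV. (1 - m j) * (\<Sum>k\<in>cutset T (\<theta> j) N. r j k) - (if \<theta> j = 0 then m j else 0)) =
      trace_on fscale (V_space T S N) (compress T S N F)" ..
  qed
  have "\<forall>j. \<exists>l. ((\<lambda>N. \<Sum>k\<in>cutset T (\<theta> j) N. r j k) \<longlongrightarrow> l) at_top"
    unfolding r_def using inverse_sum_convergent by blast
  then obtain l where l: "\<And>j. ((\<lambda>N. \<Sum>k\<in>cutset T (\<theta> j) N. r j k) \<longlongrightarrow> l j) at_top" by metis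
  have "((\<lambda>N. \<Sum>j\<in>UNIV. (1 - m j) * (\<Sum>k\<in>cutset T (\<theta> j) N. r j k) - (if \<theta> j = 0 then m j else 0)) \<longlongrightarrow>
      (\<Sum>j\<in>UNIV. (1 - m j) * l j - (if \<theta> j = 0 then m j else 0))) at_top"
    by (intro tendsto_intros l)
  then show ?thesis using tendsto_cong[OF ev] by blast
qed

end

section \<open>The constant of the boundary condition\<close>

definition re_vec :: "complex^'n \<Rightarrow> real^'n" where "re_vec x = (\<chi> i. Re (x $ i))"
definition im_vec :: "complex^'n \<Rightarrow> real^'n" where "im_vec x = (\<chi> i. Im (x $ i))"

lemma complex_vec_eqI: "re_vec x = re_vec y \<Longrightarrow> im_vec x = im_vec y \<Longrightarrow> x = y"
  by (simp add: Finite_Cartesian_Product.vec_eq_iff re_vec_def im_vec_def complex_eq_iff)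

lemma re_im_cmatrix:
  "re_vec (cmatrix B *v x) = B *v re_vec x" "im_vec (cmatrix B *v x) = B *v im_vec x"
  by (simp_all add: Finite_Cartesian_Product.vec_eq_iff re_vec_def im_vec_def matrix_vector_mult_def cmatrix_def)

lemma re_im_scale:
  "re_vec (of_real c *s x) = c *\<^sub>R re_vec x" "im_vec (of_real c *s x) = c *\<^sub>R im_vec x"
  by (simp_all add: Finite_Cartesian_Product.vec_eq_iff re_vec_def im_vec_def)

lemma det_cmatrix: "det (cmatrix A) = of_real (det A)"
  by (simp add: Determinants.det_def cmatrix_def)

lemma cmatrix_diff: "cmatrix (A - B) = cmatrix A - cmatrix B"
  by (simp add: cmatrix_def Finite_Cartesian_Product.vec_eq_iff)

lemma vector_space_scaleR: "vector_space ((*\<^sub>R) :: real \<Rightarrow> 'v::real_vector \<Rightarrow> 'v)"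
  by (rule real_vector.vector_space_axioms)

lemma ordered_basis_scaleR_iff:
  "ordered_basis (*\<^sub>R) V bs \<longleftrightarrow> distinct bs \<and> independent (set bs) \<and> span (set bs) = V"
  by (simp add: ordered_basis_def dependent_raw_def span_raw_def)

lemma det_on_UNIV:
  fixes A :: "real^'n^'n"
  shows "det_on (*\<^sub>R) UNIV ((*v) A) = det A"
proof -
  define n where "n = CARD('n)"
  obtain f where f: "bij_betw f {0..<n} (UNIV :: 'n set)"
    unfolding n_def using ex_bij_betw_nat_finite[OF finite_class.finite_UNIV] by blast
  define bs :: "(real^'n) list" where "bs = map (\<lambda>i. axis (f i) 1) [0..<n]"
  have len: "length bs = n" by (simp add: bs_def)
  have set: "set bs = Basis"
  proof -
    have "set bs = (\<lambda>k. axis k 1) ` f ` {0..<n}" by (auto simp: bs_def)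
    also have "\<dots> = range (\<lambda>k. axis k 1)" using f by (simp add: bij_betw_def)
    also have "\<dots> = Basis" by (auto simp: Basis_vec_def)
    finally show ?thesis .
  qed
  have "distinct bs"
    using f by (auto simp: bs_def distinct_map inj_on_def bij_betw_def axis_eq_axis)
  then have bs: "ordered_basis (*\<^sub>R) UNIV bs"
    by (simp add: ordered_basis_scaleR_iff set independent_Basis)
  have en: "endo (*\<^sub>R) UNIV ((*v) A)"
    by (simp add: endo_def matrix_vector_right_distrib matrix_vector_mult_scaleR)
  have "A *v (bs ! j) = (\<Sum>i<length bs. A $ f i $ f j *\<^sub>R bs ! i)" if j: "j < length bs" for j
  proof -
    have "(A *v (bs ! j)) $ k = (\<Sum>i<n. A $ f i $ f j *\<^sub>R bs ! i) $ k" for k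
    proof -
      have "(\<Sum>i<n. A $ f i $ f j *\<^sub>R bs ! i) $ k = (\<Sum>i\<in>{0..<n}. A $ f i $ f j * (if f i = k then 1 else 0))"
        by (simp add: bs_def axis_def lessThan_atLeast0 if_distrib cong: if_cong)
          (intro sum.cong, auto)
      also have "\<dots> = (\<Sum>l\<in>UNIV. A $ l $ f j * (if l = k then 1 else 0))"
        by (rule sum.reindex_bij_betw[OF f])
      also have "\<dots> = A $ k $ f j" by (simp add: if_distrib[of "\<lambda>x. _ * x"] cong: if_cong)
      also have "\<dots> = (A *v (bs ! j)) $ k"
        using j by (simp add: bs_def matrix_vector_mult_def axis_def if_distrib[of "\<lambda>x. _ * x"] cong: if_cong)
      finally show ?thesis ..
    qed
    then show ?thesis unfolding len Finite_Cartesian_Product.vec_eq_iff by blast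
  qed
  from vector_space.matrix_of_eqI[OF vector_space_scaleR bs, of "(*v) A" "\<lambda>i j. A $ f i $ f j", OF this]
  have "matrix_of (*\<^sub>R) bs ((*v) A) = Matrix.mat n n (\<lambda>(i, j). A $ f i $ f j)"
    by (simp add: len)
  then show ?thesis
    unfolding vector_space.det_on_eq[OF vector_space_scaleR bs en] using det_reindex[of f A] f by (simp add: n_def)
qed

lemma sum_lessThan_add: "(\<Sum>i<a + b. f i) = (\<Sum>i<a. f i) + (\<Sum>i<b. f (a + i :: nat))"
  for f :: "nat \<Rightarrow> 'a::comm_monoid_add"
  by (induction b) (simp_all add: add.assoc)

text \<open>In a basis adapted to the sum of K and W the matrix of B is block diagonal, with blocks
  c times the identity and the matrix of A.\<close>

lemma det_on_decomposition:
  fixes B :: "real^'n^'n"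
  assumes K: "Real_Vector_Spaces.subspace K" and W: "W = {x. \<forall>y\<in>K. inner x y = 0}"
    and BK: "\<And>x. x \<in> K \<Longrightarrow> B *v x = c *\<^sub>R x"
    and en: "endo (*\<^sub>R) W A" and BW: "\<And>x. x \<in> W \<Longrightarrow> B *v x = A x"
  shows "det B = c ^ dim K * det_on (*\<^sub>R) W A"
proof -
  have Wsub: "Real_Vector_Spaces.subspace W" unfolding W real_vector.subspace_def by (auto simp: inner_add_left)
  obtain k where k: "k \<subseteq> K" "independent k" "K \<subseteq> span k" "card k = dim K" using basis_exists by blast
  obtain w where w: "w \<subseteq> W" "independent w" "W \<subseteq> span w" "card w = dim W" using basis_exists by blast
  have fin: "finite k" "finite w" using k(2) w(2) by (auto intro: finiteI_independent)
  obtain ks where ks: "set ks = k" "distinct ks" using finite_distinct_list[OF fin(1)] by blast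
  obtain ws where ws: "set ws = w" "distinct ws" using finite_distinct_list[OF fin(2)] by blast
  have lks: "length ks = dim K" using ks k(4) distinct_card by metis
  have "K \<inter> W \<subseteq> {0}" unfolding W by auto
  moreover have "0 \<notin> k" using k(2) real_vector.dependent_zero by blast
  ultimately have disj: "k \<inter> w = {}" using k(1) w(1) by blast
  have bw: "ordered_basis (*\<^sub>R) W ws"
    using ws w real_vector.span_minimal[OF w(1) Wsub] by (auto simp: ordered_basis_scaleR_iff)
  have sp: "span (k \<union> w) = UNIV"
  proof -
    have "x \<in> span (k \<union> w)" for x
    proof -
      obtain y z where yz: "y \<in> span K" "\<And>u. u \<in> span K \<Longrightarrow> real_inner_class.orthogonal z u" "x = y + z"
        using orthogonal_subspace_decomp_exists[of K x] by blast
      have "y \<in> span k" using yz(1) k(3) real_vector.span_eq_iff[THEN iffD2, OF K] by blast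
      moreover have "z \<in> W" unfolding W using yz(2) by (auto simp: Linear_Algebra.orthogonal_def real_vector.span_base)
      then have "z \<in> span w" using w(3) by blast
      ultimately show ?thesis unfolding yz(3)
        by (meson real_vector.span_add real_vector.span_mono subsetD sup_ge1 sup_ge2)
    qed
    then show ?thesis by blast
  qed
  have "dim W + dim K = dim (UNIV :: (real^'n) set)"
    using dim_subspace_orthogonal_to_vectors[of K "UNIV :: (real^'n) set"] K
    by (simp add: W Linear_Algebra.orthogonal_def inner_commute)
  then have "card (k \<union> w) \<le> dim (UNIV :: (real^'n) set)"
    using disj fin by (simp add: card_Un_disjoint k(4) w(4))
  then have "independent (k \<union> w)"
    using sp fin by (intro card_le_dim_spanning[of _ UNIV]) auto
  then have bs: "ordered_basis (*\<^sub>R) UNIV (ks @ ws)"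
    using ks ws disj sp by (simp add: ordered_basis_scaleR_iff)
  define a where "a = length ks" define b where "b = length ws"
  define N where "N = matrix_of (*\<^sub>R) ws A"
  have N: "N \<in> carrier_mat b b" by (simp add: N_def b_def)
  define m where "m i j = (if j < a then (if i = j then c else 0) else if i < a then 0 else N $$ (i - a, j - a))" for i j
  have "B *v ((ks @ ws) ! j) = (\<Sum>i<length (ks @ ws). m i j *\<^sub>R (ks @ ws) ! i)" if j: "j < length (ks @ ws)" for j
  proof (cases "j < a")
    case True
    then have "ks ! j \<in> K" using k(1) ks(1) nth_mem[of j ks] by (auto simp: a_def)
    moreover have "(\<Sum>i<a + b. m i j *\<^sub>R (ks @ ws) ! i) = c *\<^sub>R ks ! j"
    proof -
      have "(\<Sum>i<a + b. m i j *\<^sub>R (ks @ ws) ! i) = (\<Sum>i<a + b. if i = j then c *\<^sub>R ks ! j else 0)"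
        using True by (intro sum.cong) (auto simp: m_def nth_append a_def)
      then show ?thesis using True by simp
    qed
    ultimately show ?thesis using BK True by (simp add: nth_append a_def b_def)
  next
    case False
    then have ja: "j - a < length ws" using j by (simp add: a_def)
    then have "ws ! (j - a) \<in> W" using w(1) ws(1) nth_mem by blast
    then have "B *v ((ks @ ws) ! j) = A (ws ! (j - a))" using BW False by (simp add: nth_append a_def)
    also have "\<dots> = (\<Sum>i<b. N $$ (i, j - a) *\<^sub>R ws ! i)"
      unfolding N_def b_def by (rule vector_space.matrix_of_expand[OF vector_space_scaleR bw en ja])
    also have "\<dots> = (\<Sum>i<a + b. m i j *\<^sub>R (ks @ ws) ! i)"
      using False by (simp add: sum_lessThan_add m_def nth_append a_def)
    finally show ?thesis by (simp add: a_def b_def)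
  qed
  from vector_space.matrix_of_eqI[OF vector_space_scaleR bs, of "(*v) B" m, OF this]
  have "matrix_of (*\<^sub>R) (ks @ ws) ((*v) B) = Matrix.mat (a + b) (a + b) (\<lambda>(i, j). m i j)"
    by (simp add: a_def b_def)
  also have "\<dots> = four_block_mat (c \<cdot>\<^sub>m 1\<^sub>m a) (0\<^sub>m a b) (0\<^sub>m b a) N"
    using N by (intro eq_matI) (auto simp: m_def)
  finally have "Determinant.det (matrix_of (*\<^sub>R) (ks @ ws) ((*v) B)) = Determinant.det (c \<cdot>\<^sub>m 1\<^sub>m a) * Determinant.det N"
    using det_four_block_mat_upper_right_zero[of "c \<cdot>\<^sub>m 1\<^sub>m a" a "0\<^sub>m a b" b "0\<^sub>m b a" N] N by simp
  also have "Determinant.det (c \<cdot>\<^sub>m 1\<^sub>m a) = c ^ dim K"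
    using lks by (simp add: det_smult a_def)
  finally have "Determinant.det (matrix_of (*\<^sub>R) (ks @ ws) ((*v) B)) = c ^ dim K * det_on (*\<^sub>R) W A"
    unfolding N_def vector_space.det_on_eq[OF vector_space_scaleR bw en] .
  moreover have "endo (*\<^sub>R) UNIV ((*v) B)"
    by (simp add: endo_def matrix_vector_right_distrib matrix_vector_mult_scaleR)
  ultimately show ?thesis
    using vector_space.det_on_eq[OF vector_space_scaleR bs, of "(*v) B"] det_on_UNIV[of B] by simp
qed

text \<open>Replacing S - 1 by c on the kernel turns a determinant on a subspace into an ordinary
  one. The free parameter c later separates the dimension of the kernel from the determinant on the
  complement.\<close>

lemma exists_split_matrix:
  fixes K W :: "(real^'n) set"
  assumes K: "Real_Vector_Spaces.subspace K" and W: "W = {x. \<forall>y\<in>K. inner x y = 0}"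
  shows "\<exists>B. (\<forall>x\<in>K. B *v x = c *\<^sub>R x) \<and> (\<forall>x\<in>W. B *v x = A *v x)"
proof -
  have Wsub: "Real_Vector_Spaces.subspace W" unfolding W real_vector.subspace_def by (auto simp: inner_add_left)
  have "\<exists>P. linear P \<and> (\<forall>x\<in>K. P x = x) \<and> (\<forall>x\<in>W. P x = 0)"
  proof -
    define P where "P x = (SOME y. y \<in> K \<and> x - y \<in> W)" for x
    have ex: "\<exists>y. y \<in> K \<and> x - y \<in> W" for x
    proof -
      obtain y z where yz: "y \<in> span K" "\<And>u. u \<in> span K \<Longrightarrow> real_inner_class.orthogonal z u" "x = y + z"
        using orthogonal_subspace_decomp_exists[of K x] by blast
      have "y \<in> K" using yz(1) real_vector.span_eq_iff[THEN iffD2, OF K] by simp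
      moreover have "x - y \<in> W" unfolding W yz(3) using yz(2) by (auto simp: Linear_Algebra.orthogonal_def real_vector.span_base)
      ultimately show ?thesis by blast
    qed
    have P: "P x \<in> K" "x - P x \<in> W" for x
      using someI_ex[OF ex[of x]] by (auto simp: P_def)
    have uniq: "P x = y" if "y \<in> K" "x - y \<in> W" for x y
    proof -
      have "y - P x \<in> K" using that P K by (simp add: real_vector.subspace_diff)
      moreover have "(x - P x) - (x - y) \<in> W" by (rule real_vector.subspace_diff[OF Wsub P(2) that(2)])
      then have "y - P x \<in> W" by simp
      ultimately have "inner (y - P x) (y - P x) = 0" unfolding W by auto
      then show ?thesis by simp
    qed
    have "linear P"
    proof (rule linearI)
      fix x y
      have "(x - P x) + (y - P y) \<in> W" by (rule real_vector.subspace_add[OF Wsub P(2) P(2)])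
      then show "P (x + y) = P x + P y"
        using P K by (intro uniq) (auto simp: real_vector.subspace_add algebra_simps)
      fix r
      have "r *\<^sub>R (x - P x) \<in> W" by (rule real_vector.subspace_scale[OF Wsub P(2)])
      then show "P (r *\<^sub>R x) = r *\<^sub>R P x"
        using P K by (intro uniq) (auto simp: real_vector.subspace_scale algebra_simps)
    qed
    moreover have "P x = x" if "x \<in> K" for x using that Wsub by (intro uniq) (auto simp: real_vector.subspace_0)
    moreover have "P x = 0" if "x \<in> W" for x using that K by (intro uniq) (auto simp: real_vector.subspace_0)
    ultimately show ?thesis by blast
  qed
  then obtain P where P: "linear P" "\<forall>x\<in>K. P x = x" "\<forall>x\<in>W. P x = 0" by blast
  define g where "g x = c *\<^sub>R P x + A *v (x - P x)" for x
  have "linear g"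
    unfolding g_def
    by (rule linearI) (simp_all add: linear_add[OF P(1)] linear_scale[OF P(1)] matrix_vector_right_distrib
        matrix_vector_mult_diff_distrib matrix_vector_mult_scaleR algebra_simps)
  then have "(\<forall>x\<in>K. matrix g *v x = c *\<^sub>R x) \<and> (\<forall>x\<in>W. matrix g *v x = A *v x)"
    using P by (simp add: matrix_works g_def)
  then show ?thesis by blast
qed

context boundary_value
begin

lemma ker_subspace: "Real_Vector_Spaces.subspace (ker_S S)"
  by (auto simp: ker_S_def real_vector.subspace_def matrix_vector_right_distrib matrix_vector_mult_scaleR)

lemma S_minus_1_endo:
  assumes S: "orthogonal_matrix S"
  shows "endo (*\<^sub>R) (W_S S) ((*v) (S - mat 1))"
proof -
  have "(S - mat 1) *v x \<in> W_S S" if x: "x \<in> W_S S" for x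
  proof -
    have "inner ((S - mat 1) *v x) y = 0" if y: "y \<in> ker_S S" for y
    proof -
      have Sy: "S *v y = y" using y by (simp add: ker_S_def matrix_vector_mult_diff_rdistrib)
      have "orthogonal_transformation ((*v) S)" using S by (simp add: orthogonal_transformation_matrix matrix_of_matrix_vector_mul)
      then have "inner (S *v x) (S *v y) = inner x y" by (simp add: orthogonal_transformation_def)
      then show ?thesis
        unfolding Sy by (simp add: matrix_vector_mult_diff_rdistrib inner_diff_left)
    qed
    then show ?thesis by (simp add: W_S_def)
  qed
  then show ?thesis
    by (simp add: endo_def matrix_vector_right_distrib matrix_vector_mult_scaleR)
qed

text \<open>The real hypotheses reach the complex eigenvectors through real and imaginary parts: for
  angle 0 both lie in the kernel of S - 1, for the other angles both are orthogonal to it.\<close>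

lemma split_eigenvalues:
  assumes BK: "\<And>x. x \<in> ker_S S \<Longrightarrow> B *v x = c *\<^sub>R x" and BW: "\<And>x. x \<in> W_S S \<Longrightarrow> B *v x = (S - mat 1) *v x"
  shows "complex_of_real (det B) = (\<Prod>j\<in>UNIV. if \<theta> j = 0 then of_real c else cis (\<theta> j) - 1)"
proof -
  have "cmatrix B *v v j = (if \<theta> j = 0 then of_real c else cis (\<theta> j) - 1) *s v j" for j
  proof (cases "\<theta> j = 0")
    case True
    then have Sv: "cmatrix S *v v j = v j" using Sc_v[of j] by simp
    have "re_vec (v j) \<in> ker_S S" "im_vec (v j) \<in> ker_S S"
      using re_im_cmatrix[of S "v j"] by (simp_all add: ker_S_def Sv matrix_vector_mult_diff_rdistrib)
    then have "cmatrix B *v v j = of_real c *s v j"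
      by (intro complex_vec_eqI) (simp_all only: re_im_cmatrix re_im_scale BK)
    then show ?thesis using True by simp
  next
    case False
    have orth: "inner (re_vec (v j)) y = 0 \<and> inner (im_vec (v j)) y = 0" if y: "y \<in> ker_S S" for y
    proof -
      define cy :: "complex^'n" where "cy = (\<chi> i. of_real (y $ i))"
      have "re_vec cy = y" "im_vec cy = 0"
        by (simp_all add: Finite_Cartesian_Product.vec_eq_iff re_vec_def im_vec_def cy_def)
      then have "cmatrix S *v cy = cy"
        using y by (intro complex_vec_eqI) (simp_all add: re_im_cmatrix ker_S_def matrix_vector_mult_diff_rdistrib)
      then have "cip cy (v j) = cis (\<theta> j) * cip cy (v j)" by (metis cip_Sc)
      then have "cip cy (v j) = 0" using cis_theta_1[of j] False by auto
      moreover have "Re (cip cy (v j)) = inner y (re_vec (v j))" "Im (cip cy (v j)) = - inner y (im_vec (v j))"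
        by (simp_all add: cip_def cy_def re_vec_def im_vec_def inner_vec_def sum_negf)
      ultimately show ?thesis by (simp add: inner_commute)
    qed
    then have W: "re_vec (v j) \<in> W_S S" "im_vec (v j) \<in> W_S S" by (auto simp: W_S_def)
    then have "cmatrix B *v v j = cmatrix (S - mat 1) *v v j"
      by (intro complex_vec_eqI) (simp_all only: re_im_cmatrix BW)
    also have "\<dots> = (cis (\<theta> j) - 1) *s v j"
      by (simp add: cmatrix_diff cmatrix_mat matrix_vector_mult_diff_rdistrib Sc_v vector_ssub_ldistrib
          vector_sub_rdistrib)
    finally show ?thesis using False by simp
  qed
  from diagm_eqI[OF this] show ?thesis by (simp add: det_diagm flip: det_cmatrix)
qed

lemma one_minus_cis_nz: "0 \<le> q \<Longrightarrow> q < 1 \<or> q = 1 \<and> \<theta> j \<noteq> 0 \<Longrightarrow> 1 - complex_of_real q * cis (\<theta> j) \<noteq> 0"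
proof
  assume q: "0 \<le> q" "q < 1 \<or> q = 1 \<and> \<theta> j \<noteq> 0" and 0: "1 - complex_of_real q * cis (\<theta> j) = 0"
  then have "cmod (complex_of_real q * cis (\<theta> j)) = 1" by (metis eq_iff_diff_eq_0 norm_one)
  then have "q = 1" using q(1) by (simp add: norm_mult)
  then show False using q(2) 0 cis_theta_1[of j] by simp
qed

text \<open>The product is the value at \<open>q = 1\<close> of a continuous real function without zeros that is
  \<open>1\<close> at \<open>q = 0\<close>.\<close>

lemma prod_one_minus_cis_pos:
  obtains g where "g > 0" "(\<Prod>j | \<theta> j \<noteq> 0. 1 - cis (\<theta> j)) = complex_of_real g"
proof -
  define h where "h q = (\<Prod>j | \<theta> j \<noteq> 0. 1 - complex_of_real q * cis (\<theta> j))" for q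
  have hc: "continuous_on {0..1} h" unfolding h_def by (intro continuous_intros)
  have hnz: "h q \<noteq> 0" if "q \<in> {0..1}" for q
  proof -
    have "1 - complex_of_real q * cis (\<theta> j) \<noteq> 0" if "\<theta> j \<noteq> 0" for j
      by (rule one_minus_cis_nz) (use that \<open>q \<in> {0..1}\<close> in auto)
    then show ?thesis by (simp add: h_def)
  qed
  \<comment> \<open>For q < 1 the product over all j is the real determinant of 1 - q S, and the
    factors with angle 0 are the nonzero real number 1 - q. The value q = 1 follows by
    continuity.\<close>
  have hreal: "Im (h q) = 0" if q: "q \<in> {0..<1}" for q
  proof -
    have "cmatrix (mat 1 - q *\<^sub>R S) *v v j = (1 - of_real q * cis (\<theta> j)) *s v j" for j
    proof -
      have "cmatrix (q *\<^sub>R S) *v v j = of_real q *s (cmatrix S *v v j)"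
        by (simp add: Finite_Cartesian_Product.vec_eq_iff cmatrix_def matrix_vector_mult_def sum_distrib_left mult.assoc)
      then show ?thesis
        by (simp add: cmatrix_diff cmatrix_mat matrix_vector_mult_diff_rdistrib Sc_v vector_smult_assoc vector_sub_rdistrib)
    qed
    from diagm_eqI[OF this]
    have "complex_of_real (det (mat 1 - q *\<^sub>R S)) = (\<Prod>j\<in>UNIV. 1 - of_real q * cis (\<theta> j))"
      by (simp add: det_diagm flip: det_cmatrix)
    also have "\<dots> = (\<Prod>j | \<theta> j = 0. 1 - of_real q * cis (\<theta> j)) * h q"
      unfolding h_def by (subst prod.union_disjoint[symmetric]) (auto intro!: prod.cong)
    also have "(\<Prod>j | \<theta> j = 0. 1 - of_real q * cis (\<theta> j)) = complex_of_real ((1 - q) ^ card {j. \<theta> j = 0})"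
      by simp
    finally have "h q = complex_of_real (det (mat 1 - q *\<^sub>R S) / (1 - q) ^ card {j. \<theta> j = 0})"
      using q by (simp add: field_simps)
    then show ?thesis by simp
  qed
  have "Im (h 1) = 0"
  proof -
    have "closure {0..<1::real} = {0..1}" by simp
    then show ?thesis
      using continuous_constant_on_closure[of "{0..<1::real}" "\<lambda>q. Im (h q)" 0 1] hreal hc
      by (auto intro!: continuous_intros)
  qed
  then have him: "Im (h q) = 0" if "q \<in> {0..1}" for q using hreal[of q] that by (cases "q = 1") auto
  have "Re (h 1) > 0"
  proof (rule ccontr)
    assume "\<not> 0 < Re (h 1)"
    moreover have "Re (h 0) = 1" by (simp add: h_def)
    moreover have "continuous_on {0..1} (\<lambda>q. Re (h q))" using hc by (intro continuous_intros)
    ultimately obtain q where "0 \<le> q" "q \<le> 1" "Re (h q) = 0"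
      using IVT2'[of "\<lambda>q. Re (h q)" 1 0 0] by auto
    then show False using hnz[of q] him[of q] by (auto simp: complex_eq_iff)
  qed
  moreover have "(\<Prod>j | \<theta> j \<noteq> 0. 1 - cis (\<theta> j)) = complex_of_real (Re (h 1))"
    using \<open>Im (h 1) = 0\<close> by (simp add: h_def complex_eq_iff)
  ultimately show thesis by (rule that)
qed

text \<open>The determinant of S - 1 on W is a positive number times the sign (-1)^m, where m is the
  number of nonzero angles. The absolute value in |C(S)| removes that sign.\<close>

lemma C_S_den:
  assumes S: "orthogonal_matrix S"
  shows "complex_of_real \<bar>C_S T S\<bar> * (\<Prod>j\<in>UNIV. den j) = 1"
proof -
  obtain g where g: "g > 0" "(\<Prod>j | \<theta> j \<noteq> 0. 1 - cis (\<theta> j)) = complex_of_real g"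
    by (rule prod_one_minus_cis_pos)
  define k where "k = card {j. \<theta> j = 0}" define m where "m = card {j. \<theta> j \<noteq> 0}"
  define dW where "dW = det_on (*\<^sub>R) (W_S S) ((*v) (S - mat 1))"
  have split: "(\<Prod>j\<in>UNIV. if \<theta> j = 0 then a else f j) = a ^ k * (\<Prod>j | \<theta> j \<noteq> 0. f j)" for a :: complex and f
  proof -
    have "(\<Prod>j\<in>UNIV. if \<theta> j = 0 then a else f j) =
        (\<Prod>j\<in>{j. \<theta> j = 0} \<union> {j. \<theta> j \<noteq> 0}. if \<theta> j = 0 then a else f j)"
      by (rule prod.cong) auto
    also have "\<dots> = (\<Prod>j | \<theta> j = 0. if \<theta> j = 0 then a else f j) * (\<Prod>j | \<theta> j \<noteq> 0. if \<theta> j = 0 then a else f j)"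
      by (rule prod.union_disjoint) auto
    finally show ?thesis by (simp add: k_def)
  qed
  have eq: "complex_of_real (c ^ dim (ker_S S) * dW) = of_real c ^ k * (of_real ((- 1) ^ m * g))" for c
  proof -
    obtain B where B: "\<And>x. x \<in> ker_S S \<Longrightarrow> B *v x = c *\<^sub>R x" "\<And>x. x \<in> W_S S \<Longrightarrow> B *v x = (S - mat 1) *v x"
      using exists_split_matrix[OF ker_subspace W_S_def, of c "S - mat 1"] by blast
    have "det B = c ^ dim (ker_S S) * dW"
      unfolding dW_def by (rule det_on_decomposition[OF ker_subspace W_S_def B(1) S_minus_1_endo[OF S] B(2)])
    moreover have "(\<Prod>j | \<theta> j \<noteq> 0. cis (\<theta> j) - 1) = (\<Prod>j | \<theta> j \<noteq> 0. - 1 * (1 - cis (\<theta> j)))" by simp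
    then have "(\<Prod>j | \<theta> j \<noteq> 0. cis (\<theta> j) - 1) = (- 1) ^ m * of_real g"
      unfolding prod.distrib g(2) by (simp add: m_def)
    ultimately show ?thesis using split_eigenvalues[OF B] split[of "of_real c" "\<lambda>j. cis (\<theta> j) - 1"] by simp
  qed
  have eq': "c ^ dim (ker_S S) * dW = c ^ k * ((- 1) ^ m * g)" for c :: real
    using eq[of c] unfolding of_real_power[symmetric] of_real_mult[symmetric] of_real_eq_iff .
  \<comment> \<open>At c = 1 both powers are 1, which gives the determinant; c = 2 then identifies
    the exponents.\<close>
  from eq'[of 1] have dW: "dW = (- 1) ^ m * g" by simp
  from eq'[of 2] have "(2::real) ^ dim (ker_S S) = 2 ^ k" using g(1) by (simp add: dW)
  then have dk: "dim (ker_S S) = k" by simp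
  have "\<bar>C_S T S\<bar> = 1 / (T ^ k * g)"
    using T_pos g(1) by (simp add: C_S_def dk dW_def[symmetric] dW abs_mult inverse_eq_divide)
  moreover have "(\<Prod>j\<in>UNIV. den j) = of_real (T ^ k * g)"
    unfolding den_def split g(2) by simp
  ultimately show ?thesis using T_pos g(1) by (simp flip: of_real_mult)
qed

end

lemma det_scalar_mult: "det (mat c ** A) = c ^ CARD('n) * det A" for A :: "complex^'n^'n"
  by (simp add: det_mul det_diagonal Finite_Cartesian_Product.mat_def)

section \<open>Assembling the constants\<close>

context fredholm
begin

lemma trace_Mint: "trace Mint = integral {0..T} (\<lambda>t. trace (D t)) + of_nat CARD('n) * (1 - \<nu>) * of_real T"
proof -
  have lt: "bounded_linear (trace :: complex^'n^'n \<Rightarrow> complex)"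
    unfolding linear_conv_bounded_linear[symmetric]
    by (rule linearI) (simp_all add: trace_def sum.distrib scaleR_sum_right)
  have D: "D integrable_on {0..T}" by (rule integrable_continuous_interval[OF D_cont])
  have tD: "(\<lambda>t. trace (D t)) integrable_on {0..T}"
    using integrable_linear[OF D lt] by (simp add: comp_def)
  have "trace Mint = integral {0..T} (\<lambda>t. trace (A1 t))"
    unfolding Mint_def using integral_linear[OF integrable_continuous_interval[OF M_cont] lt] by (simp add: comp_def)
  also have "(\<lambda>t. trace (A1 t)) = (\<lambda>t. trace (D t) + of_nat CARD('n) * (1 - \<nu>))"
    by (simp add: fun_eq_iff A1_def A_def trace_def Finite_Cartesian_Product.mat_def sum.distrib sum_subtractf algebra_simps)
  also have "integral {0..T} \<dots> = integral {0..T} (\<lambda>t. trace (D t)) + integral {0..T} (\<lambda>_. of_nat CARD('n) * (1 - \<nu>))"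
    by (rule Henstock_Kurzweil_Integration.integral_add[OF tD integrable_const_ivl])
  finally show ?thesis using T_pos by (simp add: scaleR_conv_of_real)
qed

text \<open>Pulling -exp(-\<nu> T) out of the n by n determinant gives (-1)^n and exp(-n \<nu> T).
  Half of the latter is returned by the trace term, whose remaining factor exp(-n T / 2), due to the
  shift by 1, cancels the n factors exp(T / 2).\<close>

lemma limit_value:
  assumes S: "orthogonal_matrix S"
  shows "(\<Prod>j\<in>UNIV. exp (of_real T / 2) / den j) * exp (- (trace Mint / 2)) * det (mat 1 - cmatrix S ** Yt T) =
    (- 1) ^ CARD('n) * complex_of_real \<bar>C_S T S\<bar> * exp (- (of_nat CARD('n) * \<nu> * complex_of_real T / 2))
      * exp (- (1 / 2) * integral {0..T} (\<lambda>t. trace (D t)))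
      * det (cmatrix S ** \<gamma> T - mat (exp (\<nu> * complex_of_real T)))"
proof -
  define n where "n = CARD('n)"
  define x where "x = exp (\<nu> * complex_of_real T)"
  have x: "exp (- \<nu> * complex_of_real T) = inverse x" "x \<noteq> 0" by (simp_all add: x_def exp_minus)
  have "mat (- inverse x) ** (cmatrix S ** \<gamma> T - mat x) = mat 1 - cmatrix S ** Yt T"
    unfolding Yt_def x(1) mult_scalar_mat unfolding mat_scalar_mult using x(2)
    by (simp add: Finite_Cartesian_Product.vec_eq_iff Finite_Cartesian_Product.mat_def algebra_simps)
  then have 1: "det (mat 1 - cmatrix S ** Yt T) = (- inverse x) ^ n * det (cmatrix S ** \<gamma> T - mat x)"
    by (metis det_scalar_mult n_def)
  have 2: "(- inverse x) ^ n = (- 1) ^ n * exp (- (of_nat n * \<nu> * of_real T))"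
    unfolding x(1)[symmetric] power_minus[of "exp _"] exp_of_nat_mult[symmetric] by (simp add: mult.assoc)
  have "(\<Prod>j\<in>UNIV. den j) \<noteq> 0" using C_S_den[OF S] by (metis mult_zero_right zero_neq_one)
  then have C: "1 / (\<Prod>j\<in>UNIV. den j) = complex_of_real \<bar>C_S T S\<bar>"
    using C_S_den[OF S] by (simp add: nonzero_divide_eq_eq)
  have "(\<Prod>j\<in>(UNIV::'n set). exp (of_real T / 2) / den j) = exp (complex_of_real T / 2) ^ n * (1 / (\<Prod>j\<in>UNIV. den j))"
    by (simp add: prod_dividef n_def)
  then have 3: "(\<Prod>j\<in>UNIV. exp (of_real T / 2) / den j) = exp (of_nat n * (complex_of_real T / 2)) * complex_of_real \<bar>C_S T S\<bar>"
    unfolding C by (simp only: exp_of_nat_mult)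
  define I where "I = integral {0..T} (\<lambda>t. trace (D t))"
  have "exp (of_nat n * (complex_of_real T / 2)) * exp (- (trace Mint / 2)) * exp (- (of_nat n * \<nu> * of_real T)) =
      exp (- (of_nat n * \<nu> * of_real T / 2)) * exp (- (1 / 2) * I)"
    unfolding trace_Mint I_def[symmetric] n_def[symmetric] exp_add[symmetric]
    by (rule arg_cong[of _ _ exp]) (simp add: field_simps)
  then show ?thesis
    unfolding 1 2 3 I_def[symmetric] n_def[symmetric] x_def[symmetric] by (simp add: mult_ac)
qed

lemma cond_det:
  assumes S: "orthogonal_matrix S"
  shows "has_cond_det T S (ddt_minus T D \<nu> \<circ> inv_ddt_P0 T S)
    ((- 1) ^ CARD('n) * complex_of_real \<bar>C_S T S\<bar> * exp (- (of_nat CARD('n) * \<nu> * complex_of_real T / 2))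
      * exp (- (1 / 2) * integral {0..T} (\<lambda>t. trace (D t)))
      * det (cmatrix S ** \<gamma> T - mat (exp (\<nu> * complex_of_real T))))"
proof -
  have "(\<lambda>f. (ddt_minus T D \<nu> \<circ> inv_ddt_P0 T S) f - f) = F" by (rule ext) (simp only: F_def)
  then show ?thesis
    unfolding has_cond_det_def Let_def limit_value[OF S, symmetric]
    using F_hilbert_schmidt trace_limit det_limit by simp
qed

end

theorem theorem1p1:
  fixes T :: real and S :: "real^'n^'n" and D \<gamma>\<^sub>D :: "real \<Rightarrow> complex^'n^'n" and \<nu> :: complex
  assumes "T > 0"
    and "orthogonal_matrix S"
    and "continuous_on {0..T} D"
    and "is_fundamental_solution T D \<gamma>\<^sub>D"
  shows "has_cond_det T S (ddt_minus T D \<nu> \<circ> inv_ddt_P0 T S)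
    ((- 1) ^ CARD('n) * complex_of_real \<bar>C_S T S\<bar>
      * exp (- (of_nat CARD('n) * \<nu> * complex_of_real T / 2))
      * exp (- (1 / 2) * integral {0..T} (\<lambda>t. trace (D t)))
      * det (cmatrix S ** \<gamma>\<^sub>D T - mat (exp (\<nu> * complex_of_real T))))"
proof -
  obtain v :: "'n \<Rightarrow> complex^'n" and \<theta> :: "'n \<Rightarrow> real" where
    v: "\<And>i j. cip (v i) (v j) = (if i = j then 1 else 0)"
    "\<And>j. cmatrix S *v v j = cis (\<theta> j) *s v j" "\<And>j. - pi < \<theta> j \<and> \<theta> j \<le> pi"
    using unitary_diagonalization[OF assms(2)] by blast
  interpret fredholm v T \<theta> S D \<gamma>\<^sub>D \<nu>
    by unfold_locales (use v assms in auto)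
  show ?thesis by (rule cond_det[OF assms(2)])
qed

end
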